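(* Let $S$ be real-analytic on a neighborhood of the origin in $\mathbb{R}^2$ and in superadapted coordinates with Newton distance $d=d(S)>1$. Then $s_0=\frac1d$, and for real-valued $\phi\in C_c^\infty(\mathbb{R}^2)$ supported in a sufficiently small neighborhood of the origin the following hold. In Cases 1 and 3, $d_0'(\phi)=0$ and $$d_0(\phi)=\frac{\Gamma(\frac1d)}{d}\left(e^{i\frac{\pi}{2d}}c_0(\phi)+e^{-i\frac{\pi}{2d}}C_0(\phi)\right).$$ In Case 2, $$d_0'(\phi)=-\frac{\Gamma(\frac1d)}{d}\left(e^{i\frac{\pi}{2d}}c_0'(\phi)+e^{-i\frac{\pi}{2d}}C_0'(\phi)\right).$$
   Context: Standing assumptions: $S$ is real-valued, $S(0,0)=0$, $\nabla S(0,0)=0$, and the Taylor expansion $\sum_{a,b}s_{ab}x^ay^b$ of $S$ at the origin is not identically zero. Newton polygon: $N(S)$ is the convex hull of the union of the quadrants $\{(t_1,t_2): t_1\ge a,\ t_2\ge b\}$ over all $(a,b)$ with $s_{ab}\neq0$. Its boundary consists of finitely many (possibly zero) compact edges of negative slope together with an unbounded vertical ray and an unbounded horizontal ray. The Newton distance is $d(S)=\inf\{t:(t,t)\in N(S)\}$, and the bisectrix is the line $t_1=t_2$. "The bisectrix intersects $N(S)$" at/in a part of $N(S)$ means that the boundary point $(d(S),d(S))$ lies there. For a compact edge $e$ of $N(S)$ put $S_e(x,y)=\sum_{(a,b)\in e}s_{ab}x^ay^b$. $S$ is in superadapted coordinates if for every compact edge $e$ of $N(S)$ intersecting the bisectrix,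 neither $S_e(1,y)$ nor $S_e(-1,y)$ has a real zero of order $\ge d(S)$ other than possibly $y=0$. Case 1: the bisectrix intersects $N(S)$ in the interior of a compact edge. Case 2: it intersects $N(S)$ at a vertex $(d,d)$. Case 3: it intersects $N(S)$ in the interior of one of the unbounded rays. For $\lambda>0$ let $J_{S,\phi}(\lambda)=\int_{\mathbb{R}^2}e^{i\lambda S(x,y)}\phi(x,y)\,dx\,dy$, and for $\epsilon>0$ let $I_{S,\phi}(\epsilon)=\int_{\{0<S<\epsilon\}}\phi\,dx\,dy$. For real-analytic $S$ and $\phi$ supported near the origin there are asymptotic expansions $J_{S,\phi}(\lambda)\sim\sum_{j\ge0}(d_j(\phi)\lambda^{-s_j}+d_j'(\phi)\ln(\lambda)\lambda^{-s_j})$ as $\lambda\to+\infty$, and, as $\epsilon\to0^+$, $I_{S,\phi}(\epsilon)\sim\sum_{j\ge0}(c_j(\phi)\epsilon^{r_j}+c_j'(\phi)\ln(\epsilon)\epsilon^{r_j})$ and $I_{-S,\phi}(\epsilon)\sim\sum_{j\ge0}(C_j(\phi)\epsilon^{r_j}+C_j'(\phi)\ln(\epsilon)\epsilon^{r_j})$. Here $\{s_j\}$ and $\{r_j\}$ are increasing arithmetic progressions of positive rationals independent of $\phi$; $s_0$ is chosen so that in any sufficiently small neighborhood $U$ of the origin $d_0(\phi)$ or $d_0'(\phi)$ is nonzero for some $\phi$ supported in $U$, and $r_0$ is chosen so that in any sufficiently small neighborhood $U$ of the origin at least one of $c_0(\phi),c_0'(\phi),C_0(\phi),C_0'(\phi)$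 is nonzero for some $\phi$ supported in $U$. *)

theory Defs
  imports "HOL-Analysis.Analysis" "HOL-Library.Landau_Symbols"
    "HOL-Computational_Algebra.Polynomial"
begin

definition real_analytic_on :: "(real \<times> real \<Rightarrow> real) \<Rightarrow> (real \<times> real) set \<Rightarrow> bool" where
  "real_analytic_on S U \<longleftrightarrow>
     (\<forall>p\<in>U. \<exists>a :: nat \<Rightarrow> nat \<Rightarrow> real. \<exists>r>0. \<forall>h k. \<bar>h\<bar> < r \<and> \<bar>k\<bar> < r \<longrightarrow>
        ((\<lambda>(m, n). a m n * h ^ m * k ^ n) has_sum S (p + (h, k))) UNIV)"

fun Ck :: "nat \<Rightarrow> (real \<times> real \<Rightarrow> real) \<Rightarrow> bool" where
  "Ck 0 f \<longleftrightarrow> continuous_on UNIV f"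
| "Ck (Suc k) f \<longleftrightarrow>
     f differentiable_on UNIV \<and> (\<forall>v. Ck k (\<lambda>p. frechet_derivative f (at p) v))"

text \<open>The real-valued functions in \<open>C\<^sub>c\<^sup>\<infinity>\<close> of the plane whose (closed) support lies in \<open>U\<close>.\<close>

definition test_functions :: "(real \<times> real) set \<Rightarrow> (real \<times> real \<Rightarrow> real) set" where
  "test_functions U =
     {\<phi>. (\<forall>k. Ck k \<phi>) \<and> compact (closure {p. \<phi> p \<noteq> 0}) \<and> closure {p. \<phi> p \<noteq> 0} \<subseteq> U}"

definition taylor_coeff :: "(real \<times> real \<Rightarrow> real) \<Rightarrow> nat \<Rightarrow> nat \<Rightarrow> real" where
  "taylor_coeff S a b =
     (deriv ^^ a) (\<lambda>x. (deriv ^^ b) (\<lambda>y. S (x, y)) 0) 0 / (fact a * fact b)"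

definition newton_polygon :: "(real \<times> real \<Rightarrow> real) \<Rightarrow> (real \<times> real) set" where
  "newton_polygon S =
     convex hull (\<Union>(a, b)\<in>{(a, b). taylor_coeff S a b \<noteq> 0}.
       {(t1, t2). t1 \<ge> real a \<and> t2 \<ge> real b})"

definition newton_distance :: "(real \<times> real \<Rightarrow> real) \<Rightarrow> real" where
  "newton_distance S = Inf {t. (t, t) \<in> newton_polygon S}"

definition bisectrix_point :: "(real \<times> real \<Rightarrow> real) \<Rightarrow> real \<times> real" where
  "bisectrix_point S = (newton_distance S, newton_distance S)"

definition compact_edge :: "(real \<times> real \<Rightarrow> real) \<Rightarrow> (real \<times> real) set \<Rightarrow> bool" where
  "compact_edge S e \<longleftrightarrow> e edge_of newton_polygon S \<and> compact e"

definition unbounded_edge :: "(real \<times> real \<Rightarrow> real) \<Rightarrow> (real \<times> real) set \<Rightarrow> bool" where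
  "unbounded_edge S e \<longleftrightarrow> e edge_of newton_polygon S \<and> \<not> bounded e"

definition edge_part :: "(real \<times> real \<Rightarrow> real) \<Rightarrow> (real \<times> real) set \<Rightarrow> real \<Rightarrow> real \<Rightarrow> real" where
  "edge_part S e x y =
     (\<Sum>(a, b)\<in>{(a, b). (real a, real b) \<in> e}. taylor_coeff S a b * x ^ a * y ^ b)"

text \<open>\<open>edge_part S e x\<close> as a polynomial in \<open>y\<close>, so that the order of its zeros is available
  as \<^const>\<open>order\<close>.\<close>

definition edge_poly :: "(real \<times> real \<Rightarrow> real) \<Rightarrow> (real \<times> real) set \<Rightarrow> real \<Rightarrow> real poly" where
  "edge_poly S e x =
     (\<Sum>(a, b)\<in>{(a, b). (real a, real b) \<in> e}. monom (taylor_coeff S a b * x ^ a) b)"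

lemma poly_edge_poly: "poly (edge_poly S e x) y = edge_part S e x y"
  by (simp add: edge_poly_def edge_part_def poly_sum poly_monom case_prod_unfold)

definition superadapted :: "(real \<times> real \<Rightarrow> real) \<Rightarrow> bool" where
  "superadapted S \<longleftrightarrow>
     (\<forall>e. compact_edge S e \<and> bisectrix_point S \<in> e \<longrightarrow>
        (\<forall>x\<in>{1, -1}. \<not> (\<exists>y. y \<noteq> 0 \<and> poly (edge_poly S e x) y = 0 \<and>
           real (order y (edge_poly S e x)) \<ge> newton_distance S)))"

definition newton_case1 :: "(real \<times> real \<Rightarrow> real) \<Rightarrow> bool" where
  "newton_case1 S \<longleftrightarrow> (\<exists>e. compact_edge S e \<and> bisectrix_point S \<in> rel_interior e)"

definition newton_case2 :: "(real \<times> real \<Rightarrow> real) \<Rightarrow> bool" where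
  "newton_case2 S \<longleftrightarrow> bisectrix_point S extreme_point_of newton_polygon S"

definition newton_case3 :: "(real \<times> real \<Rightarrow> real) \<Rightarrow> bool" where
  "newton_case3 S \<longleftrightarrow> (\<exists>e. unbounded_edge S e \<and> bisectrix_point S \<in> rel_interior e)"

definition osc_integral ::
    "(real \<times> real \<Rightarrow> real) \<Rightarrow> (real \<times> real \<Rightarrow> real) \<Rightarrow> real \<Rightarrow> complex" where
  "osc_integral S \<phi> l =
     (\<integral>p. exp (\<i> * complex_of_real (l * S p)) * complex_of_real (\<phi> p) \<partial>lborel)"

definition sublevel_integral ::
    "(real \<times> real \<Rightarrow> real) \<Rightarrow> (real \<times> real \<Rightarrow> real) \<Rightarrow> real \<Rightarrow> real" where
  "sublevel_integral S \<phi> \<epsilon> = set_lebesgue_integral lborel {p. 0 < S p \<and> S p < \<epsilon>} \<phi>"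

definition exponent_progression :: "(nat \<Rightarrow> real) \<Rightarrow> bool" where
  "exponent_progression s \<longleftrightarrow>
     (\<forall>j. s j \<in> \<rat> \<and> s j > 0) \<and> (\<exists>q>0. \<forall>j. s j = s 0 + real j * q)"

text \<open>Asymptotic expansions are meant in the sense of Poincare: the remainder after the terms
  up to index \<open>n\<close> is negligible against the pure power with the \<open>n\<close>-th exponent.\<close>

definition osc_expansion ::
    "(real \<Rightarrow> complex) \<Rightarrow> (nat \<Rightarrow> real) \<Rightarrow> (nat \<Rightarrow> complex) \<Rightarrow> (nat \<Rightarrow> complex) \<Rightarrow> bool" where
  "osc_expansion J s d d' \<longleftrightarrow>
     (\<forall>n. (\<lambda>l. J l - (\<Sum>j\<le>n. d j * complex_of_real (l powr (- s j)) +
                              d' j * complex_of_real (ln l * l powr (- s j))))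
          \<in> o[at_top](\<lambda>l. complex_of_real (l powr (- s n))))"

definition sublevel_expansion ::
    "(real \<Rightarrow> real) \<Rightarrow> (nat \<Rightarrow> real) \<Rightarrow> (nat \<Rightarrow> real) \<Rightarrow> (nat \<Rightarrow> real) \<Rightarrow> bool" where
  "sublevel_expansion I r c c' \<longleftrightarrow>
     (\<forall>n. (\<lambda>\<epsilon>. I \<epsilon> - (\<Sum>j\<le>n. c j * \<epsilon> powr r j + c' j * (ln \<epsilon> * \<epsilon> powr r j)))
          \<in> o[at_right 0](\<lambda>\<epsilon>. \<epsilon> powr r n))"

end

theory Submission
  imports Defs "HOL-Analysis.Analysis" "HOL-Real_Asymp.Real_Asymp"
begin

text \<open>
  Since both kinds of expansion are given, it suffices to compare their leading terms after a
  regularization. With \<open>J\<close> the oscillatory integral, \<open>\<integral>\<^sub>0\<^sup>\<infinity> J(T v) e\<^bsup>-v\<^esup> dv = \<integral> \<phi> / (1 - i T S)\<close>, and by the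
  layer-cake formula the right-hand side is an absolutely convergent integral of the sublevel
  integrals of \<open>S\<close> and \<open>- S\<close> against \<open>- i (1 - i u)\<^bsup>-2\<^esup> du\<close> and its conjugate. An Abelian argument as
  \<open>T \<rightarrow> \<infinity>\<close> then relates the coefficients at any common exponent in \<open>(0, 1)\<close>, and forces \<open>s\<^sub>0 = r\<^sub>0\<close>.

  It remains to see that \<open>r\<^sub>0 = 1/d\<close>, without logarithm in Cases 1 and 3. A supporting line
  \<open>\<kappa>\<^sub>1 a + \<kappa>\<^sub>2 b = 1\<close> of the Newton polygon through \<open>(d, d)\<close> yields a box of area comparable to
  \<open>\<epsilon>\<^bsup>1/d\<^esup>\<close> on which \<open>|S| < \<epsilon>\<close>. For the upper bound put \<open>y = x\<^sup>m z\<close> with \<open>m = \<kappa>\<^sub>2 / \<kappa>\<^sub>1\<close>: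
  after division by \<open>x\<^bsup>1/\<kappa>1\<^esup>\<close>, \<open>S\<close> tends to the face polynomial together with all \<open>z\<close>-derivatives, so the
  one-dimensional sublevel estimate of van der Corput type applies with the orders of the zeros of that
  polynomial, and the result is integrated in \<open>x\<close>. In superadapted coordinates these orders
  are less than \<open>d\<close> on an edge crossing the bisectrix; in the other cases the supporting line can be
  tilted so as to touch the polygon in a single vertex.
\<close>

section \<open>Sublevel sets of functions with a large derivative\<close>

text \<open>A Poincare expansion bounds a remainder and may not be differentiated, so the sublevel
  integrals cannot be turned into a density whose Fourier transform is J. Averaging against a fixed
  kernel avoids this: dominated convergence then needs only boundedness and the two leading
  coefficients. With exponent e the exponential average contributes \<open>Gamma (1 - e)\<close>,
  and the moment of the kernel on the other side is \<open>e * Gamma e * Gamma (1 - e)\<close> times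
  the phase of angle pi e / 2; the quotient at e = 1/d is the constant of the theorem. Both factors
  are finite because e < 1, that is d > 1. The minus sign in Case 2 comes from ln (u / T) = ln u -
  ln T against ln (v T) = ln v + ln T. A logarithm also feeds extra constants into the balance of
  the non-logarithmic terms, so that balance is read off only when the logarithmic coefficients
  vanish. Whether they do is a matter of strictness: orders of zeros below d leave an integral in x
  dominated by its lower end, whereas order d on a line of weight sum 1/d leaves the integral of dx
  / x.\<close>

lemma borel_sublevel:
  fixes g :: "real \<Rightarrow> real"
  assumes "J \<in> sets borel" "continuous_on J g"
  shows "{x \<in> J. \<bar>g x\<bar> < e} \<in> sets borel"
proof -
  have "(\<lambda>x. indicator J x *\<^sub>R g x) \<in> borel_measurable borel"
    by (rule borel_measurable_continuous_on_indicator[OF assms])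
  then have "{x \<in> space borel. \<bar>indicator J x *\<^sub>R g x\<bar> < e} \<inter> J \<in> sets borel"
    using assms(1) by measurable
  also have "{x \<in> space borel. \<bar>indicator J x *\<^sub>R g x\<bar> < e} \<inter> J = {x \<in> J. \<bar>g x\<bar> < e}" by auto
  finally show ?thesis .
qed

text \<open>Values at two points of the sublevel set differ by less than 2 \<eta>, so the points are
  at most 2 \<eta> / c apart, and the set lies in an interval centred at any one of them.\<close>

lemma sublevel_monotone:
  fixes h :: "real \<Rightarrow> real"
  assumes slope: "\<And>x y. x \<in> I \<Longrightarrow> y \<in> I \<Longrightarrow> x < y \<Longrightarrow> c * (y - x) \<le> h y - h x"
    and "c > 0" and "\<eta> > 0"
  shows "emeasure lborel {x \<in> I. \<bar>h x\<bar> < \<eta>} \<le> ennreal (4 * (\<eta> / c))"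
proof (cases "{x \<in> I. \<bar>h x\<bar> < \<eta>} = {}")
  case False
  then obtain x0 where x0: "x0 \<in> I" "\<bar>h x0\<bar> < \<eta>" by auto
  have "{x \<in> I. \<bar>h x\<bar> < \<eta>} \<subseteq> {x0 - 2 * (\<eta> / c) .. x0 + 2 * (\<eta> / c)}"
  proof
    fix x assume "x \<in> {x \<in> I. \<bar>h x\<bar> < \<eta>}"
    then have x: "x \<in> I" "\<bar>h x\<bar> < \<eta>" by auto
    have "c * \<bar>x - x0\<bar> \<le> 2 * \<eta>"
    proof (cases x x0 rule: linorder_cases)
      case less
      have "h x0 - h x \<le> 2 * \<eta>" using x x0 by linarith
      moreover have "\<bar>x - x0\<bar> = x0 - x" using less by simp
      ultimately show ?thesis using slope[OF x(1) x0(1) less] by simp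
    next
      case greater
      have "h x - h x0 \<le> 2 * \<eta>" using x x0 by linarith
      moreover have "\<bar>x - x0\<bar> = x - x0" using greater by simp
      ultimately show ?thesis using slope[OF x0(1) x(1) greater] by simp
    qed (use \<open>\<eta> > 0\<close> in simp)
    then have "\<bar>x - x0\<bar> \<le> 2 * (\<eta> / c)"
      using \<open>c > 0\<close> by (simp add: field_simps)
    then show "x \<in> {x0 - 2 * (\<eta> / c) .. x0 + 2 * (\<eta> / c)}" by (simp add: abs_le_iff)
  qed
  then have "emeasure lborel {x \<in> I. \<bar>h x\<bar> < \<eta>}
      \<le> emeasure lborel {x0 - 2 * (\<eta> / c) .. x0 + 2 * (\<eta> / c)}"
    by (intro emeasure_mono) auto
  also have "\<dots> = ennreal (4 * (\<eta> / c))"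
    using assms by (subst emeasure_lborel_Icc) (auto simp: divide_nonneg_pos)
  finally show ?thesis .
next
  case True
  then show ?thesis by (simp only:) simp
qed

text \<open>Recursion of the induction in \<open>sublevel_estimate_pos\<close>: two side intervals
  treated by the induction hypothesis and one middle set, which accounts for the 4. The value at 0
  is chosen to give 4 for the first derivative.\<close>

fun sublevel_const :: "nat \<Rightarrow> real" where
  "sublevel_const 0 = 0"
| "sublevel_const (Suc j) = 4 + 2 * sublevel_const j"

lemma sublevel_const_nonneg: "sublevel_const j \<ge> 0"
  by (induction j) auto

lemma derivative_lower_bound_slope:
  fixes h :: "real \<Rightarrow> real"
  assumes "is_interval I" "x \<in> I" "y \<in> I" "x < y"
    and lower: "\<And>x. x \<in> I \<Longrightarrow> h' x \<ge> c"
    and der: "\<And>x. x \<in> I \<Longrightarrow> (h has_real_derivative h' x) (at x within I)"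
  shows "c * (y - x) \<le> h y - h x"
proof -
  have sub: "{x..y} \<subseteq> I"
    using mem_is_interval_1_I[OF assms(1-3)] by auto
  have "(h has_derivative (*) (h' z)) (at z within {x..y})" if "z \<in> {x..y}" for z
    using DERIV_subset[OF der sub, of z] that sub by (auto simp: has_field_derivative_def)
  from mvt_simple[OF \<open>x < y\<close> this] obtain z where z: "z \<in> {x<..<y}" "h y - h x = h' z * (y - x)"
    by auto
  from z(1) have "z \<in> {x..y}" by simp
  then have "h' z \<ge> c" using sub lower by blast
  then show ?thesis unfolding z(2) by (rule mult_right_mono) (use \<open>x < y\<close> in simp)
qed

text \<open>Induction on the order of the derivative, \<open>j\<close> being one less than that
  order. The last derivative but one, \<open>h\<close>, is increasing, so
  \<open>\<bar>h\<bar> < \<eta>\<close> only on a short set; on the two intervals where this fails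
  the induction hypothesis applies with lower bound \<open>\<eta>\<close>. The constant depends on
  the order alone, which makes the estimate uniform over all slices later.\<close>

lemma sublevel_estimate_pos:
  fixes f :: "nat \<Rightarrow> real \<Rightarrow> real"
  assumes "is_interval I"
    and der: "\<And>i x. i \<le> j \<Longrightarrow> x \<in> I \<Longrightarrow> (f i has_real_derivative f (Suc i) x) (at x within I)"
    and "c > 0" and "\<epsilon> > 0" and lower: "\<And>x. x \<in> I \<Longrightarrow> f (Suc j) x \<ge> c"
  shows "emeasure lborel {x \<in> I. \<bar>f 0 x\<bar> < \<epsilon>}
    \<le> ennreal (sublevel_const (Suc j) * (\<epsilon> / c) powr (1 / real (Suc j)))"
  using assms
proof (induction j arbitrary: I f c)
    case 0
    have "emeasure lborel {x \<in> I. \<bar>f 0 x\<bar> < \<epsilon>} \<le> ennreal (4 * (\<epsilon> / c))"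
      by (rule sublevel_monotone) (use 0 derivative_lower_bound_slope[where h = "f 0" and h' = "f (Suc 0)" and I = I] in auto)
    then show ?case using 0 by (simp add: powr_one)
  next
    case (Suc j)
    define h where "h = f (Suc j)"
    define A where "A = \<epsilon> / c"
    define n where "n = real (Suc j)"
    have "A > 0" using Suc.prems by (simp add: A_def)
    have "n > 0" by (simp add: n_def)
    \<comment> \<open>This choice balances the two contributions: \<eta> / c and (\<epsilon> /
      \<eta>) to the power 1/n both become A to the power 1/(n+1).\<close>
    define \<eta> where "\<eta> = c * A powr (1 / (n + 1))"
    have "\<eta> > 0" using Suc.prems \<open>A > 0\<close> by (simp add: \<eta>_def)
    have hslope: "c * (y - x) \<le> h y - h x" if "x \<in> I" "y \<in> I" "x < y" for x y
      by (rule derivative_lower_bound_slope[where h' = "f (Suc (Suc j))" and I = I]) (use that Suc.prems in \<open>auto simp: h_def\<close>)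
    have hmono: "h x \<le> h y" if "x \<in> I" "y \<in> I" "x \<le> y" for x y
    proof (cases "x = y")
      case False
      then have "0 \<le> c * (y - x)" using that \<open>c > 0\<close> by simp
      then show ?thesis using hslope[of x y] that False by auto
    qed auto
    define Ip where "Ip = {x \<in> I. h x \<ge> \<eta>}"
    define Im where "Im = {x \<in> I. h x \<le> - \<eta>}"
    have intv: "is_interval Ip" "is_interval Im"
      unfolding is_interval_1 Ip_def Im_def
      using mem_is_interval_1_I[OF Suc.prems(1)] hmono order_trans[of \<eta>] order_trans[of _ _ "-\<eta>"]
      by blast+
    have quot: "(\<epsilon> / \<eta>) powr (1 / n) = A powr (1 / (n + 1))"
    proof -
      have "\<epsilon> / \<eta> = A powr (n / (n + 1))"
      proof -
        have "\<epsilon> / \<eta> = A / A powr (1 / (n + 1))" by (simp add: \<eta>_def A_def)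
        also have "\<dots> = A powr (1 - 1 / (n + 1))"
          using \<open>A > 0\<close> by (simp add: powr_diff)
        also have "1 - 1 / (n + 1) = n / (n + 1)" using \<open>n > 0\<close> by (simp add: field_simps)
        finally show ?thesis .
      qed
      then show ?thesis using \<open>n > 0\<close> by (simp add: powr_powr)
    qed
    have sub: "(f i has_real_derivative f (Suc i) x) (at x within J)"
      if "J \<subseteq> I" "x \<in> J" "i \<le> j" for i x J
      using DERIV_subset[OF Suc.prems(2)[of i x] that(1)] that by auto
    have subs: "Ip \<subseteq> I" "Im \<subseteq> I" by (auto simp: Ip_def Im_def)
    have p: "emeasure lborel {x \<in> Ip. \<bar>f 0 x\<bar> < \<epsilon>}
        \<le> ennreal (sublevel_const (Suc j) * (\<epsilon> / \<eta>) powr (1 / real (Suc j)))"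
    proof (rule Suc.IH)
      show "\<eta> \<le> f (Suc j) x" if "x \<in> Ip" for x
        using that by (simp add: Ip_def h_def)
    qed (use intv \<open>\<eta> > 0\<close> Suc.prems(4) subs sub in auto)
    have "emeasure lborel {x \<in> Im. \<bar>- f 0 x\<bar> < \<epsilon>}
        \<le> ennreal (sublevel_const (Suc j) * (\<epsilon> / \<eta>) powr (1 / real (Suc j)))"
    proof (rule Suc.IH[of Im "\<lambda>i x. - f i x"])
      show "\<eta> \<le> - f (Suc j) x" if "x \<in> Im" for x
        using that by (simp add: Im_def h_def)
      show "((\<lambda>x. - f i x) has_real_derivative - f (Suc i) x) (at x within Im)"
        if "i \<le> j" "x \<in> Im" for i x
        by (rule DERIV_minus[OF sub]) (use that subs in auto)
    qed (use intv \<open>\<eta> > 0\<close> Suc.prems(4) in auto)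
    then have m: "emeasure lborel {x \<in> Im. \<bar>f 0 x\<bar> < \<epsilon>}
        \<le> ennreal (sublevel_const (Suc j) * (\<epsilon> / \<eta>) powr (1 / real (Suc j)))"
      by simp
    have z: "emeasure lborel {x \<in> I. \<bar>h x\<bar> < \<eta>} \<le> ennreal (4 * (\<eta> / c))"
      by (rule sublevel_monotone) (use hslope Suc.prems \<open>\<eta> > 0\<close> in auto)
    have cont: "continuous_on I (f 0)" "continuous_on I h"
      unfolding h_def using DERIV_continuous[OF Suc.prems(2)]
      by (simp_all add: continuous_on_eq_continuous_within)
    have bI: "I \<in> sets borel"
      using Suc.prems(1) by (rule real_interval_borel_measurable)
    have bJ: "Ip \<in> sets borel" "Im \<in> sets borel"
      using intv by (simp_all add: real_interval_borel_measurable)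
    have mm: "{x \<in> Ip. \<bar>f 0 x\<bar> < \<epsilon>} \<in> sets lborel" "{x \<in> Im. \<bar>f 0 x\<bar> < \<epsilon>} \<in> sets lborel"
      "{x \<in> I. \<bar>h x\<bar> < \<eta>} \<in> sets lborel"
      unfolding sets_lborel
      by (rule borel_sublevel;
          use bJ bI in \<open>auto intro: continuous_on_subset[OF cont(1)] cont(2) simp: Ip_def Im_def\<close>)+
    have "emeasure lborel {x \<in> I. \<bar>f 0 x\<bar> < \<epsilon>} \<le> emeasure lborel
        ({x \<in> Ip. \<bar>f 0 x\<bar> < \<epsilon>} \<union> {x \<in> Im. \<bar>f 0 x\<bar> < \<epsilon>} \<union> {x \<in> I. \<bar>h x\<bar> < \<eta>})"
      using mm by (intro emeasure_mono) (auto simp: Ip_def Im_def)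
    also have "\<dots> \<le> emeasure lborel {x \<in> Ip. \<bar>f 0 x\<bar> < \<epsilon>} + emeasure lborel {x \<in> Im. \<bar>f 0 x\<bar> < \<epsilon>}
        + emeasure lborel {x \<in> I. \<bar>h x\<bar> < \<eta>}"
      using mm by (intro order_trans[OF emeasure_subadditive] add_mono order_refl) auto
    also have "\<dots> \<le> ennreal (sublevel_const (Suc j) * A powr (1 / (n + 1)))
        + ennreal (sublevel_const (Suc j) * A powr (1 / (n + 1))) + ennreal (4 * A powr (1 / (n + 1)))"
      using p m z quot Suc.prems by (intro add_mono) (auto simp: n_def \<eta>_def)
    also have "\<dots> = ennreal (sublevel_const (Suc (Suc j)) * A powr (1 / (n + 1)))"
      using sublevel_const_nonneg[of j]
      by (simp add: ennreal_plus[symmetric] distrib_right mult.assoc del: ennreal_plus)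
    finally show ?case by (simp add: A_def n_def add.commute)
qed

lemma sublevel_estimate:
  fixes f :: "nat \<Rightarrow> real \<Rightarrow> real"
  assumes "is_interval I" and "j \<ge> 1"
    and der: "\<And>i x. i < j \<Longrightarrow> x \<in> I \<Longrightarrow> (f i has_real_derivative f (Suc i) x) (at x within I)"
    and "c > 0" and "\<epsilon> > 0" and lower: "(\<forall>x\<in>I. f j x \<ge> c) \<or> (\<forall>x\<in>I. f j x \<le> - c)"
  shows "emeasure lborel {x \<in> I. \<bar>f 0 x\<bar> < \<epsilon>}
    \<le> ennreal (sublevel_const j * (\<epsilon> / c) powr (1 / real j))"
proof -
  obtain k where k: "j = Suc k" using \<open>j \<ge> 1\<close> by (cases j) auto
  show ?thesis
  proof (cases "\<forall>x\<in>I. f j x \<ge> c")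
    case True
    show ?thesis unfolding k
      by (rule sublevel_estimate_pos) (use assms True k in auto)
  next
    case False
    then have neg: "\<forall>x\<in>I. f j x \<le> - c" using lower by blast
    have "emeasure lborel {x \<in> I. \<bar>- f 0 x\<bar> < \<epsilon>}
        \<le> ennreal (sublevel_const (Suc k) * (\<epsilon> / c) powr (1 / real (Suc k)))"
    proof (rule sublevel_estimate_pos[where f = "\<lambda>i x. - f i x"])
      show "((\<lambda>x. - f i x) has_real_derivative - f (Suc i) x) (at x within I)"
        if "i \<le> k" "x \<in> I" for i x
        by (rule DERIV_minus[OF der]) (use that k in auto)
      show "c \<le> - f (Suc k) x" if "x \<in> I" for x
        using neg that k by force
    qed (use assms in auto)
    then show ?thesis by (simp add: k)
  qed
qed

section \<open>Power series in weighted coordinates\<close>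

text \<open>\<open>diffs\<close> is formal differentiation of a coefficient sequence. The falling
  factorial is written with a binomial coefficient so that \<open>power_series_derivatives\<close>
  can compare it with a term of the binomial theorem.\<close>

lemma coeff_funpow_diffs:
  fixes D :: "nat \<Rightarrow> real"
  shows "(diffs ^^ j) D n = fact j * real ((n + j) choose j) * D (n + j)"
proof (induction j arbitrary: n)
  case (Suc j)
  have "real (n + 1) * (fact j * real ((n + 1 + j) choose j)) = fact (Suc j) * real ((n + Suc j) choose Suc j)"
  proof -
    have "(Suc n) * ((n + Suc j) choose j) = Suc j * ((n + Suc j) choose Suc j)"
      using binomial_absorb_comp[of "n + Suc j" j] binomial_absorption[of j "n + Suc j"]
      by (simp add: binomial_absorption Suc_times_binomial_add add.commute)
    then have "real (Suc n) * real ((n + Suc j) choose j) = real (Suc j) * real ((n + Suc j) choose Suc j)"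
      by (simp only: of_nat_mult[symmetric])
    then show ?thesis by (simp add: algebra_simps)
  qed
  moreover have "(diffs ^^ Suc j) D n = real (n + 1) * (diffs ^^ j) D (n + 1)"
    unfolding funpow.simps o_apply by (subst diffs_def) simp
  ultimately show ?case
    unfolding Suc.IH by (simp add: mult.assoc[symmetric] del: fact_Suc binomial_Suc_Suc)
qed simp

text \<open>Differentiating j times multiplies a coefficient by \<open>fact j\<close> and a binomial
  coefficient, and the latter times \<open>Z ^ n\<close> is a single term in the expansion of
  \<open>(Z + 1) ^ (n + j)\<close>. Enlarging the radius by one thus bounds every derivative
  linearly by the same weighted norm of \<open>D\<close>; linearity is what lets the remainder tend
  to 0 with that norm.\<close>

lemma power_series_derivatives:
  fixes D :: "nat \<Rightarrow> real" and Z :: real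
  assumes "Z \<ge> 0" and sD: "summable (\<lambda>n. \<bar>D n\<bar> * (Z + 1) ^ n)"
  defines "E \<equiv> \<lambda>j z. \<Sum>n. (diffs ^^ j) D n * z ^ n"
  shows "\<bar>z\<bar> \<le> Z \<Longrightarrow> (E j has_real_derivative E (Suc j) z) (at z)"
    and "\<bar>z\<bar> \<le> Z \<Longrightarrow> \<bar>E j z\<bar> \<le> fact j * (\<Sum>n. \<bar>D n\<bar> * (Z + 1) ^ n)"
proof -
  have summ: "summable (\<lambda>n. (diffs ^^ j) D n * x ^ n)" if "norm x < Z + 1" for x j
    using that
  proof (induction j arbitrary: x)
    case 0
    have "summable (\<lambda>n. norm (D n * x ^ n))"
    proof (rule summable_comparison_test'[OF sD])
      show "norm (norm (D n * x ^ n)) \<le> \<bar>D n\<bar> * (Z + 1) ^ n" for n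
        using 0 by (auto simp: abs_mult power_abs intro!: mult_left_mono power_mono)
    qed
    then show ?case by (simp add: summable_rabs_cancel)
  next
    case (Suc j)
    then show ?case
      using termdiff_converges[of x "Z + 1" "(diffs ^^ j) D"] by simp
  qed
  show "(E j has_real_derivative E (Suc j) z) (at z)" if "\<bar>z\<bar> \<le> Z"
  proof -
    have "((\<lambda>x. \<Sum>n. (diffs ^^ j) D n * x ^ n) has_real_derivative
        (\<Sum>n. diffs ((diffs ^^ j) D) n * z ^ n)) (at z)"
      by (rule termdiffs_strong[of _ "Z + 1 / 2"]) (use that \<open>Z \<ge> 0\<close> in \<open>auto intro!: summ\<close>)
    then show ?thesis by (simp add: E_def)
  qed
  show "\<bar>E j z\<bar> \<le> fact j * (\<Sum>n. \<bar>D n\<bar> * (Z + 1) ^ n)" if "\<bar>z\<bar> \<le> Z"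
  proof -
    have bound: "\<bar>(diffs ^^ j) D n * z ^ n\<bar> \<le> fact j * (\<bar>D (n + j)\<bar> * (Z + 1) ^ (n + j))" for n
    proof -
      have "real ((n + j) choose j) * \<bar>z\<bar> ^ n \<le> (Z + 1) ^ (n + j)"
      proof -
        have "real ((n + j) choose j) * \<bar>z\<bar> ^ n \<le> real ((n + j) choose j) * Z ^ n"
          using that by (intro mult_left_mono power_mono) auto
        also have "\<dots> = real ((n + j) choose n) * Z ^ n * 1 ^ (n + j - n)"
          by (simp add: binomial_symmetric[of j "n + j"])
        also have "\<dots> \<le> (\<Sum>k\<le>n + j. real ((n + j) choose k) * Z ^ k * 1 ^ (n + j - k))"
          using \<open>Z \<ge> 0\<close> by (intro member_le_sum) auto
        also have "\<dots> = (Z + 1) ^ (n + j)" by (simp add: binomial_ring)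
        finally show ?thesis .
      qed
      then have "(fact j * \<bar>D (n + j)\<bar>) * (real ((n + j) choose j) * \<bar>z\<bar> ^ n)
          \<le> (fact j * \<bar>D (n + j)\<bar>) * (Z + 1) ^ (n + j)"
        by (intro mult_left_mono) auto
      then show ?thesis by (simp add: coeff_funpow_diffs abs_mult power_abs mult_ac)
    qed
    have s1: "summable (\<lambda>n. \<bar>D (n + j)\<bar> * (Z + 1) ^ (n + j))"
      using sD by (subst summable_iff_shift)
    have "\<bar>E j z\<bar> \<le> (\<Sum>n. fact j * (\<bar>D (n + j)\<bar> * (Z + 1) ^ (n + j)))"
      unfolding E_def
      using norm_suminf_le[where f = "\<lambda>n. (diffs ^^ j) D n * z ^ n", OF _ summable_mult[OF s1, of "fact j"]] bound
      by (simp only: real_norm_def)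
    also have "\<dots> = fact j * (\<Sum>n. \<bar>D (n + j)\<bar> * (Z + 1) ^ (n + j))"
      by (rule suminf_mult[OF s1])
    also have "\<dots> \<le> fact j * (\<Sum>n. \<bar>D n\<bar> * (Z + 1) ^ n)"
    proof (rule mult_left_mono)
      have "(\<Sum>n. \<bar>D n\<bar> * (Z + 1) ^ n) = (\<Sum>n. \<bar>D (n + j)\<bar> * (Z + 1) ^ (n + j))
          + (\<Sum>n<j. \<bar>D n\<bar> * (Z + 1) ^ n)"
        by (rule suminf_split_initial_segment[OF sD])
      moreover have "(\<Sum>n<j. \<bar>D n\<bar> * (Z + 1) ^ n) \<ge> 0"
        using \<open>Z \<ge> 0\<close> by (intro sum_nonneg) auto
      ultimately show "(\<Sum>n. \<bar>D (n + j)\<bar> * (Z + 1) ^ (n + j)) \<le> (\<Sum>n. \<bar>D n\<bar> * (Z + 1) ^ n)"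
        by simp
    qed simp
    finally show ?thesis .
  qed
qed

text \<open>Fubini for an absolutely summable family: summing over the first index turns the double
  series into a power series in z whose weighted norm is at most that of the family.\<close>

lemma double_power_series:
  fixes t :: "nat \<Rightarrow> nat \<Rightarrow> real"
  assumes summ: "(\<lambda>(a, b). \<bar>t a b\<bar> * R ^ b) summable_on UNIV" and "R > 0"
  defines "D \<equiv> \<lambda>b. \<Sum>\<^sub>\<infinity>a. t a b"
  shows "summable (\<lambda>b. \<bar>D b\<bar> * R ^ b)"
    and "(\<Sum>b. \<bar>D b\<bar> * R ^ b) \<le> (\<Sum>\<^sub>\<infinity>(a, b). \<bar>t a b\<bar> * R ^ b)"
    and "\<bar>z\<bar> \<le> R \<Longrightarrow> ((\<lambda>(a, b). t a b * z ^ b) has_sum (\<Sum>b. D b * z ^ b)) UNIV"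
    and "(\<lambda>a. t a b) summable_on UNIV"
proof -
  have summ': "(\<lambda>(b, a). \<bar>t a b\<bar> * R ^ b) summable_on (UNIV \<times> UNIV)"
    using summ by (subst summable_on_swap) (simp add: case_prod_unfold)
  have inner: "(\<lambda>a. \<bar>t a b\<bar>) summable_on UNIV" for b
  proof -
    have "(\<lambda>a. \<bar>t a b\<bar> * R ^ b) summable_on UNIV"
      using summable_on_SigmaD1[OF summ', of b] by simp
    then have "(\<lambda>a. (\<bar>t a b\<bar> * R ^ b) * (1 / R ^ b)) summable_on UNIV"
      by (rule summable_on_cmult_left)
    then show ?thesis using \<open>R > 0\<close> by simp
  qed
  show inner': "(\<lambda>a. t a b) summable_on UNIV" for b
    by (rule abs_summable_summable) (use inner in simp)
  have outer: "((\<lambda>b. (\<Sum>\<^sub>\<infinity>a. \<bar>t a b\<bar>) * R ^ b) has_sum (\<Sum>\<^sub>\<infinity>(b, a). \<bar>t a b\<bar> * R ^ b)) UNIV"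
  proof -
    have h: "((\<lambda>(b, a). \<bar>t a b\<bar> * R ^ b) has_sum (\<Sum>\<^sub>\<infinity>(b, a). \<bar>t a b\<bar> * R ^ b)) (UNIV \<times> UNIV)"
      using has_sum_infsum[OF summ'] by (simp only: UNIV_Times_UNIV)
    show ?thesis
    proof (rule has_sum_SigmaD[OF h])
      show "((\<lambda>y. case (b, y) of (b, a) \<Rightarrow> \<bar>t a b\<bar> * R ^ b) has_sum (\<Sum>\<^sub>\<infinity>a. \<bar>t a b\<bar>) * R ^ b) UNIV" for b
        unfolding prod.case by (rule has_sum_cmult_left[OF has_sum_infsum[OF inner]])
    qed
  qed
  have outer_sums: "(\<lambda>b. (\<Sum>\<^sub>\<infinity>a. \<bar>t a b\<bar>) * R ^ b) sums (\<Sum>\<^sub>\<infinity>(b, a). \<bar>t a b\<bar> * R ^ b)"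
    by (rule has_sum_imp_sums[OF outer])
  have Dle: "\<bar>D b\<bar> \<le> (\<Sum>\<^sub>\<infinity>a. \<bar>t a b\<bar>)" for b
    unfolding D_def using norm_infsum_bound[of "\<lambda>a. t a b" UNIV] inner[of b] by simp
  show sD: "summable (\<lambda>b. \<bar>D b\<bar> * R ^ b)"
  proof (rule summable_comparison_test'[OF sums_summable[OF outer_sums]])
    show "norm (\<bar>D b\<bar> * R ^ b) \<le> (\<Sum>\<^sub>\<infinity>a. \<bar>t a b\<bar>) * R ^ b" for b
      using Dle[of b] \<open>R > 0\<close> by (simp add: abs_mult)
  qed
  have "(\<Sum>b. \<bar>D b\<bar> * R ^ b) \<le> (\<Sum>\<^sub>\<infinity>(b, a). \<bar>t a b\<bar> * R ^ b)"
    using Dle \<open>R > 0\<close> outer_sums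
    by (subst sums_unique[OF outer_sums], intro suminf_le sD sums_summable[OF outer_sums]) (auto intro!: mult_right_mono)
  also have "\<dots> = (\<Sum>\<^sub>\<infinity>(a, b). \<bar>t a b\<bar> * R ^ b)"
    using infsum_swap_banach[of "\<lambda>a b. \<bar>t a b\<bar> * R ^ b" UNIV UNIV]
    by (subst infsum_reindex_bij_betw[symmetric, of prod.swap UNIV UNIV]) (auto simp: case_prod_unfold intro: bij_swap)
  finally show "(\<Sum>b. \<bar>D b\<bar> * R ^ b) \<le> (\<Sum>\<^sub>\<infinity>(a, b). \<bar>t a b\<bar> * R ^ b)" .
  show "((\<lambda>(a, b). t a b * z ^ b) has_sum (\<Sum>b. D b * z ^ b)) UNIV" if "\<bar>z\<bar> \<le> R"
  proof -
    have s1: "(\<lambda>(a, b). t a b * z ^ b) summable_on UNIV"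
    proof -
      have "(\<lambda>p. norm ((\<lambda>(a, b). t a b * z ^ b) p)) summable_on UNIV"
        by (rule summable_on_comparison_test[OF summ])
          (use that in \<open>auto simp: abs_mult power_abs intro!: mult_left_mono power_mono\<close>)
      then show ?thesis by (rule abs_summable_summable)
    qed
    define V where "V = (\<Sum>\<^sub>\<infinity>(a, b). t a b * z ^ b)"
    have h: "((\<lambda>(a, b). t a b * z ^ b) has_sum V) (UNIV \<times> UNIV)"
      unfolding V_def using s1 by simp
    then have h': "((\<lambda>(b, a). t a b * z ^ b) has_sum V) (UNIV \<times> UNIV)"
      by (subst has_sum_swap) (simp add: case_prod_unfold)
    have "((\<lambda>b. D b * z ^ b) has_sum V) UNIV"
      by (rule has_sum_SigmaD[OF h'])
         (auto simp: D_def intro!: has_sum_cmult_left has_sum_infsum inner')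
    then have "(\<lambda>b. D b * z ^ b) sums V" by (rule has_sum_imp_sums)
    then show ?thesis using h by (simp add: sums_unique[symmetric])
  qed
qed

lemma finite_below_line:
  assumes "\<kappa>1 > 0" "\<kappa>2 > (0::real)"
  shows "finite {(a, b). \<kappa>1 * real a + \<kappa>2 * real b \<le> c}"
proof (rule finite_subset)
  show "{(a, b). \<kappa>1 * real a + \<kappa>2 * real b \<le> c} \<subseteq> {..nat \<lceil>c / \<kappa>1\<rceil>} \<times> {..nat \<lceil>c / \<kappa>2\<rceil>}"
  proof clarify
    fix a b assume h: "\<kappa>1 * real a + \<kappa>2 * real b \<le> c"
    have "0 \<le> \<kappa>1 * real a" "0 \<le> \<kappa>2 * real b" using assms by simp_all
    then have "\<kappa>1 * real a \<le> c" "\<kappa>2 * real b \<le> c" using h by linarith+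
    then have "real a \<le> c / \<kappa>1" "real b \<le> c / \<kappa>2" using assms by (simp_all add: field_simps)
    then show "a \<in> {..nat \<lceil>c / \<kappa>1\<rceil>} \<and> b \<in> {..nat \<lceil>c / \<kappa>2\<rceil>}"
      by (metis (no_types) atMost_iff nat_le_iff le_of_int_ceiling of_nat_le_iff order_trans real_nat_ceiling_ge)
  qed
qed simp

text \<open>Only finitely many exponent pairs have weight in (1, 2], so weights above 1 keep a
  positive distance from 1. This gives one power of x that all terms off the face gain at
  least.\<close>

lemma weight_gap:
  assumes "\<kappa>1 > 0" "\<kappa>2 > (0::real)"
  obtains \<eta> where "\<eta> > 0"
    and "\<And>a b :: nat. \<kappa>1 * real a + \<kappa>2 * real b > 1 \<Longrightarrow> \<kappa>1 * real a + \<kappa>2 * real b \<ge> 1 + \<eta>"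
proof -
  define Q where "Q = {(a, b). \<kappa>1 * real a + \<kappa>2 * real b \<le> 2 \<and> \<kappa>1 * real a + \<kappa>2 * real b > 1}"
  have "finite Q"
    by (rule finite_subset[OF _ finite_below_line[OF assms, of 2]]) (auto simp: Q_def)
  define X where "X = insert 1 ((\<lambda>(a, b). \<kappa>1 * real a + \<kappa>2 * real b - 1) ` Q)"
  have X: "finite X" "X \<noteq> {}" "\<And>x. x \<in> X \<Longrightarrow> x > 0"
    using \<open>finite Q\<close> by (auto simp: X_def Q_def)
  show thesis
  proof (rule that[of "Min X"])
    show "Min X > 0" using X by simp
    fix a b :: nat assume gt: "\<kappa>1 * real a + \<kappa>2 * real b > 1"
    show "\<kappa>1 * real a + \<kappa>2 * real b \<ge> 1 + Min X"
    proof (cases "\<kappa>1 * real a + \<kappa>2 * real b \<le> 2")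
      case True
      then have "(a, b) \<in> Q" using gt by (simp add: Q_def)
      then have "\<kappa>1 * real a + \<kappa>2 * real b - 1 \<in> X" unfolding X_def by (force simp: image_iff)
      then show ?thesis using Min_le[OF X(1)] by fastforce
    next
      case False
      have "Min X \<le> 1" using X by (simp add: X_def)
      then show ?thesis using False by linarith
    qed
  qed
qed

text \<open>The part of the series on the line of weight 1, with x set to 1. The index set is finite
  when both weights are positive.\<close>

definition face_poly :: "(nat \<Rightarrow> nat \<Rightarrow> real) \<Rightarrow> real \<Rightarrow> real \<Rightarrow> real poly" where
  "face_poly s \<kappa>1 \<kappa>2 = (\<Sum>(a, b)\<in>{(a, b). \<kappa>1 * real a + \<kappa>2 * real b = 1}. monom (s a b) b)"

definition series2 :: "(nat \<Rightarrow> nat \<Rightarrow> real) \<Rightarrow> real \<Rightarrow> real \<Rightarrow> real" where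
  "series2 s x y = (\<Sum>\<^sub>\<infinity>(a, b). s a b * x ^ a * y ^ b)"

lemma finite_face:
  assumes "\<kappa>1 > 0" "\<kappa>2 > (0::real)"
  shows "finite {(a, b). \<kappa>1 * real a + \<kappa>2 * real b = 1}"
  by (rule finite_subset[OF _ finite_below_line[OF assms, of 1]]) auto

lemma face_poly_has_sum:
  assumes "\<kappa>1 > 0" "\<kappa>2 > (0::real)"
  shows "((\<lambda>(a, b). if \<kappa>1 * real a + \<kappa>2 * real b = 1 then s a b * z ^ b else 0) has_sum
    poly (face_poly s \<kappa>1 \<kappa>2) z) UNIV"
proof -
  have "((\<lambda>(a, b). s a b * z ^ b) has_sum poly (face_poly s \<kappa>1 \<kappa>2) z)
      {(a, b). \<kappa>1 * real a + \<kappa>2 * real b = 1}"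
    by (rule has_sum_finiteI[OF finite_face[OF assms]])
      (simp add: face_poly_def poly_sum poly_monom case_prod_unfold)
  then show ?thesis
    by (rule has_sum_cong_neutral[THEN iffD1, rotated 3]) auto
qed

text \<open>Under the substitution \<open>y = x\<^sup>m z\<close> with \<open>m = \<kappa>2 / \<kappa>1\<close> the terms on the line \<open>\<kappa>1 a + \<kappa>2 b = 1\<close> all
  scale like \<open>x\<close> to the power \<open>1 / \<kappa>1\<close>; the others carry an extra positive power of \<open>x\<close>.\<close>

lemma has_sum_weighted_split:
  assumes "0 < x" "\<kappa>1 > 0" "\<kappa>2 > (0::real)" "\<bar>z\<bar> \<le> R" "R > 0"
    and summ: "(\<lambda>(a, b). \<bar>if \<kappa>1 * real a + \<kappa>2 * real b = 1 then 0
        else s a b * x powr (real a + \<kappa>2 / \<kappa>1 * real b - 1 / \<kappa>1)\<bar> * R ^ b) summable_on UNIV"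
  defines "D \<equiv> \<lambda>b. \<Sum>\<^sub>\<infinity>a. if \<kappa>1 * real a + \<kappa>2 * real b = 1 then 0
        else s a b * x powr (real a + \<kappa>2 / \<kappa>1 * real b - 1 / \<kappa>1)"
  shows "series2 s x (x powr (\<kappa>2 / \<kappa>1) * z)
    = x powr (1 / \<kappa>1) * (poly (face_poly s \<kappa>1 \<kappa>2) z + (\<Sum>b. D b * z ^ b))"
proof -
  let ?T = "\<lambda>a b. if \<kappa>1 * real a + \<kappa>2 * real b = 1 then 0
        else s a b * x powr (real a + \<kappa>2 / \<kappa>1 * real b - 1 / \<kappa>1)"
  have "((\<lambda>(a, b). ?T a b * z ^ b) has_sum (\<Sum>b. D b * z ^ b)) UNIV"
    unfolding D_def by (rule double_power_series(3)[where R = R]) (use assms summ in auto)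
  from has_sum_add[OF face_poly_has_sum[OF assms(2,3)] this]
  have "((\<lambda>(a, b). x powr (1 / \<kappa>1) * ((if \<kappa>1 * real a + \<kappa>2 * real b = 1 then s a b * z ^ b else 0) + ?T a b * z ^ b))
     has_sum x powr (1 / \<kappa>1) * (poly (face_poly s \<kappa>1 \<kappa>2) z + (\<Sum>b. D b * z ^ b))) UNIV"
    unfolding case_prod_unfold by (rule has_sum_cmult_right)
  also have "(\<lambda>(a, b). x powr (1 / \<kappa>1) * ((if \<kappa>1 * real a + \<kappa>2 * real b = 1 then s a b * z ^ b else 0) + ?T a b * z ^ b))
     = (\<lambda>(a, b). s a b * x ^ a * (x powr (\<kappa>2 / \<kappa>1) * z) ^ b)"
  proof (intro ext, clarify)
    fix a b
    have e: "x ^ a * (x powr (\<kappa>2 / \<kappa>1)) ^ b = x powr (real a + \<kappa>2 / \<kappa>1 * real b)"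
    proof -
      have "(x powr (\<kappa>2 / \<kappa>1)) ^ b = x powr (\<kappa>2 / \<kappa>1 * real b)"
        using \<open>0 < x\<close> powr_realpow[of "x powr (\<kappa>2 / \<kappa>1)" b] by (simp only: powr_powr powr_gt_zero)
      then show ?thesis using \<open>0 < x\<close> by (simp add: powr_add powr_realpow)
    qed
    show "x powr (1 / \<kappa>1) * ((if \<kappa>1 * real a + \<kappa>2 * real b = 1 then s a b * z ^ b else 0) + ?T a b * z ^ b)
      = s a b * x ^ a * (x powr (\<kappa>2 / \<kappa>1) * z) ^ b"
    proof (cases "\<kappa>1 * real a + \<kappa>2 * real b = 1")
      case True
      then have "real a + \<kappa>2 / \<kappa>1 * real b = 1 / \<kappa>1"
        using assms by (simp add: field_simps)
      then show ?thesis using True e by (simp add: power_mult_distrib mult_ac)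
    next
      case False
      have "x powr (1 / \<kappa>1) * x powr (real a + \<kappa>2 / \<kappa>1 * real b - 1 / \<kappa>1)
          = x ^ a * (x powr (\<kappa>2 / \<kappa>1)) ^ b"
        unfolding e by (simp add: powr_add[symmetric])
      then show ?thesis using False by (simp add: power_mult_distrib mult_ac)
    qed
  qed
  finally show ?thesis unfolding series2_def by (rule infsumI)
qed

text \<open>Near each point some derivative of order at most K stays away from zero with a fixed
  sign, and compactness leaves finitely many such intervals. The lower bounds \<open>c\<close> are
  what survives a small perturbation of the polynomial.\<close>

lemma polynomial_cover:
  fixes p :: "real poly"
  assumes nz: "\<And>z. \<bar>z\<bar> \<le> Z \<Longrightarrow> \<exists>j\<le>K. poly ((pderiv ^^ j) p) z \<noteq> 0"
  obtains Y j c r where "finite Y" and "{-Z..Z} \<subseteq> (\<Union>y\<in>Y. {y - r y<..<y + r y})"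
    and "\<And>y. y \<in> Y \<Longrightarrow> j y \<le> K \<and> c y > (0::real) \<and>
      ((\<forall>t\<in>{y - r y<..<y + r y}. poly ((pderiv ^^ j y) p) t \<ge> c y) \<or>
       (\<forall>t\<in>{y - r y<..<y + r y}. poly ((pderiv ^^ j y) p) t \<le> - c y))"
proof -
  have ex: "\<exists>j c r. j \<le> K \<and> c > 0 \<and> r > 0 \<and>
      ((\<forall>t\<in>{y - r<..<y + r}. poly ((pderiv ^^ j) p) t \<ge> c) \<or>
       (\<forall>t\<in>{y - r<..<y + r}. poly ((pderiv ^^ j) p) t \<le> - c))" if y: "\<bar>y\<bar> \<le> Z" for y
  proof -
    obtain j where j: "j \<le> K" "poly ((pderiv ^^ j) p) y \<noteq> 0" using nz[OF y] by auto
    define q where "q = (pderiv ^^ j) p"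
    define c where "c = \<bar>poly q y\<bar> / 2"
    have "c > 0" using j by (simp add: c_def q_def)
    have "isCont (poly q) y" by simp
    then obtain r where r: "r > 0" "\<And>t. \<bar>t - y\<bar> < r \<Longrightarrow> \<bar>poly q t - poly q y\<bar> < c"
      using \<open>c > 0\<close> unfolding continuous_at_eps_delta by (metis dist_real_def)
    have "(\<forall>t\<in>{y - r<..<y + r}. poly q t \<ge> c) \<or> (\<forall>t\<in>{y - r<..<y + r}. poly q t \<le> - c)"
    proof (cases "poly q y > 0")
      case True
      have "poly q t \<ge> c" if "t \<in> {y - r<..<y + r}" for t
      proof -
        have "\<bar>poly q t - poly q y\<bar> < c" using r(2)[of t] that by (auto simp: abs_less_iff)
        then show ?thesis using True unfolding c_def by linarith
      qed
      then show ?thesis by blast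
    next
      case False
      have "poly q t \<le> - c" if "t \<in> {y - r<..<y + r}" for t
      proof -
        have "\<bar>poly q t - poly q y\<bar> < c" using r(2)[of t] that by (auto simp: abs_less_iff)
        then show ?thesis using False unfolding c_def by linarith
      qed
      then show ?thesis by blast
    qed
    then show ?thesis using j r \<open>c > 0\<close> unfolding q_def by blast
  qed
  then obtain j c r where jcr: "\<And>y. \<bar>y\<bar> \<le> Z \<Longrightarrow> j y \<le> K \<and> c y > 0 \<and> r y > 0 \<and>
      ((\<forall>t\<in>{y - r y<..<y + r y}. poly ((pderiv ^^ j y) p) t \<ge> c y) \<or>
       (\<forall>t\<in>{y - r y<..<y + r y}. poly ((pderiv ^^ j y) p) t \<le> - c y))"
    by metis
  have "compact {-Z..Z}" by simp
  then obtain Y where Y: "Y \<subseteq> {-Z..Z}" "finite Y" "{-Z..Z} \<subseteq> (\<Union>y\<in>Y. {y - r y<..<y + r y})"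
  proof (rule compactE_image[of "{-Z..Z}" "{-Z..Z}" "\<lambda>y. {y - r y<..<y + r y}"])
    show "{- Z..Z} \<subseteq> (\<Union>c\<in>{- Z..Z}. {c - r c<..<c + r c})"
    proof
      fix y assume "y \<in> {-Z..Z}"
      moreover from this have "r y > 0" using jcr[of y] by (simp add: abs_le_iff)
      ultimately show "y \<in> (\<Union>c\<in>{- Z..Z}. {c - r c<..<c + r c})" by force
    qed
  qed auto
  show thesis
  proof (rule that[OF Y(2,3)])
    fix y assume "y \<in> Y"
    then have "y \<in> {-Z..Z}" using Y(1) by blast
    then have "\<bar>y\<bar> \<le> Z" by (simp add: abs_le_iff)
    from jcr[OF this] show "j y \<le> K \<and> c y > (0::real) \<and>
      ((\<forall>t\<in>{y - r y<..<y + r y}. poly ((pderiv ^^ j y) p) t \<ge> c y) \<or>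
       (\<forall>t\<in>{y - r y<..<y + r y}. poly ((pderiv ^^ j y) p) t \<le> - c y))"
      by blast
  qed
qed

section \<open>Sublevel sets in a slice of fixed x\<close>

lemma emeasure_lborel_scale:
  assumes "c > 0" "V \<in> sets borel"
  shows "emeasure lborel ((\<lambda>v. c * v) ` V) = ennreal c * emeasure lborel (V :: real set)"
proof -
  let ?A = "(\<lambda>v. c * v) ` V"
  have A: "?A = (\<lambda>y. y / c) -` V \<inter> space borel"
    using \<open>c > 0\<close> by (auto simp: image_iff intro!: bexI[of _ "_ / c"])
  have "(\<lambda>y. y / c) \<in> borel_measurable borel" by simp
  then have Ab: "?A \<in> sets borel" unfolding A using assms(2) by (rule measurable_sets)
  have "emeasure lborel ?A = (\<integral>\<^sup>+y. indicator ?A y \<partial>lborel)"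
    using Ab by simp
  also have "\<dots> = ennreal \<bar>c\<bar> * (\<integral>\<^sup>+v. indicator ?A (0 + c * v) \<partial>lborel)"
    using Ab \<open>c > 0\<close> by (intro nn_integral_real_affine) auto
  also have "(\<lambda>v. indicator ?A (0 + c * v)) = (indicator V :: real \<Rightarrow> ennreal)"
    using \<open>c > 0\<close> by (auto simp: indicator_def fun_eq_iff)
  finally show ?thesis using assms by simp
qed

text \<open>The exponents 1/j vary over the cover; for u at most 1 each of them may be weakened to
  1/K, and for u above 1 only the trivial length 2 Z is used. The \<open>min\<close> records both
  regimes; its trivial part is needed for the very small x of \<open>strip_integral\<close>.\<close>

lemma sublevel_cover:
  fixes f :: "nat \<Rightarrow> real \<Rightarrow> real"
  assumes "finite Y" and "K \<ge> 1" and "Z \<ge> 0" and "u > 0"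
    and cover: "{-Z..Z} \<subseteq> (\<Union>y\<in>Y. J y)" and intv: "\<And>y. y \<in> Y \<Longrightarrow> is_interval (J y)"
    and cont: "continuous_on {-Z..Z} (f 0)"
    and der: "\<And>i t. \<bar>t\<bar> \<le> Z \<Longrightarrow> (f i has_real_derivative f (Suc i) t) (at t)"
    and lower: "\<And>y. y \<in> Y \<Longrightarrow> j y \<le> K \<and> c y > 0 \<and>
      ((\<forall>t\<in>J y \<inter> {-Z..Z}. f (j y) t \<ge> c y) \<or> (\<forall>t\<in>J y \<inter> {-Z..Z}. f (j y) t \<le> - c y))"
  shows "emeasure lborel {t \<in> {-Z..Z}. \<bar>f 0 t\<bar> < u} \<le>
    ennreal ((2 * Z + (\<Sum>y\<in>Y. sublevel_const (j y) * (1 / c y) powr (1 / real (j y)) + 2 * Z * (1 / c y) powr (1 / real K)))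
      * min 1 (u powr (1 / real K)))"
proof -
  define B where "B y = sublevel_const (j y) * (1 / c y) powr (1 / real (j y)) + 2 * Z * (1 / c y) powr (1 / real K)" for y
  have B0: "B y \<ge> 0" for y using sublevel_const_nonneg \<open>Z \<ge> 0\<close> by (simp add: B_def)
  have meas: "{t \<in> J y \<inter> {-Z..Z}. \<bar>f 0 t\<bar> < u} \<in> sets borel" if "y \<in> Y" for y
    by (rule borel_sublevel)
      (use real_interval_borel_measurable[OF intv[OF that]] cont in \<open>auto intro: continuous_on_subset\<close>)
  have triv: "emeasure lborel {t \<in> {-Z..Z}. \<bar>f 0 t\<bar> < u} \<le> ennreal (2 * Z)"
  proof -
    have "emeasure lborel {t \<in> {-Z..Z}. \<bar>f 0 t\<bar> < u} \<le> emeasure lborel {-Z..Z}"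
      by (intro emeasure_mono) auto
    then show ?thesis using \<open>Z \<ge> 0\<close> by simp
  qed
  show ?thesis
  proof (cases "u \<le> 1")
    case False
    then have "1 \<le> u powr (1 / real K)" by (intro ge_one_powr_ge_zero) auto
    then have "min 1 (u powr (1 / real K)) = 1" by simp
    moreover have "2 * Z \<le> 2 * Z + sum B Y" using B0 by (simp add: sum_nonneg)
    ultimately show ?thesis
      unfolding B_def[symmetric] by (simp only: mult_1_right order_trans[OF triv ennreal_leI])
  next
    case True
    have piece: "emeasure lborel {t \<in> J y \<inter> {-Z..Z}. \<bar>f 0 t\<bar> < u} \<le> ennreal (B y * u powr (1 / real K))"
      if y: "y \<in> Y" for y
    proof (cases "j y = 0")
      case True
      \<comment> \<open>For order 0 the function itself is bounded below, so the set is empty unless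
        u exceeds \<open>c y\<close>; then the trivial length is absorbed because (u / c y) to the
        power 1/K is at least 1.\<close>
      have c: "c y > 0" using lower[OF y] by simp
      show ?thesis
      proof (cases "u \<le> c y")
        case True
        have "{t \<in> J y \<inter> {-Z..Z}. \<bar>f 0 t\<bar> < u} = {}"
        proof -
          have "\<not> \<bar>f 0 t\<bar> < u" if "t \<in> J y \<inter> {-Z..Z}" for t
          proof -
            have "f 0 t \<ge> c y \<or> f 0 t \<le> - c y" using lower[OF y] \<open>j y = 0\<close> that by auto
            then show ?thesis using True by linarith
          qed
          then show ?thesis by blast
        qed
        then show ?thesis by (simp only: emeasure_empty) simp
      next
        case False
        have "emeasure lborel {t \<in> J y \<inter> {-Z..Z}. \<bar>f 0 t\<bar> < u} \<le> emeasure lborel {-Z..Z}"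
          by (intro emeasure_mono) auto
        also have "\<dots> \<le> ennreal (B y * u powr (1 / real K))"
        proof -
          have "1 \<le> (1 / c y * u) powr (1 / real K)"
            using False c by (intro ge_one_powr_ge_zero) (auto simp: field_simps)
          also have "\<dots> = (1 / c y) powr (1 / real K) * u powr (1 / real K)"
            using c \<open>u > 0\<close> by (simp only: powr_mult)
          finally have "2 * Z * 1 \<le> 2 * Z * ((1 / c y) powr (1 / real K) * u powr (1 / real K))"
            using \<open>Z \<ge> 0\<close> by (intro mult_left_mono) auto
          also have "\<dots> \<le> B y * u powr (1 / real K)"
            using sublevel_const_nonneg[of "j y"] by (simp add: B_def distrib_right mult.assoc)
          finally show ?thesis using \<open>Z \<ge> 0\<close> by (simp add: ennreal_leI)
        qed
        finally show ?thesis .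
      qed
    next
      case False
      have c: "c y > 0" "j y \<le> K" using lower[OF y] by simp_all
      have "emeasure lborel {t \<in> J y \<inter> {-Z..Z}. \<bar>f 0 t\<bar> < u}
          \<le> ennreal (sublevel_const (j y) * (u / c y) powr (1 / real (j y)))"
      proof (rule sublevel_estimate)
        show "is_interval (J y \<inter> {-Z..Z})" using intv[OF y] by (simp add: is_interval_Int)
        show "(f i has_real_derivative f (Suc i) x) (at x within J y \<inter> {- Z..Z})"
          if "x \<in> J y \<inter> {- Z..Z}" for i x
          by (rule has_field_derivative_at_within[OF der]) (use that in \<open>auto simp: abs_le_iff\<close>)
      qed (use False c \<open>u > 0\<close> lower[OF y] in auto)
      also have "\<dots> \<le> ennreal (B y * u powr (1 / real K))"
      proof (rule ennreal_leI)
        have "(u / c y) powr (1 / real (j y)) = (1 / c y) powr (1 / real (j y)) * u powr (1 / real (j y))"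
          using c \<open>u > 0\<close> by (simp add: powr_mult[symmetric])
        also have "\<dots> \<le> (1 / c y) powr (1 / real (j y)) * u powr (1 / real K)"
          using c False True \<open>u > 0\<close> by (intro mult_left_mono powr_mono') (auto simp: field_simps)
        finally have "sublevel_const (j y) * (u / c y) powr (1 / real (j y))
            \<le> sublevel_const (j y) * ((1 / c y) powr (1 / real (j y)) * u powr (1 / real K))"
          using sublevel_const_nonneg by (intro mult_left_mono) auto
        also have "\<dots> \<le> B y * u powr (1 / real K)"
          using \<open>Z \<ge> 0\<close> by (simp add: B_def distrib_right mult.assoc)
        finally show "sublevel_const (j y) * (u / c y) powr (1 / real (j y)) \<le> B y * u powr (1 / real K)" .
      qed
      finally show ?thesis .
    qed
    have "emeasure lborel {t \<in> {-Z..Z}. \<bar>f 0 t\<bar> < u}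
        \<le> emeasure lborel (\<Union>y\<in>Y. {t \<in> J y \<inter> {-Z..Z}. \<bar>f 0 t\<bar> < u})"
      using cover meas \<open>finite Y\<close> by (intro emeasure_mono sets.finite_UN) auto
    also have "\<dots> \<le> (\<Sum>y\<in>Y. emeasure lborel {t \<in> J y \<inter> {-Z..Z}. \<bar>f 0 t\<bar> < u})"
      using meas \<open>finite Y\<close> by (intro emeasure_subadditive_finite) auto
    also have "\<dots> \<le> (\<Sum>y\<in>Y. ennreal (B y * u powr (1 / real K)))"
      by (intro sum_mono piece)
    also have "\<dots> = ennreal (sum B Y * u powr (1 / real K))"
      using B0 by (subst sum_ennreal) (auto simp: sum_distrib_right)
    also have "\<dots> \<le> ennreal ((2 * Z + sum B Y) * min 1 (u powr (1 / real K)))"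
    proof -
      have "u powr (1 / real K) \<le> 1" using True \<open>u > 0\<close> by (intro powr_le1) auto
      then have "min 1 (u powr (1 / real K)) = u powr (1 / real K)" by simp
      then show ?thesis using \<open>Z \<ge> 0\<close> by (intro ennreal_leI) (simp add: distrib_right)
    qed
    finally show ?thesis unfolding B_def .
  qed
qed

text \<open>The point is uniformity of \<open>C\<close> in x. Each remainder coefficient at x is at
  most a factor \<open>(x / x1) powr \<eta>\<close> times its size at a reference abscissa
  \<open>x1\<close>, so one convergent double series at \<open>x1\<close> controls all slices. Below
  \<open>x0\<close> the remainder costs at most half of the lower bounds of
  \<open>polynomial_cover\<close>; \<open>sublevel_cover\<close> is then applied to the rescaled
  function at level \<open>\<epsilon> * x powr (- 1 / \<kappa>1)\<close>, and undoing the
  substitution multiplies lengths by \<open>x powr (\<kappa>2 / \<kappa>1)\<close>.\<close>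

lemma strip_slice_estimate:
  assumes "\<rho> > 0" and summ: "(\<lambda>(a, b). \<bar>s a b\<bar> * \<rho> ^ a * \<rho> ^ b) summable_on UNIV"
    and \<kappa>: "\<kappa>1 > 0" "\<kappa>2 > (0::real)"
    and supp: "\<And>a b. s a b \<noteq> 0 \<Longrightarrow> \<kappa>1 * real a + \<kappa>2 * real b \<ge> 1"
    and "K \<ge> 1" "Z > 0"
    and nz: "\<And>z. \<bar>z\<bar> \<le> Z \<Longrightarrow> \<exists>j\<le>K. poly ((pderiv ^^ j) (face_poly s \<kappa>1 \<kappa>2)) z \<noteq> 0"
  obtains C x0 where "C \<ge> 0" "0 < x0" "x0 \<le> \<rho>"
    and "Z * x0 powr (\<kappa>2 / \<kappa>1) \<le> \<rho>"
    and "\<And>x \<epsilon>. 0 < x \<Longrightarrow> x < x0 \<Longrightarrow> \<epsilon> > 0 \<Longrightarrow>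
      emeasure lborel {y. \<bar>y\<bar> \<le> Z * x powr (\<kappa>2 / \<kappa>1) \<and> \<bar>series2 s x y\<bar> < \<epsilon>}
      \<le> ennreal (C * x powr (\<kappa>2 / \<kappa>1) * min 1 ((\<epsilon> * x powr (- 1 / \<kappa>1)) powr (1 / real K)))"
proof -
  define m where "m = \<kappa>2 / \<kappa>1"
  have "m > 0" using \<kappa> by (simp add: m_def)
  \<comment> \<open>The extra 1 is the enlargement of the radius consumed by
    \<open>power_series_derivatives\<close>.\<close>
  define R where "R = Z + 1"
  have "R > 0" using \<open>Z > 0\<close> by (simp add: R_def)
  define w where "w a b = real a + m * real b - 1 / \<kappa>1" for a b
  \<comment> \<open>Ensures that all points with first coordinate \<open>x1\<close> and
    \<open>\<bar>z\<bar> \<le> R\<close> have second coordinate at most \<rho>, so the given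
    absolute sum dominates.\<close>
  define x1 where "x1 = min \<rho> ((\<rho> / R) powr (1 / m))"
  have x1: "x1 > 0" "x1 \<le> \<rho>" using \<open>\<rho> > 0\<close> \<open>R > 0\<close> by (auto simp: x1_def)
  have x1R: "x1 powr m * R \<le> \<rho>"
  proof -
    have "x1 powr m \<le> ((\<rho> / R) powr (1 / m)) powr m"
      using x1 \<open>m > 0\<close> by (intro powr_mono2) (auto simp: x1_def)
    also have "\<dots> = \<rho> / R" using \<open>m > 0\<close> \<open>\<rho> > 0\<close> \<open>R > 0\<close> by (simp add: powr_powr)
    finally show ?thesis using \<open>R > 0\<close> by (simp add: field_simps)
  qed
  obtain \<eta>0 where \<eta>0: "\<eta>0 > 0"
    "\<And>a b :: nat. \<kappa>1 * real a + \<kappa>2 * real b > 1 \<Longrightarrow> \<kappa>1 * real a + \<kappa>2 * real b \<ge> 1 + \<eta>0"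
    using weight_gap[OF \<kappa>] by blast
  define \<eta> where "\<eta> = \<eta>0 / \<kappa>1"
  have "\<eta> > 0" using \<eta>0 \<kappa> by (simp add: \<eta>_def)
  have w\<eta>: "w a b \<ge> \<eta>" if "s a b \<noteq> 0" "\<kappa>1 * real a + \<kappa>2 * real b \<noteq> 1" for a b
  proof -
    have "\<kappa>1 * real a + \<kappa>2 * real b \<ge> 1 + \<eta>0" using \<eta>0(2)[of a b] supp[OF that(1)] that(2) by simp
    then have "(\<kappa>1 * real a + \<kappa>2 * real b) / \<kappa>1 \<ge> (1 + \<eta>0) / \<kappa>1"
      using \<kappa> by (intro divide_right_mono) auto
    then show ?thesis using \<kappa> by (simp add: w_def m_def \<eta>_def add_divide_distrib)
  qed
  define T where "T x a b = (if \<kappa>1 * real a + \<kappa>2 * real b = 1 then 0 else s a b * x powr w a b)" for x a b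
  have T1: "(\<lambda>(a, b). \<bar>T x1 a b\<bar> * R ^ b) summable_on UNIV"
  proof (rule summable_on_comparison_test)
    show "(\<lambda>p. x1 powr (- 1 / \<kappa>1) * (case p of (a, b) \<Rightarrow> \<bar>s a b\<bar> * \<rho> ^ a * \<rho> ^ b)) summable_on UNIV"
      by (rule summable_on_cmult_right[OF summ])
    fix p :: "nat \<times> nat"
    obtain a b where p: "p = (a, b)" by (cases p)
    have "x1 powr w a b * R ^ b = x1 powr (- 1 / \<kappa>1) * (x1 ^ a * (x1 powr m * R) ^ b)"
    proof -
      have "(x1 powr m) ^ b = x1 powr (m * real b)"
        using x1 powr_realpow[of "x1 powr m" b] by (simp only: powr_powr powr_gt_zero)
      then show ?thesis
        using x1 by (simp add: w_def powr_add powr_diff powr_minus powr_realpow power_mult_distrib field_simps)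
    qed
    also have "\<dots> \<le> x1 powr (- 1 / \<kappa>1) * (\<rho> ^ a * \<rho> ^ b)"
      using x1 x1R \<open>R > 0\<close> by (intro mult_left_mono mult_mono power_mono) auto
    finally have "\<bar>s a b\<bar> * (x1 powr w a b * R ^ b) \<le> \<bar>s a b\<bar> * (x1 powr (- 1 / \<kappa>1) * (\<rho> ^ a * \<rho> ^ b))"
      by (rule mult_left_mono) simp
    then show "(case p of (a, b) \<Rightarrow> \<bar>T x1 a b\<bar> * R ^ b)
        \<le> x1 powr (- 1 / \<kappa>1) * (case p of (a, b) \<Rightarrow> \<bar>s a b\<bar> * \<rho> ^ a * \<rho> ^ b)"
      using \<open>\<rho> > 0\<close> by (simp add: p T_def abs_mult mult_ac)
    show "0 \<le> (case p of (a, b) \<Rightarrow> \<bar>T x1 a b\<bar> * R ^ b)" using \<open>R > 0\<close> by (simp add: p)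
  qed
  define M where "M = (\<Sum>\<^sub>\<infinity>(a, b). \<bar>T x1 a b\<bar> * R ^ b)"
  have "M \<ge> 0" unfolding M_def using \<open>R > 0\<close> by (intro infsum_nonneg) auto
  \<comment> \<open>Every term that is present carries a power of x of exponent at least \<eta>, and
    \<open>x / x1\<close> is at most 1.\<close>
  have Tle: "\<bar>T x a b\<bar> * R ^ b \<le> (x / x1) powr \<eta> * (\<bar>T x1 a b\<bar> * R ^ b)" if "0 < x" "x \<le> x1" for x a b
  proof (cases "s a b \<noteq> 0 \<and> \<kappa>1 * real a + \<kappa>2 * real b \<noteq> 1")
    case True
    have "x powr w a b = (x / x1) powr w a b * x1 powr w a b"
      using that x1 by (simp add: powr_mult[symmetric])
    also have "\<dots> \<le> (x / x1) powr \<eta> * x1 powr w a b"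
      using that x1 w\<eta>[of a b] True by (intro mult_right_mono powr_mono') auto
    finally have "\<bar>s a b\<bar> * R ^ b * x powr w a b \<le> \<bar>s a b\<bar> * R ^ b * ((x / x1) powr \<eta> * x1 powr w a b)"
      using \<open>R > 0\<close> by (intro mult_left_mono) auto
    then show ?thesis using True by (simp add: T_def abs_mult mult_ac)
  qed (auto simp: T_def)
  define D where "D x b = (\<Sum>\<^sub>\<infinity>a. T x a b)" for x b
  have Tx: "(\<lambda>(a, b). \<bar>T x a b\<bar> * R ^ b) summable_on UNIV" if "0 < x" "x \<le> x1" for x
    by (rule summable_on_comparison_test[OF summable_on_cmult_right[OF T1, of "(x / x1) powr \<eta>"]])
      (use Tle[OF that] \<open>R > 0\<close> in auto)
  have Dsum: "summable (\<lambda>b. \<bar>D x b\<bar> * (Z + 1) ^ b)" if "0 < x" "x \<le> x1" for x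
    unfolding D_def R_def[symmetric] by (rule double_power_series(1)[OF Tx[OF that] \<open>R > 0\<close>])
  have Dle: "(\<Sum>b. \<bar>D x b\<bar> * (Z + 1) ^ b) \<le> (x / x1) powr \<eta> * M" if "0 < x" "x \<le> x1" for x
  proof -
    have "(\<Sum>b. \<bar>D x b\<bar> * R ^ b) \<le> (\<Sum>\<^sub>\<infinity>(a, b). \<bar>T x a b\<bar> * R ^ b)"
      unfolding D_def by (rule double_power_series(2)[OF Tx[OF that] \<open>R > 0\<close>])
    also have "\<dots> \<le> (\<Sum>\<^sub>\<infinity>p. (x / x1) powr \<eta> * (case p of (a, b) \<Rightarrow> \<bar>T x1 a b\<bar> * R ^ b))"
      by (rule infsum_mono[OF Tx[OF that] summable_on_cmult_right[OF T1]]) (use Tle[OF that] in auto)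
    also have "\<dots> = (x / x1) powr \<eta> * M"
      unfolding M_def by (rule infsum_cmult_right) (rule T1)
    finally show ?thesis by (simp add: R_def)
  qed
  define p where "p = face_poly s \<kappa>1 \<kappa>2"
  define E where "E x j z = (\<Sum>n. (diffs ^^ j) (D x) n * z ^ n)" for x j z
  define G where "G x j z = poly ((pderiv ^^ j) p) z + E x j z" for x j z
  have Gder: "(G x j has_real_derivative G x (Suc j) z) (at z)" if "0 < x" "x \<le> x1" "\<bar>z\<bar> \<le> Z" for x j z
    unfolding G_def E_def
    using DERIV_add[OF poly_DERIV power_series_derivatives(1)[OF _ Dsum[OF that(1,2)] that(3)]] \<open>Z > 0\<close>
    by (simp add: less_imp_le)
  have Ebound: "\<bar>E x j z\<bar> \<le> fact j * ((x / x1) powr \<eta> * M)" if "0 < x" "x \<le> x1" "\<bar>z\<bar> \<le> Z" for x j z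
  proof -
    have "\<bar>E x j z\<bar> \<le> fact j * (\<Sum>b. \<bar>D x b\<bar> * (Z + 1) ^ b)"
      unfolding E_def using power_series_derivatives(2)[OF _ Dsum[OF that(1,2)] that(3)] \<open>Z > 0\<close> by simp
    also have "\<dots> \<le> fact j * ((x / x1) powr \<eta> * M)" using Dle[OF that(1,2)] by (intro mult_left_mono) auto
    finally show ?thesis .
  qed
  obtain Y j c r where Y: "finite Y" "{-Z..Z} \<subseteq> (\<Union>y\<in>Y. {y - r y<..<y + r y})"
    "\<And>y. y \<in> Y \<Longrightarrow> j y \<le> K \<and> c y > (0::real) \<and>
      ((\<forall>t\<in>{y - r y<..<y + r y}. poly ((pderiv ^^ j y) p) t \<ge> c y) \<or>
       (\<forall>t\<in>{y - r y<..<y + r y}. poly ((pderiv ^^ j y) p) t \<le> - c y))"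
  proof (rule polynomial_cover[of Z K p])
    show "\<exists>j\<le>K. poly ((pderiv ^^ j) p) z \<noteq> 0" if "\<bar>z\<bar> \<le> Z" for z
      using nz[OF that] by (simp add: p_def)
  qed (rule that)
  define c0 where "c0 = Min (insert 1 (c ` Y))"
  have c0: "c0 > 0" "\<And>y. y \<in> Y \<Longrightarrow> c0 \<le> c y"
    using Y by (auto simp: c0_def)
  \<comment> \<open>Solves \<open>fact K * q * (M + 1) = c0 / 2\<close>; the 1 keeps the denominator
    positive when the remainder is absent.\<close>
  define q where "q = c0 / (2 * fact K * (M + 1))"
  have "q > 0" using c0 \<open>M \<ge> 0\<close> by (simp add: q_def)
  define x0 where "x0 = x1 * min 1 (q powr (1 / \<eta>))"
  have x0: "0 < x0" "x0 \<le> x1"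
    using x1 \<open>q > 0\<close> by (auto simp: x0_def mult_le_cancel_left1)
  have small: "\<bar>E x i z\<bar> \<le> c0 / 2" if "0 < x" "x < x0" "\<bar>z\<bar> \<le> Z" "i \<le> K" for x i z
  proof -
    have "x / x1 \<le> q powr (1 / \<eta>)"
    proof -
      have "x \<le> x1 * q powr (1 / \<eta>)"
        using that x1 by (intro order_trans[OF less_imp_le[OF that(2)]]) (simp add: x0_def mult_left_mono)
      then show ?thesis using x1 by (simp add: field_simps)
    qed
    then have "(x / x1) powr \<eta> \<le> (q powr (1 / \<eta>)) powr \<eta>"
      using that x1 \<open>\<eta> > 0\<close> by (intro powr_mono2) auto
    then have "(x / x1) powr \<eta> \<le> q" using \<open>\<eta> > 0\<close> \<open>q > 0\<close> by (simp add: powr_powr)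
    then have "fact i * ((x / x1) powr \<eta> * M) \<le> fact K * (q * (M + 1))"
      using \<open>M \<ge> 0\<close> \<open>q > 0\<close> \<open>i \<le> K\<close> by (intro mult_mono fact_mono) auto
    also have "\<dots> = c0 / 2" using \<open>M \<ge> 0\<close> by (simp add: q_def)
    finally show ?thesis using Ebound[of x z i] that x0 by simp
  qed
  define C where "C = 2 * Z + (\<Sum>y\<in>Y. sublevel_const (j y) * (1 / (c0 / 2)) powr (1 / real (j y)) + 2 * Z * (1 / (c0 / 2)) powr (1 / real K))"
  show thesis
  proof (rule that)
    show "C \<ge> 0" unfolding C_def using \<open>Z > 0\<close> sublevel_const_nonneg by (intro add_nonneg_nonneg sum_nonneg) auto
    show "0 < x0" by (rule x0)
    show "x0 \<le> \<rho>" using x0 x1 by simp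
    have "Z * x0 powr m \<le> R * x1 powr m"
      using x0 x1 \<open>m > 0\<close> \<open>Z > 0\<close> by (intro mult_mono powr_mono2) (auto simp: R_def)
    then show "Z * x0 powr (\<kappa>2 / \<kappa>1) \<le> \<rho>" using x1R by (simp add: m_def mult.commute)
    fix x \<epsilon> :: real assume x: "0 < x" "x < x0" and "\<epsilon> > 0"
    define u where "u = \<epsilon> * x powr (- 1 / \<kappa>1)"
    have "u > 0" using \<open>\<epsilon> > 0\<close> x by (simp add: u_def)
    have xx1: "x \<le> x1" using x x0 by simp
    let ?V = "{t \<in> {-Z..Z}. \<bar>G x 0 t\<bar> < u}"
    have contG: "continuous_on {-Z..Z} (G x 0)"
      by (intro continuous_at_imp_continuous_on ballI DERIV_isCont[OF Gder[OF x(1) xx1]]) (auto simp: abs_le_iff)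
    have V: "emeasure lborel ?V \<le> ennreal (C * min 1 (u powr (1 / real K)))"
      unfolding C_def
    proof (rule sublevel_cover[where f = "G x" and J = "\<lambda>y. {y - r y<..<y + r y}" and c = "\<lambda>_. c0 / 2"])
      fix y assume y: "y \<in> Y"
      have "\<bar>E x (j y) t\<bar> \<le> c0 / 2" if "t \<in> {-Z..Z}" for t
        using small[OF x, of t "j y"] Y(3)[OF y] that by (auto simp: abs_le_iff)
      then show "j y \<le> K \<and> 0 < c0 / 2 \<and>
         ((\<forall>t\<in>{y - r y<..<y + r y} \<inter> {- Z..Z}. c0 / 2 \<le> G x (j y) t) \<or>
          (\<forall>t\<in>{y - r y<..<y + r y} \<inter> {- Z..Z}. G x (j y) t \<le> - (c0 / 2)))"
      proof -
        have e: "- (c0 / 2) \<le> E x (j y) t \<and> E x (j y) t \<le> c0 / 2" if "t \<in> {-Z..Z}" for t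
          using \<open>\<And>t. t \<in> {-Z..Z} \<Longrightarrow> \<bar>E x (j y) t\<bar> \<le> c0 / 2\<close>[OF that] by linarith
        have pos: "c0 / 2 \<le> G x (j y) t"
          if "t \<in> {-Z..Z}" "c y \<le> poly ((pderiv ^^ j y) p) t" for t
          using e[OF that(1)] that(2) c0(2)[OF y] unfolding G_def by linarith
        have neg: "G x (j y) t \<le> - (c0 / 2)"
          if "t \<in> {-Z..Z}" "poly ((pderiv ^^ j y) p) t \<le> - c y" for t
          using e[OF that(1)] that(2) c0(2)[OF y] unfolding G_def by linarith
        show ?thesis using Y(3)[OF y] c0(1) pos neg by auto
      qed
    qed (use Y \<open>K \<ge> 1\<close> \<open>Z > 0\<close> \<open>u > 0\<close> contG Gder[OF x(1) xx1] in \<open>auto simp: is_interval_oo\<close>)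
    have FG: "series2 s x (x powr m * z) = x powr (1 / \<kappa>1) * G x 0 z" if "\<bar>z\<bar> \<le> Z" for z
      using has_sum_weighted_split[OF x(1) \<kappa>, of z R s] Tx[OF x(1) xx1] that \<open>R > 0\<close>
      unfolding G_def E_def D_def T_def p_def w_def m_def R_def by simp
    have "{y. \<bar>y\<bar> \<le> Z * x powr m \<and> \<bar>series2 s x y\<bar> < \<epsilon>} = (\<lambda>v. x powr m * v) ` ?V"
    proof (intro equalityI subsetI)
      have eq: "\<bar>series2 s x (x powr m * v)\<bar> < \<epsilon> \<longleftrightarrow> \<bar>G x 0 v\<bar> < u" if "\<bar>v\<bar> \<le> Z" for v
        unfolding FG[OF that] using x by (simp add: u_def abs_mult powr_minus field_simps)
      {
        fix y assume y: "y \<in> {y. \<bar>y\<bar> \<le> Z * x powr m \<and> \<bar>series2 s x y\<bar> < \<epsilon>}"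
        define v where "v = y / x powr m"
        have yv: "y = x powr m * v" using x by (simp add: v_def)
        have "\<bar>v\<bar> \<le> Z" using y x by (simp add: v_def abs_divide field_simps)
        moreover from this have "\<bar>G x 0 v\<bar> < u" using eq[of v] y yv by simp
        ultimately show "y \<in> (\<lambda>v. x powr m * v) ` ?V" unfolding yv by (auto simp: abs_le_iff)
      }
      {
        fix y assume "y \<in> (\<lambda>v. x powr m * v) ` ?V"
        then obtain v where v: "y = x powr m * v" "v \<in> {-Z..Z}" "\<bar>G x 0 v\<bar> < u" by auto
        then have "\<bar>v\<bar> \<le> Z" by (simp add: abs_le_iff)
        then show "y \<in> {y. \<bar>y\<bar> \<le> Z * x powr m \<and> \<bar>series2 s x y\<bar> < \<epsilon>}"
          using eq[of v] v by (auto simp: abs_mult mult.commute mult_right_mono)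
      }
    qed
    then have "emeasure lborel {y. \<bar>y\<bar> \<le> Z * x powr m \<and> \<bar>series2 s x y\<bar> < \<epsilon>}
        = emeasure lborel ((\<lambda>v. x powr m * v) ` ?V)" by (rule arg_cong)
    also have "\<dots> = ennreal (x powr m) * emeasure lborel ?V"
      by (rule emeasure_lborel_scale[OF _ borel_sublevel[OF _ contG]]) (use x in auto)
    also have "\<dots> \<le> ennreal (x powr m) * ennreal (C * min 1 (u powr (1 / real K)))"
      by (intro mult_left_mono V) simp
    also have "\<dots> = ennreal (C * x powr m * min 1 (u powr (1 / real K)))"
      by (simp add: ennreal_mult'[symmetric] mult_ac)
    finally show "emeasure lborel {y. \<bar>y\<bar> \<le> Z * x powr (\<kappa>2 / \<kappa>1) \<and> \<bar>series2 s x y\<bar> < \<epsilon>}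
      \<le> ennreal (C * x powr (\<kappa>2 / \<kappa>1) * min 1 ((\<epsilon> * x powr (- 1 / \<kappa>1)) powr (1 / real K)))"
      by (simp add: m_def u_def)
  qed
qed

section \<open>Area of sublevel sets\<close>

lemma has_sum_prod_decode:
  fixes f :: "nat \<times> nat \<Rightarrow> real"
  assumes "f summable_on UNIV"
  shows "(\<lambda>n. f (prod_decode n)) sums (\<Sum>\<^sub>\<infinity>p. f p)"
proof -
  have "((\<lambda>n. f (prod_decode n)) has_sum (\<Sum>\<^sub>\<infinity>p. f p)) UNIV"
    using has_sum_reindex_bij_betw[OF bij_prod_decode, of f] has_sum_infsum[OF assms] by simp
  then show ?thesis by (rule has_sum_imp_sums)
qed

lemma series2_summable:
  fixes s :: "nat \<Rightarrow> nat \<Rightarrow> real"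
  assumes "(\<lambda>(a, b). \<bar>s a b\<bar> * \<rho> ^ a * \<rho> ^ b) summable_on UNIV"
    and "\<bar>x\<bar> \<le> \<rho>" "\<bar>y\<bar> \<le> \<rho>"
  shows "(\<lambda>(a, b). s a b * x ^ a * y ^ b) summable_on UNIV"
proof (rule abs_summable_summable, rule summable_on_comparison_test[OF assms(1)])
  show "norm (case p of (a, b) \<Rightarrow> s a b * x ^ a * y ^ b) \<le> (case p of (a, b) \<Rightarrow> \<bar>s a b\<bar> * \<rho> ^ a * \<rho> ^ b)" for p
    using assms(2,3) by (auto simp: abs_mult power_abs case_prod_unfold intro!: mult_mono power_mono)
qed auto

text \<open>Enumerating the pairs by \<open>prod_decode\<close> turns the unordered double sum into
  a series of measurable functions. Cutting off by zero outside the closed square avoids points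
  where the series may fail to converge.\<close>

lemma series2_measurable:
  fixes s :: "nat \<Rightarrow> nat \<Rightarrow> real"
  assumes "(\<lambda>(a, b). \<bar>s a b\<bar> * \<rho> ^ a * \<rho> ^ b) summable_on UNIV"
  shows "(\<lambda>(x, y). if \<bar>x\<bar> \<le> \<rho> \<and> \<bar>y\<bar> \<le> \<rho> then series2 s x y else 0) \<in> borel_measurable (borel \<Otimes>\<^sub>M borel)"
proof -
  let ?t = "\<lambda>n (x, y). s (fst (prod_decode n)) (snd (prod_decode n)) * x ^ fst (prod_decode n) * y ^ snd (prod_decode n) :: real"
  have "(\<lambda>(x, y). if \<bar>x\<bar> \<le> \<rho> \<and> \<bar>y\<bar> \<le> \<rho> then series2 s x y else 0)
      = (\<lambda>p. if \<bar>fst p\<bar> \<le> \<rho> \<and> \<bar>snd p\<bar> \<le> \<rho> then (\<Sum>n. ?t n p) else 0)"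
  proof
    fix p :: "real \<times> real"
    show "(case p of (x, y) \<Rightarrow> if \<bar>x\<bar> \<le> \<rho> \<and> \<bar>y\<bar> \<le> \<rho> then series2 s x y else 0) =
       (if \<bar>fst p\<bar> \<le> \<rho> \<and> \<bar>snd p\<bar> \<le> \<rho> then (\<Sum>n. ?t n p) else 0)"
      using sums_unique[OF has_sum_prod_decode[OF series2_summable[OF assms, of "fst p" "snd p"]]]
      by (simp add: series2_def case_prod_unfold)
  qed
  also have "\<dots> \<in> borel_measurable (borel \<Otimes>\<^sub>M borel)"
    unfolding case_prod_unfold by measurable
  finally show ?thesis .
qed

section \<open>Integration of the slice bounds in x\<close>

lemma nn_integral_powr_0:
  assumes "q > -1" "c \<ge> (0::real)"
  shows "(\<integral>\<^sup>+x. indicator {0..c} x * ennreal (x powr q) \<partial>lborel) = ennreal (c powr (q + 1) / (q + 1))"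
  using nn_integral_has_integral_lebesgue'[of _ "\<lambda>x. x powr q", OF _ has_integral_powr_from_0[OF assms]]
  by (simp add: mult.commute)

lemma nn_integral_powr_inf:
  assumes "q < -1" "c > (0::real)"
  shows "(\<integral>\<^sup>+x. indicator {c..} x * ennreal (x powr q) \<partial>lborel) = ennreal (- (c powr (q + 1)) / (q + 1))"
  using nn_integral_has_integral_lebesgue'[of _ "\<lambda>x. x powr q", OF _ has_integral_powr_to_inf[OF assms]]
  by (simp add: mult.commute)

lemma nn_integral_inverse:
  assumes "0 < a" "a \<le> (b::real)"
  shows "(\<integral>\<^sup>+x. indicator {a..b} x * ennreal (x powr -1) \<partial>lborel) = ennreal (ln b - ln a)"
proof -
  have "((\<lambda>x. x powr -1) has_integral (ln b - ln a)) {a..b}"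
  proof (rule fundamental_theorem_of_calculus[OF assms(2)])
    show "(ln has_vector_derivative x powr -1) (at x within {a..b})" if "x \<in> {a..b}" for x
      using that assms
      by (auto simp: has_real_derivative_iff_has_vector_derivative[symmetric] powr_minus
          inverse_eq_divide intro!: derivative_eq_intros)
  qed
  from nn_integral_has_integral_lebesgue'[of _ "\<lambda>x. x powr -1", OF _ this]
  show ?thesis by (simp add: mult.commute)
qed

text \<open>The integral over 0 < x < x0 of the slice bound in \<open>strip_slice_estimate\<close>,
  without its constant. The two entries of the \<open>min\<close> cross at x =
  \<open>\<epsilon> powr \<kappa>1\<close>.\<close>

definition strip_integral :: "real \<Rightarrow> real \<Rightarrow> nat \<Rightarrow> real \<Rightarrow> real \<Rightarrow> ennreal" where
  "strip_integral \<kappa>1 \<kappa>2 K x0 \<epsilon> = (\<integral>\<^sup>+x. indicator {0<..<x0} x *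
     ennreal (x powr (\<kappa>2 / \<kappa>1) * min 1 ((\<epsilon> * x powr (- 1 / \<kappa>1)) powr (1 / real K))) \<partial>lborel)"

lemma powr_scaled:
  assumes "x > 0" "\<epsilon> > (0::real)"
  shows "x powr m * (\<epsilon> * x powr (- 1 / k)) powr t = \<epsilon> powr t * x powr (m - t / k)"
proof -
  have "(\<epsilon> * x powr (- 1 / k)) powr t = \<epsilon> powr t * x powr (- (t / k))"
    by (simp add: powr_mult powr_powr)
  then show ?thesis using assms powr_add[of x m "- (t / k)"] by simp
qed

text \<open>For any \<theta> between 0 and 1/K the \<open>min\<close> is at most the \<theta>-th
  power of its argument, and \<theta> < \<open>\<kappa>1 + \<kappa>2\<close> makes the resulting
  power of x integrable at 0. A tilted line has weight sum above 1/d, so \<theta> = 1/d is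
  admissible even with K = d, and no logarithm arises.\<close>

lemma strip_integral_subcritical:
  assumes "\<kappa>1 > 0" "\<kappa>2 > 0" "K \<ge> 1" "x0 > 0" "0 < \<theta>" "\<theta> < \<kappa>1 + \<kappa>2" "\<theta> \<le> 1 / real K" "\<epsilon> > 0"
  shows "strip_integral \<kappa>1 \<kappa>2 K x0 \<epsilon>
    \<le> ennreal (x0 powr (\<kappa>2 / \<kappa>1 - \<theta> / \<kappa>1 + 1) / (\<kappa>2 / \<kappa>1 - \<theta> / \<kappa>1 + 1) * \<epsilon> powr \<theta>)"
proof -
  define q where "q = \<kappa>2 / \<kappa>1 - \<theta> / \<kappa>1"
  have q: "q > -1" using assms by (simp add: q_def field_simps)
  have pt: "x powr (\<kappa>2 / \<kappa>1) * min 1 ((\<epsilon> * x powr (- 1 / \<kappa>1)) powr (1 / real K)) \<le> \<epsilon> powr \<theta> * x powr q"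
    if "x > 0" for x
  proof -
    define u where "u = \<epsilon> * x powr (- 1 / \<kappa>1)"
    have "u > 0" using assms that by (simp add: u_def)
    have "min 1 (u powr (1 / real K)) \<le> u powr \<theta>"
    proof (cases "u \<le> 1")
      case True
      then have "u powr (1 / real K) \<le> u powr \<theta>" using assms \<open>u > 0\<close> by (intro powr_mono') auto
      then show ?thesis by simp
    next
      case False
      then have "1 \<le> u powr \<theta>" using assms by (intro ge_one_powr_ge_zero) auto
      then show ?thesis by simp
    qed
    then have "x powr (\<kappa>2 / \<kappa>1) * min 1 (u powr (1 / real K)) \<le> x powr (\<kappa>2 / \<kappa>1) * u powr \<theta>"
      by (intro mult_left_mono) auto
    also have "\<dots> = \<epsilon> powr \<theta> * x powr q"
      unfolding u_def q_def by (rule powr_scaled) (use that assms in auto)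
    finally show ?thesis by (simp add: u_def)
  qed
  have "strip_integral \<kappa>1 \<kappa>2 K x0 \<epsilon> \<le> (\<integral>\<^sup>+x. ennreal (\<epsilon> powr \<theta>) * (indicator {0..x0} x * ennreal (x powr q)) \<partial>lborel)"
    unfolding strip_integral_def
  proof (intro nn_integral_mono)
    fix x :: real
    show "indicator {0<..<x0} x * ennreal (x powr (\<kappa>2 / \<kappa>1) * min 1 ((\<epsilon> * x powr (- 1 / \<kappa>1)) powr (1 / real K)))
      \<le> ennreal (\<epsilon> powr \<theta>) * (indicator {0..x0} x * ennreal (x powr q))"
    proof (cases "x \<in> {0<..<x0}")
      case True
      then show ?thesis using ennreal_leI[OF pt[of x]] by (simp add: ennreal_mult')
    qed simp
  qed
  also have "\<dots> = ennreal (\<epsilon> powr \<theta>) * ennreal (x0 powr (q + 1) / (q + 1))"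
    using nn_integral_powr_0[OF q, of x0] assms by (subst nn_integral_cmult) auto
  finally show ?thesis by (simp add: ennreal_mult'[symmetric] q_def mult.commute)
qed

text \<open>Left of the crossover the whole slice is counted, which already costs the order
  \<open>\<epsilon> powr (\<kappa>1 + \<kappa>2)\<close>; right of it the power bound is integrated.
  Whether the second integral adds a logarithm is decided by its exponent alone.\<close>

lemma strip_integral_split:
  assumes "\<kappa>1 > 0" "\<kappa>2 > 0" "K \<ge> 1" "\<epsilon> > 0"
  shows "strip_integral \<kappa>1 \<kappa>2 K x0 \<epsilon> \<le> ennreal (\<epsilon> powr (\<kappa>1 + \<kappa>2) / (\<kappa>2 / \<kappa>1 + 1))
    + ennreal (\<epsilon> powr (1 / real K)) * (\<integral>\<^sup>+x. indicator {\<epsilon> powr \<kappa>1..x0} x * ennreal (x powr (\<kappa>2 / \<kappa>1 - 1 / (\<kappa>1 * real K))) \<partial>lborel)"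
proof -
  define a where "a = \<epsilon> powr \<kappa>1"
  have "a > 0" using assms by (simp add: a_def)
  let ?m = "\<kappa>2 / \<kappa>1"
  let ?q = "?m - 1 / (\<kappa>1 * real K)"
  have m: "?m > 0" using assms by simp
  have eq: "x powr ?m * (\<epsilon> * x powr (- 1 / \<kappa>1)) powr (1 / real K) = \<epsilon> powr (1 / real K) * x powr ?q" if "x > 0" for x
    using powr_scaled[OF that assms(4), of ?m \<kappa>1 "1 / real K"] by (simp add: mult.commute)
  have "strip_integral \<kappa>1 \<kappa>2 K x0 \<epsilon> \<le> (\<integral>\<^sup>+x. indicator {0..a} x * ennreal (x powr ?m)
      + ennreal (\<epsilon> powr (1 / real K)) * (indicator {a..x0} x * ennreal (x powr ?q)) \<partial>lborel)"
    unfolding strip_integral_def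
  proof (intro nn_integral_mono)
    fix x :: real
    let ?l = "x powr ?m * min 1 ((\<epsilon> * x powr (- 1 / \<kappa>1)) powr (1 / real K))"
    have 1: "?l \<le> x powr ?m" by (simp add: mult_left_le)
    have 2: "?l \<le> \<epsilon> powr (1 / real K) * x powr ?q" if "x > 0"
      unfolding eq[OF that, symmetric] by (intro mult_left_mono) auto
    consider "x \<notin> {0<..<x0}" | "x \<in> {0<..<x0}" "x \<le> a" | "x \<in> {0<..<x0}" "a < x" by fastforce
    then show "indicator {0<..<x0} x * ennreal ?l \<le> indicator {0..a} x * ennreal (x powr ?m)
      + ennreal (\<epsilon> powr (1 / real K)) * (indicator {a..x0} x * ennreal (x powr ?q))"
    proof cases
      case 2
      have "ennreal ?l \<le> ennreal (x powr ?m)" using 1 by (rule ennreal_leI)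
      then show ?thesis using 2 by (simp add: indicator_def add_increasing2)
    next
      case 3
      have "ennreal ?l \<le> ennreal (\<epsilon> powr (1 / real K) * x powr ?q)"
        by (rule ennreal_leI[OF 2]) (use 3 in simp)
      then show ?thesis using 3 by (simp add: ennreal_mult' add_increasing)
    qed simp
  qed
  also have "\<dots> = (\<integral>\<^sup>+x. indicator {0..a} x * ennreal (x powr ?m) \<partial>lborel)
      + ennreal (\<epsilon> powr (1 / real K)) * (\<integral>\<^sup>+x. indicator {a..x0} x * ennreal (x powr ?q) \<partial>lborel)"
    by (subst nn_integral_add) (auto simp: nn_integral_cmult)
  also have "(\<integral>\<^sup>+x. indicator {0..a} x * ennreal (x powr ?m) \<partial>lborel) = ennreal (a powr (?m + 1) / (?m + 1))"
    using m \<open>a > 0\<close> by (intro nn_integral_powr_0) auto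
  also have "a powr (?m + 1) = \<epsilon> powr (\<kappa>1 + \<kappa>2)"
    using assms by (simp add: a_def powr_powr distrib_left add.commute)
  finally show ?thesis by (simp add: a_def)
qed

text \<open>Weight sum below 1/K means that the exponent of x is below -1: the integral converges at
  infinity and is determined by the crossover point. This is where orders strictly below d are
  exploited.\<close>

lemma strip_integral_critical:
  assumes "\<kappa>1 > 0" "\<kappa>2 > 0" "K \<ge> 1" "\<kappa>1 + \<kappa>2 < 1 / real K"
  obtains C where "C \<ge> 0" "\<And>\<epsilon>. \<epsilon> > 0 \<Longrightarrow> strip_integral \<kappa>1 \<kappa>2 K x0 \<epsilon> \<le> ennreal (C * \<epsilon> powr (\<kappa>1 + \<kappa>2))"
proof -
  let ?m = "\<kappa>2 / \<kappa>1"
  let ?q = "?m - 1 / (\<kappa>1 * real K)"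
  have q: "?q < -1"
  proof -
    have "(\<kappa>1 + \<kappa>2) / \<kappa>1 < (1 / real K) / \<kappa>1" using assms by (intro divide_strict_right_mono) auto
    then show ?thesis using assms by (simp add: add_divide_distrib mult.commute)
  qed
  define C where "C = 1 / (?m + 1) + 1 / - (?q + 1)"
  have m: "?m > 0" using assms by simp
  show thesis
  proof
    show "C \<ge> 0" using q m by (simp add: C_def)
    fix \<epsilon> :: real assume "\<epsilon> > 0"
    define a where "a = \<epsilon> powr \<kappa>1"
    have "a > 0" using \<open>\<epsilon> > 0\<close> by (simp add: a_def)
    have "(\<integral>\<^sup>+x. indicator {a..x0} x * ennreal (x powr ?q) \<partial>lborel)
        \<le> (\<integral>\<^sup>+x. indicator {a..} x * ennreal (x powr ?q) \<partial>lborel)"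
      by (intro nn_integral_mono) (auto simp: indicator_def)
    also have "\<dots> = ennreal (- (a powr (?q + 1)) / (?q + 1))"
      by (rule nn_integral_powr_inf[OF q \<open>a > 0\<close>])
    finally have "ennreal (\<epsilon> powr (1 / real K)) * (\<integral>\<^sup>+x. indicator {a..x0} x * ennreal (x powr ?q) \<partial>lborel)
        \<le> ennreal (\<epsilon> powr (1 / real K)) * ennreal (- (a powr (?q + 1)) / (?q + 1))"
      by (rule mult_left_mono) simp
    also have "\<dots> = ennreal (\<epsilon> powr (1 / real K) * a powr (?q + 1) * (1 / - (?q + 1)))"
    proof -
      have "e * (- A / Q) = e * A * (1 / - Q)" for e A Q :: real by simp
      then show ?thesis by (simp only: ennreal_mult'[OF powr_ge_zero, symmetric])
    qed
    also have "\<epsilon> powr (1 / real K) * a powr (?q + 1) = \<epsilon> powr (\<kappa>1 + \<kappa>2)"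
    proof -
      have "\<kappa>1 * (?q + 1) = \<kappa>1 + \<kappa>2 - 1 / real K" using assms by (simp add: field_simps)
      then show ?thesis using \<open>\<epsilon> > 0\<close> by (simp add: a_def powr_powr powr_add[symmetric])
    qed
    finally have "strip_integral \<kappa>1 \<kappa>2 K x0 \<epsilon> \<le> ennreal (\<epsilon> powr (\<kappa>1 + \<kappa>2) / (?m + 1))
        + ennreal (\<epsilon> powr (\<kappa>1 + \<kappa>2) * (1 / - (?q + 1)))"
      using strip_integral_split[OF assms(1-3) \<open>\<epsilon> > 0\<close>, of x0]
      unfolding a_def by (meson add_left_mono order_trans)
    also have "\<dots> = ennreal (C * \<epsilon> powr (\<kappa>1 + \<kappa>2))"
    proof -
      have nn: "0 \<le> \<epsilon> powr (\<kappa>1 + \<kappa>2) / (?m + 1)" "0 \<le> \<epsilon> powr (\<kappa>1 + \<kappa>2) * (1 / - (?q + 1))"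
        using q m by (auto intro!: mult_nonneg_nonneg divide_nonneg_nonneg)
      have "e / Y + e * (1 / Q) = (1 / Y + 1 / Q) * e" for e Y Q :: real by (simp add: distrib_right)
      then show ?thesis unfolding ennreal_plus[OF nn, symmetric] C_def by (simp only:)
    qed
    finally show "strip_integral \<kappa>1 \<kappa>2 K x0 \<epsilon> \<le> ennreal (C * \<epsilon> powr (\<kappa>1 + \<kappa>2))" .
  qed
qed

text \<open>Equality makes the exponent exactly -1, and the integral of dx / x from the crossover to
  x0 is the logarithm.\<close>

lemma strip_integral_log:
  assumes "\<kappa>1 > 0" "\<kappa>2 > 0" "K \<ge> 1" "\<kappa>1 + \<kappa>2 = 1 / real K" "x0 > 0"
  obtains C where "C \<ge> 0" "\<And>\<epsilon>. \<epsilon> > 0 \<Longrightarrow>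
    strip_integral \<kappa>1 \<kappa>2 K x0 \<epsilon> \<le> ennreal (C * (\<epsilon> powr (\<kappa>1 + \<kappa>2) * (1 + \<bar>ln \<epsilon>\<bar>)))"
proof -
  let ?m = "\<kappa>2 / \<kappa>1"
  have q: "?m - 1 / (\<kappa>1 * real K) = -1"
  proof -
    have "1 / (\<kappa>1 * real K) = (\<kappa>1 + \<kappa>2) / \<kappa>1" using assms(4) by (simp add: mult.commute)
    also have "\<dots> = 1 + \<kappa>2 / \<kappa>1" using assms(1) by (simp add: add_divide_distrib)
    finally show ?thesis by simp
  qed
  define C where "C = 1 / (?m + 1) + (\<bar>ln x0\<bar> + \<kappa>1)"
  have m: "?m > 0" using assms by simp
  show thesis
  proof
    show "C \<ge> 0" using m assms by (simp add: C_def)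
    fix \<epsilon> :: real assume "\<epsilon> > 0"
    define a where "a = \<epsilon> powr \<kappa>1"
    have "a > 0" using \<open>\<epsilon> > 0\<close> by (simp add: a_def)
    let ?e = "\<epsilon> powr (\<kappa>1 + \<kappa>2)"
    have "(\<integral>\<^sup>+x. indicator {a..x0} x * ennreal (x powr -1) \<partial>lborel) \<le> ennreal (\<bar>ln x0\<bar> + \<kappa>1 * \<bar>ln \<epsilon>\<bar>)"
    proof (cases "a \<le> x0")
      case True
      have "ln a = \<kappa>1 * ln \<epsilon>" using \<open>\<epsilon> > 0\<close> by (simp add: a_def ln_powr)
      moreover have "- (\<kappa>1 * ln \<epsilon>) \<le> \<kappa>1 * \<bar>ln \<epsilon>\<bar>"
        using assms(1) by (metis abs_ge_minus_self less_imp_le mult_left_mono mult_minus_right)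
      ultimately have "ln x0 - ln a \<le> \<bar>ln x0\<bar> + \<kappa>1 * \<bar>ln \<epsilon>\<bar>" by simp
      then show ?thesis unfolding nn_integral_inverse[OF \<open>a > 0\<close> True] by (rule ennreal_leI)
    qed simp
    then have i: "ennreal ?e * (\<integral>\<^sup>+x. indicator {a..x0} x * ennreal (x powr -1) \<partial>lborel)
        \<le> ennreal ?e * ennreal (\<bar>ln x0\<bar> + \<kappa>1 * \<bar>ln \<epsilon>\<bar>)"
      by (rule mult_left_mono) simp
    have "strip_integral \<kappa>1 \<kappa>2 K x0 \<epsilon> \<le> ennreal (?e / (?m + 1))
        + ennreal ?e * (\<integral>\<^sup>+x. indicator {a..x0} x * ennreal (x powr -1) \<partial>lborel)"
      using strip_integral_split[OF assms(1-3) \<open>\<epsilon> > 0\<close>, of x0] unfolding a_def q assms(4) .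
    also note add_left_mono[OF i]
    finally have "strip_integral \<kappa>1 \<kappa>2 K x0 \<epsilon> \<le> ennreal (?e / (?m + 1))
        + ennreal ?e * ennreal (\<bar>ln x0\<bar> + \<kappa>1 * \<bar>ln \<epsilon>\<bar>)" .
    also have "\<dots> = ennreal (?e / (?m + 1) + ?e * (\<bar>ln x0\<bar> + \<kappa>1 * \<bar>ln \<epsilon>\<bar>))"
    proof -
      have nn: "0 \<le> ?e / (?m + 1)" "0 \<le> ?e * (\<bar>ln x0\<bar> + \<kappa>1 * \<bar>ln \<epsilon>\<bar>)"
        using m assms(1) by (auto intro!: divide_nonneg_nonneg)
      show ?thesis
        unfolding ennreal_plus[OF nn] by (simp only: ennreal_mult'[OF powr_ge_zero])
    qed
    also have "\<dots> \<le> ennreal (C * (?e * (1 + \<bar>ln \<epsilon>\<bar>)))"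
    proof (rule ennreal_leI)
      have "1 / (?m + 1) + (\<bar>ln x0\<bar> + \<kappa>1 * \<bar>ln \<epsilon>\<bar>) \<le> C * (1 + \<bar>ln \<epsilon>\<bar>)"
        using m assms by (simp add: C_def distrib_left distrib_right add_increasing add_increasing2)
      then have "?e * (1 / (?m + 1) + (\<bar>ln x0\<bar> + \<kappa>1 * \<bar>ln \<epsilon>\<bar>)) \<le> ?e * (C * (1 + \<bar>ln \<epsilon>\<bar>))"
        by (intro mult_left_mono) auto
      then show "?e / (?m + 1) + ?e * (\<bar>ln x0\<bar> + \<kappa>1 * \<bar>ln \<epsilon>\<bar>) \<le> C * (?e * (1 + \<bar>ln \<epsilon>\<bar>))"
        by (simp add: algebra_simps)
    qed
    finally show "strip_integral \<kappa>1 \<kappa>2 K x0 \<epsilon> \<le> ennreal (C * (?e * (1 + \<bar>ln \<epsilon>\<bar>)))" .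
  qed
qed

section \<open>Symmetries and the area near the origin\<close>

lemma series2_swap: "series2 (\<lambda>b a. s a b) y x = series2 s x y"
proof -
  have "series2 (\<lambda>b a. s a b) y x = (\<Sum>\<^sub>\<infinity>p. case prod.swap p of (a, b) \<Rightarrow> s a b * x ^ a * y ^ b)"
    unfolding series2_def by (rule infsum_cong) (auto simp: mult_ac)
  also have "\<dots> = series2 s x y"
    unfolding series2_def by (rule infsum_reindex_bij_betw) (rule bij_swap)
  finally show ?thesis .
qed

lemma series2_reflect: "series2 (\<lambda>a b. \<sigma> ^ a * s a b) x y = series2 s (\<sigma> * x) y"
  unfolding series2_def by (rule infsum_cong) (auto simp: power_mult_distrib)

lemma summable_swap2:
  fixes s :: "nat \<Rightarrow> nat \<Rightarrow> real"
  assumes "(\<lambda>(a, b). \<bar>s a b\<bar> * \<rho> ^ a * \<rho> ^ b) summable_on UNIV"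
  shows "(\<lambda>(b, a). \<bar>s a b\<bar> * \<rho> ^ b * \<rho> ^ a) summable_on UNIV"
proof -
  have "(\<lambda>(b, a). \<bar>s a b\<bar> * \<rho> ^ b * \<rho> ^ a) summable_on (UNIV \<times> UNIV)"
    using assms by (subst summable_on_swap) (simp add: case_prod_unfold mult_ac)
  then show ?thesis by simp
qed

lemma lborel_reflect_fst:
  fixes X :: "(real \<times> real) set"
  assumes X: "X \<in> sets (borel \<Otimes>\<^sub>M borel)" and "\<sigma> \<in> {1, -1 :: real}"
  shows "(\<lambda>(x, y). (\<sigma> * x, y)) -` X \<in> sets (borel \<Otimes>\<^sub>M borel)"
    and "emeasure (lborel \<Otimes>\<^sub>M lborel) ((\<lambda>(x, y). (\<sigma> * x, y)) -` X) = emeasure (lborel \<Otimes>\<^sub>M lborel) X"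
proof -
  have m: "(\<lambda>(x, y). (\<sigma> * x, y)) \<in> borel \<Otimes>\<^sub>M borel \<rightarrow>\<^sub>M borel \<Otimes>\<^sub>M (borel :: real measure)"
    by measurable
  have s: "sets (lborel \<Otimes>\<^sub>M lborel) = sets (borel \<Otimes>\<^sub>M (borel :: real measure))"
    by (rule sets_pair_measure_cong) simp_all
  show *: "(\<lambda>(x, y). (\<sigma> * x, y)) -` X \<in> sets (borel \<Otimes>\<^sub>M borel)"
    using measurable_sets[OF m X] by (simp add: space_pair_measure)
  have "emeasure (lborel \<Otimes>\<^sub>M lborel) X = (\<integral>\<^sup>+x. emeasure lborel (Pair x -` X) \<partial>lborel)"
    by (rule lborel.emeasure_pair_measure_alt) (simp add: s X)
  also have "\<dots> = ennreal \<bar>\<sigma>\<bar> * (\<integral>\<^sup>+x. emeasure lborel (Pair (0 + \<sigma> * x) -` X) \<partial>lborel)"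
    by (rule nn_integral_real_affine)
      (use lborel.measurable_emeasure_Pair[of X lborel] assms(2) in \<open>auto simp: s X\<close>)
  also have "\<dots> = (\<integral>\<^sup>+x. emeasure lborel (Pair x -` ((\<lambda>(x, y). (\<sigma> * x, y)) -` X)) \<partial>lborel)"
    using assms(2) by (auto simp: vimage_def)
  also have "\<dots> = emeasure (lborel \<Otimes>\<^sub>M lborel) ((\<lambda>(x, y). (\<sigma> * x, y)) -` X)"
    by (rule lborel.emeasure_pair_measure_alt[symmetric]) (simp add: s *)
  finally show "emeasure (lborel \<Otimes>\<^sub>M lborel) ((\<lambda>(x, y). (\<sigma> * x, y)) -` X) = emeasure (lborel \<Otimes>\<^sub>M lborel) X" ..
qed

lemma lborel_swap:
  fixes X :: "(real \<times> real) set"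
  assumes X: "X \<in> sets (borel \<Otimes>\<^sub>M borel)"
  shows "(\<lambda>(x, y). (y, x)) -` X \<in> sets (borel \<Otimes>\<^sub>M borel)"
    and "emeasure (lborel \<Otimes>\<^sub>M lborel) ((\<lambda>(x, y). (y, x)) -` X) = emeasure (lborel \<Otimes>\<^sub>M lborel) X"
proof -
  have m: "(\<lambda>(x, y). (y, x)) \<in> borel \<Otimes>\<^sub>M borel \<rightarrow>\<^sub>M borel \<Otimes>\<^sub>M (borel :: real measure)"
    by measurable
  have s: "sets (lborel \<Otimes>\<^sub>M lborel) = sets (borel \<Otimes>\<^sub>M (borel :: real measure))"
    by (rule sets_pair_measure_cong) simp_all
  show "(\<lambda>(x, y). (y, x)) -` X \<in> sets (borel \<Otimes>\<^sub>M borel)"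
    using measurable_sets[OF m X] by (simp add: space_pair_measure)
  have "emeasure (lborel \<Otimes>\<^sub>M lborel) X = emeasure (distr (lborel \<Otimes>\<^sub>M lborel) (lborel \<Otimes>\<^sub>M lborel) (\<lambda>(x, y). (y, x))) X"
    by (subst lborel_pair.distr_pair_swap[symmetric]) simp
  also have "\<dots> = emeasure (lborel \<Otimes>\<^sub>M lborel) ((\<lambda>(x, y). (y, x)) -` X)"
    by (subst emeasure_distr) (auto simp: s X space_pair_measure)
  finally show "emeasure (lborel \<Otimes>\<^sub>M lborel) ((\<lambda>(x, y). (y, x)) -` X) = emeasure (lborel \<Otimes>\<^sub>M lborel) X" ..
qed

text \<open>Integrates the slice bound by Tonelli. The bound \<open>bd\<close> is a parameter, so
  one argument serves all three estimates of \<open>strip_integral\<close>; these are required for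
  every x0 because the slice estimate chooses its own.\<close>

lemma strip_area:
  fixes s :: "nat \<Rightarrow> nat \<Rightarrow> real"
  assumes "\<rho> > 0" and summ: "(\<lambda>(a, b). \<bar>s a b\<bar> * \<rho> ^ a * \<rho> ^ b) summable_on UNIV"
    and \<kappa>: "\<kappa>1 > 0" "\<kappa>2 > (0::real)"
    and supp: "\<And>a b. s a b \<noteq> 0 \<Longrightarrow> \<kappa>1 * real a + \<kappa>2 * real b \<ge> 1"
    and "K \<ge> 1" "Z > 0"
    and nz: "\<And>z. \<bar>z\<bar> \<le> Z \<Longrightarrow> \<exists>j\<le>K. poly ((pderiv ^^ j) (face_poly s \<kappa>1 \<kappa>2)) z \<noteq> 0"
    and strip: "\<And>x0. 0 < x0 \<Longrightarrow> x0 \<le> \<rho> \<Longrightarrow> \<exists>C\<ge>0. \<forall>\<epsilon>>0. strip_integral \<kappa>1 \<kappa>2 K x0 \<epsilon> \<le> ennreal (C * bd \<epsilon>)"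
  shows "\<exists>C\<ge>0. \<exists>x0>0. x0 \<le> \<rho> \<and> Z * x0 powr (\<kappa>2 / \<kappa>1) \<le> \<rho> \<and> (\<forall>\<epsilon>>0.
      {(x, y). 0 < x \<and> x < x0 \<and> \<bar>y\<bar> \<le> Z * x powr (\<kappa>2 / \<kappa>1) \<and> \<bar>series2 s x y\<bar> < \<epsilon>} \<in> sets (borel \<Otimes>\<^sub>M borel) \<and>
      emeasure (lborel \<Otimes>\<^sub>M lborel) {(x, y). 0 < x \<and> x < x0 \<and> \<bar>y\<bar> \<le> Z * x powr (\<kappa>2 / \<kappa>1) \<and> \<bar>series2 s x y\<bar> < \<epsilon>}
      \<le> ennreal (C * bd \<epsilon>))"
proof -
  let ?m = "\<kappa>2 / \<kappa>1"
  obtain C x0 where C: "C \<ge> 0" "0 < x0" "x0 \<le> \<rho>" "Z * x0 powr ?m \<le> \<rho>"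
    "\<And>x \<epsilon>. 0 < x \<Longrightarrow> x < x0 \<Longrightarrow> \<epsilon> > 0 \<Longrightarrow>
      emeasure lborel {y. \<bar>y\<bar> \<le> Z * x powr ?m \<and> \<bar>series2 s x y\<bar> < \<epsilon>}
      \<le> ennreal (C * x powr ?m * min 1 ((\<epsilon> * x powr (- 1 / \<kappa>1)) powr (1 / real K)))"
    by (rule strip_slice_estimate[OF \<open>\<rho> > 0\<close> summ \<kappa> supp \<open>K \<ge> 1\<close> \<open>Z > 0\<close> nz]) blast+
  obtain C' where C': "C' \<ge> 0" "\<And>\<epsilon>. \<epsilon> > 0 \<Longrightarrow> strip_integral \<kappa>1 \<kappa>2 K x0 \<epsilon> \<le> ennreal (C' * bd \<epsilon>)"
    using strip[OF C(2,3)] by blast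
  have "{(x, y). 0 < x \<and> x < x0 \<and> \<bar>y\<bar> \<le> Z * x powr ?m \<and> \<bar>series2 s x y\<bar> < \<epsilon>} \<in> sets (borel \<Otimes>\<^sub>M borel) \<and>
      emeasure (lborel \<Otimes>\<^sub>M lborel) {(x, y). 0 < x \<and> x < x0 \<and> \<bar>y\<bar> \<le> Z * x powr ?m \<and> \<bar>series2 s x y\<bar> < \<epsilon>}
      \<le> ennreal (C * C' * bd \<epsilon>)" if "\<epsilon> > 0" for \<epsilon>
  proof -
    define g where "g = (\<lambda>(x, y). if \<bar>x\<bar> \<le> \<rho> \<and> \<bar>y\<bar> \<le> \<rho> then series2 s x y else 0)"
    have gm: "g \<in> borel_measurable (borel \<Otimes>\<^sub>M borel)"
      unfolding g_def by (rule series2_measurable[OF summ])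
    let ?X = "{(x, y). 0 < x \<and> x < x0 \<and> \<bar>y\<bar> \<le> Z * x powr ?m \<and> \<bar>series2 s x y\<bar> < \<epsilon>}"
    have inb: "\<bar>y\<bar> \<le> \<rho>" if "0 < x" "x < x0" "\<bar>y\<bar> \<le> Z * x powr ?m" for x y
    proof -
      have "x powr ?m \<le> x0 powr ?m" using that \<kappa> by (intro powr_mono2) auto
      then have "Z * x powr ?m \<le> Z * x0 powr ?m" using \<open>Z > 0\<close> by simp
      then show ?thesis using that C(4) by linarith
    qed
    have "?X = {p \<in> space (borel \<Otimes>\<^sub>M borel). 0 < fst p \<and> fst p < x0 \<and> \<bar>snd p\<bar> \<le> Z * fst p powr ?m \<and> \<bar>g p\<bar> < \<epsilon>}"
      using inb C(3) by (auto simp: space_pair_measure g_def)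
    also have "\<dots> \<in> sets (borel \<Otimes>\<^sub>M borel)"
    proof -
      let ?M = "borel \<Otimes>\<^sub>M borel :: (real \<times> real) measure"
      have "{p \<in> space ?M. \<bar>g p\<bar> < \<epsilon>} \<in> sets ?M"
        by (rule borel_measurable_less[OF borel_measurable_abs[OF gm]]) simp
      moreover have f: "fst \<in> borel_measurable ?M" "snd \<in> borel_measurable ?M"
        by (rule measurable_fst measurable_snd)+
      have "{p \<in> space ?M. \<bar>snd p\<bar> \<le> Z * fst p powr ?m} \<in> sets ?M"
        by (intro borel_measurable_le borel_measurable_abs borel_measurable_times powr_real_measurable f) simp_all
      moreover have "{p \<in> space ?M. 0 < fst p} \<in> sets ?M"
        "{p \<in> space ?M. fst p < x0} \<in> sets ?M"
        using f by (auto intro!: borel_measurable_less)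
      ultimately have "{p \<in> space ?M. 0 < fst p} \<inter> ({p \<in> space ?M. fst p < x0} \<inter>
          ({p \<in> space ?M. \<bar>snd p\<bar> \<le> Z * fst p powr ?m}
          \<inter> {p \<in> space ?M. \<bar>g p\<bar> < \<epsilon>})) \<in> sets ?M"
        by (intro sets.Int)
      then show ?thesis by (simp add: Int_def conj_ac cong: conj_cong)
    qed
    finally have X: "?X \<in> sets (borel \<Otimes>\<^sub>M borel)" .
    then have "?X \<in> sets (lborel \<Otimes>\<^sub>M lborel)"
      by (simp add: sets_pair_measure_cong[OF sets_lborel sets_lborel])
    then have "emeasure (lborel \<Otimes>\<^sub>M lborel) ?X = (\<integral>\<^sup>+x. emeasure lborel (Pair x -` ?X) \<partial>lborel)"
      by (rule lborel.emeasure_pair_measure_alt)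
    also have "\<dots> \<le> (\<integral>\<^sup>+x. ennreal C * (indicator {0<..<x0} x *
         ennreal (x powr ?m * min 1 ((\<epsilon> * x powr (- 1 / \<kappa>1)) powr (1 / real K)))) \<partial>lborel)"
    proof (intro nn_integral_mono)
      fix x :: real
      show "emeasure lborel (Pair x -` ?X) \<le> ennreal C * (indicator {0<..<x0} x *
         ennreal (x powr ?m * min 1 ((\<epsilon> * x powr (- 1 / \<kappa>1)) powr (1 / real K))))"
      proof (cases "0 < x \<and> x < x0")
        case True
        then have "Pair x -` ?X = {y. \<bar>y\<bar> \<le> Z * x powr ?m \<and> \<bar>series2 s x y\<bar> < \<epsilon>}" by auto
        then show ?thesis using C(5)[of x \<epsilon>] True \<open>\<epsilon> > 0\<close> C(1)
          by (simp add: ennreal_mult'[symmetric] mult.assoc)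
      next
        case False
        then have "Pair x -` ?X = {}" by auto
        then show ?thesis by (simp only:) simp
      qed
    qed
    also have "\<dots> = ennreal C * strip_integral \<kappa>1 \<kappa>2 K x0 \<epsilon>"
      unfolding strip_integral_def by (rule nn_integral_cmult) simp
    also have "\<dots> \<le> ennreal C * ennreal (C' * bd \<epsilon>)"
      by (intro mult_left_mono C'(2)[OF \<open>\<epsilon> > 0\<close>]) simp
    also have "\<dots> = ennreal (C * C' * bd \<epsilon>)"
      using C(1) by (simp add: ennreal_mult'[symmetric] mult.assoc)
    finally show ?thesis using X by blast
  qed
  moreover have "C * C' \<ge> 0" using C(1) C'(1) by simp
  ultimately show ?thesis using C(2-4) by blast
qed

lemma finite_order_near_0:
  assumes "j \<le> K" "poly ((pderiv ^^ j) p) (0::real) \<noteq> 0"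
  obtains \<delta> where "\<delta> > 0" "\<And>z. \<bar>z\<bar> \<le> \<delta> \<Longrightarrow> \<exists>j\<le>K. poly ((pderiv ^^ j) p) z \<noteq> 0"
proof -
  let ?q = "(pderiv ^^ j) p"
  have "isCont (poly ?q) 0" by simp
  then obtain r where r: "r > 0" "\<And>t. \<bar>t\<bar> < r \<Longrightarrow> \<bar>poly ?q t - poly ?q 0\<bar> < \<bar>poly ?q 0\<bar>"
    using assms(2) unfolding continuous_at_eps_delta
    by (metis diff_zero dist_real_def zero_less_abs_iff)
  have "\<exists>j\<le>K. poly ((pderiv ^^ j) p) z \<noteq> 0" if "\<bar>z\<bar> \<le> r / 2" for z
  proof -
    have "\<bar>z\<bar> < r" using that r(1) by linarith
    from r(2)[OF this] have "poly ?q z \<noteq> 0" by auto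
    then show ?thesis using assms(1) by blast
  qed
  then show thesis using that[of "r / 2"] r(1) by simp
qed

text \<open>The regions \<open>|y| \<le> Z |x|\<^sup>m\<close> and \<open>|x| \<le> \<delta> |y|\<^bsup>1/m\<^esup>\<close> cover a neighbourhood of the origin once
  \<open>Z = \<delta>\<^bsup>-m\<^esup>\<close>, and the second is the first with the coordinates exchanged; there only the order of
  the face polynomial at \<open>0\<close> matters.\<close>

lemma sublevel_area:
  fixes s :: "nat \<Rightarrow> nat \<Rightarrow> real"
  assumes "\<rho> > 0" and summ: "(\<lambda>(a, b). \<bar>s a b\<bar> * \<rho> ^ a * \<rho> ^ b) summable_on UNIV"
    and \<kappa>: "\<kappa>1 > 0" "\<kappa>2 > (0::real)"
    and supp: "\<And>a b. s a b \<noteq> 0 \<Longrightarrow> \<kappa>1 * real a + \<kappa>2 * real b \<ge> 1"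
    and "K \<ge> 1"
    and nz: "\<And>\<sigma> z. \<sigma> \<in> {1, -1} \<Longrightarrow> \<exists>j\<le>K. poly ((pderiv ^^ j) (face_poly (\<lambda>a b. \<sigma> ^ a * s a b) \<kappa>1 \<kappa>2)) z \<noteq> 0"
    and nz0: "\<And>\<sigma>. \<sigma> \<in> {1, -1} \<Longrightarrow> \<exists>j\<le>K. poly ((pderiv ^^ j) (face_poly (\<lambda>b a. \<sigma> ^ b * s a b) \<kappa>2 \<kappa>1)) 0 \<noteq> 0"
    and strip: "\<And>x0. 0 < x0 \<Longrightarrow> \<exists>C\<ge>0. \<forall>\<epsilon>>0. strip_integral \<kappa>1 \<kappa>2 K x0 \<epsilon> \<le> ennreal (C * bd \<epsilon>)"
    and strip': "\<And>x0. 0 < x0 \<Longrightarrow> \<exists>C\<ge>0. \<forall>\<epsilon>>0. strip_integral \<kappa>2 \<kappa>1 K x0 \<epsilon> \<le> ennreal (C * bd \<epsilon>)"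
    and bd: "\<And>\<epsilon>. \<epsilon> > 0 \<Longrightarrow> bd \<epsilon> \<ge> 0"
  shows "\<exists>C\<ge>0. \<exists>r>0. r \<le> \<rho> \<and> (\<forall>\<epsilon>>0. \<exists>N\<in>sets lborel.
      {(x, y). \<bar>x\<bar> < r \<and> \<bar>y\<bar> < r \<and> \<bar>series2 s x y\<bar> < \<epsilon>} \<subseteq> N \<and> emeasure lborel N \<le> ennreal (C * bd \<epsilon>))"
proof -
  let ?m = "\<kappa>2 / \<kappa>1" let ?n = "\<kappa>1 / \<kappa>2"
  have sgn: "(\<lambda>(a, b). \<bar>\<sigma> ^ a * s a b\<bar> * \<rho> ^ a * \<rho> ^ b) = (\<lambda>(a, b). \<bar>s a b\<bar> * \<rho> ^ a * \<rho> ^ b)"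
    "(\<lambda>(b, a). \<bar>\<sigma> ^ b * s a b\<bar> * \<rho> ^ b * \<rho> ^ a) = (\<lambda>(b, a). \<bar>s a b\<bar> * \<rho> ^ b * \<rho> ^ a)"
    if "\<sigma> \<in> {1, -1}" for \<sigma> using that by (auto simp: abs_mult power_abs)
  have "\<exists>\<delta>>0. \<forall>z. \<bar>z\<bar> \<le> \<delta> \<longrightarrow> (\<exists>j\<le>K. poly ((pderiv ^^ j) (face_poly (\<lambda>b a. \<sigma> ^ b * s a b) \<kappa>2 \<kappa>1)) z \<noteq> 0)"
    if \<sigma>: "\<sigma> \<in> {1, -1}" for \<sigma>
  proof -
    obtain j where j: "j \<le> K" "poly ((pderiv ^^ j) (face_poly (\<lambda>b a. \<sigma> ^ b * s a b) \<kappa>2 \<kappa>1)) 0 \<noteq> 0"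
      using nz0[OF \<sigma>] by blast
    from finite_order_near_0[OF this] show ?thesis by blast
  qed
  note ex = this
  obtain \<delta>1 where \<delta>1: "\<delta>1 > 0"
    "\<And>z. \<bar>z\<bar> \<le> \<delta>1 \<Longrightarrow> \<exists>j\<le>K. poly ((pderiv ^^ j) (face_poly (\<lambda>b a. 1 ^ b * s a b) \<kappa>2 \<kappa>1)) z \<noteq> 0"
    using ex[of 1] by blast
  obtain \<delta>2 where \<delta>2: "\<delta>2 > 0"
    "\<And>z. \<bar>z\<bar> \<le> \<delta>2 \<Longrightarrow> \<exists>j\<le>K. poly ((pderiv ^^ j) (face_poly (\<lambda>b a. (-1) ^ b * s a b) \<kappa>2 \<kappa>1)) z \<noteq> 0"
    using ex[of "-1"] by blast
  define \<delta> where "\<delta> = min \<delta>1 \<delta>2"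
  have \<delta>: "\<delta> > 0" "\<delta> \<le> \<delta>1" "\<delta> \<le> \<delta>2" using \<delta>1(1) \<delta>2(1) by (auto simp: \<delta>_def)
  define Z where "Z = \<delta> powr (- ?m)"
  have "Z > 0" using \<delta> by (simp add: Z_def)
  let ?A = "\<lambda>\<sigma> x0 \<epsilon>. {(x, y). 0 < x \<and> x < x0 \<and> \<bar>y\<bar> \<le> Z * x powr ?m \<and> \<bar>series2 (\<lambda>a b. \<sigma> ^ a * s a b) x y\<bar> < \<epsilon>}"
  let ?B = "\<lambda>\<sigma> x0 \<epsilon>. {(x, y). 0 < x \<and> x < x0 \<and> \<bar>y\<bar> \<le> \<delta> * x powr ?n \<and> \<bar>series2 (\<lambda>b a. \<sigma> ^ b * s a b) x y\<bar> < \<epsilon>}"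
  have A: "\<exists>C\<ge>0. \<exists>x0>0. x0 \<le> \<rho> \<and> Z * x0 powr ?m \<le> \<rho> \<and> (\<forall>\<epsilon>>0. ?A \<sigma> x0 \<epsilon> \<in> sets (borel \<Otimes>\<^sub>M borel) \<and>
      emeasure (lborel \<Otimes>\<^sub>M lborel) (?A \<sigma> x0 \<epsilon>) \<le> ennreal (C * bd \<epsilon>))" if \<sigma>: "\<sigma> \<in> {1, -1}" for \<sigma>
  proof (rule strip_area[where K = K])
    show "1 \<le> \<kappa>1 * real a + \<kappa>2 * real b" if "\<sigma> ^ a * s a b \<noteq> 0" for a b
      using supp[of a b] that by simp
    show "\<exists>j\<le>K. poly ((pderiv ^^ j) (face_poly (\<lambda>a b. \<sigma> ^ a * s a b) \<kappa>1 \<kappa>2)) z \<noteq> 0" for z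
      by (rule nz[OF \<sigma>])
    show "(\<lambda>(a, b). \<bar>\<sigma> ^ a * s a b\<bar> * \<rho> ^ a * \<rho> ^ b) summable_on UNIV"
      unfolding sgn(1)[OF \<sigma>] by (rule summ)
  qed (use \<open>\<rho> > 0\<close> \<kappa> \<open>K \<ge> 1\<close> \<open>Z > 0\<close> strip in simp_all)
  have B: "\<exists>C\<ge>0. \<exists>x0>0. x0 \<le> \<rho> \<and> \<delta> * x0 powr ?n \<le> \<rho> \<and> (\<forall>\<epsilon>>0. ?B \<sigma> x0 \<epsilon> \<in> sets (borel \<Otimes>\<^sub>M borel) \<and>
      emeasure (lborel \<Otimes>\<^sub>M lborel) (?B \<sigma> x0 \<epsilon>) \<le> ennreal (C * bd \<epsilon>))" if \<sigma>: "\<sigma> \<in> {1, -1}" for \<sigma>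
  proof (rule strip_area[where K = K])
    show "1 \<le> \<kappa>2 * real a + \<kappa>1 * real b" if "\<sigma> ^ a * s b a \<noteq> 0" for a b
      using supp[of b a] that by (simp add: add.commute)
    show "\<exists>j\<le>K. poly ((pderiv ^^ j) (face_poly (\<lambda>b a. \<sigma> ^ b * s a b) \<kappa>2 \<kappa>1)) z \<noteq> 0" if "\<bar>z\<bar> \<le> \<delta>" for z
    proof -
      have "\<sigma> = 1 \<or> \<sigma> = -1" using \<sigma> by simp
      then show ?thesis using \<delta>1(2)[of z] \<delta>2(2)[of z] \<delta> that by force
    qed
    show "(\<lambda>(a, b). \<bar>\<sigma> ^ a * s b a\<bar> * \<rho> ^ a * \<rho> ^ b) summable_on UNIV"
      unfolding sgn(2)[OF \<sigma>] by (rule summable_swap2[OF summ])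
  qed (use \<open>\<rho> > 0\<close> \<kappa> \<open>K \<ge> 1\<close> \<delta> strip' in simp_all)
  define PA where "PA \<sigma> C x0 \<longleftrightarrow> C \<ge> 0 \<and> x0 > 0 \<and> x0 \<le> \<rho> \<and> (\<forall>\<epsilon>>0. ?A \<sigma> x0 \<epsilon> \<in> sets (borel \<Otimes>\<^sub>M borel) \<and>
      emeasure (lborel \<Otimes>\<^sub>M lborel) (?A \<sigma> x0 \<epsilon>) \<le> ennreal (C * bd \<epsilon>))" for \<sigma> C x0
  have "\<exists>C x0. PA \<sigma> C x0" if "\<sigma> \<in> {1, -1}" for \<sigma>
    unfolding PA_def using A[OF that] by blast
  then obtain CA xA where "\<And>\<sigma>. \<sigma> \<in> {1, -1} \<Longrightarrow> PA \<sigma> (CA \<sigma>) (xA \<sigma>)" by metis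
  note CA = this[unfolded PA_def]
  define PB where "PB \<sigma> C x0 \<longleftrightarrow> C \<ge> 0 \<and> x0 > 0 \<and> x0 \<le> \<rho> \<and> (\<forall>\<epsilon>>0. ?B \<sigma> x0 \<epsilon> \<in> sets (borel \<Otimes>\<^sub>M borel) \<and>
      emeasure (lborel \<Otimes>\<^sub>M lborel) (?B \<sigma> x0 \<epsilon>) \<le> ennreal (C * bd \<epsilon>))" for \<sigma> C x0
  have "\<exists>C x0. PB \<sigma> C x0" if "\<sigma> \<in> {1, -1}" for \<sigma>
    unfolding PB_def using B[OF that] by blast
  then obtain CB xB where "\<And>\<sigma>. \<sigma> \<in> {1, -1} \<Longrightarrow> PB \<sigma> (CB \<sigma>) (xB \<sigma>)" by metis
  note CB = this[unfolded PB_def]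
  define r where "r = Min {xA 1, xA (-1), xB 1, xB (-1)}"
  have r: "r > 0" "r \<le> \<rho>" "r \<le> xA 1" "r \<le> xA (-1)" "r \<le> xB 1" "r \<le> xB (-1)"
  proof -
    have "xA 1 > 0" "xA 1 \<le> \<rho>" "xA (-1) > 0" "xB 1 > 0" "xB (-1) > 0"
      using CA[of 1] CA[of "-1"] CB[of 1] CB[of "-1"] by blast+
    then show "r > 0" "r \<le> \<rho>" "r \<le> xA 1" "r \<le> xA (-1)" "r \<le> xB 1" "r \<le> xB (-1)"
      by (simp_all add: r_def min_le_iff_disj)
  qed
  have C0: "CA 1 \<ge> 0" "CA (-1) \<ge> 0" "CB 1 \<ge> 0" "CB (-1) \<ge> 0"
    using CA[of 1] CA[of "-1"] CB[of 1] CB[of "-1"] by blast+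
  define C where "C = CA 1 + CA (-1) + (CB 1 + CB (-1))"
  have "\<exists>N\<in>sets lborel. {(x, y). \<bar>x\<bar> < r \<and> \<bar>y\<bar> < r \<and> \<bar>series2 s x y\<bar> < \<epsilon>} \<subseteq> N \<and> emeasure lborel N \<le> ennreal (C * bd \<epsilon>)"
    if "\<epsilon> > 0" for \<epsilon>
  proof -
    define N where "N \<sigma> = (\<lambda>(x, y). (\<sigma> * x, y)) -` ?A \<sigma> (xA \<sigma>) \<epsilon>" for \<sigma> :: real
    define N' where "N' \<sigma> = (\<lambda>(x, y). (y, x)) -` ((\<lambda>(x, y). (\<sigma> * x, y)) -` ?B \<sigma> (xB \<sigma>) \<epsilon>)" for \<sigma> :: real
    have N: "N \<sigma> \<in> sets lborel" "emeasure lborel (N \<sigma>) \<le> ennreal (CA \<sigma> * bd \<epsilon>)" if \<sigma>: "\<sigma> \<in> {1, -1}" for \<sigma>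
    proof -
      have A: "?A \<sigma> (xA \<sigma>) \<epsilon> \<in> sets (borel \<Otimes>\<^sub>M borel)"
        "emeasure (lborel \<Otimes>\<^sub>M lborel) (?A \<sigma> (xA \<sigma>) \<epsilon>) \<le> ennreal (CA \<sigma> * bd \<epsilon>)"
        using CA[OF \<sigma>] \<open>\<epsilon> > 0\<close> by blast+
      show "N \<sigma> \<in> sets lborel"
        unfolding N_def sets_lborel borel_prod[symmetric] by (rule lborel_reflect_fst(1)[OF A(1) \<sigma>])
      show "emeasure lborel (N \<sigma>) \<le> ennreal (CA \<sigma> * bd \<epsilon>)"
        unfolding N_def lborel_prod[symmetric] lborel_reflect_fst(2)[OF A(1) \<sigma>] by (rule A(2))
    qed
    have N': "N' \<sigma> \<in> sets lborel" "emeasure lborel (N' \<sigma>) \<le> ennreal (CB \<sigma> * bd \<epsilon>)" if \<sigma>: "\<sigma> \<in> {1, -1}" for \<sigma>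
    proof -
      have B: "?B \<sigma> (xB \<sigma>) \<epsilon> \<in> sets (borel \<Otimes>\<^sub>M borel)"
        "emeasure (lborel \<Otimes>\<^sub>M lborel) (?B \<sigma> (xB \<sigma>) \<epsilon>) \<le> ennreal (CB \<sigma> * bd \<epsilon>)"
        using CB[OF \<sigma>] \<open>\<epsilon> > 0\<close> by blast+
      note R = lborel_reflect_fst[OF B(1) \<sigma>]
      show "N' \<sigma> \<in> sets lborel"
        unfolding N'_def sets_lborel borel_prod[symmetric] by (rule lborel_swap(1)[OF R(1)])
      show "emeasure lborel (N' \<sigma>) \<le> ennreal (CB \<sigma> * bd \<epsilon>)"
        unfolding N'_def lborel_prod[symmetric] lborel_swap(2)[OF R(1)] R(2) by (rule B(2))
    qed
    have sq: "\<sigma> * (\<sigma> * x) = x" if "\<sigma> \<in> {1, -1}" for \<sigma> x :: real using that by auto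
    have memN: "(x, y) \<in> N \<sigma>" if "\<sigma> \<in> {1, -1}" "0 < \<sigma> * x" "\<sigma> * x < xA \<sigma>"
      "\<bar>y\<bar> \<le> Z * (\<sigma> * x) powr ?m" "\<bar>series2 s x y\<bar> < \<epsilon>" for \<sigma> x y
      using that unfolding N_def by (simp only: vimage_eq mem_Collect_eq prod.case series2_reflect sq)
    have memN': "(x, y) \<in> N' \<sigma>" if "\<sigma> \<in> {1, -1}" "0 < \<sigma> * y" "\<sigma> * y < xB \<sigma>"
      "\<bar>x\<bar> \<le> \<delta> * (\<sigma> * y) powr ?n" "\<bar>series2 s x y\<bar> < \<epsilon>" for \<sigma> x y
    proof -
      have "series2 (\<lambda>b a. \<sigma> ^ b * s a b) (\<sigma> * y) x = series2 s x y"
        unfolding series2_reflect[of \<sigma> "\<lambda>b a. s a b"] sq[OF that(1)] by (rule series2_swap)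
      then show ?thesis
        using that unfolding N'_def by (simp only: vimage_eq mem_Collect_eq prod.case)
    qed
    show ?thesis
    proof (intro bexI conjI)
      \<comment> \<open>The strips exclude x = 0 or y = 0 respectively, so only the origin escapes
        all of them; as a point it has measure zero.\<close>
      show "{(0, 0)} \<union> ((N 1 \<union> N (-1)) \<union> (N' 1 \<union> N' (-1))) \<in> sets lborel"
        using N(1) N'(1) by (intro sets.Un) auto
      show "{(x, y). \<bar>x\<bar> < r \<and> \<bar>y\<bar> < r \<and> \<bar>series2 s x y\<bar> < \<epsilon>} \<subseteq> {(0, 0)} \<union> ((N 1 \<union> N (-1)) \<union> (N' 1 \<union> N' (-1)))"
      proof
        fix p assume "p \<in> {(x, y). \<bar>x\<bar> < r \<and> \<bar>y\<bar> < r \<and> \<bar>series2 s x y\<bar> < \<epsilon>}"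
        then obtain x y where p: "p = (x, y)" and xy: "\<bar>x\<bar> < r" "\<bar>y\<bar> < r" "\<bar>series2 s x y\<bar> < \<epsilon>" by auto
        show "p \<in> {(0, 0)} \<union> ((N 1 \<union> N (-1)) \<union> (N' 1 \<union> N' (-1)))"
        proof (rule ccontr)
          assume np: "\<not> ?thesis"
          then have nA: "(x, y) \<notin> N' (-1)" "(x, y) \<notin> N' 1" "(x, y) \<notin> N (-1)" "(x, y) \<notin> N 1"
            by (auto simp: p)
          have inA: "\<bar>y\<bar> > Z * \<bar>x\<bar> powr ?m" if "x \<noteq> 0"
          proof (rule ccontr)
            assume neg: "\<not> \<bar>y\<bar> > Z * \<bar>x\<bar> powr ?m"
            show False
            proof (cases "x > 0")
              case True
              have "(x, y) \<in> N 1"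
              proof (rule memN)
                show "\<bar>y\<bar> \<le> Z * (1 * x) powr ?m" using neg True by simp
              qed (use True xy r in simp_all)
              then show False using nA by blast
            next
              case False
              have "(x, y) \<in> N (-1)"
              proof (rule memN)
                show "\<bar>y\<bar> \<le> Z * (- 1 * x) powr ?m" using neg False that by simp
              qed (use False that xy r in simp_all)
              then show False using nA by blast
            qed
          qed
          have inB: "\<bar>x\<bar> > \<delta> * \<bar>y\<bar> powr ?n" if "y \<noteq> 0"
          proof (rule ccontr)
            assume neg: "\<not> \<bar>x\<bar> > \<delta> * \<bar>y\<bar> powr ?n"
            show False
            proof (cases "y > 0")
              case True
              have "(x, y) \<in> N' 1"
              proof (rule memN')
                show "\<bar>x\<bar> \<le> \<delta> * (1 * y) powr ?n" using neg True by simp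
              qed (use True xy r in simp_all)
              then show False using nA by blast
            next
              case False
              have "(x, y) \<in> N' (-1)"
              proof (rule memN')
                show "\<bar>x\<bar> \<le> \<delta> * (- 1 * y) powr ?n" using neg False that by simp
              qed (use False that xy r in simp_all)
              then show False using nA by blast
            qed
          qed
          have "x = 0 \<and> y = 0"
          proof (rule ccontr)
            assume "\<not> (x = 0 \<and> y = 0)"
            have "y \<noteq> 0"
            proof
              assume "y = 0"
              then have "x \<noteq> 0" using \<open>\<not> (x = 0 \<and> y = 0)\<close> by simp
              then show False using inA \<open>y = 0\<close> \<open>Z > 0\<close> by (simp add: mult_less_0_iff)
            qed
            then have x: "\<bar>x\<bar> > \<delta> * \<bar>y\<bar> powr ?n" by (rule inB)
            moreover have "\<delta> * \<bar>y\<bar> powr ?n \<ge> 0" using \<delta>(1) by simp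
            ultimately have "x \<noteq> 0" by linarith
            \<comment> \<open>Outside both regions the two strict inequalities combine to
              \<open>\<bar>y\<bar>\<close> > \<open>\<bar>y\<bar>\<close>, since Z cancels the power
              of \<delta>.\<close>
            have "Z * \<bar>x\<bar> powr ?m \<ge> Z * (\<delta> * \<bar>y\<bar> powr ?n) powr ?m"
              using x \<delta>(1) \<kappa> \<open>Z > 0\<close> by (intro mult_left_mono powr_mono2) auto
            also have "Z * (\<delta> * \<bar>y\<bar> powr ?n) powr ?m = \<bar>y\<bar>"
              using \<delta>(1) \<kappa> \<open>y \<noteq> 0\<close> by (simp add: Z_def powr_mult powr_powr powr_minus)
            finally show False using inA[OF \<open>x \<noteq> 0\<close>] by simp
          qed
          then show False using np by (simp add: p)
        qed
      qed
      have z: "emeasure lborel {(0::real, 0::real)} = 0" by simp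
      have "emeasure lborel ({(0, 0)} \<union> ((N 1 \<union> N (-1)) \<union> (N' 1 \<union> N' (-1)))) \<le>
         emeasure lborel {(0::real, 0::real)} + ((emeasure lborel (N 1) + emeasure lborel (N (-1))) + (emeasure lborel (N' 1) + emeasure lborel (N' (-1))))"
        using N(1) N'(1)
        by (intro order_trans[OF emeasure_subadditive] add_mono order_refl sets.Un) auto
      also have "\<dots> \<le> 0 + ((ennreal (CA 1 * bd \<epsilon>) + ennreal (CA (-1) * bd \<epsilon>)) + (ennreal (CB 1 * bd \<epsilon>) + ennreal (CB (-1) * bd \<epsilon>)))"
        using N(2) N'(2) z by (intro add_mono) auto
      also have "\<dots> = ennreal (C * bd \<epsilon>)"
      proof -
        have nn: "0 \<le> CA 1 * bd \<epsilon>" "0 \<le> CA (-1) * bd \<epsilon>" "0 \<le> CB 1 * bd \<epsilon>" "0 \<le> CB (-1) * bd \<epsilon>"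
          using C0 bd[OF \<open>\<epsilon> > 0\<close>] by simp_all
        show ?thesis
          unfolding ennreal_plus[OF nn(1,2), symmetric] ennreal_plus[OF nn(3,4), symmetric]
            ennreal_plus[OF add_nonneg_nonneg[OF nn(1,2)] add_nonneg_nonneg[OF nn(3,4)], symmetric] C_def
          by (simp only: distrib_right add_0)
      qed
      finally show "emeasure lborel ({(0, 0)} \<union> ((N 1 \<union> N (-1)) \<union> (N' 1 \<union> N' (-1)))) \<le> ennreal (C * bd \<epsilon>)" .
    qed
  qed
  moreover have "C \<ge> 0" using C0 by (simp add: C_def)
  ultimately show ?thesis using r by blast
qed

section \<open>Newton polygons\<close>

text \<open>Formulated for any set of exponent pairs, so that exchanging the coordinates is the
  image under \<open>prod.swap\<close>.\<close>

definition quadrants :: "(nat \<times> nat) set \<Rightarrow> (real \<times> real) set" where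
  "quadrants A = (\<Union>(a, b)\<in>A. {(t1, t2). t1 \<ge> real a \<and> t2 \<ge> real b})"

text \<open>Dickson's lemma for pairs. Given one member (a0, b0), the lowest member in each column
  up to a0 and the leftmost in each row up to b0 suffice. It replaces an infinite support by a
  finite set wherever compactness or an \<open>eventually\<close> over all members is
  needed.\<close>

lemma ex_finite_dominating:
  fixes A :: "(nat \<times> nat) set"
  assumes "A \<noteq> {}"
  obtains F where "finite F" "F \<subseteq> A" "\<And>a b. (a, b) \<in> A \<Longrightarrow> \<exists>(c, d)\<in>F. c \<le> a \<and> d \<le> b"
proof -
  obtain a0 b0 where ab0: "(a0, b0) \<in> A" using assms by auto
  define f where "f a = (a, LEAST b. (a, b) \<in> A)" for a
  define g where "g b = (LEAST a. (a, b) \<in> A, b)" for b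
  define F where "F = (f ` {..a0} \<union> g ` {..b0}) \<inter> A"
  have f: "f a \<in> A" "snd (f a) \<le> b" if "(a, b) \<in> A" for a b
    using LeastI[of "\<lambda>b. (a, b) \<in> A", OF that] Least_le[of "\<lambda>b. (a, b) \<in> A", OF that] by (auto simp: f_def)
  have g: "g b \<in> A" "fst (g b) \<le> a" if "(a, b) \<in> A" for a b
    using LeastI[of "\<lambda>a. (a, b) \<in> A", OF that] Least_le[of "\<lambda>a. (a, b) \<in> A", OF that] by (auto simp: g_def)
  show thesis
  proof
    show "finite F" "F \<subseteq> A" by (auto simp: F_def)
    fix a b assume ab: "(a, b) \<in> A"
    consider "a \<le> a0" | "b \<le> b0" | "a0 \<le> a" "b0 \<le> b" by linarith
    then show "\<exists>(c, d)\<in>F. c \<le> a \<and> d \<le> b"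
    proof cases
      case 1
      then have "f a \<in> F" using f[OF ab] by (auto simp: F_def)
      then show ?thesis using f(2)[OF ab] by (intro bexI[of _ "f a"]) (auto simp: f_def)
    next
      case 2
      then have "g b \<in> F" using g[OF ab] by (auto simp: F_def)
      then show ?thesis using g(2)[OF ab] by (intro bexI[of _ "g b"]) (auto simp: g_def)
    next
      case 3
      have "f a0 \<in> F" using f[OF ab0] by (auto simp: F_def)
      then show ?thesis using f(2)[OF ab0] 3 by (intro bexI[of _ "f a0"]) (auto simp: f_def)
    qed
  qed
qed

text \<open>By Dickson's lemma the hull is the sum of a polytope and the closed first quadrant, that
  is, of a compact and a closed set. Closedness makes the infimum in the Newton distance a
  minimum.\<close>

lemma closed_hull_quadrants:
  assumes "A \<noteq> {}"
  shows "closed (convex hull (quadrants A))"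
proof -
  obtain F where F: "finite F" "F \<subseteq> A" "\<And>a b. (a, b) \<in> A \<Longrightarrow> \<exists>(c, d)\<in>F. c \<le> a \<and> d \<le> b"
    using ex_finite_dominating[OF assms] by metis
  define P where "P = (\<lambda>(a, b). (real a, real b)) ` F"
  define Q where "Q = {(x, y). (0::real) \<le> x \<and> (0::real) \<le> y}"
  have Q: "Q = {0..} \<times> {0..}" by (auto simp: Q_def)
  have "quadrants A = P + Q"
  proof (intro equalityI subsetI)
    fix p assume "p \<in> quadrants A"
    then obtain a b where ab: "(a, b) \<in> A" "fst p \<ge> real a" "snd p \<ge> real b" by (auto simp: quadrants_def)
    then obtain c d where cd: "(c, d) \<in> F" "c \<le> a" "d \<le> b" using F(3) by blast
    have "p = (real c, real d) + (p - (real c, real d))" by simp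
    moreover have "(real c, real d) \<in> P" using cd(1) by (force simp: P_def)
    moreover have "p - (real c, real d) \<in> Q" using ab cd by (auto simp: Q_def minus_prod_def)
    ultimately show "p \<in> P + Q" by (metis set_plus_intro)
  next
    fix p assume "p \<in> P + Q"
    then obtain a b x y where "(a, b) \<in> F" "p = (real a + x, real b + y)" "x \<ge> 0" "y \<ge> 0"
      by (auto simp: set_plus_def P_def Q_def)
    then show "p \<in> quadrants A" using F(2) by (force simp: quadrants_def)
  qed
  then have "convex hull (quadrants A) = convex hull P + convex hull Q"
    by (simp add: convex_hull_set_plus)
  also have "convex hull Q = Q"
    unfolding Q by (intro convex_hull_eq[THEN iffD2] convex_Times) auto
  finally have e: "convex hull (quadrants A) = (\<Union>x\<in>convex hull P. \<Union>y\<in>Q. {x + y})"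
    unfolding set_plus_def by blast
  show ?thesis
    unfolding e
  proof (rule compact_closed_sums)
    show "compact (convex hull P)" using F(1) by (simp add: P_def finite_imp_compact_convex_hull)
    show "closed Q" unfolding Q by (intro closed_Times) auto
  qed
qed

lemma hull_quadrants_upward:
  assumes "p \<in> convex hull (quadrants A)" "0 \<le> fst v" "0 \<le> snd v"
  shows "p + v \<in> convex hull (quadrants A)"
proof -
  have "convex hull (quadrants A) \<subseteq> {p. p + v \<in> convex hull (quadrants A)}"
  proof (rule hull_minimal)
    have "{p. p + v \<in> convex hull (quadrants A)} = (\<lambda>p. - v + p) ` (convex hull (quadrants A))"
      by (force simp: image_iff)
    then show "convex {p. p + v \<in> convex hull (quadrants A)}" by (simp add: convex_translation)
    show "quadrants A \<subseteq> {p. p + v \<in> convex hull (quadrants A)}"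
    proof
      fix p assume "p \<in> quadrants A"
      then have "p + v \<in> quadrants A" using assms(2,3) by (force simp: quadrants_def plus_prod_def)
      then show "p \<in> {p. p + v \<in> convex hull (quadrants A)}" by (simp add: hull_inc)
    qed
  qed
  then show ?thesis using assms(1) by auto
qed

lemma hull_quadrants_halfspace:
  assumes "\<kappa>1 \<ge> 0" "\<kappa>2 \<ge> 0" and "\<And>a b. (a, b) \<in> A \<Longrightarrow> c \<le> \<kappa>1 * real a + \<kappa>2 * real b"
    and "p \<in> convex hull (quadrants A)"
  shows "c \<le> \<kappa>1 * fst p + \<kappa>2 * snd p"
proof -
  have "convex hull (quadrants A) \<subseteq> {x. (\<kappa>1, \<kappa>2) \<bullet> x \<ge> c}"
  proof (rule hull_minimal)
    show "convex {x. (\<kappa>1, \<kappa>2) \<bullet> x \<ge> c}" by (rule convex_halfspace_ge)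
    show "quadrants A \<subseteq> {x. (\<kappa>1, \<kappa>2) \<bullet> x \<ge> c}"
    proof
      fix p assume "p \<in> quadrants A"
      then obtain a b where ab: "(a, b) \<in> A" "fst p \<ge> real a" "snd p \<ge> real b" by (auto simp: quadrants_def)
      have "c \<le> \<kappa>1 * real a + \<kappa>2 * real b" by (rule assms(3)[OF ab(1)])
      also have "\<dots> \<le> \<kappa>1 * fst p + \<kappa>2 * snd p"
        using ab assms(1,2) by (intro add_mono mult_left_mono) auto
      finally show "p \<in> {x. (\<kappa>1, \<kappa>2) \<bullet> x \<ge> c}" by (simp add: inner_prod_def)
    qed
  qed
  then show ?thesis using assms(4) by (auto simp: inner_prod_def)
qed

section \<open>Supporting lines through the bisectrix point\<close>

definition diagonal_distance :: "(nat \<times> nat) set \<Rightarrow> real" where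
  "diagonal_distance A = Inf {t. (t, t) \<in> convex hull (quadrants A)}"

lemma diagonal_distance:
  assumes "A \<noteq> {}"
  shows diagonal_distance_in: "(diagonal_distance A, diagonal_distance A) \<in> convex hull (quadrants A)"
    and diagonal_distance_le: "\<And>t. (t, t) \<in> convex hull (quadrants A) \<Longrightarrow> diagonal_distance A \<le> t"
proof -
  define T where "T = {t. (t, t) \<in> convex hull (quadrants A)}"
  obtain a b where ab: "(a, b) \<in> A" using assms by auto
  have "(real (max a b), real (max a b)) \<in> quadrants A" unfolding quadrants_def by (rule UN_I[OF ab]) auto
  then have "T \<noteq> {}" using hull_inc unfolding T_def by fastforce
  have bdd: "bdd_below T"
  proof (rule bdd_belowI[of _ 0])
    fix t assume "t \<in> T"
    then show "0 \<le> t"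
      using hull_quadrants_halfspace[of 1 0 A 0 "(t, t)"] by (simp add: T_def)
  qed
  have "T = (\<lambda>t. (t, t)) -` (convex hull (quadrants A))" by (auto simp: T_def)
  then have "closed T"
    by (auto intro!: closed_vimage closed_hull_quadrants[OF assms] continuous_intros)
  then have "Inf T \<in> T" by (rule closed_contains_Inf[OF \<open>T \<noteq> {}\<close> bdd])
  then show "(diagonal_distance A, diagonal_distance A) \<in> convex hull (quadrants A)"
    by (simp add: diagonal_distance_def T_def)
  show "diagonal_distance A \<le> t" if "(t, t) \<in> convex hull (quadrants A)" for t
    unfolding diagonal_distance_def T_def[symmetric] by (rule cInf_lower[OF _ bdd]) (use that in \<open>simp add: T_def\<close>)
qed

text \<open>The open lower left quadrant with corner (d, d) misses the hull, since any common point
  could be pushed up to the diagonal below d. A line separating the two must pass through (d, d);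
  the hull is closed upwards, so its normal has no negative entry. Normalising the value on the line
  to 1 gives the weight sum 1/d.\<close>

lemma supporting_weight:
  assumes "A \<noteq> {}" and d: "d = diagonal_distance A" "d > 0"
  obtains \<kappa>1 \<kappa>2 where "\<kappa>1 \<ge> 0" "\<kappa>2 \<ge> 0" "\<kappa>1 + \<kappa>2 = 1 / d"
    "\<And>a b. (a, b) \<in> A \<Longrightarrow> 1 \<le> \<kappa>1 * real a + \<kappa>2 * real b"
proof -
  let ?N = "convex hull (quadrants A)"
  have dN: "(d, d) \<in> ?N" using diagonal_distance_in[OF assms(1)] d by simp
  define S where "S = {..<d} \<times> {..<d}"
  have "S \<inter> ?N = {}"
  proof (rule ccontr)
    assume "S \<inter> ?N \<noteq> {}"
    then obtain x y where xy: "x < d" "y < d" "(x, y) \<in> ?N" by (auto simp: S_def)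
    have "(x, y) + (max x y - x, max x y - y) \<in> ?N"
      by (rule hull_quadrants_upward[OF xy(3)]) auto
    then have "(max x y, max x y) \<in> ?N" by simp
    then show False using diagonal_distance_le[OF assms(1)] xy d by fastforce
  qed
  moreover have "convex S" "S \<noteq> {}" unfolding S_def by (auto intro!: convex_Times exI[of _ "d - 1"])
  ultimately obtain k c where k: "k \<noteq> 0" "\<And>x. x \<in> S \<Longrightarrow> k \<bullet> x \<le> c" "\<And>x. x \<in> ?N \<Longrightarrow> k \<bullet> x \<ge> c"
    using separating_hyperplane_sets[of S ?N] dN by (metis convex_convex_hull empty_iff)
  obtain k1 k2 where k12: "k = (k1, k2)" by (cases k)
  have c1: "c \<le> (k1 + k2) * d" using k(3)[OF dN] by (simp add: k12 inner_prod_def distrib_right)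
  \<comment> \<open>The corner itself is not in the open quadrant, so the inequality is obtained in
    the limit along the diagonal.\<close>
  have c2: "(k1 + k2) * d \<le> c"
  proof (rule tendsto_upperbound)
    show "((\<lambda>\<delta>. (k1 + k2) * (d - \<delta>)) \<longlongrightarrow> (k1 + k2) * d) (at_right 0)"
      by (auto intro!: tendsto_eq_intros)
    show "\<forall>\<^sub>F \<delta> in at_right 0. (k1 + k2) * (d - \<delta>) \<le> c"
      using eventually_at_right_less[of 0]
    proof eventually_elim
      case (elim \<delta>)
      then show ?case using k(2)[of "(d - \<delta>, d - \<delta>)"] by (simp add: S_def k12 inner_prod_def algebra_simps)
    qed
  qed simp
  have c: "c = (k1 + k2) * d" using c1 c2 by simp
  have "k1 \<ge> 0" using k(3)[OF hull_quadrants_upward[OF dN, of "(1, 0)"]] c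
    by (simp add: k12 inner_prod_def algebra_simps)
  moreover have "k2 \<ge> 0" using k(3)[OF hull_quadrants_upward[OF dN, of "(0, 1)"]] c
    by (simp add: k12 inner_prod_def algebra_simps)
  moreover have "k1 \<noteq> 0 \<or> k2 \<noteq> 0" using k(1) by (auto simp: k12 zero_prod_def)
  ultimately have pos: "k1 + k2 > 0" "k1 \<ge> 0" "k2 \<ge> 0" by auto
  then have "c > 0" using c d by simp
  show thesis
  proof
    show "0 \<le> k1 / c" "0 \<le> k2 / c" using pos \<open>c > 0\<close> by simp_all
    show "k1 / c + k2 / c = 1 / d" using pos c d by (simp add: add_divide_distrib[symmetric])
    fix a b assume "(a, b) \<in> A"
    then have "(real a, real b) \<in> ?N" by (intro hull_inc) (force simp: quadrants_def)
    then have "c \<le> k1 * real a + k2 * real b" using k(3) by (fastforce simp: k12 inner_prod_def)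
    then have "c / c \<le> (k1 * real a + k2 * real b) / c" using \<open>c > 0\<close> by (intro divide_right_mono) auto
    then show "1 \<le> k1 / c * real a + k2 / c * real b"
      using \<open>c > 0\<close> by (simp add: add_divide_distrib)
  qed
qed

text \<open>A lexicographic half-space: strict in the first functional, and decided by the second on
  its boundary. It serves in \<open>face_point_left\<close> to locate points on the face without
  describing the face.\<close>

lemma convex_lex_halfspace:
  fixes u v :: "'a :: real_inner"
  shows "convex {p. u \<bullet> p > c \<or> (u \<bullet> p = c \<and> v \<bullet> p > e)}"
proof (rule convexI)
  fix p q :: 'a and s t :: real
  assume p: "p \<in> {p. u \<bullet> p > c \<or> (u \<bullet> p = c \<and> v \<bullet> p > e)}" and q: "q \<in> {p. u \<bullet> p > c \<or> (u \<bullet> p = c \<and> v \<bullet> p > e)}"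
    and st: "0 \<le> s" "0 \<le> t" "s + t = 1"
  show "s *\<^sub>R p + t *\<^sub>R q \<in> {p. u \<bullet> p > c \<or> (u \<bullet> p = c \<and> v \<bullet> p > e)}"
  proof (cases "s = 0 \<or> t = 0")
    case True
    then show ?thesis using p q st by auto
  next
    case False
    then have st': "0 < s" "0 < t" using st by auto
    have mix: "s * x + t * y \<ge> z" "x > z \<or> y > z \<Longrightarrow> s * x + t * y > z" if "x \<ge> z" "y \<ge> z" for x y z :: real
    proof -
      have "z = s * z + t * z" using st(3) by (simp add: distrib_right[symmetric])
      then have e: "s * x + t * y - z = s * (x - z) + t * (y - z)" by (simp add: algebra_simps)
      have nn: "0 \<le> s * (x - z)" "0 \<le> t * (y - z)" using st' that by auto
      then show "s * x + t * y \<ge> z" using e by linarith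
      assume "x > z \<or> y > z"
      then have "0 < s * (x - z) \<or> 0 < t * (y - z)" using st' by auto
      then show "s * x + t * y > z" using e nn by linarith
    qed
    have up: "u \<bullet> p \<ge> c" "u \<bullet> q \<ge> c" using p q by auto
    show ?thesis
    proof (cases "u \<bullet> p > c \<or> u \<bullet> q > c")
      case True
      then show ?thesis using mix(2)[OF up] by (simp add: inner_add_right)
    next
      case False
      then have "u \<bullet> p = c" "u \<bullet> q = c" "v \<bullet> p > e" "v \<bullet> q > e" using p q up by auto
      then show ?thesis using mix(2)[of e "v \<bullet> p" "v \<bullet> q"] st(3)
        by (simp add: inner_add_right distrib_right[symmetric])
    qed
  qed
qed

text \<open>If every member on the line lay strictly right of the bisectrix, all quadrants and hence
  their hull would lie in a lexicographic half-space that does not contain (d, d).\<close>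

lemma face_point_left:
  assumes "A \<noteq> {}" and d: "d = diagonal_distance A" "d > 0"
    and \<kappa>: "\<kappa>1 \<ge> 0" "\<kappa>2 \<ge> 0" "\<kappa>1 + \<kappa>2 = 1 / d"
    and supp: "\<And>a b. (a, b) \<in> A \<Longrightarrow> 1 \<le> \<kappa>1 * real a + \<kappa>2 * real b"
  shows "\<exists>(a, b)\<in>A. \<kappa>1 * real a + \<kappa>2 * real b = 1 \<and> real a \<le> d"
proof (rule ccontr)
  assume neg: "\<not> ?thesis"
  let ?G = "{p. (\<kappa>1, \<kappa>2) \<bullet> p > 1 \<or> ((\<kappa>1, \<kappa>2) \<bullet> p = 1 \<and> (1, 0) \<bullet> p > d)}"
  have "convex hull (quadrants A) \<subseteq> ?G"
  proof (rule hull_minimal)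
    show "convex ?G" by (rule convex_lex_halfspace)
    show "quadrants A \<subseteq> ?G"
    proof
      fix p assume "p \<in> quadrants A"
      then obtain a b where ab: "(a, b) \<in> A" "fst p \<ge> real a" "snd p \<ge> real b" by (auto simp: quadrants_def)
      have le: "\<kappa>1 * real a + \<kappa>2 * real b \<le> \<kappa>1 * fst p + \<kappa>2 * snd p"
        using ab \<kappa> by (intro add_mono mult_left_mono) auto
      show "p \<in> ?G"
      proof (cases "\<kappa>1 * real a + \<kappa>2 * real b = 1")
        case True
        then have "real a > d" using neg ab(1) by force
        then show ?thesis using le True ab(2) by (auto simp: inner_prod_def)
      next
        case False
        then show ?thesis using le supp[OF ab(1)] by (auto simp: inner_prod_def)
      qed
    qed
  qed
  then have "(d, d) \<in> ?G" using diagonal_distance_in[OF assms(1)] d by auto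
  moreover have "\<kappa>1 * d + \<kappa>2 * d = 1" using \<kappa>(3) d(2) by (simp add: distrib_right[symmetric])
  ultimately show False by (simp add: inner_prod_def)
qed

text \<open>Increasing \<open>\<kappa>1\<close> while keeping the line through \<open>(a0, b0)\<close> pushes every other point of the
  face, lying to the right of \<open>(a0, b0)\<close>, strictly above the line.\<close>

lemma expose_left_vertex:
  assumes "(a0, b0) \<in> A" "b0 > 0" and \<kappa>: "\<kappa>1 \<ge> 0" "\<kappa>2 > 0"
    and supp: "\<And>a b. (a, b) \<in> A \<Longrightarrow> 1 \<le> \<kappa>1 * real a + \<kappa>2 * real b"
    and face: "\<kappa>1 * real a0 + \<kappa>2 * real b0 = 1"
    and left: "\<And>a b. (a, b) \<in> A \<Longrightarrow> \<kappa>1 * real a + \<kappa>2 * real b = 1 \<Longrightarrow> a0 \<le> a"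
  obtains \<mu>1 \<mu>2 t where "t > 0" "\<mu>1 = \<kappa>1 + t" "\<mu>2 = \<kappa>2 - t * real a0 / real b0" "\<mu>1 > 0" "\<mu>2 > 0"
    "\<mu>1 * real a0 + \<mu>2 * real b0 = 1"
    "\<And>a b. (a, b) \<in> A \<Longrightarrow> (a, b) \<noteq> (a0, b0) \<Longrightarrow> 1 < \<mu>1 * real a + \<mu>2 * real b"
proof -
  \<comment> \<open>One tilt must work for all members at once. It suffices to handle the finite
    dominating set; the remaining members follow because both new weights are positive.\<close>
  obtain F where F: "finite F" "F \<subseteq> A" "\<And>a b. (a, b) \<in> A \<Longrightarrow> \<exists>(c, d)\<in>F. c \<le> a \<and> d \<le> b"
    using ex_finite_dominating[of A] assms(1) by (metis empty_iff)
  let ?w = "\<lambda>t a b. (\<kappa>1 + t) * real a + (\<kappa>2 - t * real a0 / real b0) * real b"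
  have pt: "\<forall>\<^sub>F t in at_right 0. (a, b) \<noteq> (a0, b0) \<longrightarrow> 1 < ?w t a b" if ab: "(a, b) \<in> F" for a b
  proof (cases "\<kappa>1 * real a + \<kappa>2 * real b > 1")
    case True
    have "((\<lambda>t. ?w t a b) \<longlongrightarrow> \<kappa>1 * real a + \<kappa>2 * real b) (at_right 0)"
      using \<open>b0 > 0\<close> by (auto intro!: tendsto_eq_intros)
    then have "\<forall>\<^sub>F t in at_right 0. 1 < ?w t a b" using True by (rule order_tendstoD)
    then show ?thesis by eventually_elim simp
  next
    case False
    then have f: "\<kappa>1 * real a + \<kappa>2 * real b = 1" using supp[of a b] ab F(2) by force
    then have "a0 \<le> a" using left[of a b] ab F(2) by auto
    have "\<forall>\<^sub>F t in at_right (0::real). t > 0" by (rule eventually_at_right_less)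
    then show ?thesis
    proof eventually_elim
      case (elim t)
      show ?case
      proof
        assume ne: "(a, b) \<noteq> (a0, b0)"
        have "a \<noteq> a0"
        proof
          assume "a = a0"
          then have "\<kappa>2 * real b = \<kappa>2 * real b0" using f face unfolding \<open>a = a0\<close> by linarith
          then show False using \<kappa> ne \<open>a = a0\<close> by simp
        qed
        then have "a0 < a" using \<open>a0 \<le> a\<close> by simp
        have "\<kappa>1 * real a0 \<le> \<kappa>1 * real a" using \<kappa> \<open>a0 \<le> a\<close> by (intro mult_left_mono) auto
        then have "\<kappa>2 * real b \<le> \<kappa>2 * real b0" using f face by linarith
        then have "real b \<le> real b0" using \<kappa> by simp
        then have "real a0 * (real b / real b0) \<le> real a0 * 1"
          using \<open>b0 > 0\<close> by (intro mult_left_mono) auto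
        then have "0 < t * (real a - real a0 * (real b / real b0))" using elim \<open>a0 < a\<close> by simp
        then show "1 < ?w t a b" using f by (simp add: algebra_simps)
      qed
    qed
  qed
  have "\<forall>\<^sub>F t in at_right 0. \<forall>p\<in>F. p \<noteq> (a0, b0) \<longrightarrow> 1 < ?w t (fst p) (snd p)"
  proof (intro eventually_ball_finite[OF F(1)] ballI)
    show "\<forall>\<^sub>F t in at_right 0. p \<noteq> (a0, b0) \<longrightarrow> 1 < ?w t (fst p) (snd p)" if "p \<in> F" for p
      using pt[of "fst p" "snd p"] that by simp
  qed
  moreover have "\<forall>\<^sub>F t in at_right 0. 0 < \<kappa>2 - t * real a0 / real b0"
  proof (rule order_tendstoD)
    show "((\<lambda>t. \<kappa>2 - t * real a0 / real b0) \<longlongrightarrow> \<kappa>2) (at_right 0)"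
      using \<open>b0 > 0\<close> by (auto intro!: tendsto_eq_intros)
  qed (rule \<kappa>)
  moreover have "\<forall>\<^sub>F t in at_right (0::real). t > 0" by (rule eventually_at_right_less)
  ultimately have "\<forall>\<^sub>F t in at_right 0. t > 0 \<and> 0 < \<kappa>2 - t * real a0 / real b0 \<and> (\<forall>p\<in>F. p \<noteq> (a0, b0) \<longrightarrow> 1 < ?w t (fst p) (snd p))"
    by eventually_elim auto
  then obtain t where t: "t > 0" "0 < \<kappa>2 - t * real a0 / real b0"
     "\<And>p. p \<in> F \<Longrightarrow> p \<noteq> (a0, b0) \<Longrightarrow> 1 < ?w t (fst p) (snd p)"
    using eventually_happens'[OF trivial_limit_at_right_real] by blast
  have w0: "?w t a0 b0 = 1" using face \<open>b0 > 0\<close> by (simp add: algebra_simps)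
  show thesis
  proof
    show "t > 0" "\<kappa>1 + t > 0" "0 < \<kappa>2 - t * real a0 / real b0" using t \<kappa> by simp_all
    show "?w t a0 b0 = 1" by (rule w0)
    fix a b assume ab: "(a, b) \<in> A" "(a, b) \<noteq> (a0, b0)"
    obtain c e where ce: "(c, e) \<in> F" "c \<le> a" "e \<le> b" using F(3)[OF ab(1)] by blast
    have pos: "0 < \<kappa>1 + t" "0 < \<kappa>2 - t * real a0 / real b0" using t \<kappa> by simp_all
    have le: "?w t c e \<le> ?w t a b" using ce pos by (intro add_mono mult_left_mono) auto
    show "1 < ?w t a b"
    proof (cases "(c, e) = (a0, b0)")
      case True
      then have "c < a \<or> e < b" using ce ab(2) by auto
      then have "?w t c e < ?w t a b"
      proof
        assume "c < a"
        then show ?thesis using ce pos by (intro add_less_le_mono mult_strict_left_mono mult_left_mono) auto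
      next
        assume "e < b"
        then show ?thesis using ce pos by (intro add_le_less_mono mult_strict_left_mono mult_left_mono) auto
      qed
      then show ?thesis using w0 True by simp
    next
      case False
      then show ?thesis using t(3)[OF ce(1)] le by simp
    qed
  qed (rule refl)+
qed

definition exposes :: "(nat \<times> nat) set \<Rightarrow> real \<Rightarrow> real \<Rightarrow> nat \<Rightarrow> nat \<Rightarrow> bool" where
  "exposes A \<kappa>1 \<kappa>2 a0 b0 \<longleftrightarrow> \<kappa>1 > 0 \<and> \<kappa>2 > 0 \<and> (a0, b0) \<in> A \<and> \<kappa>1 * real a0 + \<kappa>2 * real b0 = 1 \<and>
     (\<forall>a b. (a, b) \<in> A \<longrightarrow> (a, b) \<noteq> (a0, b0) \<longrightarrow> 1 < \<kappa>1 * real a + \<kappa>2 * real b)"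

lemma exposes_swap:
  "exposes (prod.swap ` A) \<kappa>2 \<kappa>1 b0 a0 \<longleftrightarrow> exposes A \<kappa>1 \<kappa>2 a0 b0"
  unfolding exposes_def by (auto simp: add.commute)

lemma diagonal_distance_swap: "diagonal_distance (prod.swap ` A) = diagonal_distance A"
proof -
  have q: "quadrants (prod.swap ` A) = prod.swap ` quadrants A"
    by (force simp: quadrants_def image_iff)
  have lin: "linear (prod.swap :: real \<times> real \<Rightarrow> real \<times> real)"
    by (auto intro!: linearI simp: prod_eq_iff)
  have "convex hull (quadrants (prod.swap ` A)) = prod.swap ` (convex hull (quadrants A))"
    unfolding q by (rule convex_hull_linear_image[OF lin, symmetric])
  then have "(t, t) \<in> convex hull (quadrants (prod.swap ` A)) \<longleftrightarrow> (t, t) \<in> convex hull (quadrants A)" for t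
    by simp
  then show ?thesis by (simp add: diagonal_distance_def)
qed

text \<open>The leftmost member of the face is exposed by a tilt. If it lies on the bisectrix, its
  two coordinates agree and the tilt preserves the weight sum. Otherwise the explicit form of the
  tilted weights is kept, since the caller has to compare their sum with 1/d.\<close>

lemma face_left_end:
  assumes "A \<noteq> {}" and d: "d = diagonal_distance A" "d > 0"
    and \<kappa>: "\<kappa>1 \<ge> 0" "\<kappa>2 > 0" "\<kappa>1 + \<kappa>2 = 1 / d"
    and supp: "\<And>a b. (a, b) \<in> A \<Longrightarrow> 1 \<le> \<kappa>1 * real a + \<kappa>2 * real b"
  obtains (below) a0 b0 where "(a0, b0) \<in> A" "\<kappa>1 * real a0 + \<kappa>2 * real b0 = 1" "real a0 < d"
      "\<exists>t>0. exposes A (\<kappa>1 + t) (\<kappa>2 - t * real a0 / real b0) a0 b0"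
  | (vertex) \<mu>1 \<mu>2 n where "d = real n" "\<mu>1 + \<mu>2 = 1 / d" "exposes A \<mu>1 \<mu>2 n n"
proof -
  define Q where "Q a \<longleftrightarrow> (\<exists>b. (a, b) \<in> A \<and> \<kappa>1 * real a + \<kappa>2 * real b = 1)" for a
  obtain a b where ab: "(a, b) \<in> A" "\<kappa>1 * real a + \<kappa>2 * real b = 1" "real a \<le> d"
    using face_point_left[OF assms(1) d \<kappa>(1) _ \<kappa>(3) supp] \<kappa>(2) by force
  then have "Q a" by (auto simp: Q_def)
  define a0 where "a0 = (LEAST a. Q a)"
  have "Q a0" "a0 \<le> a" using LeastI[of Q a] Least_le[of Q a] \<open>Q a\<close> by (auto simp: a0_def)
  then obtain b0 where b0: "(a0, b0) \<in> A" "\<kappa>1 * real a0 + \<kappa>2 * real b0 = 1" by (auto simp: Q_def)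
  have a0d: "real a0 \<le> d" using ab \<open>a0 \<le> a\<close> by simp
  have left: "a0 \<le> a" if "(a, b) \<in> A" "\<kappa>1 * real a + \<kappa>2 * real b = 1" for a b
    using that Least_le[of Q a] by (auto simp: a0_def Q_def)
  have "b0 > 0"
  proof (rule ccontr)
    assume "\<not> b0 > 0"
    then have "\<kappa>1 * real a0 = 1" using b0 by simp
    moreover have "\<kappa>1 * real a0 \<le> \<kappa>1 * d" using a0d \<kappa> by (intro mult_left_mono) auto
    moreover have "\<kappa>1 * d + \<kappa>2 * d = 1" using \<kappa>(3) d(2) by (simp add: distrib_right[symmetric])
    moreover have "\<kappa>2 * d > 0" using \<kappa> d by simp
    ultimately show False by linarith
  qed
  obtain \<mu>1 \<mu>2 t where t: "t > 0" "\<mu>1 = \<kappa>1 + t" "\<mu>2 = \<kappa>2 - t * real a0 / real b0" "\<mu>1 > 0" "\<mu>2 > 0"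
    "\<mu>1 * real a0 + \<mu>2 * real b0 = 1"
    "\<And>a b. (a, b) \<in> A \<Longrightarrow> (a, b) \<noteq> (a0, b0) \<Longrightarrow> 1 < \<mu>1 * real a + \<mu>2 * real b"
    by (rule expose_left_vertex[OF b0(1) \<open>b0 > 0\<close> \<kappa>(1,2) supp b0(2) left]) blast+
  have ex: "exposes A \<mu>1 \<mu>2 a0 b0" unfolding exposes_def using t b0 by blast
  show thesis
  proof (cases "real a0 < d")
    case True
    show ?thesis by (rule below[OF b0 True]) (use ex t in blast)
  next
    case False
    then have "real a0 = d" using a0d by simp
    have "\<kappa>2 * real b0 = \<kappa>2 * d"
    proof -
      have "\<kappa>1 * d + \<kappa>2 * d = 1" using \<kappa>(3) d(2) by (simp add: distrib_right[symmetric])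
      then show ?thesis using b0(2) unfolding \<open>real a0 = d\<close> by linarith
    qed
    then have "real b0 = d" using \<kappa> by simp
    then have "b0 = a0" using \<open>real a0 = d\<close> by simp
    show ?thesis
    proof (rule vertex[of a0 \<mu>1 \<mu>2])
      show "\<mu>1 + \<mu>2 = 1 / d" using t(2,3) \<kappa>(3) \<open>b0 = a0\<close> \<open>b0 > 0\<close> by simp
    qed (use \<open>real a0 = d\<close> ex \<open>b0 = a0\<close> in auto)
  qed
qed

text \<open>A vanishing weight makes the supporting line horizontal or vertical, so the bisectrix
  meets an unbounded ray or its end. In the ray case the line is tilted about that end, which raises
  the weight sum. With both weights positive the two ends of the face are found separately, the
  second one by exchanging the coordinates.\<close>

lemma newton_cases:
  assumes "A \<noteq> {}" and d: "d = diagonal_distance A" "d > 0"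
  obtains (edge) \<kappa>1 \<kappa>2 a1 b1 a2 b2 where "\<kappa>1 > 0" "\<kappa>2 > 0" "\<kappa>1 + \<kappa>2 = 1 / d"
      "\<And>a b. (a, b) \<in> A \<Longrightarrow> 1 \<le> \<kappa>1 * real a + \<kappa>2 * real b"
      "(a1, b1) \<in> A" "\<kappa>1 * real a1 + \<kappa>2 * real b1 = 1" "real a1 < d"
      "(a2, b2) \<in> A" "\<kappa>1 * real a2 + \<kappa>2 * real b2 = 1" "real b2 < d"
  | (vertex) \<kappa>1 \<kappa>2 n where "d = real n" "\<kappa>1 + \<kappa>2 = 1 / d" "exposes A \<kappa>1 \<kappa>2 n n"
  | (horizontal) \<kappa>1 \<kappa>2 a0 n where "d = real n" "\<kappa>1 + \<kappa>2 > 1 / d" "a0 < n" "exposes A \<kappa>1 \<kappa>2 a0 n"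
  | (vertical) \<kappa>1 \<kappa>2 n b0 where "d = real n" "\<kappa>1 + \<kappa>2 > 1 / d" "b0 < n" "exposes A \<kappa>1 \<kappa>2 n b0"
proof -
  obtain \<kappa>1 \<kappa>2 where \<kappa>: "\<kappa>1 \<ge> 0" "\<kappa>2 \<ge> 0" "\<kappa>1 + \<kappa>2 = 1 / d"
    and supp: "\<And>a b. (a, b) \<in> A \<Longrightarrow> 1 \<le> \<kappa>1 * real a + \<kappa>2 * real b"
    using supporting_weight[OF assms] by metis
  let ?A' = "prod.swap ` A"
  have d': "d = diagonal_distance ?A'" using d by (simp add: diagonal_distance_swap)
  have A': "?A' \<noteq> {}" using assms(1) by simp
  have supp': "1 \<le> \<kappa>2 * real a + \<kappa>1 * real b" if "(a, b) \<in> ?A'" for a b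
    using supp[of b a] that by (auto simp: add.commute)
  have pos: "1 / d > 0" using d by simp
  have "\<kappa>1 = 0 \<or> \<kappa>2 = 0 \<or> (\<kappa>1 > 0 \<and> \<kappa>2 > 0)" using \<kappa> by auto
  then consider "\<kappa>1 = 0" "\<kappa>2 > 0" | "\<kappa>2 = 0" "\<kappa>1 > 0" | "\<kappa>1 > 0" "\<kappa>2 > 0"
    using \<kappa> pos by fastforce
  then show thesis
  proof cases
    case 1
    show ?thesis
    proof (rule face_left_end[OF assms \<kappa>(1) 1(2) \<kappa>(3) supp])
      fix a0 b0 assume h: "(a0, b0) \<in> A" "\<kappa>1 * real a0 + \<kappa>2 * real b0 = 1" "real a0 < d"
        and ex: "\<exists>t>0. exposes A (\<kappa>1 + t) (\<kappa>2 - t * real a0 / real b0) a0 b0"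
      have "\<kappa>2 * real b0 = \<kappa>2 * d" using h(2) 1 \<kappa>(3) d(2) by simp
      then have b0: "real b0 = d" using 1 by simp
      obtain t where t: "t > 0" "exposes A (\<kappa>1 + t) (\<kappa>2 - t * real a0 / real b0) a0 b0" using ex by blast
      \<comment> \<open>As a0 < b0 = d, the tilt adds more to the first weight than it takes from
        the second.\<close>
      have "t * real a0 / real b0 < t"
        using h(3) b0 t(1) d(2) by (simp add: field_simps)
      then show thesis using horizontal[OF b0[symmetric] _ _ t(2)] \<kappa>(3) h(3) b0 by simp
    qed (assumption | rule vertex)+
  next
    case 2
    have s: "\<kappa>2 + \<kappa>1 = 1 / d" using \<kappa> by simp
    show ?thesis
    proof (rule face_left_end[OF A' d' d(2) \<kappa>(2) 2(2) s supp'])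
      fix b0 a0 assume h: "(b0, a0) \<in> ?A'" "\<kappa>2 * real b0 + \<kappa>1 * real a0 = 1" "real b0 < d"
        and ex: "\<exists>t>0. exposes ?A' (\<kappa>2 + t) (\<kappa>1 - t * real b0 / real a0) b0 a0"
      have "\<kappa>1 * real a0 = \<kappa>1 * d" using h(2) 2 \<kappa>(3) d(2) by simp
      then have a0: "real a0 = d" using 2 by simp
      obtain t where t: "t > 0" "exposes A (\<kappa>1 - t * real b0 / real a0) (\<kappa>2 + t) a0 b0"
        using ex by (auto simp: exposes_swap)
      have "t * real b0 / real a0 < t"
        using h(3) a0 t(1) d(2) by (simp add: field_simps)
      then show thesis using vertical[OF a0[symmetric] _ _ t(2)] \<kappa>(3) h(3) a0 by simp
    next
      fix \<mu>1 \<mu>2 n assume "d = real n" "\<mu>1 + \<mu>2 = 1 / d" "exposes ?A' \<mu>1 \<mu>2 n n"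
      then show thesis using vertex[of n \<mu>2 \<mu>1] by (simp add: exposes_swap add.commute)
    qed
  next
    case 3
    have s: "\<kappa>2 + \<kappa>1 = 1 / d" using \<kappa> by simp
    show ?thesis
    proof (rule face_left_end[OF assms \<kappa>(1) 3(2) \<kappa>(3) supp])
      fix a1 b1 assume h1: "(a1, b1) \<in> A" "\<kappa>1 * real a1 + \<kappa>2 * real b1 = 1" "real a1 < d"
      show thesis
      proof (rule face_left_end[OF A' d' d(2) \<kappa>(2) 3(1) s supp'])
        fix b2 a2 assume h2: "(b2, a2) \<in> ?A'" "\<kappa>2 * real b2 + \<kappa>1 * real a2 = 1" "real b2 < d"
        show thesis
          by (rule edge[OF 3 \<kappa>(3) supp h1, of a2 b2]) (use h2 in \<open>auto simp: add.commute\<close>)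
      next
        fix \<mu>1 \<mu>2 n assume "d = real n" "\<mu>1 + \<mu>2 = 1 / d" "exposes ?A' \<mu>1 \<mu>2 n n"
        then show thesis using vertex[of n \<mu>2 \<mu>1] by (simp add: exposes_swap add.commute)
      qed
    qed (assumption | rule vertex)+
  qed
qed

text \<open>The open half-plane of weight above 1 together with the exposed point is convex,
  contains the hull, and has that point as an extreme point.\<close>

lemma exposed_extreme_point:
  assumes "exposes A \<kappa>1 \<kappa>2 a0 b0"
  shows "(real a0, real b0) extreme_point_of (convex hull (quadrants A))"
proof -
  let ?p = "(real a0, real b0)" and ?k = "(\<kappa>1, \<kappa>2)"
  have \<kappa>: "\<kappa>1 > 0" "\<kappa>2 > 0" "(a0, b0) \<in> A" "\<kappa>1 * real a0 + \<kappa>2 * real b0 = 1"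
    "\<And>a b. (a, b) \<in> A \<Longrightarrow> (a, b) \<noteq> (a0, b0) \<Longrightarrow> 1 < \<kappa>1 * real a + \<kappa>2 * real b"
    using assms by (auto simp: exposes_def)
  let ?H = "{x. ?k \<bullet> x > 1} \<union> {?p}"
  have kp: "?k \<bullet> ?p = 1" using \<kappa>(4) by (simp add: inner_prod_def)
  have mix: "x = ?p \<and> y = ?p" if "x \<in> ?H" "y \<in> ?H" "0 < u" "u < 1" "?k \<bullet> ((1 - u) *\<^sub>R x + u *\<^sub>R y) \<le> 1" for x y u
  proof -
    have ge: "?k \<bullet> x \<ge> 1" "?k \<bullet> y \<ge> 1" using that(1,2) kp by auto
    have "(1 - u) * (?k \<bullet> x - 1) + u * (?k \<bullet> y - 1) \<le> 0"
      using that(5) by (simp add: inner_add_right algebra_simps)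
    moreover have nn: "0 \<le> (1 - u) * (?k \<bullet> x - 1)" "0 \<le> u * (?k \<bullet> y - 1)" using ge that(3,4) by simp_all
    ultimately have "(1 - u) * (?k \<bullet> x - 1) = 0" "u * (?k \<bullet> y - 1) = 0" by linarith+
    then have "?k \<bullet> x = 1" "?k \<bullet> y = 1" using that(3,4) by simp_all
    then show ?thesis using that(1,2) by auto
  qed
  have "convex ?H"
  proof (rule convexI)
    fix x y :: "real \<times> real" and s t :: real
    assume xy: "x \<in> ?H" "y \<in> ?H" and st: "0 \<le> s" "0 \<le> t" "s + t = 1"
    have s: "s = 1 - t" using st by simp
    show "s *\<^sub>R x + t *\<^sub>R y \<in> ?H"
    proof (cases "0 < t \<and> t < 1")
      case True
      show ?thesis
      proof (cases "?k \<bullet> ((1 - t) *\<^sub>R x + t *\<^sub>R y) \<le> 1")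
        case True
        then have "x = ?p" "y = ?p" using mix[OF xy] \<open>0 < t \<and> t < 1\<close> by auto
        then have "s *\<^sub>R x + t *\<^sub>R y = ?p" using st(3) by (simp add: scaleR_left_distrib[symmetric] del: scaleR_Pair)
        then show ?thesis by simp
      qed (simp add: s)
    next
      case False
      then have "t = 0 \<or> t = 1" using st by auto
      then have "s *\<^sub>R x + t *\<^sub>R y = x \<or> s *\<^sub>R x + t *\<^sub>R y = y" unfolding s by (elim disjE) simp_all
      then show ?thesis using xy by (elim disjE) simp_all
    qed
  qed
  moreover have "quadrants A \<subseteq> ?H"
  proof
    fix x assume "x \<in> quadrants A"
    then obtain a b where ab: "(a, b) \<in> A" "fst x \<ge> real a" "snd x \<ge> real b" by (auto simp: quadrants_def)
    have le: "\<kappa>1 * real a \<le> \<kappa>1 * fst x" "\<kappa>2 * real b \<le> \<kappa>2 * snd x" using ab \<kappa> by auto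
    show "x \<in> ?H"
    proof (cases "(a, b) = (a0, b0)")
      case False
      then show ?thesis using \<kappa>(5)[OF ab(1)] le by (simp add: inner_prod_def)
    next
      case True
      show ?thesis
      proof (cases "x = ?p")
        case False
        then have "fst x > real a \<or> snd x > real b" using ab True by (auto simp: prod_eq_iff)
        then have "\<kappa>1 * real a < \<kappa>1 * fst x \<or> \<kappa>2 * real b < \<kappa>2 * snd x" using \<kappa> by auto
        then show ?thesis using le \<kappa>(4) True by (auto simp: inner_prod_def)
      qed simp
    qed
  qed
  ultimately have sub: "convex hull (quadrants A) \<subseteq> ?H" by (rule hull_minimal[rotated])
  have "?p \<in> convex hull (quadrants A)"
    by (rule hull_inc) (use \<kappa>(3) in \<open>force simp: quadrants_def\<close>)
  moreover have "?p \<notin> open_segment x y" if "x \<in> convex hull (quadrants A)" "y \<in> convex hull (quadrants A)" for x y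
  proof
    assume "?p \<in> open_segment x y"
    then obtain u where u: "x \<noteq> y" "0 < u" "u < 1" "?p = (1 - u) *\<^sub>R x + u *\<^sub>R y" by (auto simp: in_segment)
    moreover have "?k \<bullet> ((1 - u) *\<^sub>R x + u *\<^sub>R y) \<le> 1" unfolding u(4)[symmetric] kp by simp
    ultimately have "x = ?p \<and> y = ?p" using mix[of x y u] that sub by blast
    then show False using u(1) by simp
  qed
  ultimately show ?thesis unfolding extreme_point_of_def by blast
qed

text \<open>A face meeting the relative interior of \<open>e\<close> contains \<open>e\<close>, so
  the singleton face of the extreme point would contain an edge. This separates a vertex on the
  bisectrix from Cases 1 and 3.\<close>

lemma extreme_point_not_in_rel_interior_edge:
  fixes N :: "(real \<times> real) set"
  assumes "p extreme_point_of N" "e edge_of N" "p \<in> rel_interior e"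
  shows False
proof -
  have e: "e face_of N" "aff_dim e = 1" using assms(2) by (auto simp: edge_of_def)
  have pe: "p \<in> e" using assms(3) rel_interior_subset by blast
  have "{p} face_of N" using assms(1) by (simp add: face_of_singleton)
  then have "e \<subseteq> {p}"
    by (rule subset_of_face_of) (use e face_of_imp_subset assms(3) in auto)
  then have "e = {p}" using pe by auto
  then show False using e(2) by simp
qed

text \<open>Two distinct members give the face dimension one, and positivity of both weights bounds
  it inside the first quadrant. It provides the edge to which superadaptedness is applied.\<close>

lemma face_is_compact_edge:
  assumes "A \<noteq> {}" and \<kappa>: "\<kappa>1 > 0" "\<kappa>2 > 0"
    and supp: "\<And>a b. (a, b) \<in> A \<Longrightarrow> 1 \<le> \<kappa>1 * real a + \<kappa>2 * real b"
    and "(a1, b1) \<in> A" "\<kappa>1 * real a1 + \<kappa>2 * real b1 = 1"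
    and "(a2, b2) \<in> A" "\<kappa>1 * real a2 + \<kappa>2 * real b2 = 1" "(a1, b1) \<noteq> (a2, b2)"
  shows "convex hull (quadrants A) \<inter> {x. (\<kappa>1, \<kappa>2) \<bullet> x = 1} edge_of convex hull (quadrants A)"
    and "compact (convex hull (quadrants A) \<inter> {x. (\<kappa>1, \<kappa>2) \<bullet> x = 1})"
proof -
  let ?N = "convex hull (quadrants A)" and ?k = "(\<kappa>1, \<kappa>2)"
  let ?e = "?N \<inter> {x. ?k \<bullet> x = 1}"
  have face: "?e face_of ?N"
    by (rule face_of_Int_supporting_hyperplane_ge)
      (use hull_quadrants_halfspace[of \<kappa>1 \<kappa>2 A 1] supp \<kappa> in \<open>auto simp: inner_prod_def\<close>)
  have pts: "(real a1, real b1) \<in> ?e" "(real a2, real b2) \<in> ?e"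
    using assms by (auto intro!: hull_inc simp: inner_prod_def) (force simp: quadrants_def)+
  have "aff_dim ?e \<le> aff_dim {x. ?k \<bullet> x = 1}" by (rule aff_dim_subset) auto
  also have "\<dots> = 1" using \<kappa> by (simp add: aff_dim_hyperplane zero_prod_def)
  finally have "aff_dim ?e \<le> 1" .
  moreover have "1 \<le> aff_dim ?e"
  proof -
    have "aff_dim {(real a1, real b1), (real a2, real b2)} = 1"
      using assms(9) by (simp add: aff_dim_2)
    then show ?thesis using pts aff_dim_subset[of "{(real a1, real b1), (real a2, real b2)}" ?e] by simp
  qed
  ultimately show "?e edge_of ?N" using face by (simp add: edge_of_def)
  have "bounded ?e"
  proof (rule bounded_subset)
    show "?e \<subseteq> {0..1 / \<kappa>1} \<times> {0..1 / \<kappa>2}"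
    proof
      fix x assume x: "x \<in> ?e"
      have nn: "0 \<le> fst x" "0 \<le> snd x"
        using hull_quadrants_halfspace[of 1 0 A 0 x] hull_quadrants_halfspace[of 0 1 A 0 x] x by auto
      have "\<kappa>1 * fst x + \<kappa>2 * snd x = 1" using x by (simp add: inner_prod_def)
      moreover have "0 \<le> \<kappa>1 * fst x" "0 \<le> \<kappa>2 * snd x" using nn \<kappa> by simp_all
      ultimately have "\<kappa>1 * fst x \<le> 1" "\<kappa>2 * snd x \<le> 1" by linarith+
      then show "x \<in> {0..1 / \<kappa>1} \<times> {0..1 / \<kappa>2}"
        using nn \<kappa> by (auto simp: mem_Times_iff field_simps)
    qed
  qed (intro bounded_Times; simp)
  moreover have "closed ?e"
    by (intro closed_Int closed_hull_quadrants[OF assms(1)] closed_hyperplane)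
  ultimately show "compact ?e" by (simp add: compact_eq_bounded_closed)
qed

section \<open>Regularized oscillatory integrals\<close>

lemma abs_ln_le_powr:
  assumes "x > (0::real)" "\<tau> > 0"
  shows "\<bar>ln x\<bar> \<le> (x powr \<tau> + x powr (- \<tau>)) / \<tau>"
proof -
  have up: "ln y \<le> y powr \<tau> / \<tau>" if "y > 0" for y :: real
  proof -
    have "\<tau> * ln y = ln (y powr \<tau>)" using that by (simp add: ln_powr)
    also have "\<dots> \<le> y powr \<tau> - 1" using that by (intro ln_le_minus_one) simp
    finally show ?thesis using assms by (simp add: field_simps)
  qed
  have "ln x \<le> x powr \<tau> / \<tau>" using up assms by simp
  moreover have "- ln x \<le> x powr (- \<tau>) / \<tau>"
    using up[of "1 / x"] assms by (simp add: ln_div powr_divide powr_minus_divide)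
  moreover have "0 \<le> x powr \<tau> / \<tau>" "0 \<le> x powr (- \<tau>) / \<tau>" using assms by auto
  ultimately show ?thesis by (simp add: add_divide_distrib abs_le_iff)
qed

text \<open>The limit controls the remainder only near 0; away from 0 boundedness of
  \<open>f\<close> and any small positive power of t take over. The global bound is what dominated
  convergence needs, because \<open>h v / T\<close> is not small for all v.\<close>

lemma abelian_remainder_bound:
  fixes f :: "real \<Rightarrow> complex"
  assumes "e > 0" "\<tau> > 0" and bdd: "\<And>t. t > 0 \<Longrightarrow> norm (f t) \<le> B"
    and lim: "((\<lambda>t. f t / of_real (t powr e) - (c + c' * of_real (ln t))) \<longlongrightarrow> 0) (at_right 0)"
  obtains C where "C \<ge> 0"
    "\<And>t. t > 0 \<Longrightarrow> norm (f t / of_real (t powr e) - (c + c' * of_real (ln t))) \<le> 1 + C * t powr \<tau>"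
proof -
  let ?R = "\<lambda>t. f t / of_real (t powr e) - (c + c' * of_real (ln t))"
  have "B \<ge> 0" using bdd[of 1] norm_ge_zero[of "f 1"] by linarith
  have "\<forall>\<^sub>F t in at_right 0. norm (?R t) < 1"
    using lim by (auto simp: tendsto_iff dist_norm dest: spec[of _ 1])
  then obtain t0 where t0: "t0 > 0" "\<And>t. 0 < t \<Longrightarrow> t < t0 \<Longrightarrow> norm (?R t) < 1"
    unfolding eventually_at_right_field by auto
  define C where "C = B * t0 powr (- e - \<tau>) + norm c * t0 powr (- \<tau>)
    + norm c' * ((1 + t0 powr (- (2 * \<tau>))) / \<tau>)"
  have "C \<ge> 0" using \<open>B \<ge> 0\<close> assms(2) by (simp add: C_def)
  have "norm (?R t) \<le> 1 + C * t powr \<tau>" if "t > 0" for t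
  proof (cases "t < t0")
    case True
    then show ?thesis using t0(2)[OF that True] \<open>C \<ge> 0\<close> by (simp add: add_increasing2 less_imp_le)
  next
    case False
    \<comment> \<open>For t at least t0 every nonpositive power is traded for the single power
      \<open>t powr \<tau>\<close>.\<close>
    have pw: "t powr (- a) \<le> t0 powr (- a - \<tau>) * t powr \<tau>" if "a \<ge> 0" for a
    proof -
      have "t powr (- a) = t powr (- a - \<tau>) * t powr \<tau>" using \<open>t > 0\<close> by (simp add: powr_add[symmetric])
      also have "\<dots> \<le> t0 powr (- a - \<tau>) * t powr \<tau>"
        using that assms t0(1) False by (intro mult_right_mono powr_mono2') auto
      finally show ?thesis .
    qed
    have "norm (?R t) \<le> norm (f t / of_real (t powr e)) + (norm c + norm (c' * of_real (ln t)))"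
      by (intro order_trans[OF norm_triangle_ineq4] add_left_mono norm_triangle_ineq)
    also have "norm (f t / of_real (t powr e)) \<le> B * (t0 powr (- e - \<tau>) * t powr \<tau>)"
    proof -
      have "norm (f t / of_real (t powr e)) = norm (f t) * t powr (- e)"
        by (simp add: norm_divide powr_minus divide_inverse norm_mult norm_inverse)
      also have "\<dots> \<le> B * (t0 powr (- e - \<tau>) * t powr \<tau>)"
        using bdd[OF \<open>t > 0\<close>] pw[of e] assms \<open>B \<ge> 0\<close> by (intro mult_mono) auto
      finally show ?thesis .
    qed
    also have "norm c \<le> norm c * (t0 powr (- \<tau>) * t powr \<tau>)"
      using mult_left_mono[OF pw[of 0], of "norm c"] \<open>t > 0\<close> by simp
    also have "norm (c' * of_real (ln t)) \<le> norm c' * ((1 + t0 powr (- (2 * \<tau>))) / \<tau> * t powr \<tau>)"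
    proof -
      have "\<bar>ln t\<bar> \<le> (t powr \<tau> + t powr (- \<tau>)) / \<tau>" by (rule abs_ln_le_powr[OF \<open>t > 0\<close> assms(2)])
      also have "\<dots> \<le> (t powr \<tau> + t0 powr (- \<tau> - \<tau>) * t powr \<tau>) / \<tau>"
        using pw[of \<tau>] assms by (intro divide_right_mono add_left_mono) auto
      also have "\<dots> = (1 + t0 powr (- (2 * \<tau>))) / \<tau> * t powr \<tau>" by (simp add: field_simps)
      finally show ?thesis using mult_left_mono[of "\<bar>ln t\<bar>" _ "norm c'"] by (simp only: norm_mult norm_of_real norm_ge_zero)
    qed
    finally have "norm (?R t) \<le> C * t powr \<tau>" by (simp add: C_def distrib_right mult.assoc)
    then show ?thesis by simp
  qed
  then show thesis using \<open>C \<ge> 0\<close> that by blast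
qed

text \<open>Used with \<open>h v = 1 / v\<close> for the oscillatory integral and with \<open>h v = sqrt v\<close> for the sublevel
  integrals.\<close>

lemma abelian:
  fixes f k :: "real \<Rightarrow> complex" and h :: "real \<Rightarrow> real"
  assumes "e > 0" "\<tau> > 0" and bdd: "\<And>t. t > 0 \<Longrightarrow> norm (f t) \<le> B"
    and lim: "((\<lambda>t. f t / of_real (t powr e) - (c + c' * of_real (ln t))) \<longlongrightarrow> 0) (at_right 0)"
    and meas: "f \<in> borel_measurable borel" "h \<in> borel_measurable borel" "k \<in> borel_measurable borel"
    and hpos: "\<And>v. v > 0 \<Longrightarrow> h v > 0" and k0: "\<And>v. v \<le> 0 \<Longrightarrow> k v = 0"
    and i1: "integrable lborel (\<lambda>v. norm (k v) * h v powr (e - \<tau>))"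
    and i2: "integrable lborel (\<lambda>v. norm (k v) * h v powr (e + \<tau>))"
  shows "((\<lambda>T. of_real (T powr e) * (\<integral>v. f (h v / T) * k v \<partial>lborel)
      - (c - c' * of_real (ln T)) * (\<integral>v. k v * of_real (h v powr e) \<partial>lborel))
    \<longlongrightarrow> c' * (\<integral>v. k v * of_real (h v powr e * ln (h v)) \<partial>lborel)) at_top"
proof -
  define R where "R t = f t / of_real (t powr e) - (c + c' * of_real (ln t))" for t
  note [measurable] = meas
  have Rm [measurable]: "R \<in> borel_measurable borel" unfolding R_def by measurable
  obtain C where C: "C \<ge> 0" "\<And>t. t > 0 \<Longrightarrow> norm (R t) \<le> 1 + C * t powr \<tau>"
    using abelian_remainder_bound[OF assms(1,2) bdd lim] unfolding R_def by blast
  let ?w = "\<lambda>v. norm (k v) * h v powr (e - \<tau>) + norm (k v) * h v powr (e + \<tau>)"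
  have iw: "integrable lborel ?w" using i1 i2 by simp
  \<comment> \<open>The two assumed moments straddle e. Their sum dominates the moment of order e
    and, by \<open>abs_ln_le_powr\<close>, also that moment with a logarithm.\<close>
  have hw: "h v powr e \<le> h v powr (e - \<tau>) + h v powr (e + \<tau>)" if "v > 0" for v
  proof (cases "h v \<le> 1")
    case True
    then have "h v powr e \<le> h v powr (e - \<tau>)" using hpos[OF that] assms(2) by (intro powr_mono') auto
    then show ?thesis by (simp add: add_increasing2)
  next
    case False
    then have "h v powr e \<le> h v powr (e + \<tau>)" using assms(2) by (intro powr_mono) auto
    then show ?thesis by (simp add: add_increasing)
  qed
  have I0: "integrable lborel (\<lambda>v. k v * of_real (h v powr e))"
  proof (rule Bochner_Integration.integrable_bound[OF iw], measurable, intro AE_I2)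
    fix v show "norm (k v * of_real (h v powr e)) \<le> norm (?w v)"
      using mult_left_mono[OF hw[of v], of "norm (k v)"] k0[of v]
      by (cases "v > 0") (auto simp: norm_mult distrib_left)
  qed
  have I1: "integrable lborel (\<lambda>v. k v * of_real (h v powr e * ln (h v)))"
  proof (rule Bochner_Integration.integrable_bound[of _ "\<lambda>v. (1 / \<tau>) * ?w v"])
    show "AE v in lborel. norm (k v * of_real (h v powr e * ln (h v))) \<le> norm ((1 / \<tau>) * ?w v)"
    proof (intro AE_I2)
      fix v
      show "norm (k v * of_real (h v powr e * ln (h v))) \<le> norm ((1 / \<tau>) * ?w v)"
      proof (cases "v > 0")
        case True
        have "h v powr e * \<bar>ln (h v)\<bar> \<le> h v powr e * ((h v powr \<tau> + h v powr (- \<tau>)) / \<tau>)"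
          by (intro mult_left_mono abs_ln_le_powr hpos[OF True] assms(2)) simp
        also have "\<dots> = (h v powr (e + \<tau>) + h v powr (e - \<tau>)) / \<tau>"
          by (simp add: powr_add powr_diff powr_minus field_simps)
        finally have "norm (k v) * (h v powr e * \<bar>ln (h v)\<bar>) \<le> norm (k v) * ((h v powr (e + \<tau>) + h v powr (e - \<tau>)) / \<tau>)"
          by (rule mult_left_mono) simp
        also have "\<dots> = (1 / \<tau>) * ?w v" by (simp add: field_simps)
        finally show ?thesis using assms(2) by (simp add: norm_mult abs_mult)
      qed (simp add: k0)
    qed
  qed (use iw in \<open>auto intro!: integrable_mult_right\<close>)
  \<comment> \<open>For T at least 1 the growth bound at \<open>h v / T\<close> is at most that at
    \<open>h v\<close>, so the dominating function is independent of T.\<close>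
  have dom: "norm (k v * of_real (h v powr e) * R (h v / T)) \<le> (1 + C) * ?w v" if "T \<ge> 1" for v T
  proof (cases "v > 0")
    case True
    have h: "h v > 0" by (rule hpos[OF True])
    have "(h v / T) powr \<tau> \<le> h v powr \<tau>"
      using that h assms(2) by (intro powr_mono2) (auto simp: divide_le_eq)
    then have "1 + C * (h v / T) powr \<tau> \<le> 1 + C * h v powr \<tau>" using C(1) by (simp add: mult_left_mono)
    moreover have "norm (R (h v / T)) \<le> 1 + C * (h v / T) powr \<tau>" using C(2)[of "h v / T"] h that by simp
    ultimately have "norm (R (h v / T)) \<le> 1 + C * h v powr \<tau>" by linarith
    then have "h v powr e * norm (R (h v / T)) \<le> h v powr e * (1 + C * h v powr \<tau>)"
      by (rule mult_left_mono) simp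
    also have "\<dots> = h v powr e + C * h v powr (e + \<tau>)" by (simp add: powr_add distrib_left)
    also have "\<dots> \<le> (1 + C) * (h v powr (e - \<tau>) + h v powr (e + \<tau>))"
    proof -
      have "0 \<le> C * h v powr (e - \<tau>)" using C(1) by simp
      then show ?thesis using hw[OF True] by (simp add: algebra_simps)
    qed
    finally have "norm (k v) * (h v powr e * norm (R (h v / T))) \<le> norm (k v) * ((1 + C) * (h v powr (e - \<tau>) + h v powr (e + \<tau>)))"
      by (rule mult_left_mono) simp
    then show ?thesis by (simp add: norm_mult algebra_simps)
  qed (simp add: k0)
  have conv: "((\<lambda>T. \<integral>v. k v * of_real (h v powr e) * R (h v / T) \<partial>lborel) \<longlongrightarrow> (\<integral>v. 0 \<partial>(lborel :: real measure))) at_top"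
  proof (rule integral_dominated_convergence_at_top[where w = "\<lambda>v. (1 + C) * ?w v" and M = lborel
      and s = "\<lambda>T v. k v * of_real (h v powr e) * R (h v / T)" and f = "\<lambda>_. 0"])
    show "integrable lborel (\<lambda>v. (1 + C) * ?w v)" using iw by (intro integrable_mult_right)
    show "\<forall>\<^sub>F T in at_top. AE v in lborel. norm (k v * of_real (h v powr e) * R (h v / T)) \<le> (1 + C) * ?w v"
      using eventually_ge_at_top[of 1] by eventually_elim (use dom in simp)
    show "AE v in lborel. ((\<lambda>T. k v * of_real (h v powr e) * R (h v / T)) \<longlongrightarrow> 0) at_top"
    proof (intro AE_I2)
      fix v
      show "((\<lambda>T. k v * of_real (h v powr e) * R (h v / T)) \<longlongrightarrow> 0) at_top"
      proof (cases "v > 0")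
        case True
        have "filterlim (\<lambda>T. h v / T) (at_right 0) at_top"
          unfolding filterlim_at
        proof
          show "((\<lambda>T. h v / T) \<longlongrightarrow> 0) at_top" by real_asymp
          show "\<forall>\<^sub>F T in at_top. h v / T \<in> {0<..} \<and> h v / T \<noteq> 0"
            using eventually_gt_at_top[of 0] by eventually_elim (use hpos[OF True] in simp)
        qed
        from filterlim_compose[OF lim this] have "((\<lambda>T. R (h v / T)) \<longlongrightarrow> 0) at_top"
          by (simp add: R_def)
        then show ?thesis by (rule tendsto_mult_right_zero)
      qed (simp add: k0)
    qed
  qed measurable
  have eq: "of_real (T powr e) * (\<integral>v. f (h v / T) * k v \<partial>lborel)
      - (c - c' * of_real (ln T)) * (\<integral>v. k v * of_real (h v powr e) \<partial>lborel)
    = c' * (\<integral>v. k v * of_real (h v powr e * ln (h v)) \<partial>lborel)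
      + (\<integral>v. k v * of_real (h v powr e) * R (h v / T) \<partial>lborel)" if "T \<ge> 1" for T
  proof -
    have I2: "integrable lborel (\<lambda>v. k v * of_real (h v powr e) * R (h v / T))"
    proof (rule Bochner_Integration.integrable_bound[of _ "\<lambda>v. (1 + C) * ?w v"])
      show "AE v in lborel. norm (k v * of_real (h v powr e) * R (h v / T)) \<le> norm ((1 + C) * ?w v)"
        using order_trans[OF dom[OF that] abs_ge_self] by simp
    qed (use iw in \<open>auto intro!: integrable_mult_right\<close>)
    have pt: "of_real (T powr e) * (f (h v / T) * k v)
       = (c - c' * of_real (ln T)) * (k v * of_real (h v powr e)) + c' * (k v * of_real (h v powr e * ln (h v)))
         + k v * of_real (h v powr e) * R (h v / T)" for v
    proof (cases "v > 0")
      case True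
      have h: "h v > 0" by (rule hpos[OF True])
      have "f (h v / T) = of_real ((h v / T) powr e) * (c + c' * of_real (ln (h v / T)) + R (h v / T))"
        using h that by (simp add: R_def)
      also have "(h v / T) powr e = h v powr e / T powr e" using h that by (simp add: powr_divide)
      also have "ln (h v / T) = ln (h v) - ln T" using h that by (simp add: ln_div)
      finally have f: "f (h v / T) = of_real (h v powr e / T powr e) * (c + c' * of_real (ln (h v) - ln T) + R (h v / T))" .
      show ?thesis unfolding f using that by (simp add: algebra_simps)
    qed (simp add: k0)
    have "of_real (T powr e) * (\<integral>v. f (h v / T) * k v \<partial>lborel) = (\<integral>v. of_real (T powr e) * (f (h v / T) * k v) \<partial>lborel)"
      by simp
    also have "\<dots> = (c - c' * of_real (ln T)) * (\<integral>v. k v * of_real (h v powr e) \<partial>lborel)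
        + c' * (\<integral>v. k v * of_real (h v powr e * ln (h v)) \<partial>lborel)
        + (\<integral>v. k v * of_real (h v powr e) * R (h v / T) \<partial>lborel)"
      unfolding pt using I0 I1 I2 by simp
    finally show ?thesis by simp
  qed
  have "((\<lambda>T. c' * (\<integral>v. k v * of_real (h v powr e * ln (h v)) \<partial>lborel)
      + (\<integral>v. k v * of_real (h v powr e) * R (h v / T) \<partial>lborel)) \<longlongrightarrow>
      c' * (\<integral>v. k v * of_real (h v powr e * ln (h v)) \<partial>lborel) + 0) at_top"
    using conv by (intro tendsto_intros) simp
  moreover have "\<forall>\<^sub>F T in at_top. c' * (\<integral>v. k v * of_real (h v powr e * ln (h v)) \<partial>lborel)
      + (\<integral>v. k v * of_real (h v powr e) * R (h v / T) \<partial>lborel)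
    = of_real (T powr e) * (\<integral>v. f (h v / T) * k v \<partial>lborel)
      - (c - c' * of_real (ln T)) * (\<integral>v. k v * of_real (h v powr e) \<partial>lborel)"
    using eventually_ge_at_top[of 1] by eventually_elim (simp only: eq)
  ultimately show ?thesis by (simp only: add_0_right) (rule Lim_transform_eventually)
qed

section \<open>Gamma and Beta integrals, and the moments of the kernel\<close>

lemma nn_integral_Gamma:
  assumes "x > (0::real)" "a > 0"
  shows "(\<integral>\<^sup>+w. ennreal (if w > 0 then w powr (x - 1) * exp (- (a * w)) else 0) \<partial>lborel)
    = ennreal (Gamma x * a powr (- x))"
proof -
  define g where "g w = (if w > 0 then w powr (x - 1) * exp (- w) else 0)" for w :: real
  define f where "f w = (if w > 0 then w powr (x - 1) * exp (- (a * w)) else 0)" for w :: real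
  have gG: "(\<integral>\<^sup>+w. ennreal (g w) \<partial>lborel) = ennreal (Gamma x)"
  proof -
    have "(\<integral>\<^sup>+w. ennreal (w powr (x - 1) / exp w) * indicator {0..} w \<partial>lborel) = ennreal (Gamma x)"
      by (rule nn_integral_has_integral_lebesgue'[OF _ Gamma_integral_real[OF assms(1)]]) simp
    also have "(\<lambda>w. ennreal (w powr (x - 1) / exp w) * indicator {0..} w) = (\<lambda>w. ennreal (g w))"
      by (auto simp: g_def fun_eq_iff exp_minus divide_inverse indicator_def)
    finally show ?thesis .
  qed
  have fg: "f (0 + (1 / a) * w) = a powr (1 - x) * g w" for w
  proof (cases "w > 0")
    case True
    have "(w / a) powr (x - 1) = a powr (1 - x) * w powr (x - 1)"
    proof -
      have "a powr (1 - x) = 1 / a powr (x - 1)" using powr_minus_divide[of a "x - 1"] by simp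
      then show ?thesis by (simp add: powr_divide)
    qed
    then show ?thesis using True assms by (simp add: f_def g_def)
  next
    case False
    then have "\<not> w / a > 0" using assms by (auto simp: zero_less_divide_iff)
    then show ?thesis using False by (simp add: f_def g_def)
  qed
  have "(\<integral>\<^sup>+w. ennreal (f w) \<partial>lborel) = ennreal \<bar>1 / a\<bar> * (\<integral>\<^sup>+w. ennreal (f (0 + (1 / a) * w)) \<partial>lborel)"
    using assms by (intro nn_integral_real_affine) (auto simp: f_def)
  also have "\<dots> = ennreal (1 / a) * (ennreal (a powr (1 - x)) * ennreal (Gamma x))"
  proof -
    have "(\<integral>\<^sup>+w. ennreal (a powr (1 - x) * g w) \<partial>lborel) = ennreal (a powr (1 - x)) * (\<integral>\<^sup>+w. ennreal (g w) \<partial>lborel)"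
      unfolding ennreal_mult'[OF powr_ge_zero] by (rule nn_integral_cmult) (simp add: g_def[abs_def])
    then show ?thesis unfolding fg gG using assms by simp
  qed
  also have "\<dots> = ennreal (1 / a * (a powr (1 - x) * Gamma x))"
  proof -
    have "0 \<le> 1 / a" using assms by simp
    then show ?thesis by (simp only: ennreal_mult' powr_ge_zero)
  qed
  also have "1 / a * (a powr (1 - x) * Gamma x) = Gamma x * a powr (- x)"
    using assms by (simp add: powr_diff powr_minus field_simps)
  finally show ?thesis by (simp add: f_def)
qed

text \<open>Integrand of Euler's Beta integral B(\<beta>, 2 - \<beta>); the parameters add up to 2,
  and Gamma 2 = 1 removes the denominator.\<close>

definition beta_kernel :: "real \<Rightarrow> real \<Rightarrow> real" where
  "beta_kernel \<beta> v = (if v > 0 then v powr (\<beta> - 1) / (1 + v)\<^sup>2 else 0)"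

lemma beta_kernel_nonneg: "beta_kernel \<beta> v \<ge> 0"
  by (simp add: beta_kernel_def)

lemma beta_kernel_measurable [measurable]: "beta_kernel \<beta> \<in> borel_measurable borel"
  unfolding beta_kernel_def by measurable

text \<open>Expand \<open>1 / (1 + v)\<^sup>2\<close> as the integral of w exp (-(1 + v) w) over w >
  0 and exchange the order of integration; both inner integrals are Gamma integrals.\<close>

lemma nn_integral_beta_kernel:
  assumes "0 < \<beta>" "\<beta> < 2"
  shows "(\<integral>\<^sup>+v. ennreal (beta_kernel \<beta> v) \<partial>lborel) = ennreal (Gamma \<beta> * Gamma (2 - \<beta>))"
proof -
  define F where "F v w = (if v > 0 \<and> w > 0 then v powr (\<beta> - 1) * w * exp (- w) * exp (- (v * w)) else 0)" for v w :: real
  have Fm: "(\<lambda>(v, w). ennreal (F v w)) \<in> borel_measurable (lborel \<Otimes>\<^sub>M lborel)"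
    unfolding F_def case_prod_unfold by measurable
  have w: "(\<integral>\<^sup>+w. ennreal (F v w) \<partial>lborel) = ennreal (beta_kernel \<beta> v)" for v
  proof (cases "v > 0")
    case True
    have "(\<integral>\<^sup>+w. ennreal (F v w) \<partial>lborel) = (\<integral>\<^sup>+w. ennreal (v powr (\<beta> - 1)) * ennreal (if w > 0 then w powr (2 - 1) * exp (- ((1 + v) * w)) else 0) \<partial>lborel)"
      using True by (intro nn_integral_cong) (auto simp: F_def ennreal_mult'[symmetric] exp_add[symmetric] algebra_simps)
    also have "\<dots> = ennreal (v powr (\<beta> - 1)) * ennreal (Gamma 2 * (1 + v) powr (- 2))"
      using True by (subst nn_integral_cmult) (auto simp: nn_integral_Gamma)
    also have "\<dots> = ennreal (v powr (\<beta> - 1) * (Gamma 2 * (1 + v) powr (- 2)))"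
      by (simp add: ennreal_mult'[symmetric])
    also have "v powr (\<beta> - 1) * (Gamma 2 * (1 + v) powr (- 2)) = beta_kernel \<beta> v"
    proof -
      have "Gamma (2 :: real) = 1" using Gamma_fact[of 1, where ?'a = real] by simp
      moreover have "(1 + v) powr (- 2) = 1 / (1 + v)\<^sup>2"
        using True powr_realpow[of "1 + v" 2] by (simp add: powr_minus_divide)
      ultimately show ?thesis using True by (simp add: beta_kernel_def)
    qed
    finally show ?thesis .
  qed (simp add: F_def beta_kernel_def)
  have v: "(\<integral>\<^sup>+v. ennreal (F v w) \<partial>lborel) = ennreal (Gamma \<beta>) * ennreal (if w > 0 then w powr ((2 - \<beta>) - 1) * exp (- (1 * w)) else 0)" for w
  proof (cases "w > 0")
    case True
    have "(\<integral>\<^sup>+v. ennreal (F v w) \<partial>lborel) = (\<integral>\<^sup>+v. ennreal (w * exp (- w)) * ennreal (if v > 0 then v powr (\<beta> - 1) * exp (- (w * v)) else 0) \<partial>lborel)"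
      using True by (intro nn_integral_cong) (auto simp: F_def ennreal_mult'[symmetric] mult_ac)
    also have "\<dots> = ennreal (w * exp (- w)) * ennreal (Gamma \<beta> * w powr (- \<beta>))"
      using True assms by (subst nn_integral_cmult) (auto simp: nn_integral_Gamma)
    also have "\<dots> = ennreal (Gamma \<beta>) * ennreal (w * w powr (- \<beta>) * exp (- w))"
      using True assms Gamma_real_pos[of \<beta>] by (simp add: ennreal_mult'[symmetric] mult_ac)
    also have "w * w powr (- \<beta>) = w powr (1 - \<beta>)" using True by (simp add: powr_diff powr_minus divide_inverse)
    finally show ?thesis using True by simp
  qed (simp add: F_def)
  have "(\<integral>\<^sup>+v. ennreal (beta_kernel \<beta> v) \<partial>lborel) = (\<integral>\<^sup>+v. (\<integral>\<^sup>+w. ennreal (F v w) \<partial>lborel) \<partial>lborel)"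
    unfolding w ..
  also have "\<dots> = (\<integral>\<^sup>+w. (\<integral>\<^sup>+v. ennreal (F v w) \<partial>lborel) \<partial>lborel)"
    by (rule lborel_pair.Fubini'[OF Fm, symmetric])
  also have "\<dots> = ennreal (Gamma \<beta>) * (\<integral>\<^sup>+w. ennreal (if w > 0 then w powr ((2 - \<beta>) - 1) * exp (- (1 * w)) else 0) \<partial>lborel)"
    unfolding v by (rule nn_integral_cmult) measurable
  also have "\<dots> = ennreal (Gamma \<beta>) * ennreal (Gamma (2 - \<beta>) * 1 powr (- (2 - \<beta>)))"
  proof -
    have "2 - \<beta> > 0" using assms by simp
    then show ?thesis by (simp only: nn_integral_Gamma zero_less_one)
  qed
  also have "\<dots> = ennreal (Gamma \<beta> * Gamma (2 - \<beta>))"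
  proof -
    have "0 \<le> Gamma \<beta>" using assms Gamma_real_pos[of \<beta>] by simp
    then show ?thesis by (simp only: ennreal_mult' powr_one_eq_one mult_1_right)
  qed
  finally show ?thesis .
qed

lemma beta_kernel_integral:
  assumes "0 < \<beta>" "\<beta> < 2"
  shows "integrable lborel (beta_kernel \<beta>)"
    and "(\<integral>v. beta_kernel \<beta> v \<partial>lborel) = Gamma \<beta> * Gamma (2 - \<beta>)"
proof -
  have G: "0 \<le> Gamma \<beta> * Gamma (2 - \<beta>)" using assms by (intro mult_nonneg_nonneg less_imp_le Gamma_real_pos) auto
  show "integrable lborel (beta_kernel \<beta>)"
    by (rule integrableI_nonneg) (auto simp: nn_integral_beta_kernel[OF assms] beta_kernel_nonneg)
  show "(\<integral>v. beta_kernel \<beta> v \<partial>lborel) = Gamma \<beta> * Gamma (2 - \<beta>)"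
    by (subst integral_eq_nn_integral) (auto simp: nn_integral_beta_kernel[OF assms] beta_kernel_nonneg G)
qed

lemma Gamma_reflection_real:
  assumes "0 < x" "x < (1::real)"
  shows "Gamma x * Gamma (1 - x) = pi / sin (pi * x)"
proof -
  have "complex_of_real (Gamma x * Gamma (1 - x)) = Gamma (of_real x) * Gamma (1 - of_real x)"
  proof -
    have "1 - complex_of_real x = of_real (1 - x)" by simp
    then show ?thesis by (simp only: Gamma_complex_of_real of_real_mult)
  qed
  also have "\<dots> = of_real (pi / sin (pi * x))"
    unfolding Gamma_reflection_complex by (simp add: sin_of_real flip: of_real_mult)
  finally show ?thesis by (simp only: of_real_eq_iff)
qed

text \<open>Up to the substitution \<open>u = sqrt v\<close> this is \<open>- i (1 - i u)\<^bsup>-2\<^esup> du\<close>, a primitive of which is \<open>- 1 / (1 - i u)\<close>.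
  In the variable \<open>v\<close> its moments become Beta integrals.\<close>

definition osc_kernel :: "real \<Rightarrow> complex" where
  "osc_kernel v = (if v > 0 then - \<i> / ((1 - \<i> * of_real (sqrt v))\<^sup>2 * of_real (2 * sqrt v)) else 0)"

lemma osc_kernel_measurable [measurable]: "osc_kernel \<in> borel_measurable borel"
  unfolding osc_kernel_def by measurable

lemma norm_one_minus_i_sqrt:
  assumes "v \<ge> 0" shows "norm ((1 - \<i> * of_real (sqrt v))\<^sup>2) = 1 + v"
proof -
  have "(norm (1 - \<i> * of_real (sqrt v)))\<^sup>2 = 1 + v"
    unfolding cmod_power2 using assms by simp
  then show ?thesis by (simp add: norm_power)
qed

text \<open>The norm of the kernel is 1 / (2 (1 + v) sqrt v); writing 1 / (1 + v) as (1 + v) over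
  its square splits the weighted norm into two Beta integrands, which are integrable exactly for
  orders between -1 and 1.\<close>

lemma osc_kernel_integrable:
  assumes "-1 < \<alpha>" "\<alpha> < 1"
  shows "integrable lborel (\<lambda>v. norm (osc_kernel v) * sqrt v powr \<alpha>)"
proof (rule Bochner_Integration.integrable_bound)
  let ?b = "(\<alpha> + 1) / 2"
  have b: "0 < ?b" "?b < 2" using assms by simp_all
  have b': "0 < ?b + 1" "?b + 1 < 2" using assms b(1) by (linarith, simp)
  show "integrable lborel (\<lambda>v. beta_kernel ?b v + beta_kernel (?b + 1) v)"
    by (rule Bochner_Integration.integrable_add[OF beta_kernel_integral(1)[OF b(1,2)] beta_kernel_integral(1)[OF b']])
  show "AE v in lborel. norm (norm (osc_kernel v) * sqrt v powr \<alpha>) \<le> norm (beta_kernel ?b v + beta_kernel (?b + 1) v)"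
  proof (intro AE_I2)
    fix v :: real
    show "norm (norm (osc_kernel v) * sqrt v powr \<alpha>) \<le> norm (beta_kernel ?b v + beta_kernel (?b + 1) v)"
    proof (cases "v > 0")
      case True
      have "norm (osc_kernel v) = 1 / ((1 + v) * (2 * sqrt v))"
        using True norm_one_minus_i_sqrt[of v] by (simp add: osc_kernel_def norm_divide norm_mult)
      moreover have "sqrt v powr \<alpha> / sqrt v = v powr (?b - 1)"
      proof -
        have "sqrt v powr \<alpha> / sqrt v = sqrt v powr (\<alpha> - 1)" using True by (simp add: powr_diff)
        also have "\<dots> = v powr ((\<alpha> - 1) / 2)" using True by (simp add: powr_half_sqrt[symmetric] powr_powr)
        finally show ?thesis by (simp add: field_simps)
      qed
      moreover have "1 / (A * (2 * s)) * p = (p / s) / (2 * A)" for A s p :: real by simp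
      ultimately have "norm (osc_kernel v) * sqrt v powr \<alpha> = v powr (?b - 1) / (2 * (1 + v))"
        by (simp only:)
      also have "\<dots> \<le> v powr (?b - 1) / (1 + v)"
        using True by (intro divide_left_mono) auto
      also have "\<dots> = v powr (?b - 1) * (1 + v) / (1 + v)\<^sup>2"
        using True by (simp add: power2_eq_square)
      also have "\<dots> = beta_kernel ?b v + beta_kernel (?b + 1) v"
      proof -
        have "v powr (?b + 1 - 1) = v powr (?b - 1) * v"
        proof -
          have "?b + 1 - 1 = (?b - 1) + 1" by (simp only: diff_add_cancel add_diff_cancel_right')
          then show ?thesis using True by (simp only: powr_add powr_one less_imp_le)
        qed
        then show ?thesis using True by (simp only: beta_kernel_def if_True distrib_left mult_1_right add_divide_distrib)
      qed
      finally show ?thesis by simp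
    qed (simp add: osc_kernel_def)
  qed
qed measurable

text \<open>Multiplying numerator and denominator by \<open>(1 + \<i> * sqrt v)\<^sup>2\<close>
  makes the denominator real and leaves three Beta integrands. Reflection turns their values into
  multiples of 1 / sin and 1 / cos of pi e / 2, and the double angle formula collects them into one
  exponential: the phase of the theorem.\<close>

lemma osc_kernel_moment:
  assumes "0 < e" "e < 1"
  shows "(\<integral>v. osc_kernel v * of_real (sqrt v powr e) \<partial>lborel)
    = of_real (e * Gamma e * Gamma (1 - e)) * exp (\<i> * of_real (pi * e / 2))"
proof -
  let ?b = "\<lambda>\<beta> v. complex_of_real (beta_kernel \<beta> v)"
  have pt: "osc_kernel v * of_real (sqrt v powr e)
     = ?b (e / 2 + 1) v - (\<i> / 2) * (?b ((e + 1) / 2) v - ?b ((e + 3) / 2) v)" for v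
  proof (cases "v > 0")
    case True
    define s where "s = sqrt v"
    have s: "s > 0" "s * s = v" using True by (simp_all add: s_def)
    have sc: "complex_of_real s * complex_of_real s = complex_of_real v" by (simp only: s(2)[symmetric] of_real_mult)
    have ne: "1 - \<i> * of_real s \<noteq> 0" "1 + complex_of_real v \<noteq> 0" "complex_of_real s \<noteq> 0"
      using s True by (auto simp: complex_eq_iff)
    have prod1: "(1 - \<i> * of_real s) * (1 + \<i> * of_real s) = 1 + complex_of_real v"
      by (simp add: algebra_simps sc)
    have inv: "1 / (1 - \<i> * of_real s)\<^sup>2 = (1 + \<i> * of_real s)\<^sup>2 / (1 + complex_of_real v)\<^sup>2"
    proof -
      have "(1 - \<i> * of_real s)\<^sup>2 * (1 + \<i> * of_real s)\<^sup>2 = (1 + complex_of_real v)\<^sup>2"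
        by (simp only: power_mult_distrib[symmetric] prod1)
      then show ?thesis using ne by (subst frac_eq_eq) (auto simp: mult.commute)
    qed
    have "osc_kernel v = - \<i> / (2 * of_real s) * (1 / (1 - \<i> * of_real s)\<^sup>2)"
      using True by (simp add: osc_kernel_def s_def)
    also have "\<dots> = (- \<i> * (1 + \<i> * of_real s)\<^sup>2) / (2 * of_real s * (1 + complex_of_real v)\<^sup>2)"
      unfolding inv by simp
    also have "- \<i> * (1 + \<i> * of_real s)\<^sup>2 = 2 * of_real s - \<i> * (1 - of_real v)"
      by (simp add: power2_eq_square algebra_simps sc)
    finally have k: "osc_kernel v = (2 * of_real s - \<i> * (1 - of_real v)) / (2 * of_real s * (1 + complex_of_real v)\<^sup>2)" .
    have p0: "s powr e = v powr (e / 2)" using True by (simp add: s_def powr_half_sqrt[symmetric] powr_powr)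
    have p1: "v powr ((e + 1) / 2 - 1) = s powr e / s"
    proof -
      have "s powr e / s = s powr (e - 1)" using s by (simp add: powr_diff)
      also have "\<dots> = v powr ((e - 1) / 2)" using True by (simp add: s_def powr_half_sqrt[symmetric] powr_powr)
      finally show ?thesis by (simp add: field_simps)
    qed
    have p2: "v powr ((e + 3) / 2 - 1) = s powr e / s * v"
    proof -
      have "v powr ((e + 3) / 2 - 1) = v powr (((e + 1) / 2 - 1) + 1)" by (simp add: field_simps)
      also have "\<dots> = v powr ((e + 1) / 2 - 1) * v" using True by (simp only: powr_add powr_one)
      finally show ?thesis unfolding p1 .
    qed
    have b: "?b (e / 2 + 1) v = of_real (s powr e) / (1 + complex_of_real v)\<^sup>2"
      "?b ((e + 1) / 2) v = of_real (s powr e) / (of_real s * (1 + complex_of_real v)\<^sup>2)"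
      "?b ((e + 3) / 2) v = of_real (s powr e) * of_real v / (of_real s * (1 + complex_of_real v)\<^sup>2)"
      using True p0 p1 p2 by (simp_all add: beta_kernel_def)
    show ?thesis unfolding b k s_def[symmetric] using ne by (simp add: field_simps)
  qed (simp add: osc_kernel_def beta_kernel_def)
  have ib: "integrable lborel (?b \<beta>)" "(\<integral>v. ?b \<beta> v \<partial>lborel) = of_real (Gamma \<beta> * Gamma (2 - \<beta>))"
    if "0 < \<beta>" "\<beta> < 2" for \<beta>
    using beta_kernel_integral[OF that] by simp_all
  have refl_half: "Gamma ((e + 1) / 2) * Gamma ((1 - e) / 2) = pi / cos (pi * e / 2)"
  proof -
    have "Gamma ((e + 1) / 2) * Gamma (1 - (e + 1) / 2) = pi / sin (pi * ((e + 1) / 2))"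
      by (rule Gamma_reflection_real) (use assms in simp_all)
    moreover have "1 - (e + 1) / 2 = (1 - e) / 2" by (simp add: field_simps)
    moreover have "sin (pi * ((e + 1) / 2)) = cos (pi * e / 2)"
    proof -
      have "pi * ((e + 1) / 2) = pi * e / 2 + pi / 2" by (simp add: field_simps)
      then show ?thesis by (simp only: sin_add) simp
    qed
    ultimately show ?thesis by (simp only:)
  qed
  have "(\<integral>v. osc_kernel v * of_real (sqrt v powr e) \<partial>lborel)
    = of_real (Gamma (e / 2 + 1) * Gamma (2 - (e / 2 + 1)))
      - (\<i> / 2) * (of_real (Gamma ((e + 1) / 2) * Gamma (2 - (e + 1) / 2)) - of_real (Gamma ((e + 3) / 2) * Gamma (2 - (e + 3) / 2)))"
    unfolding pt using assms ib[of "e / 2 + 1"] ib[of "(e + 1) / 2"] ib[of "(e + 3) / 2"]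
    by (subst Bochner_Integration.integral_diff) auto
  also have "Gamma (e / 2 + 1) * Gamma (2 - (e / 2 + 1)) = e / 2 * (pi / sin (pi * e / 2))"
  proof -
    have g: "Gamma (e / 2 + 1) = e / 2 * Gamma (e / 2)" using assms by (intro Gamma_plus1) (auto elim!: nonpos_Ints_cases)
    have "2 - (e / 2 + 1) = 1 - e / 2" by simp
    moreover have "Gamma (e / 2) * Gamma (1 - e / 2) = pi / sin (pi * (e / 2))"
      by (rule Gamma_reflection_real) (use assms in simp_all)
    ultimately show ?thesis unfolding g by (simp only: mult.assoc times_divide_eq_right)
  qed
  also have "Gamma ((e + 1) / 2) * Gamma (2 - (e + 1) / 2) = (1 - e) / 2 * (pi / cos (pi * e / 2))"
  proof -
    have "Gamma ((1 - e) / 2 + 1) = (1 - e) / 2 * Gamma ((1 - e) / 2)" using assms by (intro Gamma_plus1) (auto elim!: nonpos_Ints_cases)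
    moreover have "2 - (e + 1) / 2 = (1 - e) / 2 + 1" by (simp add: field_simps)
    ultimately have "Gamma ((e + 1) / 2) * Gamma (2 - (e + 1) / 2) = (1 - e) / 2 * (Gamma ((e + 1) / 2) * Gamma ((1 - e) / 2))"
      by (simp only: mult_ac)
    then show ?thesis by (simp only: refl_half)
  qed
  also have "Gamma ((e + 3) / 2) * Gamma (2 - (e + 3) / 2) = (1 + e) / 2 * (pi / cos (pi * e / 2))"
  proof -
    have "Gamma ((e + 1) / 2 + 1) = (e + 1) / 2 * Gamma ((e + 1) / 2)" using assms by (intro Gamma_plus1) (auto elim!: nonpos_Ints_cases)
    moreover have "(e + 3) / 2 = (e + 1) / 2 + 1" "2 - (e + 3) / 2 = (1 - e) / 2" by (simp_all add: field_simps)
    ultimately have "Gamma ((e + 3) / 2) * Gamma (2 - (e + 3) / 2) = (e + 1) / 2 * (Gamma ((e + 1) / 2) * Gamma ((1 - e) / 2))"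
      by (simp only: mult_ac)
    then show ?thesis unfolding refl_half by (simp only: add.commute)
  qed
  also have "complex_of_real (e / 2 * (pi / sin (pi * e / 2)))
      - (\<i> / 2) * (of_real ((1 - e) / 2 * (pi / cos (pi * e / 2))) - of_real ((1 + e) / 2 * (pi / cos (pi * e / 2))))
    = of_real (e * (pi / sin (pi * e))) * exp (\<i> * of_real (pi * e / 2))"
  proof -
    define a where "a = pi * e / 2"
    have "0 < a" "a < pi / 2" using assms by (simp_all add: a_def)
    then have sc: "sin a > 0" "cos a > 0" by (auto intro!: sin_gt_zero cos_gt_zero)
    have "sin (pi * e) = 2 * sin a * cos a" using sin_double[of a] by (simp add: a_def)
    then show ?thesis
      unfolding a_def[symmetric] using sc by (simp add: complex_eq_iff exp_Euler[symmetric] Re_exp Im_exp field_simps)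
  qed
  also have "e * (pi / sin (pi * e)) = e * Gamma e * Gamma (1 - e)"
    using Gamma_reflection_real[OF assms] by (simp only: mult.assoc)
  finally show ?thesis .
qed

text \<open>The tail of the kernel reproduces 1 / (1 - i z), the function that
  \<open>exp_tail_integral\<close> yields as a Laplace transform. This agreement is what links
  sublevel integrals with oscillatory ones.\<close>

lemma osc_kernel_tail:
  assumes "z > 0"
  shows "(\<integral>v. (if v > z\<^sup>2 then osc_kernel v else 0) \<partial>lborel) = 1 / (1 - \<i> * of_real z)"
proof -
  have "integrable lborel (\<lambda>v. norm (osc_kernel v))"
  proof -
    have "(\<lambda>v. norm (osc_kernel v) * sqrt v powr 0) = (\<lambda>v. norm (osc_kernel v))"
      by (auto simp: osc_kernel_def fun_eq_iff)
    then show ?thesis using osc_kernel_integrable[of 0] by simp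
  qed
  then have int: "integrable lborel osc_kernel" by (subst integrable_norm_iff[symmetric]) auto
  define F where "F v = - (1 / (1 - \<i> * of_real (sqrt v)))" for v
  have ne: "1 - \<i> * of_real x \<noteq> 0" for x by (simp add: complex_eq_iff)
  have "(LBINT v=ereal (z\<^sup>2)..\<infinity>. osc_kernel v) = 0 - F (z\<^sup>2)"
  proof (rule interval_integral_FTC_integrable)
    fix v assume "ereal (z\<^sup>2) < ereal v"
    then have v: "v > 0" using assms by (meson ereal_less(3) less_ereal.simps(1) less_trans zero_less_power)
    show "(F has_vector_derivative osc_kernel v) (at v)"
    proof -
      have "(sqrt has_real_derivative (1 / (2 * sqrt v))) (at v)"
      proof -
        have "inverse (sqrt v) / 2 = 1 / (2 * sqrt v)" by (simp add: field_simps)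
        then show ?thesis using DERIV_real_sqrt[OF v] by (simp only:)
      qed
      then have 1: "((\<lambda>x. complex_of_real (sqrt x)) has_vector_derivative of_real (1 / (2 * sqrt v))) (at v)"
        by (rule has_vector_derivative_of_real)
      have 2: "((\<lambda>s. - (1 / (1 - \<i> * s))) has_field_derivative - \<i> / (1 - \<i> * of_real (sqrt v))\<^sup>2) (at (of_real (sqrt v)))"
        using ne by (auto intro!: derivative_eq_intros simp: power2_eq_square)
      show ?thesis
      proof -
        have "of_real (1 / (2 * sqrt v)) * (- \<i> / (1 - \<i> * of_real (sqrt v))\<^sup>2) = osc_kernel v"
          using v by (simp add: osc_kernel_def)
        then show ?thesis
          using field_vector_diff_chain_at[OF 1 2] unfolding F_def[abs_def] o_def by (simp only:)
      qed
    qed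
    have "continuous_on {0<..} (\<lambda>x. - \<i> / ((1 - \<i> * of_real (sqrt x))\<^sup>2 * of_real (2 * sqrt x)))"
      using ne by (intro continuous_intros) auto
    then have "continuous_on {0<..} osc_kernel"
      by (rule continuous_on_eq) (simp add: osc_kernel_def)
    then show "isCont osc_kernel v" using v by (simp add: continuous_on_eq_continuous_at)
  next
    show "set_integrable lborel (einterval (ereal (z\<^sup>2)) \<infinity>) osc_kernel"
      unfolding set_integrable_def by (rule integrable_mult_indicator[OF _ int]) simp
    show "((F \<circ> real_of_ereal) \<longlongrightarrow> F (z\<^sup>2)) (at_right (ereal (z\<^sup>2)))"
      unfolding ereal_tendsto_simps F_def using ne by (intro tendsto_intros) auto
    show "((F \<circ> real_of_ereal) \<longlongrightarrow> 0) (at_left \<infinity>)"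
      unfolding ereal_tendsto_simps
    proof (rule Lim_null_comparison)
      show "((\<lambda>v. 1 / sqrt v) \<longlongrightarrow> 0) at_top" by real_asymp
      show "\<forall>\<^sub>F v in at_top. norm (F v) \<le> 1 / sqrt v"
        using eventually_gt_at_top[of 0]
      proof eventually_elim
        case (elim v)
        have "sqrt v \<le> norm (1 - \<i> * of_real (sqrt v))"
          using abs_Im_le_cmod[of "1 - \<i> * of_real (sqrt v)"] elim by simp
        then show ?case using elim by (simp add: F_def norm_divide frac_le)
      qed
    qed
  qed simp
  also have "0 - F (z\<^sup>2) = 1 / (1 - \<i> * of_real z)" using assms by (simp add: F_def)
  also have "(LBINT v=ereal (z\<^sup>2)..\<infinity>. osc_kernel v) = (\<integral>v. (if v > z\<^sup>2 then osc_kernel v else 0) \<partial>lborel)"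
    unfolding interval_integral_to_infinity_eq set_lebesgue_integral_def
    by (intro Bochner_Integration.integral_cong) (auto simp: indicator_def)
  finally show ?thesis .
qed

section \<open>Two evaluations of the regularized integral\<close>

lemma integrable_product_pair:
  fixes g :: "real \<Rightarrow> real" and \<phi> :: "'a :: euclidean_space \<Rightarrow> real"
  assumes g: "integrable lborel g" and \<phi>: "integrable lborel \<phi>"
  shows "integrable (lborel \<Otimes>\<^sub>M lborel) (\<lambda>(v, p). g v * \<phi> p)"
proof (rule lborel_pair.Fubini_integrable)
  have [measurable]: "g \<in> borel_measurable borel" "\<phi> \<in> borel_measurable borel"
    using borel_measurable_integrable[OF g] borel_measurable_integrable[OF \<phi>] by simp_all
  show "(\<lambda>(v, p). g v * \<phi> p) \<in> borel_measurable (lborel \<Otimes>\<^sub>M lborel)"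
    unfolding case_prod_unfold by measurable
  have "(\<integral>p. norm (case (v, p) of (v, p) \<Rightarrow> g v * \<phi> p) \<partial>lborel) = \<bar>g v\<bar> * (\<integral>p. \<bar>\<phi> p\<bar> \<partial>lborel)" for v
    by (simp add: abs_mult)
  then show "integrable lborel (\<lambda>v. \<integral>p. norm (case (v, p) of (v, p) \<Rightarrow> g v * \<phi> p) \<partial>lborel)"
    using g by simp
  show "AE v in lborel. integrable lborel (\<lambda>p. case (v, p) of (v, p) \<Rightarrow> g v * \<phi> p)"
    using \<phi> by simp
qed

lemma exp_tail_integral:
  fixes z :: real
  shows "(\<integral>v. (if v > 0 then exp (- (1 - \<i> * of_real z) * of_real v) else 0) \<partial>lborel) = 1 / (1 - \<i> * of_real z)"
    and "integrable lborel (\<lambda>v::real. if v > 0 then exp (- v) else 0 :: real)"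
proof -
  have nn: "(\<integral>\<^sup>+v. ennreal (if v > 0 then exp (- v) else 0) \<partial>lborel) = 1"
  proof -
    have "(\<integral>\<^sup>+v. ennreal (if v > 0 then v powr (1 - 1) * exp (- (1 * v)) else 0) \<partial>lborel) = ennreal (Gamma 1 * 1 powr (- 1))"
      by (rule nn_integral_Gamma) simp_all
    also have "(\<lambda>v. ennreal (if v > 0 then v powr (1 - 1) * exp (- (1 * v)) else 0)) = (\<lambda>v. ennreal (if v > 0 then exp (- v) else 0))"
      by (auto simp: fun_eq_iff)
    finally show ?thesis by simp
  qed
  show int: "integrable lborel (\<lambda>v::real. if v > 0 then exp (- v) else 0 :: real)"
    by (rule integrableI_nonneg) (auto simp: nn)
  define c where "c = 1 - \<i> * of_real z"
  have c: "c \<noteq> 0" "Re c = 1" by (auto simp: c_def complex_eq_iff)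
  have nrm: "norm (exp (- c * of_real v)) = exp (- v)" for v :: real by (simp add: c)
  have "(LBINT v=ereal 0..\<infinity>. exp (- c * of_real v)) = 0 - (- (1 / c) * exp (- c * of_real 0))"
  proof (rule interval_integral_FTC_integrable[where F = "\<lambda>v. - (1 / c) * exp (- c * of_real v)"])
    show "((\<lambda>v. - (1 / c) * exp (- c * of_real v)) has_vector_derivative exp (- c * of_real v)) (at v)" for v
    proof -
      have 1: "((\<lambda>x. complex_of_real x) has_vector_derivative of_real 1) (at v)"
        by (rule has_vector_derivative_of_real) (auto intro!: derivative_eq_intros)
      have 2: "((\<lambda>s. - (1 / c) * exp (- c * s)) has_field_derivative exp (- c * of_real v)) (at (of_real v))"
        using c by (auto intro!: derivative_eq_intros)
      show ?thesis using field_vector_diff_chain_at[OF 1 2] by (simp add: o_def)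
    qed
    show "isCont (\<lambda>v. exp (- c * of_real v)) v" for v :: real by (intro continuous_intros)
    show "set_integrable lborel (einterval (ereal 0) \<infinity>) (\<lambda>v. exp (- c * of_real v))"
      unfolding set_integrable_def
      by (rule Bochner_Integration.integrable_bound[OF int])
         (auto simp: einterval_def indicator_def nrm c)
    show "(((\<lambda>v. - (1 / c) * exp (- c * of_real v)) \<circ> real_of_ereal) \<longlongrightarrow> - (1 / c) * exp (- c * of_real 0)) (at_right (ereal 0))"
      unfolding ereal_tendsto_simps by (intro tendsto_intros)
    show "(((\<lambda>v. - (1 / c) * exp (- c * of_real v)) \<circ> real_of_ereal) \<longlongrightarrow> 0) (at_left \<infinity>)"
      unfolding ereal_tendsto_simps
    proof (rule Lim_null_comparison)
      show "((\<lambda>v. norm (1 / c) * exp (- v)) \<longlongrightarrow> 0) at_top" by real_asymp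
    qed (auto simp: norm_mult nrm[simplified] norm_divide c)
  qed simp
  also have "(LBINT v=ereal 0..\<infinity>. exp (- c * of_real v)) = (\<integral>v. (if v > 0 then exp (- c * of_real v) else 0) \<partial>lborel)"
    unfolding interval_integral_to_infinity_eq set_lebesgue_integral_def
    by (intro Bochner_Integration.integral_cong) (auto simp: indicator_def)
  finally show "(\<integral>v. (if v > 0 then exp (- (1 - \<i> * of_real z) * of_real v) else 0) \<partial>lborel) = 1 / (1 - \<i> * of_real z)"
    unfolding c_def by simp
qed

lemma laplace_osc:
  fixes S \<phi> :: "'a :: euclidean_space \<Rightarrow> real"
  assumes [measurable]: "S \<in> borel_measurable borel" and \<phi>: "integrable lborel \<phi>"
  shows "(\<integral>v. (\<integral>p. exp (\<i> * of_real (v * T * S p)) * of_real (\<phi> p) \<partial>lborel) * (if v > 0 then of_real (exp (- v)) else 0) \<partial>lborel)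
    = (\<integral>p. of_real (\<phi> p) / (1 - \<i> * of_real (T * S p)) \<partial>lborel)"
proof -
  have \<phi>m [measurable]: "\<phi> \<in> borel_measurable borel" using borel_measurable_integrable[OF \<phi>] by simp
  define F where "F v p = exp (\<i> * of_real (v * T * S p)) * of_real (\<phi> p) * (if v > 0 then of_real (exp (- v)) else 0)" for v p
  have int: "integrable (lborel \<Otimes>\<^sub>M lborel) (\<lambda>(v, p). F v p)"
  proof (rule Bochner_Integration.integrable_bound[OF integrable_product_pair[OF exp_tail_integral(2) \<phi>]])
    show "(\<lambda>(v, p). F v p) \<in> borel_measurable (lborel \<Otimes>\<^sub>M lborel)"
      unfolding F_def case_prod_unfold by measurable
    show "AE x in lborel \<Otimes>\<^sub>M lborel. norm (case x of (v, p) \<Rightarrow> F v p) \<le> norm (case x of (v, p) \<Rightarrow> (if 0 < v then exp (- v) else 0) * \<phi> p)"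
      by (intro AE_I2) (auto simp: F_def norm_mult abs_mult)
  qed
  have "(\<integral>v. (\<integral>p. exp (\<i> * of_real (v * T * S p)) * of_real (\<phi> p) \<partial>lborel) * (if v > 0 then of_real (exp (- v)) else 0) \<partial>lborel)
      = (\<integral>v. (\<integral>p. F v p \<partial>lborel) \<partial>lborel)"
    unfolding F_def by simp
  also have "\<dots> = (\<integral>p. (\<integral>v. F v p \<partial>lborel) \<partial>lborel)"
    by (rule lborel_pair.Fubini_integral[OF int, symmetric])
  also have "\<dots> = (\<integral>p. of_real (\<phi> p) / (1 - \<i> * of_real (T * S p)) \<partial>lborel)"
  proof (rule Bochner_Integration.integral_cong[OF refl])
    fix p
    have "(\<integral>v. F v p \<partial>lborel) = (\<integral>v. of_real (\<phi> p) * (if v > 0 then exp (- (1 - \<i> * of_real (T * S p)) * of_real v) else 0) \<partial>lborel)"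
      by (intro Bochner_Integration.integral_cong)
        (auto simp: F_def exp_of_real[symmetric] exp_add[symmetric] algebra_simps)
    also have "\<dots> = of_real (\<phi> p) * (1 / (1 - \<i> * of_real (T * S p)))"
      unfolding exp_tail_integral(1)[symmetric] by (rule integral_mult_right_zero)
    finally show "(\<integral>v. F v p \<partial>lborel) = of_real (\<phi> p) / (1 - \<i> * of_real (T * S p))" by simp
  qed
  finally show ?thesis .
qed

text \<open>For fixed p, S p < sqrt v / T means v > (T S p) squared, so after exchanging the
  integrals the inner one is a tail of the kernel. The product of the norm of the kernel with \<phi>
  justifies the exchange.\<close>

lemma layer_cake_osc:
  fixes S \<phi> :: "'a :: euclidean_space \<Rightarrow> real"
  assumes [measurable]: "S \<in> borel_measurable borel" and \<phi>: "integrable lborel \<phi>" and "T > 0"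
  shows "(\<integral>v. of_real (\<integral>p. (if 0 < S p \<and> S p < sqrt v / T then \<phi> p else 0) \<partial>lborel) * osc_kernel v \<partial>lborel)
    = (\<integral>p. (if S p > 0 then of_real (\<phi> p) / (1 - \<i> * of_real (T * S p)) else 0) \<partial>lborel)"
proof -
  have \<phi>m [measurable]: "\<phi> \<in> borel_measurable borel" using borel_measurable_integrable[OF \<phi>] by simp
  define F where "F v p = of_real (if 0 < S p \<and> S p < sqrt v / T then \<phi> p else 0) * osc_kernel v" for v p
  have ik: "integrable lborel (\<lambda>v. norm (osc_kernel v))"
  proof -
    have "(\<lambda>v. norm (osc_kernel v) * sqrt v powr 0) = (\<lambda>v. norm (osc_kernel v))"
      by (auto simp: osc_kernel_def fun_eq_iff)
    then show ?thesis using osc_kernel_integrable[of 0] by simp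
  qed
  have int: "integrable (lborel \<Otimes>\<^sub>M lborel) (\<lambda>(v, p). F v p)"
  proof (rule Bochner_Integration.integrable_bound[OF integrable_product_pair[OF ik \<phi>]])
    show "(\<lambda>(v, p). F v p) \<in> borel_measurable (lborel \<Otimes>\<^sub>M lborel)"
      unfolding F_def case_prod_unfold by measurable
    show "AE x in lborel \<Otimes>\<^sub>M lborel. norm (case x of (v, p) \<Rightarrow> F v p) \<le> norm (case x of (v, p) \<Rightarrow> norm (osc_kernel v) * \<phi> p)"
      by (intro AE_I2) (auto simp: F_def norm_mult abs_mult)
  qed
  have "(\<integral>v. of_real (\<integral>p. (if 0 < S p \<and> S p < sqrt v / T then \<phi> p else 0) \<partial>lborel) * osc_kernel v \<partial>lborel)
      = (\<integral>v. (\<integral>p. F v p \<partial>lborel) \<partial>lborel)"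
    unfolding F_def by simp
  also have "\<dots> = (\<integral>p. (\<integral>v. F v p \<partial>lborel) \<partial>lborel)"
    by (rule lborel_pair.Fubini_integral[OF int, symmetric])
  also have "\<dots> = (\<integral>p. (if S p > 0 then of_real (\<phi> p) / (1 - \<i> * of_real (T * S p)) else 0) \<partial>lborel)"
  proof (rule Bochner_Integration.integral_cong[OF refl])
    fix p
    show "(\<integral>v. F v p \<partial>lborel) = (if S p > 0 then of_real (\<phi> p) / (1 - \<i> * of_real (T * S p)) else 0)"
    proof (cases "S p > 0")
      case True
      have TS: "T * S p > 0" using True \<open>T > 0\<close> by simp
      have iff: "S p < sqrt v / T \<longleftrightarrow> v > (T * S p)\<^sup>2" for v
      proof -
        have "S p < sqrt v / T \<longleftrightarrow> T * S p < sqrt v" using \<open>T > 0\<close> by (simp add: less_divide_eq mult.commute)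
        also have "\<dots> \<longleftrightarrow> (T * S p)\<^sup>2 < v"
          using TS real_less_rsqrt real_sqrt_less_iff[of "(T * S p)\<^sup>2" v] by simp
        finally show ?thesis .
      qed
      have "(\<integral>v. F v p \<partial>lborel) = (\<integral>v. of_real (\<phi> p) * (if v > (T * S p)\<^sup>2 then osc_kernel v else 0) \<partial>lborel)"
        unfolding F_def iff using True by (intro Bochner_Integration.integral_cong) auto
      also have "\<dots> = of_real (\<phi> p) * (1 / (1 - \<i> * of_real (T * S p)))"
        unfolding osc_kernel_tail[OF TS, symmetric] by (rule integral_mult_right_zero)
      finally show ?thesis using True by simp
    next
      case False
      then have "F v p = 0" for v by (simp add: F_def)
      then show ?thesis using False by simp
    qed
  qed
  finally show ?thesis .
qed

text \<open>Conjugation changes the sign of S in 1 / (1 - i T S) and fixes the real function \<phi>,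
  so the part S < 0 is the conjugate of the layer cake for -S. Neither sublevel integral sees S = 0,
  where the integrand equals \<phi>; hence the null set hypothesis.\<close>

lemma laplace_identity:
  fixes S \<phi> :: "'a :: euclidean_space \<Rightarrow> real"
  assumes Sm [measurable]: "S \<in> borel_measurable borel" and \<phi>: "integrable lborel \<phi>" and "T > 0"
    and null: "AE p in lborel. \<phi> p \<noteq> 0 \<longrightarrow> S p \<noteq> 0"
  shows "(\<integral>v. (\<integral>p. exp (\<i> * of_real (v * T * S p)) * of_real (\<phi> p) \<partial>lborel) * (if v > 0 then of_real (exp (- v)) else 0) \<partial>lborel)
    = (\<integral>v. of_real (\<integral>p. (if 0 < S p \<and> S p < sqrt v / T then \<phi> p else 0) \<partial>lborel) * osc_kernel v \<partial>lborel)
    + (\<integral>v. of_real (\<integral>p. (if 0 < - S p \<and> - S p < sqrt v / T then \<phi> p else 0) \<partial>lborel) * cnj (osc_kernel v) \<partial>lborel)"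
proof -
  have \<phi>m [measurable]: "\<phi> \<in> borel_measurable borel" using borel_measurable_integrable[OF \<phi>] by simp
  let ?q = "\<lambda>p. of_real (\<phi> p) / (1 - \<i> * of_real (T * S p)) :: complex"
  have neg: "(\<integral>v. of_real (\<integral>p. (if 0 < - S p \<and> - S p < sqrt v / T then \<phi> p else 0) \<partial>lborel) * cnj (osc_kernel v) \<partial>lborel)
      = (\<integral>p. (if S p < 0 then ?q p else 0) \<partial>lborel)"
  proof -
    have "(\<integral>v. of_real (\<integral>p. (if 0 < - S p \<and> - S p < sqrt v / T then \<phi> p else 0) \<partial>lborel) * cnj (osc_kernel v) \<partial>lborel)
        = (\<integral>v. cnj (of_real (\<integral>p. (if 0 < - S p \<and> - S p < sqrt v / T then \<phi> p else 0) \<partial>lborel) * osc_kernel v) \<partial>lborel)"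
      by simp
    also have "\<dots> = cnj (\<integral>v. of_real (\<integral>p. (if 0 < - S p \<and> - S p < sqrt v / T then \<phi> p else 0) \<partial>lborel) * osc_kernel v \<partial>lborel)"
      by (simp only: Bochner_Integration.integral_cnj)
    also have "\<dots> = cnj (\<integral>p. (if - S p > 0 then of_real (\<phi> p) / (1 - \<i> * of_real (T * - S p)) else 0) \<partial>lborel)"
      by (subst layer_cake_osc[of "\<lambda>p. - S p"]) (use \<phi> \<open>T > 0\<close> in auto)
    also have "\<dots> = (\<integral>p. cnj (if - S p > 0 then of_real (\<phi> p) / (1 - \<i> * of_real (T * - S p)) else 0) \<partial>lborel)"
      by (simp only: Bochner_Integration.integral_cnj)
    also have "\<dots> = (\<integral>p. (if S p < 0 then ?q p else 0) \<partial>lborel)"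
      by (intro Bochner_Integration.integral_cong) auto
    finally show ?thesis .
  qed
  have le: "norm (?q p) \<le> \<bar>\<phi> p\<bar>" for p
  proof -
    have "1 \<le> norm (1 - \<i> * of_real (T * S p))"
      using abs_Re_le_cmod[of "1 - \<i> * of_real (T * S p)"] by simp
    then show ?thesis by (simp add: norm_divide divide_le_eq mult_le_cancel_left1)
  qed
  have int: "integrable lborel (\<lambda>p. if P p then ?q p else 0)" if [measurable]: "Measurable.pred borel P" for P
  proof (rule Bochner_Integration.integrable_bound[OF \<phi>])
    show "AE p in lborel. norm (if P p then ?q p else 0) \<le> norm (\<phi> p)"
      using le by (intro AE_I2) auto
  qed measurable
  have "(\<integral>p. ?q p \<partial>lborel) = (\<integral>p. (if S p > 0 then ?q p else 0) + (if S p < 0 then ?q p else 0) \<partial>lborel)"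
    by (rule integral_cong_AE) (use null in \<open>auto elim!: eventually_mono\<close>)
  also have "\<dots> = (\<integral>p. (if S p > 0 then ?q p else 0) \<partial>lborel) + (\<integral>p. (if S p < 0 then ?q p else 0) \<partial>lborel)"
    by (rule Bochner_Integration.integral_add; rule int) measurable
  finally show ?thesis
    unfolding laplace_osc[OF Sm \<phi>] layer_cake_osc[OF Sm \<phi> \<open>T > 0\<close>] neg .
qed

section \<open>Asymptotics of both sides and comparison of coefficients\<close>

lemma Gamma_kernel:
  assumes "\<alpha> < (1::real)"
  shows "integrable lborel (\<lambda>v. (if v > 0 then exp (- v) else 0) * (1 / v) powr \<alpha>)"
    and "(\<integral>v. (if v > 0 then exp (- v) else 0) * (1 / v) powr \<alpha> \<partial>lborel) = Gamma (1 - \<alpha>)"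
proof -
  let ?f = "\<lambda>v. (if v > 0 then exp (- v) else 0) * (1 / v) powr \<alpha>"
  have eq: "?f w = (if w > 0 then w powr ((1 - \<alpha>) - 1) * exp (- (1 * w)) else 0)" for w
    by (auto simp: powr_divide powr_minus_divide)
  have nn: "(\<integral>\<^sup>+v. ennreal (?f v) \<partial>lborel) = ennreal (Gamma (1 - \<alpha>))"
    unfolding eq using nn_integral_Gamma[of "1 - \<alpha>" 1] assms by simp
  show "integrable lborel ?f"
    by (rule integrableI_nonneg) (auto simp: nn)
  show "(\<integral>v. ?f v \<partial>lborel) = Gamma (1 - \<alpha>)"
    by (subst integral_eq_nn_integral) (use nn Gamma_real_pos[of "1 - \<alpha>"] assms in auto)
qed

text \<open>The substitution l = 1/t moves infinity to 0 and reverses the sign of the logarithm. The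
  constant \<open>X\<close> is left unevaluated: it is multiplied by the logarithmic coefficient and
  disappears with it.\<close>

lemma abelian_osc:
  fixes J :: "real \<Rightarrow> complex"
  assumes e: "0 < e" "e < 1" and bdd: "\<And>l. norm (J l) \<le> B" and [measurable]: "J \<in> borel_measurable borel"
    and lim: "((\<lambda>l. J l / of_real (l powr (- e)) - (\<delta> + \<delta>' * of_real (ln l))) \<longlongrightarrow> 0) at_top"
  shows "\<exists>X. ((\<lambda>T. of_real (T powr e) * (\<integral>v. J (v * T) * (if v > 0 then of_real (exp (- v)) else 0) \<partial>lborel)
      - (\<delta> + \<delta>' * of_real (ln T)) * of_real (Gamma (1 - e))) \<longlongrightarrow> \<delta>' * X) at_top"
proof -
  define k :: "real \<Rightarrow> complex" where "k v = (if v > 0 then of_real (exp (- v)) else 0)" for v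
  have [measurable]: "k \<in> borel_measurable borel" unfolding k_def by measurable
  \<comment> \<open>Half the distance to 1, so that the moment of order \<open>e + \<tau>\<close>
    still converges.\<close>
  define \<tau> where "\<tau> = (1 - e) / 2"
  have \<tau>: "\<tau> > 0" "e - \<tau> < 1" "e + \<tau> < 1" using e by (simp_all add: \<tau>_def field_simps)
  have nk: "norm (k v) * (1 / v) powr \<alpha> = (if v > 0 then exp (- v) else 0) * (1 / v) powr \<alpha>" for v \<alpha>
    by (simp add: k_def)
  have lim': "((\<lambda>t. J (1 / t) / of_real (t powr e) - (\<delta> + (- \<delta>') * of_real (ln t))) \<longlongrightarrow> 0) (at_right 0)"
  proof -
    have "filterlim (\<lambda>t::real. 1 / t) at_top (at_right 0)" by real_asymp
    from filterlim_compose[OF lim this]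
    have "((\<lambda>t. J (1 / t) / of_real ((1 / t) powr (- e)) - (\<delta> + \<delta>' * of_real (ln (1 / t)))) \<longlongrightarrow> 0) (at_right 0)" .
    moreover have "\<forall>\<^sub>F t in at_right 0. J (1 / t) / of_real ((1 / t) powr (- e)) - (\<delta> + \<delta>' * of_real (ln (1 / t)))
       = J (1 / t) / of_real (t powr e) - (\<delta> + (- \<delta>') * of_real (ln t))"
      using eventually_at_right_less[of "0::real"]
      by eventually_elim (simp add: powr_minus_divide powr_divide ln_div)
    ultimately show ?thesis by (rule Lim_transform_eventually)
  qed
  have "((\<lambda>T. of_real (T powr e) * (\<integral>v. J (1 / ((1 / v) / T)) * k v \<partial>lborel)
      - (\<delta> - (- \<delta>') * of_real (ln T)) * (\<integral>v. k v * of_real ((1 / v) powr e) \<partial>lborel))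
    \<longlongrightarrow> (- \<delta>') * (\<integral>v. k v * of_real ((1 / v) powr e * ln (1 / v)) \<partial>lborel)) at_top"
  proof (rule abelian[where f = "\<lambda>t. J (1 / t)" and h = "\<lambda>v. 1 / v" and \<tau> = \<tau> and B = B])
    show "integrable lborel (\<lambda>v. norm (k v) * (1 / v) powr (e - \<tau>))"
      "integrable lborel (\<lambda>v. norm (k v) * (1 / v) powr (e + \<tau>))"
      unfolding nk by (rule Gamma_kernel(1); rule \<tau>)+
  qed (use e \<tau> bdd lim' in \<open>auto simp: k_def\<close>)
  also have "(\<integral>v. k v * of_real ((1 / v) powr e) \<partial>lborel) = of_real (Gamma (1 - e))"
  proof -
    have "(\<integral>v. k v * of_real ((1 / v) powr e) \<partial>lborel) = (\<integral>v. of_real ((if v > 0 then exp (- v) else 0) * (1 / v) powr e) \<partial>lborel)"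
      by (intro Bochner_Integration.integral_cong) (auto simp: k_def)
    also have "\<dots> = of_real (Gamma (1 - e))"
      unfolding integral_complex_of_real by (simp only: Gamma_kernel(2)[OF e(2)])
    finally show ?thesis .
  qed
  finally have "((\<lambda>T. of_real (T powr e) * (\<integral>v. J (v * T) * k v \<partial>lborel)
      - (\<delta> + \<delta>' * of_real (ln T)) * of_real (Gamma (1 - e)))
    \<longlongrightarrow> \<delta>' * - (\<integral>v. k v * of_real ((1 / v) powr e * ln (1 / v)) \<partial>lborel)) at_top"
    by simp
  then show ?thesis unfolding k_def by blast
qed

text \<open>Integrability depends only on the norm of the kernel; \<open>k\<close> is so constrained
  in order to cover \<open>osc_kernel\<close> and its conjugate together.\<close>

lemma abelian_sublevel:
  fixes I :: "real \<Rightarrow> real" and k :: "real \<Rightarrow> complex"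
  assumes e: "0 < e" "e < 1" and bdd: "\<And>l. \<bar>I l\<bar> \<le> B" and [measurable]: "I \<in> borel_measurable borel"
    and lim: "((\<lambda>t. I t / t powr e - (c + c' * ln t)) \<longlongrightarrow> 0) (at_right 0)"
    and k: "\<And>v. norm (k v) = norm (osc_kernel v)" and [measurable]: "k \<in> borel_measurable borel"
  shows "\<exists>X. ((\<lambda>T. of_real (T powr e) * (\<integral>v. of_real (I (sqrt v / T)) * k v \<partial>lborel)
      - (of_real c - of_real c' * of_real (ln T)) * (\<integral>v. k v * of_real (sqrt v powr e) \<partial>lborel)) \<longlongrightarrow> of_real c' * X) at_top"
proof -
  define \<tau> where "\<tau> = (1 - e) / 2"
  have \<tau>: "\<tau> > 0" "-1 < e - \<tau>" "e - \<tau> < 1" "-1 < e + \<tau>" "e + \<tau> < 1" using e by (simp_all add: \<tau>_def field_simps)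
  have lim': "((\<lambda>t. complex_of_real (I t) / of_real (t powr e) - (of_real c + of_real c' * of_real (ln t))) \<longlongrightarrow> 0) (at_right 0)"
    using tendsto_of_real[OF lim, where ?'a = complex] by simp
  have k0: "k v = 0" if "v \<le> 0" for v
    using k[of v] that by (simp add: osc_kernel_def)
  show ?thesis
    by (rule exI, rule abelian[where f = "\<lambda>t. of_real (I t)" and h = sqrt and \<tau> = \<tau> and B = B])
      (use e \<tau> bdd lim' osc_kernel_integrable k k0 in \<open>auto simp del: of_real_divide\<close>)
qed

text \<open>After multiplication by T to the power e the identity says that P + Q ln T converges.
  Hence Q = 0, the relation of the logarithmic coefficients. If the sublevel expansions have no
  logarithm, neither has J, the unknown constants vanish and P = 0 gives the other relation.\<close>

lemma osc_sublevel_comparison: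
  fixes S \<phi> :: "'a :: euclidean_space \<Rightarrow> real" and \<delta> \<delta>' :: complex
  defines "J \<equiv> \<lambda>l. \<integral>p. exp (\<i> * of_real (l * S p)) * of_real (\<phi> p) \<partial>lborel"
    and "Ipos \<equiv> \<lambda>t. \<integral>p. (if 0 < S p \<and> S p < t then \<phi> p else 0) \<partial>lborel"
    and "Ineg \<equiv> \<lambda>t. \<integral>p. (if 0 < - S p \<and> - S p < t then \<phi> p else 0) \<partial>lborel"
  assumes e: "0 < e" "e < 1" and Sm [measurable]: "S \<in> borel_measurable borel" and \<phi>: "integrable lborel \<phi>"
    and null: "AE p in lborel. \<phi> p \<noteq> 0 \<longrightarrow> S p \<noteq> 0"
    and limJ: "((\<lambda>l. J l / of_real (l powr (- e)) - (\<delta> + \<delta>' * of_real (ln l))) \<longlongrightarrow> 0) at_top"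
    and limp: "((\<lambda>t. Ipos t / t powr e - (c + c' * ln t)) \<longlongrightarrow> 0) (at_right 0)"
    and limm: "((\<lambda>t. Ineg t / t powr e - (C + C' * ln t)) \<longlongrightarrow> 0) (at_right 0)"
  shows "\<delta>' = - of_real (e * Gamma e) * (exp (\<i> * of_real (pi * e / 2)) * of_real c' + exp (- \<i> * of_real (pi * e / 2)) * of_real C')"
    and "c' = 0 \<Longrightarrow> C' = 0 \<Longrightarrow>
      \<delta> = of_real (e * Gamma e) * (exp (\<i> * of_real (pi * e / 2)) * of_real c + exp (- \<i> * of_real (pi * e / 2)) * of_real C)"
proof -
  have \<phi>m [measurable]: "\<phi> \<in> borel_measurable borel" using borel_measurable_integrable[OF \<phi>] by simp
  define B where "B = (\<integral>p. \<bar>\<phi> p\<bar> \<partial>lborel)"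
  have i\<phi>: "integrable lborel (\<lambda>p. \<bar>\<phi> p\<bar>)" using \<phi> by simp
  have bJ: "norm (J l) \<le> B" for l
    unfolding J_def B_def
    by (rule order_trans[OF integral_norm_bound]) (simp add: norm_mult)
  have bI: "\<bar>\<integral>p. (if P p then \<phi> p else 0) \<partial>lborel\<bar> \<le> B" for P
  proof (cases "integrable lborel (\<lambda>p. if P p then \<phi> p else 0)")
    case True
    have "\<bar>\<integral>p. (if P p then \<phi> p else 0) \<partial>lborel\<bar> \<le> (\<integral>p. \<bar>if P p then \<phi> p else 0\<bar> \<partial>lborel)"
      by (rule integral_abs_bound)
    also have "\<dots> \<le> B" unfolding B_def
      by (rule integral_mono) (use True i\<phi> in auto)
    finally show ?thesis .
  qed (simp add: not_integrable_integral_eq B_def)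
  have [measurable]: "J \<in> borel_measurable borel" "Ipos \<in> borel_measurable borel" "Ineg \<in> borel_measurable borel"
    unfolding J_def Ipos_def Ineg_def by measurable
  obtain X1 where X1: "((\<lambda>T. of_real (T powr e) * (\<integral>v. J (v * T) * (if v > 0 then of_real (exp (- v)) else 0) \<partial>lborel)
      - (\<delta> + \<delta>' * of_real (ln T)) * of_real (Gamma (1 - e))) \<longlongrightarrow> \<delta>' * X1) at_top"
    using abelian_osc[OF e bJ _ limJ] by auto
  define M where "M = (\<integral>v. osc_kernel v * of_real (sqrt v powr e) \<partial>lborel)"
  have cM: "(\<integral>v. cnj (osc_kernel v) * of_real (sqrt v powr e) \<partial>lborel) = cnj M"
    unfolding M_def Bochner_Integration.integral_cnj[symmetric] by simp
  obtain X2 where X2: "((\<lambda>T. of_real (T powr e) * (\<integral>v. of_real (Ipos (sqrt v / T)) * osc_kernel v \<partial>lborel)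
      - (of_real c - of_real c' * of_real (ln T)) * M) \<longlongrightarrow> of_real c' * X2) at_top"
    using abelian_sublevel[OF e _ _ limp, of B osc_kernel] bI by (auto simp: Ipos_def M_def)
  have cm: "(\<lambda>v. cnj (osc_kernel v)) \<in> borel_measurable borel"
    by (rule measurable_compose[OF osc_kernel_measurable])
      (intro borel_measurable_continuous_onI continuous_intros)
  obtain X3 where X3: "((\<lambda>T. of_real (T powr e) * (\<integral>v. of_real (Ineg (sqrt v / T)) * cnj (osc_kernel v) \<partial>lborel)
      - (of_real C - of_real C' * of_real (ln T)) * cnj M) \<longlongrightarrow> of_real C' * X3) at_top"
    using abelian_sublevel[OF e _ _ limm, of B "\<lambda>v. cnj (osc_kernel v)"] bI cm unfolding cM by (auto simp: Ineg_def)
  define P where "P = \<delta> * of_real (Gamma (1 - e)) - (of_real c * M + of_real C * cnj M)"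
  define Q where "Q = \<delta>' * of_real (Gamma (1 - e)) + (of_real c' * M + of_real C' * cnj M)"
  have PQ: "((\<lambda>T. P + Q * of_real (ln T)) \<longlongrightarrow> (of_real c' * X2 + of_real C' * X3) - \<delta>' * X1) at_top"
  proof (rule Lim_transform_eventually[OF tendsto_diff[OF tendsto_add[OF X2 X3] X1]])
    show "\<forall>\<^sub>F T in at_top. (of_real (T powr e) * (\<integral>v. of_real (Ipos (sqrt v / T)) * osc_kernel v \<partial>lborel)
      - (of_real c - of_real c' * of_real (ln T)) * M) +
      (of_real (T powr e) * (\<integral>v. of_real (Ineg (sqrt v / T)) * cnj (osc_kernel v) \<partial>lborel)
      - (of_real C - of_real C' * of_real (ln T)) * cnj M) -
      (of_real (T powr e) * (\<integral>v. J (v * T) * (if v > 0 then of_real (exp (- v)) else 0) \<partial>lborel)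
      - (\<delta> + \<delta>' * of_real (ln T)) * of_real (Gamma (1 - e))) = P + Q * of_real (ln T)"
      using eventually_gt_at_top[of 0]
    proof eventually_elim
      case (elim T)
      have "(\<integral>v. J (v * T) * (if v > 0 then of_real (exp (- v)) else 0) \<partial>lborel)
        = (\<integral>v. of_real (Ipos (sqrt v / T)) * osc_kernel v \<partial>lborel) + (\<integral>v. of_real (Ineg (sqrt v / T)) * cnj (osc_kernel v) \<partial>lborel)"
        unfolding J_def Ipos_def Ineg_def by (rule laplace_identity[OF Sm \<phi> elim null])
      then show ?case by (simp only: P_def Q_def) (simp add: algebra_simps)
    qed
  qed
  \<comment> \<open>Division by ln T sends a convergent quantity to 0 and P + Q ln T to Q.\<close>
  have "((\<lambda>T. (P + Q * of_real (ln T)) * of_real (1 / ln T)) \<longlongrightarrow> ((of_real c' * X2 + of_real C' * X3) - \<delta>' * X1) * of_real 0) at_top"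
    by (rule tendsto_mult[OF PQ tendsto_of_real]) real_asymp
  moreover have "((\<lambda>T. (P + Q * of_real (ln T)) * of_real (1 / ln T)) \<longlongrightarrow> P * of_real 0 + Q) at_top"
  proof (rule Lim_transform_eventually)
    show "((\<lambda>T. P * of_real (1 / ln T) + Q) \<longlongrightarrow> P * of_real 0 + Q) at_top"
      by (intro tendsto_intros) real_asymp
    show "\<forall>\<^sub>F T in at_top. P * of_real (1 / ln T) + Q = (P + Q * of_real (ln T)) * of_real (1 / ln T)"
      using eventually_gt_at_top[of 1] by eventually_elim (simp add: field_simps)
  qed
  ultimately have Q0: "Q = 0" using tendsto_unique[OF trivial_limit_at_top_linorder] by fastforce
  have Gp: "Gamma (1 - e) > 0" using e by simp
  have M: "M = of_real (e * Gamma e) * of_real (Gamma (1 - e)) * exp (\<i> * of_real (pi * e / 2))"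
    unfolding M_def osc_kernel_moment[OF e] by simp
  have cM': "cnj M = of_real (e * Gamma e) * of_real (Gamma (1 - e)) * exp (- \<i> * of_real (pi * e / 2))"
    unfolding M by (simp add: exp_cnj)
  define g where "g = complex_of_real (Gamma (1 - e))"
  have g0: "g \<noteq> 0" using Gp by (simp add: g_def)
  have "g * \<delta>' = g * (- of_real (e * Gamma e) * (exp (\<i> * of_real (pi * e / 2)) * of_real c' + exp (- \<i> * of_real (pi * e / 2)) * of_real C'))"
  proof -
    have "g * d = g * (- K * (E1 * c1 + E2 * c2))" if "d * g + (c1 * (K * g * E1) + c2 * (K * g * E2)) = 0"
      for d K E1 E2 c1 c2 :: complex using that by algebra
    then show ?thesis
      using Q0 unfolding Q_def cM' unfolding M unfolding g_def[symmetric] by blast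
  qed
  then show d': "\<delta>' = - of_real (e * Gamma e) * (exp (\<i> * of_real (pi * e / 2)) * of_real c' + exp (- \<i> * of_real (pi * e / 2)) * of_real C')"
    by (rule mult_left_cancel[OF g0, THEN iffD1])
  assume "c' = 0" "C' = 0"
  then have "\<delta>' = 0" using d' by simp
  then have "((\<lambda>T::real. P) \<longlongrightarrow> 0) at_top" using PQ Q0 \<open>c' = 0\<close> \<open>C' = 0\<close> by simp
  then have "P = 0" by (simp add: tendsto_const_iff)
  then have "g * \<delta> = g * (of_real (e * Gamma e) * (exp (\<i> * of_real (pi * e / 2)) * of_real c + exp (- \<i> * of_real (pi * e / 2)) * of_real C))"
    unfolding P_def cM' unfolding M unfolding g_def[symmetric] by (simp add: algebra_simps)
  then show "\<delta> = of_real (e * Gamma e) * (exp (\<i> * of_real (pi * e / 2)) * of_real c + exp (- \<i> * of_real (pi * e / 2)) * of_real C)"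
    by (rule mult_left_cancel[OF g0, THEN iffD1])
qed

section \<open>Taylor coefficients and test functions\<close>

lemma funpow_deriv_power_series:
  fixes c :: "nat \<Rightarrow> real"
  assumes "r > 0" and summ: "\<And>x. \<bar>x\<bar> < r \<Longrightarrow> summable (\<lambda>n. c n * x ^ n)"
    and f: "\<And>x. \<bar>x\<bar> < r \<Longrightarrow> f x = (\<Sum>n. c n * x ^ n)"
  shows "(deriv ^^ k) f 0 = fact k * c k"
proof -
  have s: "summable (\<lambda>n. (diffs ^^ k) c n * x ^ n)" if "\<bar>x\<bar> < r" for k x
    using that
  proof (induction k arbitrary: x)
    case (Suc k)
    then show ?case using termdiff_converges[of x r "(diffs ^^ k) c"] by simp
  qed (simp add: summ)
  have "(deriv ^^ k) f x = (\<Sum>n. (diffs ^^ k) c n * x ^ n)" if "\<bar>x\<bar> < r" for x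
    using that
  proof (induction k arbitrary: x)
    case (Suc k)
    obtain q where q: "\<bar>x\<bar> < q" "q < r" using dense[OF Suc.prems] by blast
    have "((\<lambda>x. \<Sum>n. (diffs ^^ k) c n * x ^ n) has_real_derivative (\<Sum>n. diffs ((diffs ^^ k) c) n * x ^ n)) (at x)"
      by (rule termdiffs_strong[of _ q]) (use q s[of q k] in auto)
    then have "((deriv ^^ k) f has_real_derivative (\<Sum>n. diffs ((diffs ^^ k) c) n * x ^ n)) (at x)"
      by (rule has_field_derivative_transform_within_open[of _ _ _ "{-r<..<r}"])
        (use Suc in \<open>auto simp: abs_less_iff\<close>)
    then show ?case by (simp add: DERIV_imp_deriv)
  qed (simp add: f)
  from this[of 0] have "(deriv ^^ k) f 0 = (\<Sum>n. (diffs ^^ k) c n * 0 ^ n)" using \<open>r > 0\<close> by simp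
  also have "\<dots> = (diffs ^^ k) c 0" by (rule powser_zero)
  also have "\<dots> = fact k * c k" by (simp add: coeff_funpow_diffs)
  finally show ?thesis .
qed

text \<open>The derivatives in y are taken first, for every small x; by
  \<open>double_power_series\<close> the result is again a power series in x, so the one-variable
  formula applies twice.\<close>

lemma taylor_coeff_series2:
  fixes s :: "nat \<Rightarrow> nat \<Rightarrow> real"
  assumes "\<rho> > 0" and summ: "(\<lambda>(a, b). \<bar>s a b\<bar> * \<rho> ^ a * \<rho> ^ b) summable_on UNIV"
    and S: "\<And>x y. \<bar>x\<bar> \<le> \<rho> \<Longrightarrow> \<bar>y\<bar> \<le> \<rho> \<Longrightarrow> S (x, y) = series2 s x y"
  shows "taylor_coeff S a b = s a b"
proof -
  define A where "A x b = (\<Sum>\<^sub>\<infinity>a. s a b * x ^ a)" for x b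
  have sx: "(\<lambda>(a, b). \<bar>s a b * x ^ a\<bar> * \<rho> ^ b) summable_on UNIV" if "\<bar>x\<bar> \<le> \<rho>" for x
    by (rule summable_on_comparison_test[OF summ])
      (use that \<open>\<rho> > 0\<close> in \<open>auto simp: abs_mult power_abs intro!: mult_right_mono mult_left_mono power_mono\<close>)
  have inner: "(deriv ^^ b) (\<lambda>y. S (x, y)) 0 = fact b * A x b" if x: "\<bar>x\<bar> \<le> \<rho>" for x b
  proof (rule funpow_deriv_power_series[OF \<open>\<rho> > 0\<close>])
    fix y :: real assume y: "\<bar>y\<bar> < \<rho>"
    have "summable (\<lambda>b. \<bar>A x b\<bar> * \<rho> ^ b)"
      unfolding A_def by (rule double_power_series(1)[OF sx[OF x] \<open>\<rho> > 0\<close>])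
    then have "summable (\<lambda>b. \<bar>A x b * y ^ b\<bar>)"
      by (rule summable_comparison_test'[where N = 0])
        (use y in \<open>auto simp: abs_mult power_abs intro!: mult_left_mono power_mono\<close>)
    then show "summable (\<lambda>b. A x b * y ^ b)" by (rule summable_rabs_cancel)
    have "((\<lambda>(a, b). s a b * x ^ a * y ^ b) has_sum (\<Sum>b. A x b * y ^ b)) UNIV"
      unfolding A_def by (rule double_power_series(3)[OF sx[OF x] \<open>\<rho> > 0\<close>]) (use y in simp)
    then show "S (x, y) = (\<Sum>b. A x b * y ^ b)"
      using S[of x y] x y by (simp add: series2_def infsumI)
  qed
  have "(deriv ^^ a) (\<lambda>x. (deriv ^^ b) (\<lambda>y. S (x, y)) 0) 0 = fact a * (fact b * s a b)"
  proof (rule funpow_deriv_power_series[OF \<open>\<rho> > 0\<close>])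
    fix x :: real assume x: "\<bar>x\<bar> < \<rho>"
    have "(\<lambda>a. s a b * x ^ a) summable_on UNIV"
      by (rule double_power_series(4)[OF sx \<open>\<rho> > 0\<close>]) (use x in simp)
    then have "((\<lambda>a. s a b * x ^ a) has_sum A x b) UNIV" unfolding A_def by (rule has_sum_infsum)
    then have "(\<lambda>a. s a b * x ^ a) sums A x b" by (rule has_sum_imp_sums)
    then have sm: "(\<lambda>a. fact b * (s a b * x ^ a)) sums (fact b * A x b)" by (rule sums_mult)
    show "summable (\<lambda>a. fact b * s a b * x ^ a)" using sums_summable[OF sm] by (simp add: mult.assoc)
    show "(deriv ^^ b) (\<lambda>y. S (x, y)) 0 = (\<Sum>a. fact b * s a b * x ^ a)"
      using inner[of x b] x sums_unique[OF sm] by (simp add: mult.assoc)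
  qed
  then show ?thesis by (simp add: taylor_coeff_def)
qed

lemma real_analytic_series2:
  assumes "real_analytic_on S U" "(0, 0) \<in> U"
  obtains s \<rho> where "\<rho> > 0" "(\<lambda>(a, b). \<bar>s a b\<bar> * \<rho> ^ a * \<rho> ^ b) summable_on UNIV"
    "\<And>x y. \<bar>x\<bar> \<le> \<rho> \<Longrightarrow> \<bar>y\<bar> \<le> \<rho> \<Longrightarrow> S (x, y) = series2 s x y"
    "\<And>a b. taylor_coeff S a b = s a b"
proof -
  obtain s r where r: "r > 0" and hs: "\<forall>h k. \<bar>h\<bar> < r \<and> \<bar>k\<bar> < r \<longrightarrow>
      ((\<lambda>(m, n). s m n * h ^ m * k ^ n) has_sum S ((0, 0) + (h, k))) UNIV"
    using bspec[OF assms(1)[unfolded real_analytic_on_def] assms(2)] by blast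
  \<comment> \<open>The corner (\<rho>, \<rho>) then lies inside the square of convergence; real
    summability there is absolute and dominates the whole closed square.\<close>
  define \<rho> where "\<rho> = r / 2"
  have \<rho>: "\<rho> > 0" "\<rho> < r" using r by (simp_all add: \<rho>_def)
  have "(\<lambda>(m, n). s m n * \<rho> ^ m * \<rho> ^ n) summable_on UNIV"
    using hs[rule_format, of \<rho> \<rho>] \<rho> by (auto simp: summable_on_def)
  then have "(\<lambda>p. norm ((\<lambda>(m, n). s m n * \<rho> ^ m * \<rho> ^ n) p)) summable_on UNIV"
    by (rule summable_on_iff_abs_summable_on_real[THEN iffD1])
  moreover have "(\<lambda>p. norm ((\<lambda>(m, n). s m n * \<rho> ^ m * \<rho> ^ n) p)) = (\<lambda>(a, b). \<bar>s a b\<bar> * \<rho> ^ a * \<rho> ^ b)"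
    using \<rho> by (auto simp: abs_mult)
  ultimately have summ: "(\<lambda>(a, b). \<bar>s a b\<bar> * \<rho> ^ a * \<rho> ^ b) summable_on UNIV" by (simp only:)
  have S: "S (x, y) = series2 s x y" if "\<bar>x\<bar> \<le> \<rho>" "\<bar>y\<bar> \<le> \<rho>" for x y
    using hs[rule_format, of x y] that \<rho> by (simp add: series2_def infsumI)
  show thesis by (rule that[OF \<rho>(1) summ S taylor_coeff_series2[OF \<rho>(1) summ S]])
qed

section \<open>Calculus of test functions\<close>

lemma Ck_frechet: "Ck (Suc k) f \<Longrightarrow> Ck k (\<lambda>p. frechet_derivative f (at p) v)"
  by (simp only: Ck.simps)

text \<open>Needed for products: the derivative of f g contains undifferentiated factors, which must
  be available at the lower order.\<close>

lemma Ck_Suc_imp_Ck: "Ck (Suc k) f \<Longrightarrow> Ck k f"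
proof (induction k arbitrary: f)
  case 0
  then show ?case by (simp add: differentiable_imp_continuous_on)
next
  case (Suc k)
  then have "Ck k (\<lambda>p. frechet_derivative f (at p) v)" for v
    by (intro Suc.IH Ck_frechet)
  then show ?case using Suc.prems by simp
qed

lemma has_derivative_frechet:
  assumes "f differentiable_on UNIV"
  shows "(f has_derivative frechet_derivative f (at p)) (at p)"
  using assms frechet_derivative_works by (auto simp: differentiable_on_def)

lemma Ck_add: "Ck k f \<Longrightarrow> Ck k g \<Longrightarrow> Ck k (\<lambda>p. f p + g p)"
proof (induction k arbitrary: f g)
  case (Suc k)
  have d: "f differentiable_on UNIV" "g differentiable_on UNIV" using Suc.prems by simp_all
  have h: "((\<lambda>p. f p + g p) has_derivative (\<lambda>v. frechet_derivative f (at p) v + frechet_derivative g (at p) v)) (at p)" for p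
    by (intro has_derivative_add has_derivative_frechet d)
  then have "(\<lambda>p. f p + g p) differentiable_on UNIV"
    unfolding differentiable_on_def differentiable_def by fastforce
  moreover have "Ck k (\<lambda>p. frechet_derivative (\<lambda>p. f p + g p) (at p) v)" for v
    unfolding frechet_derivative_at[OF h, symmetric] by (intro Suc.IH Ck_frechet Suc.prems)
  ultimately show ?case by simp
qed (auto intro: continuous_intros)

lemma Ck_mult: "Ck k f \<Longrightarrow> Ck k g \<Longrightarrow> Ck k (\<lambda>p. f p * g p)"
proof (induction k arbitrary: f g)
  case (Suc k)
  have d: "f differentiable_on UNIV" "g differentiable_on UNIV" using Suc.prems by simp_all
  have h: "((\<lambda>p. f p * g p) has_derivative (\<lambda>v. f p * frechet_derivative g (at p) v + frechet_derivative f (at p) v * g p)) (at p)" for p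
    by (intro has_derivative_mult has_derivative_frechet d)
  then have "(\<lambda>p. f p * g p) differentiable_on UNIV"
    unfolding differentiable_on_def differentiable_def by fastforce
  moreover have "Ck k (\<lambda>p. frechet_derivative (\<lambda>p. f p * g p) (at p) v)" for v
    unfolding frechet_derivative_at[OF h, symmetric]
    by (intro Ck_add Suc.IH Ck_frechet Suc.prems Ck_Suc_imp_Ck[OF Suc.prems(1)] Ck_Suc_imp_Ck[OF Suc.prems(2)])
  ultimately show ?case by simp
qed (auto intro: continuous_intros)

lemma Ck_const: "Ck k (\<lambda>_. c)"
proof (induction k arbitrary: c)
  case (Suc k)
  have "((\<lambda>_. c) has_derivative (\<lambda>_. 0)) (at p)" for p :: "real \<times> real" by simp
  then have "frechet_derivative (\<lambda>_. c) (at p) = (\<lambda>_. 0)" for p :: "real \<times> real"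
    by (metis frechet_derivative_at)
  then show ?case using Suc by simp
qed simp

lemma Ck_affine: "Ck k f \<Longrightarrow> Ck k (\<lambda>p. f (a + m *\<^sub>R p))"
proof (induction k arbitrary: f)
  case 0
  then show ?case by (auto intro!: continuous_on_compose2[of UNIV f] continuous_intros)
next
  case (Suc k)
  have d: "f differentiable_on UNIV" using Suc.prems by simp
  have h: "((\<lambda>p. f (a + m *\<^sub>R p)) has_derivative (\<lambda>v. m * frechet_derivative f (at (a + m *\<^sub>R p)) v)) (at p)" for p
  proof -
    have "((\<lambda>p. a + m *\<^sub>R p) has_derivative (\<lambda>v. m *\<^sub>R v)) (at p)"
      by (auto intro!: derivative_eq_intros)
    from has_derivative_compose[OF this has_derivative_frechet[OF d]]
    have "((\<lambda>p. f (a + m *\<^sub>R p)) has_derivative (\<lambda>v. frechet_derivative f (at (a + m *\<^sub>R p)) (m *\<^sub>R v))) (at p)" .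
    moreover have "linear (frechet_derivative f (at (a + m *\<^sub>R p)))"
      using has_derivative_frechet[OF d] has_derivative_linear by blast
    ultimately show ?thesis by (simp add: linear_scale)
  qed
  then have "(\<lambda>p. f (a + m *\<^sub>R p)) differentiable_on UNIV"
    unfolding differentiable_on_def differentiable_def by fastforce
  moreover have "Ck k (\<lambda>p. frechet_derivative (\<lambda>p. f (a + m *\<^sub>R p)) (at p) v)" for v
    unfolding frechet_derivative_at[OF h, symmetric]
    by (intro Ck_mult Ck_const Suc.IH[of "\<lambda>q. frechet_derivative f (at q) v"] Ck_frechet Suc.prems)
  ultimately show ?case by simp
qed

lemma test_functions_mono: "W \<subseteq> V \<Longrightarrow> test_functions W \<subseteq> test_functions V"
  by (auto simp: test_functions_def)

lemma test_function_props:
  assumes "\<phi> \<in> test_functions W"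
  shows test_function_continuous: "continuous_on UNIV \<phi>"
    and test_function_integrable: "integrable lborel \<phi>"
    and test_function_bounded: "\<exists>B\<ge>0. \<forall>p. \<bar>\<phi> p\<bar> \<le> B"
    and test_function_outside: "p \<notin> W \<Longrightarrow> \<phi> p = 0"
proof -
  define K where "K = closure {p. \<phi> p \<noteq> 0}"
  have K: "compact K" "K \<subseteq> W" "\<And>k. Ck k \<phi>" using assms by (auto simp: test_functions_def K_def)
  have out: "\<phi> p = 0" if "p \<notin> K" for p
    using that closure_subset[of "{p. \<phi> p \<noteq> 0}"] by (auto simp: K_def)
  show c: "continuous_on UNIV \<phi>" using K(3)[of 0] by simp
  have "(\<lambda>p. indicator K p *\<^sub>R \<phi> p) = \<phi>" using out by (auto simp: indicator_def fun_eq_iff)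
  moreover have "set_integrable lborel K \<phi>"
    by (rule borel_integrable_compact[OF K(1) continuous_on_subset[OF c subset_UNIV], folded set_integrable_def])
  ultimately show "integrable lborel \<phi>"
    unfolding set_integrable_def by (simp only:)
  have "bounded (\<phi> ` K)"
    by (intro compact_imp_bounded compact_continuous_image continuous_on_subset[OF c subset_UNIV] K(1))
  then obtain B where B: "\<And>p. p \<in> K \<Longrightarrow> \<bar>\<phi> p\<bar> \<le> B" by (auto simp: bounded_iff)
  show "\<exists>B\<ge>0. \<forall>p. \<bar>\<phi> p\<bar> \<le> B"
  proof (intro exI[of _ "max B 0"] conjI allI)
    fix p show "\<bar>\<phi> p\<bar> \<le> max B 0" using B[of p] out[of p] by (cases "p \<in> K") auto
  qed simp
  show "p \<notin> W \<Longrightarrow> \<phi> p = 0" using out K(2) by blast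
qed

text \<open>Squaring and rescaling a given test function avoids constructing a bump function.\<close>

lemma ex_nonneg_test_function:
  assumes "\<phi> \<in> test_functions V" "\<phi> p0 \<noteq> 0" "open W" "(0, 0) \<in> W"
  obtains \<psi> where "\<psi> \<in> test_functions W" "\<And>p. \<psi> p \<ge> 0" "\<psi> (0, 0) > 0"
proof -
  define K where "K = closure {p. \<phi> p \<noteq> 0}"
  have K: "compact K" "\<And>k. Ck k \<phi>" using assms(1) by (auto simp: test_functions_def K_def)
  obtain \<epsilon> where \<epsilon>: "\<epsilon> > 0" "ball (0, 0) \<epsilon> \<subseteq> W" using assms(3,4) by (auto simp: open_contains_ball)
  obtain R where R: "R > 0" "\<And>p. p \<in> K \<Longrightarrow> norm p \<le> R"
    using compact_imp_bounded[OF K(1)] by (auto simp: bounded_pos)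
  \<comment> \<open>Every point of the support is within R + norm p0 of p0, so contraction by m
    towards the origin brings it into the ball; the 1 makes the inequality strict.\<close>
  define m where "m = (R + norm p0) / \<epsilon> + 1"
  have m: "m > 0" using R(1) \<epsilon>(1) by (simp add: m_def add_nonneg_pos)
  define \<psi> where "\<psi> p = \<phi> (p0 + m *\<^sub>R p) * \<phi> (p0 + m *\<^sub>R p)" for p
  define K' where "K' = (\<lambda>q. (1 / m) *\<^sub>R (q - p0)) ` K"
  have K': "compact K'" unfolding K'_def
    by (intro compact_continuous_image continuous_intros K(1))
  have sub: "{p. \<psi> p \<noteq> 0} \<subseteq> K'"
  proof
    fix p assume "p \<in> {p. \<psi> p \<noteq> 0}"
    then have "p0 + m *\<^sub>R p \<in> K" using closure_subset[of "{p. \<phi> p \<noteq> 0}"] by (auto simp: K_def \<psi>_def)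
    moreover have "p = (1 / m) *\<^sub>R ((p0 + m *\<^sub>R p) - p0)" using m by simp
    ultimately show "p \<in> K'" unfolding K'_def by blast
  qed
  then have cl: "closure {p. \<psi> p \<noteq> 0} \<subseteq> K'" by (rule closure_minimal[OF _ compact_imp_closed[OF K']])
  have "K' \<subseteq> W"
  proof
    fix p assume "p \<in> K'"
    then obtain q where q: "q \<in> K" "p = (1 / m) *\<^sub>R (q - p0)" by (auto simp: K'_def)
    have "norm (q - p0) \<le> R + norm p0" using norm_triangle_ineq4[of q p0] R(2)[OF q(1)] by linarith
    also have "\<dots> < \<epsilon> * m" using \<epsilon>(1) by (simp add: m_def field_simps)
    finally have "norm p < \<epsilon>" using m q(2) by (simp add: divide_less_eq mult.commute)
    then show "p \<in> W" using \<epsilon>(2) by (auto simp: dist_norm zero_prod_def[symmetric])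
  qed
  have "\<psi> \<in> test_functions W"
  proof -
    have "compact (closure {p. \<psi> p \<noteq> 0})"
    proof -
      have "closure {p. \<psi> p \<noteq> 0} = K' \<inter> closure {p. \<psi> p \<noteq> 0}" using cl by blast
      then show ?thesis using compact_Int_closed[OF K' closed_closure, of "{p. \<psi> p \<noteq> 0}"] by (simp only:)
    qed
    moreover have "Ck k \<psi>" for k unfolding \<psi>_def by (intro Ck_mult Ck_affine K(2))
    ultimately show ?thesis using cl \<open>K' \<subseteq> W\<close> by (auto simp: test_functions_def)
  qed
  moreover have "\<psi> p \<ge> 0" for p by (simp add: \<psi>_def)
  moreover have "\<psi> (0, 0) > 0" using assms(2) by (auto simp: \<psi>_def zero_prod_def[symmetric] zero_less_mult_iff linorder_neq_iff)
  ultimately show thesis by (rule that)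
qed

section \<open>Superadapted coordinates\<close>

text \<open>On a line with positive weights b determines a, so no two terms of the face polynomial
  collide.\<close>

lemma coeff_face_poly:
  assumes \<kappa>: "\<kappa>1 > 0" "\<kappa>2 > 0" and "\<kappa>1 * real a + \<kappa>2 * real b = 1"
  shows "coeff (face_poly s \<kappa>1 \<kappa>2) b = s a b"
proof -
  have "coeff (face_poly s \<kappa>1 \<kappa>2) b = (\<Sum>(a', b')\<in>{(a, b). \<kappa>1 * real a + \<kappa>2 * real b = 1}. if b' = b then s a' b' else 0)"
    by (simp add: face_poly_def coeff_sum case_prod_unfold)
  also have "\<dots> = (\<Sum>(a', b')\<in>{(a, b)}. if b' = b then s a' b' else 0)"
  proof (rule sum.mono_neutral_right[OF finite_face[OF \<kappa>]])
    show "{(a, b)} \<subseteq> {(a, b). \<kappa>1 * real a + \<kappa>2 * real b = 1}" using assms(3) by simp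
    show "\<forall>p\<in>{(a, b). \<kappa>1 * real a + \<kappa>2 * real b = 1} - {(a, b)}. (case p of (a', b') \<Rightarrow> if b' = b then s a' b' else 0) = 0"
    proof
      fix p assume p: "p \<in> {(a, b). \<kappa>1 * real a + \<kappa>2 * real b = 1} - {(a, b)}"
      obtain a' b' where ab: "p = (a', b')" by (cases p)
      have h: "\<kappa>1 * real a' + \<kappa>2 * real b' = 1" "(a', b') \<notin> {(a, b)}" using p by (auto simp: ab)
      have "b' \<noteq> b"
      proof
        assume "b' = b"
        then have "\<kappa>1 * real a' = \<kappa>1 * real a" using h(1) assms(3) unfolding \<open>b' = b\<close> by linarith
        then show False using \<kappa> h(2) \<open>b' = b\<close> by simp
      qed
      then show "(case p of (a', b') \<Rightarrow> if b' = b then s a' b' else 0) = 0" by (simp add: ab)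
    qed
  qed
  finally show ?thesis by simp
qed

lemma poly_higher_pderiv_0: "poly ((pderiv ^^ j) p) (0 :: real) = fact j * coeff p j"
proof (induction j arbitrary: p)
  case (Suc j)
  have "(pderiv ^^ Suc j) p = (pderiv ^^ j) (pderiv p)" by (simp add: funpow_swap1)
  then show ?case by (simp only: Suc.IH coeff_pderiv) (simp add: algebra_simps)
qed (simp add: poly_0_coeff_0)

text \<open>Translates the order of a zero, in which superadaptedness is phrased, into the
  nonvanishing derivative that \<open>polynomial_cover\<close> requires.\<close>

lemma order_nonvanishing_derivative:
  fixes p :: "real poly"
  assumes "p \<noteq> 0"
  shows "poly ((pderiv ^^ order z p) p) z \<noteq> 0"
  using assms
proof (induction "order z p" arbitrary: p)
  case 0
  then show ?case by (metis funpow_0 order_root)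
next
  case (Suc n)
  have "pderiv p \<noteq> 0"
  proof
    assume "pderiv p = 0"
    then obtain c where c: "p = [:c:]" using pderiv_eq_0_iff[of p] degree_eq_zeroE by blast
    then have "order z p = 0" using Suc.prems by (auto intro!: order_0I)
    then show False using Suc.hyps(2) by simp
  qed
  have o: "order z p = Suc (order z (pderiv p))"
    by (rule order_pderiv) (use Suc.hyps(2) Suc.prems in \<open>auto simp: order_root\<close>)
  then have "poly ((pderiv ^^ order z (pderiv p)) (pderiv p)) z \<noteq> 0"
    using Suc.hyps \<open>pderiv p \<noteq> 0\<close> by auto
  then show ?case unfolding o by (simp add: funpow_swap1)
qed

text \<open>An exposed vertex is alone on its line. The factor \<open>\<tau>\<close> stands for the
  signs created by reflecting one coordinate.\<close>

lemma face_poly_exposed: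
  assumes ex: "exposes {(a, b). s a b \<noteq> 0} \<kappa>1 \<kappa>2 a0 b0"
  shows "face_poly (\<lambda>a b. \<tau> a * s a b) \<kappa>1 \<kappa>2 = monom (\<tau> a0 * s a0 b0) b0"
    and "face_poly (\<lambda>b a. \<tau> b * s a b) \<kappa>2 \<kappa>1 = monom (\<tau> b0 * s a0 b0) a0"
proof -
  have \<kappa>: "\<kappa>1 > 0" "\<kappa>2 > 0" and face: "\<kappa>1 * real a0 + \<kappa>2 * real b0 = 1"
    and gt: "\<And>a b. s a b \<noteq> 0 \<Longrightarrow> (a, b) \<noteq> (a0, b0) \<Longrightarrow> 1 < \<kappa>1 * real a + \<kappa>2 * real b"
    using ex by (auto simp: exposes_def)
  have "face_poly (\<lambda>a b. \<tau> a * s a b) \<kappa>1 \<kappa>2 = (\<Sum>(a, b)\<in>{(a0, b0)}. monom (\<tau> a * s a b) b)"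
    unfolding face_poly_def
    by (rule sum.mono_neutral_right[OF finite_face[OF \<kappa>]]) (use face gt in force)+
  then show "face_poly (\<lambda>a b. \<tau> a * s a b) \<kappa>1 \<kappa>2 = monom (\<tau> a0 * s a0 b0) b0" by simp
  have "face_poly (\<lambda>b a. \<tau> b * s a b) \<kappa>2 \<kappa>1 = (\<Sum>(b, a)\<in>{(b0, a0)}. monom (\<tau> b * s a b) a)"
    unfolding face_poly_def
    by (rule sum.mono_neutral_right[OF finite_face[OF \<kappa>(2,1)]]) (use face gt in \<open>force simp: add.commute\<close>)+
  then show "face_poly (\<lambda>b a. \<tau> b * s a b) \<kappa>2 \<kappa>1 = monom (\<tau> b0 * s a0 b0) a0" by simp
qed

lemma higher_pderiv_monom_same:
  "(pderiv ^^ n) (monom c n) = monom (fact n * c :: real) 0"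
proof (induction n arbitrary: c)
  case (Suc n)
  have "(pderiv ^^ Suc n) (monom c (Suc n)) = (pderiv ^^ n) (monom (real (Suc n) * c) n)"
    by (simp add: funpow_swap1 pderiv_monom)
  then show ?case by (simp only: Suc) (simp add: algebra_simps)
qed simp

text \<open>The line may carry exponent pairs outside the polygon, but their Taylor coefficients are
  zero. Evaluating the edge at x = \<sigma> is the same as putting the powers of \<sigma> into the
  coefficients, which is how the half-plane x < 0 enters.\<close>

lemma edge_poly_eq_face_poly:
  assumes \<kappa>: "\<kappa>1 > 0" "\<kappa>2 > 0"
  shows "edge_poly S (newton_polygon S \<inter> {x. (\<kappa>1, \<kappa>2) \<bullet> x = 1}) \<sigma>
    = face_poly (\<lambda>a b. \<sigma> ^ a * taylor_coeff S a b) \<kappa>1 \<kappa>2"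
  unfolding edge_poly_def face_poly_def
proof (rule sum.mono_neutral_cong_left[OF finite_face[OF \<kappa>]])
  show "{(a, b). (real a, real b) \<in> newton_polygon S \<inter> {x. (\<kappa>1, \<kappa>2) \<bullet> x = 1}} \<subseteq> {(a, b). \<kappa>1 * real a + \<kappa>2 * real b = 1}"
    by (auto simp: inner_prod_def)
  show "\<forall>p\<in>{(a, b). \<kappa>1 * real a + \<kappa>2 * real b = 1} - {(a, b). (real a, real b) \<in> newton_polygon S \<inter> {x. (\<kappa>1, \<kappa>2) \<bullet> x = 1}}.
      (case p of (a, b) \<Rightarrow> monom (\<sigma> ^ a * taylor_coeff S a b) b) = 0"
  proof
    fix p assume p: "p \<in> {(a, b). \<kappa>1 * real a + \<kappa>2 * real b = 1} - {(a, b). (real a, real b) \<in> newton_polygon S \<inter> {x. (\<kappa>1, \<kappa>2) \<bullet> x = 1}}"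
    obtain a b where ab: "p = (a, b)" by (cases p)
    have h: "\<kappa>1 * real a + \<kappa>2 * real b = 1"
      "(a, b) \<notin> {(a, b). (real a, real b) \<in> newton_polygon S \<inter> {x. (\<kappa>1, \<kappa>2) \<bullet> x = 1}}"
      using p by (auto simp: ab)
    then have "(real a, real b) \<notin> newton_polygon S" by (simp add: inner_prod_def)
    then have "taylor_coeff S a b = 0"
      unfolding newton_polygon_def by (rule contrapos_np) (rule hull_inc, force)
    then show "(case p of (a, b) \<Rightarrow> monom (\<sigma> ^ a * taylor_coeff S a b) b) = 0" by (simp add: ab)
  qed
qed (auto simp: mult.commute)

lemma newton_polygon_eq: "newton_polygon S = convex hull (quadrants {(a, b). taylor_coeff S a b \<noteq> 0})"
  by (simp add: newton_polygon_def quadrants_def)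

lemma newton_distance_eq: "newton_distance S = diagonal_distance {(a, b). taylor_coeff S a b \<noteq> 0}"
  by (simp add: newton_distance_def diagonal_distance_def newton_polygon_eq)

text \<open>Phrased with a measurable cover because F is arbitrary; \<open>bd\<close> allows bounds
  with and without a logarithm.\<close>

definition sublevel_bound :: "(real \<Rightarrow> real \<Rightarrow> real) \<Rightarrow> real \<Rightarrow> (real \<Rightarrow> real) \<Rightarrow> bool" where
  "sublevel_bound F r bd \<longleftrightarrow> (\<exists>C\<ge>0. \<forall>\<epsilon>>0. \<exists>N\<in>sets lborel.
      {(x, y). \<bar>x\<bar> < r \<and> \<bar>y\<bar> < r \<and> \<bar>F x y\<bar> < \<epsilon>} \<subseteq> N \<and> emeasure lborel N \<le> ennreal (C * bd \<epsilon>))"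

text \<open>The face polynomial is a monomial in both coordinate orders, and its derivative of order
  b0, respectively a0, is a nonzero constant. So K need only be at least both exponents.\<close>

lemma sublevel_bound_exposed:
  fixes s :: "nat \<Rightarrow> nat \<Rightarrow> real"
  assumes "\<rho> > 0" and summ: "(\<lambda>(a, b). \<bar>s a b\<bar> * \<rho> ^ a * \<rho> ^ b) summable_on UNIV"
    and ex: "exposes {(a, b). s a b \<noteq> 0} \<kappa>1 \<kappa>2 a0 b0" and "a0 \<le> K" "b0 \<le> K" "K \<ge> 1"
    and strip: "\<And>x0. 0 < x0 \<Longrightarrow> \<exists>C\<ge>0. \<forall>\<epsilon>>0. strip_integral \<kappa>1 \<kappa>2 K x0 \<epsilon> \<le> ennreal (C * bd \<epsilon>)"
    and strip': "\<And>x0. 0 < x0 \<Longrightarrow> \<exists>C\<ge>0. \<forall>\<epsilon>>0. strip_integral \<kappa>2 \<kappa>1 K x0 \<epsilon> \<le> ennreal (C * bd \<epsilon>)"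
    and bd: "\<And>\<epsilon>. \<epsilon> > 0 \<Longrightarrow> bd \<epsilon> \<ge> 0"
  shows "\<exists>r>0. r \<le> \<rho> \<and> sublevel_bound (series2 s) r bd"
proof -
  have \<kappa>: "\<kappa>1 > 0" "\<kappa>2 > 0" and s0: "s a0 b0 \<noteq> 0" and face: "\<kappa>1 * real a0 + \<kappa>2 * real b0 = 1"
    and gt: "\<And>a b. s a b \<noteq> 0 \<Longrightarrow> (a, b) \<noteq> (a0, b0) \<Longrightarrow> 1 < \<kappa>1 * real a + \<kappa>2 * real b"
    using ex by (auto simp: exposes_def)
  have nz: "poly ((pderiv ^^ n) (monom c n)) z \<noteq> 0" if "c \<noteq> 0" for c z :: real and n
    using that by (simp add: higher_pderiv_monom_same poly_monom)
  have "\<exists>C\<ge>0. \<exists>r>0. r \<le> \<rho> \<and> (\<forall>\<epsilon>>0. \<exists>N\<in>sets lborel.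
      {(x, y). \<bar>x\<bar> < r \<and> \<bar>y\<bar> < r \<and> \<bar>series2 s x y\<bar> < \<epsilon>} \<subseteq> N \<and> emeasure lborel N \<le> ennreal (C * bd \<epsilon>))"
  proof (rule sublevel_area[OF \<open>\<rho> > 0\<close> summ \<kappa> _ \<open>K \<ge> 1\<close> _ _ strip strip' bd])
    show "1 \<le> \<kappa>1 * real a + \<kappa>2 * real b" if "s a b \<noteq> 0" for a b
      using gt[OF that] face by (cases "(a, b) = (a0, b0)") auto
    show "\<exists>j\<le>K. poly ((pderiv ^^ j) (face_poly (\<lambda>a b. \<sigma> ^ a * s a b) \<kappa>1 \<kappa>2)) z \<noteq> 0" if "\<sigma> \<in> {1, -1}" for \<sigma> z
      unfolding face_poly_exposed(1)[OF ex] using nz[of "\<sigma> ^ a0 * s a0 b0" b0 z] s0 that \<open>b0 \<le> K\<close> by auto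
    show "\<exists>j\<le>K. poly ((pderiv ^^ j) (face_poly (\<lambda>b a. \<sigma> ^ b * s a b) \<kappa>2 \<kappa>1)) 0 \<noteq> 0" if "\<sigma> \<in> {1, -1}" for \<sigma>
      unfolding face_poly_exposed(2)[OF ex] using nz[of "\<sigma> ^ b0 * s a0 b0" a0 0] s0 that \<open>a0 \<le> K\<close> by auto
  qed
  then show ?thesis unfolding sublevel_bound_def by blast
qed

text \<open>All relevant orders are below d: for z nonzero by superadaptedness, at z = 0 because a
  point of the edge has b2 < d, and at infinity, which is 0 after exchanging coordinates, because
  another point has a1 < d.\<close>

lemma sublevel_bound_edge:
  assumes "\<rho> > 0" and summ: "(\<lambda>(a, b). \<bar>taylor_coeff S a b\<bar> * \<rho> ^ a * \<rho> ^ b) summable_on UNIV"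
    and sup: "superadapted S" and d: "d = newton_distance S" "d > 1"
    and \<kappa>: "\<kappa>1 > 0" "\<kappa>2 > 0" "\<kappa>1 + \<kappa>2 = 1 / d"
    and supp: "\<And>a b. taylor_coeff S a b \<noteq> 0 \<Longrightarrow> 1 \<le> \<kappa>1 * real a + \<kappa>2 * real b"
    and p1: "taylor_coeff S a1 b1 \<noteq> 0" "\<kappa>1 * real a1 + \<kappa>2 * real b1 = 1" "real a1 < d"
    and p2: "taylor_coeff S a2 b2 \<noteq> 0" "\<kappa>1 * real a2 + \<kappa>2 * real b2 = 1" "real b2 < d"
  shows "\<exists>r>0. r \<le> \<rho> \<and> sublevel_bound (series2 (taylor_coeff S)) r (\<lambda>\<epsilon>. \<epsilon> powr (1 / d))"
proof -
  let ?s = "taylor_coeff S" and ?A = "{(a, b). taylor_coeff S a b \<noteq> 0}"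
  \<comment> \<open>The largest integer strictly below d, hence d - 1 for integral d; strictness
    yields 1/d < 1/K as in \<open>strip_integral_critical\<close>.\<close>
  define K where "K = nat \<lceil>d\<rceil> - 1"
  have K: "K \<ge> 1" "real K < d" using d(2) unfolding K_def by linarith+
  have leK: "n \<le> K" if "real n < d" for n using that unfolding K_def by linarith
  have dk: "\<kappa>1 * d + \<kappa>2 * d = 1" using \<kappa>(3) d(2) by (simp add: distrib_right[symmetric])
  have ne: "(a1, b1) \<noteq> (a2, b2)"
  proof
    assume "(a1, b1) = (a2, b2)"
    then have "\<kappa>1 * real a1 < \<kappa>1 * d" "\<kappa>2 * real b1 < \<kappa>2 * d" using p1(3) p2(3) \<kappa> by simp_all
    then show False using p1(2) dk by linarith
  qed
  have A: "?A \<noteq> {}" "(a1, b1) \<in> ?A" "(a2, b2) \<in> ?A" using p1(1) p2(1) by auto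
  let ?e = "newton_polygon S \<inter> {x. (\<kappa>1, \<kappa>2) \<bullet> x = 1}"
  have "compact_edge S ?e"
    unfolding compact_edge_def newton_polygon_eq
    using face_is_compact_edge[OF A(1) \<kappa>(1,2) _ A(2) p1(2) A(3) p2(2) ne] supp by auto
  moreover have "bisectrix_point S \<in> ?e"
    using diagonal_distance_in[OF A(1)] dk d(1)
    by (simp add: bisectrix_point_def newton_polygon_eq newton_distance_eq inner_prod_def)
  ultimately have sa: "real (order y (edge_poly S ?e x)) < d" if "x \<in> {1, -1}" "y \<noteq> 0" "poly (edge_poly S ?e x) y = 0" for x y
    using sup that unfolding superadapted_def d(1) by (meson not_le)
  have "\<exists>C\<ge>0. \<exists>r>0. r \<le> \<rho> \<and> (\<forall>\<epsilon>>0. \<exists>N\<in>sets lborel.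
      {(x, y). \<bar>x\<bar> < r \<and> \<bar>y\<bar> < r \<and> \<bar>series2 ?s x y\<bar> < \<epsilon>} \<subseteq> N \<and> emeasure lborel N \<le> ennreal (C * \<epsilon> powr (1 / d)))"
  proof (rule sublevel_area[OF \<open>\<rho> > 0\<close> summ \<kappa>(1,2) supp K(1)])
    fix \<sigma> :: real assume \<sigma>: "\<sigma> \<in> {1, -1}"
    have co: "coeff (face_poly (\<lambda>a b. \<sigma> ^ a * ?s a b) \<kappa>1 \<kappa>2) b2 \<noteq> 0"
      using coeff_face_poly[OF \<kappa>(1,2) p2(2), of "\<lambda>a b. \<sigma> ^ a * ?s a b"] p2(1) \<sigma> by auto
    then have p0: "face_poly (\<lambda>a b. \<sigma> ^ a * ?s a b) \<kappa>1 \<kappa>2 \<noteq> 0" by auto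
    fix z :: real
    show "\<exists>j\<le>K. poly ((pderiv ^^ j) (face_poly (\<lambda>a b. \<sigma> ^ a * ?s a b) \<kappa>1 \<kappa>2)) z \<noteq> 0"
    proof (cases "z = 0")
      case True
      then show ?thesis using co leK[OF p2(3)] by (auto simp: poly_higher_pderiv_0 intro!: exI[of _ b2])
    next
      case False
      have "order z (face_poly (\<lambda>a b. \<sigma> ^ a * ?s a b) \<kappa>1 \<kappa>2) \<le> K"
      proof (cases "poly (face_poly (\<lambda>a b. \<sigma> ^ a * ?s a b) \<kappa>1 \<kappa>2) z = 0")
        case True
        then show ?thesis using leK sa[OF \<sigma> False] unfolding edge_poly_eq_face_poly[OF \<kappa>(1,2)] by blast
      qed (simp add: order_0I)
      then show ?thesis using order_nonvanishing_derivative[OF p0, of z] by blast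
    qed
  next
    fix \<sigma> :: real assume \<sigma>: "\<sigma> \<in> {1, -1}"
    have "\<kappa>2 * real b1 + \<kappa>1 * real a1 = 1" using p1(2) by (simp add: add.commute)
    from coeff_face_poly[OF \<kappa>(2,1) this, of "\<lambda>b a. \<sigma> ^ b * ?s a b"]
    have "coeff (face_poly (\<lambda>b a. \<sigma> ^ b * ?s a b) \<kappa>2 \<kappa>1) a1 \<noteq> 0" using p1(1) \<sigma> by auto
    then show "\<exists>j\<le>K. poly ((pderiv ^^ j) (face_poly (\<lambda>b a. \<sigma> ^ b * ?s a b) \<kappa>2 \<kappa>1)) 0 \<noteq> 0"
      using leK[OF p1(3)] by (auto simp: poly_higher_pderiv_0 intro!: exI[of _ a1])
  next
    have lt: "1 / d < 1 / real K" using K by (intro divide_strict_left_mono) auto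
    fix x0 :: real
    show "\<exists>C\<ge>0. \<forall>\<epsilon>>0. strip_integral \<kappa>1 \<kappa>2 K x0 \<epsilon> \<le> ennreal (C * \<epsilon> powr (1 / d))"
      using strip_integral_critical[OF \<kappa>(1,2) K(1), of x0] lt \<kappa>(3) by metis
    show "\<exists>C\<ge>0. \<forall>\<epsilon>>0. strip_integral \<kappa>2 \<kappa>1 K x0 \<epsilon> \<le> ennreal (C * \<epsilon> powr (1 / d))"
      using strip_integral_critical[OF \<kappa>(2,1) K(1), of x0] lt \<kappa>(3) by (metis add.commute)
  qed auto
  then show ?thesis unfolding sublevel_bound_def by blast
qed

lemma sublevel_bound_weaken:
  assumes "sublevel_bound F r bd" "\<And>\<epsilon>. \<epsilon> > 0 \<Longrightarrow> bd \<epsilon> \<le> bd' \<epsilon>"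
  shows "sublevel_bound F r bd'"
  using assms unfolding sublevel_bound_def
  by (meson ennreal_leI mult_left_mono order_trans)

text \<open>At a vertex (n, n) the weight sum is exactly 1/K with K = n = d, which costs a
  logarithm. On a ray K = d as well, but the tilted weights sum to more than 1/d and the subcritical
  estimate reaches 1/d without one.\<close>

lemma sublevel_bound_superadapted:
  assumes "\<rho> > 0" and summ: "(\<lambda>(a, b). \<bar>taylor_coeff S a b\<bar> * \<rho> ^ a * \<rho> ^ b) summable_on UNIV"
    and ne: "\<exists>a b. taylor_coeff S a b \<noteq> 0"
    and sup: "superadapted S" and d: "d = newton_distance S" "d > 1"
  shows "\<exists>r>0. r \<le> \<rho> \<and> sublevel_bound (series2 (taylor_coeff S)) r (\<lambda>\<epsilon>. \<epsilon> powr (1 / d) * (1 + \<bar>ln \<epsilon>\<bar>)) \<and>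
     (newton_case1 S \<or> newton_case3 S \<longrightarrow> sublevel_bound (series2 (taylor_coeff S)) r (\<lambda>\<epsilon>. \<epsilon> powr (1 / d)))"
proof -
  let ?s = "taylor_coeff S" and ?A = "{(a, b). taylor_coeff S a b \<noteq> 0}"
  have A: "?A \<noteq> {}" using ne by auto
  have d': "d = diagonal_distance ?A" "d > 0" using d by (simp_all add: newton_distance_eq)
  have nolog: ?thesis if ex: "\<exists>r>0. r \<le> \<rho> \<and> sublevel_bound (series2 ?s) r (\<lambda>\<epsilon>. \<epsilon> powr (1 / d))"
  proof -
    obtain r where r: "r > 0" "r \<le> \<rho>" "sublevel_bound (series2 ?s) r (\<lambda>\<epsilon>. \<epsilon> powr (1 / d))" using ex by blast
    have "sublevel_bound (series2 ?s) r (\<lambda>\<epsilon>. \<epsilon> powr (1 / d) * (1 + \<bar>ln \<epsilon>\<bar>))"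
      by (rule sublevel_bound_weaken[OF r(3)]) (simp add: mult_le_cancel_left1)
    then show ?thesis using r by blast
  qed
  have sub: "\<exists>C\<ge>0. \<forall>\<epsilon>>0. strip_integral \<kappa>1 \<kappa>2 n x0 \<epsilon> \<le> ennreal (C * \<epsilon> powr (1 / d))"
    if "\<kappa>1 > 0" "\<kappa>2 > 0" "1 / d < \<kappa>1 + \<kappa>2" "d = real n" "x0 > 0" for \<kappa>1 \<kappa>2 n x0
  proof -
    have "0 < \<kappa>2 / \<kappa>1 - 1 / d / \<kappa>1 + 1" using that d(2) by (simp add: field_simps)
    then show ?thesis
      using strip_integral_subcritical[of \<kappa>1 \<kappa>2 n x0 "1 / d"] that d(2)
      by (intro exI[of _ "x0 powr (\<kappa>2 / \<kappa>1 - 1 / d / \<kappa>1 + 1) / (\<kappa>2 / \<kappa>1 - 1 / d / \<kappa>1 + 1)"]) auto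
  qed
  show ?thesis
  proof (rule newton_cases[OF A d'])
    fix \<kappa>1 \<kappa>2 a1 b1 a2 b2
    assume "\<kappa>1 > 0" "\<kappa>2 > 0" "\<kappa>1 + \<kappa>2 = 1 / d" "\<And>a b. (a, b) \<in> ?A \<Longrightarrow> 1 \<le> \<kappa>1 * real a + \<kappa>2 * real b"
      "(a1, b1) \<in> ?A" "\<kappa>1 * real a1 + \<kappa>2 * real b1 = 1" "real a1 < d"
      "(a2, b2) \<in> ?A" "\<kappa>1 * real a2 + \<kappa>2 * real b2 = 1" "real b2 < d"
    then show ?thesis
      by (intro nolog sublevel_bound_edge[OF \<open>\<rho> > 0\<close> summ sup d, of \<kappa>1 \<kappa>2 a1 b1 a2 b2]) auto
  next
    fix \<kappa>1 \<kappa>2 n assume h: "d = real n" "\<kappa>1 + \<kappa>2 = 1 / d" "exposes ?A \<kappa>1 \<kappa>2 n n"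
    have \<kappa>: "\<kappa>1 > 0" "\<kappa>2 > 0" using h(3) by (auto simp: exposes_def)
    have n: "n \<ge> 1" using h(1) d(2) by simp
    have "\<exists>r>0. r \<le> \<rho> \<and> sublevel_bound (series2 ?s) r (\<lambda>\<epsilon>. \<epsilon> powr (1 / d) * (1 + \<bar>ln \<epsilon>\<bar>))"
    proof (rule sublevel_bound_exposed[OF \<open>\<rho> > 0\<close> summ h(3) order_refl order_refl n])
      fix x0 :: real assume "x0 > 0"
      have eq: "\<kappa>1 + \<kappa>2 = 1 / real n" "\<kappa>2 + \<kappa>1 = 1 / real n" using h(1,2) by simp_all
      show "\<exists>C\<ge>0. \<forall>\<epsilon>>0. strip_integral \<kappa>1 \<kappa>2 n x0 \<epsilon> \<le> ennreal (C * (\<epsilon> powr (1 / d) * (1 + \<bar>ln \<epsilon>\<bar>)))"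
        by (rule strip_integral_log[OF \<kappa> n eq(1) \<open>x0 > 0\<close>]) (use eq h(1) in auto)
      show "\<exists>C\<ge>0. \<forall>\<epsilon>>0. strip_integral \<kappa>2 \<kappa>1 n x0 \<epsilon> \<le> ennreal (C * (\<epsilon> powr (1 / d) * (1 + \<bar>ln \<epsilon>\<bar>)))"
        by (rule strip_integral_log[OF \<kappa>(2,1) n eq(2) \<open>x0 > 0\<close>]) (use eq h(1) in auto)
    qed simp
    \<comment> \<open>The bisectrix point is a vertex here, so the bound without logarithm is not
      claimed.\<close>
    moreover have "\<not> (newton_case1 S \<or> newton_case3 S)"
    proof -
      have "bisectrix_point S extreme_point_of newton_polygon S"
        using exposed_extreme_point[OF h(3)] h(1) d(1) by (simp add: bisectrix_point_def newton_polygon_eq)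
      then show ?thesis
        using extreme_point_not_in_rel_interior_edge
        unfolding newton_case1_def newton_case3_def compact_edge_def unbounded_edge_def by blast
    qed
    ultimately show ?thesis by blast
  next
    fix \<kappa>1 \<kappa>2 a0 n assume h: "d = real n" "1 / d < \<kappa>1 + \<kappa>2" "a0 < n" "exposes ?A \<kappa>1 \<kappa>2 a0 n"
    have \<kappa>: "\<kappa>1 > 0" "\<kappa>2 > 0" using h(4) by (auto simp: exposes_def)
    show ?thesis
      by (rule nolog, rule sublevel_bound_exposed[OF \<open>\<rho> > 0\<close> summ h(4), of n])
        (use h sub[OF \<kappa> h(2,1)] sub[OF \<kappa>(2,1) _ h(1)] in \<open>auto simp: add.commute\<close>)
  next
    fix \<kappa>1 \<kappa>2 n b0 assume h: "d = real n" "1 / d < \<kappa>1 + \<kappa>2" "b0 < n" "exposes ?A \<kappa>1 \<kappa>2 n b0"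
    have \<kappa>: "\<kappa>1 > 0" "\<kappa>2 > 0" using h(4) by (auto simp: exposes_def)
    show ?thesis
      by (rule nolog, rule sublevel_bound_exposed[OF \<open>\<rho> > 0\<close> summ h(4), of n])
        (use h sub[OF \<kappa> h(2,1)] sub[OF \<kappa>(2,1) _ h(1)] in \<open>auto simp: add.commute\<close>)
  qed
qed

text \<open>On the box with sides t \<rho> \<open>\<epsilon> powr \<kappa>1\<close> and t \<rho>
  \<open>\<epsilon> powr \<kappa>2\<close> every term is at most t \<epsilon> times its absolute
  value at (\<rho>, \<rho>), as all weights are at least 1. Zero weights are allowed, for the
  bisectrix may meet an unbounded ray.\<close>

lemma small_box:
  fixes s :: "nat \<Rightarrow> nat \<Rightarrow> real"
  assumes "\<rho> > 0" and summ: "(\<lambda>(a, b). \<bar>s a b\<bar> * \<rho> ^ a * \<rho> ^ b) summable_on UNIV"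
    and \<kappa>: "\<kappa>1 \<ge> 0" "\<kappa>2 \<ge> 0"
    and supp: "\<And>a b. s a b \<noteq> 0 \<Longrightarrow> 1 \<le> \<kappa>1 * real a + \<kappa>2 * real b" and "r > 0"
  shows "\<exists>c>0. \<forall>\<epsilon>. 0 < \<epsilon> \<and> \<epsilon> < 1 \<longrightarrow> (\<exists>x y. 0 < x \<and> x \<le> r \<and> 0 < y \<and> y \<le> r \<and>
     x * y = c * \<epsilon> powr (\<kappa>1 + \<kappa>2) \<and> (\<forall>u v. \<bar>u\<bar> \<le> x \<and> \<bar>v\<bar> \<le> y \<longrightarrow> \<bar>series2 s u v\<bar> < \<epsilon>))"
proof -
  define M where "M = (\<Sum>\<^sub>\<infinity>(a, b). \<bar>s a b\<bar> * \<rho> ^ a * \<rho> ^ b)"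
  have "M \<ge> 0" unfolding M_def using \<open>\<rho> > 0\<close> by (intro infsum_nonneg) auto
  \<comment> \<open>The three entries give \<open>t ^ (a + b) \<le> t\<close>, a box inside the
    prescribed square, and t M < 1.\<close>
  define t where "t = Min {1, r / \<rho>, 1 / (M + 1)}"
  have t: "t > 0" "t \<le> 1" "t * \<rho> \<le> r" "t * M < 1"
  proof -
    show "t > 0" "t \<le> 1" using \<open>M \<ge> 0\<close> \<open>r > 0\<close> \<open>\<rho> > 0\<close> by (auto simp: t_def)
    have "t \<le> r / \<rho>" "t \<le> 1 / (M + 1)" by (auto simp: t_def)
    then show "t * \<rho> \<le> r" using \<open>\<rho> > 0\<close> by (simp add: field_simps)
    have "t * M < t * (M + 1)" using \<open>t > 0\<close> by simp
    also have "\<dots> \<le> 1" using \<open>t \<le> 1 / (M + 1)\<close> \<open>M \<ge> 0\<close> by (simp add: field_simps)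
    finally show "t * M < 1" .
  qed
  have "\<exists>x y. 0 < x \<and> x \<le> r \<and> 0 < y \<and> y \<le> r \<and>
     x * y = (t * \<rho>)\<^sup>2 * \<epsilon> powr (\<kappa>1 + \<kappa>2) \<and> (\<forall>u v. \<bar>u\<bar> \<le> x \<and> \<bar>v\<bar> \<le> y \<longrightarrow> \<bar>series2 s u v\<bar> < \<epsilon>)"
    if \<epsilon>: "0 < \<epsilon>" "\<epsilon> < 1" for \<epsilon>
  proof -
    define x where "x = t * \<rho> * \<epsilon> powr \<kappa>1"
    define y where "y = t * \<rho> * \<epsilon> powr \<kappa>2"
    have pos: "0 < x" "0 < y" using t \<open>\<rho> > 0\<close> \<epsilon> by (simp_all add: x_def y_def)
    have e1: "\<epsilon> powr \<kappa>1 \<le> 1" "\<epsilon> powr \<kappa>2 \<le> 1" using \<epsilon> \<kappa> by (simp_all add: powr_le1)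
    have "t * \<rho> * \<epsilon> powr \<kappa>1 \<le> t * \<rho> * 1" "t * \<rho> * \<epsilon> powr \<kappa>2 \<le> t * \<rho> * 1"
      using e1 t \<open>\<rho> > 0\<close> by (auto intro!: mult_left_mono)
    then have xy: "x \<le> r" "y \<le> r" using t(3) by (simp_all add: x_def y_def)
    have tm: "\<bar>s a b * u ^ a * v ^ b\<bar> \<le> (t * \<epsilon>) * (\<bar>s a b\<bar> * \<rho> ^ a * \<rho> ^ b)" if uv: "\<bar>u\<bar> \<le> x" "\<bar>v\<bar> \<le> y" for a b u v
    proof (cases "s a b = 0")
      case False
      have k: "1 \<le> \<kappa>1 * real a + \<kappa>2 * real b" by (rule supp[OF False])
      \<comment> \<open>The constant term would have weight 0; its absence yields the factor
        t.\<close>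
      then have ab: "a + b \<ge> 1" by (cases "a = 0"; cases "b = 0") auto
      have pw: "(\<epsilon> powr \<kappa>1) ^ a * (\<epsilon> powr \<kappa>2) ^ b = \<epsilon> powr (\<kappa>1 * real a + \<kappa>2 * real b)"
        using \<epsilon> powr_realpow[of "\<epsilon> powr \<kappa>1" a] powr_realpow[of "\<epsilon> powr \<kappa>2" b]
        by (simp add: powr_powr powr_add)
      have "\<epsilon> powr (\<kappa>1 * real a + \<kappa>2 * real b) \<le> \<epsilon> powr 1" using k \<epsilon> by (intro powr_mono') auto
      then have pe: "\<epsilon> powr (\<kappa>1 * real a + \<kappa>2 * real b) \<le> \<epsilon>" using \<epsilon> by simp
      have tp: "t ^ (a + b) \<le> t" using power_decreasing[OF ab, of t] t by simp
      have "\<bar>u\<bar> ^ a * \<bar>v\<bar> ^ b \<le> x ^ a * y ^ b" using uv pos by (intro mult_mono power_mono) auto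
      also have "\<dots> = (t ^ (a + b) * \<epsilon> powr (\<kappa>1 * real a + \<kappa>2 * real b)) * (\<rho> ^ a * \<rho> ^ b)"
        by (simp add: x_def y_def power_mult_distrib power_add pw[symmetric])
      also have "\<dots> \<le> (t * \<epsilon>) * (\<rho> ^ a * \<rho> ^ b)"
        using tp pe t \<epsilon> \<open>\<rho> > 0\<close> by (intro mult_right_mono mult_mono) auto
      finally have "\<bar>s a b\<bar> * (\<bar>u\<bar> ^ a * \<bar>v\<bar> ^ b) \<le> \<bar>s a b\<bar> * ((t * \<epsilon>) * (\<rho> ^ a * \<rho> ^ b))"
        by (rule mult_left_mono) simp
      then show ?thesis by (simp add: abs_mult power_abs mult_ac)
    qed simp
    have "\<bar>series2 s u v\<bar> < \<epsilon>" if uv: "\<bar>u\<bar> \<le> x" "\<bar>v\<bar> \<le> y" for u v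
    proof -
      have sm: "(\<lambda>p. (t * \<epsilon>) * (case p of (a, b) \<Rightarrow> \<bar>s a b\<bar> * \<rho> ^ a * \<rho> ^ b)) summable_on UNIV"
        by (rule summable_on_cmult_right[OF summ])
      have sn: "(\<lambda>p. norm (case p of (a, b) \<Rightarrow> s a b * u ^ a * v ^ b)) summable_on UNIV"
        by (rule summable_on_comparison_test[OF sm]) (use tm[OF uv] in auto)
      have "\<bar>series2 s u v\<bar> \<le> (\<Sum>\<^sub>\<infinity>p. norm (case p of (a, b) \<Rightarrow> s a b * u ^ a * v ^ b))"
        unfolding series2_def using norm_infsum_bound[OF sn] by simp
      also have "\<dots> \<le> (\<Sum>\<^sub>\<infinity>p. (t * \<epsilon>) * (case p of (a, b) \<Rightarrow> \<bar>s a b\<bar> * \<rho> ^ a * \<rho> ^ b))"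
        by (rule infsum_mono[OF sn sm]) (use tm[OF uv] in auto)
      also have "\<dots> = (t * \<epsilon>) * M" unfolding M_def by (rule infsum_cmult_right) (rule summ)
      also have "\<dots> < \<epsilon>" using t(4) \<epsilon> mult_strict_right_mono[OF t(4), of \<epsilon>] by (simp add: mult_ac)
      finally show ?thesis .
    qed
    moreover have "x * y = (t * \<rho>)\<^sup>2 * \<epsilon> powr (\<kappa>1 + \<kappa>2)"
      using \<epsilon> by (simp add: x_def y_def powr_add power2_eq_square)
    ultimately show ?thesis using pos xy by blast
  qed
  moreover have "(t * \<rho>)\<^sup>2 > 0" using t \<open>\<rho> > 0\<close> by simp
  ultimately show ?thesis by blast
qed

section \<open>Leading coefficients\<close>

lemma leading_sublevel:
  assumes "sublevel_expansion I r c c'"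
  shows "((\<lambda>t. I t / t powr r 0 - (c 0 + c' 0 * ln t)) \<longlongrightarrow> 0) (at_right 0)"
proof -
  have "(\<lambda>t. I t - (c 0 * t powr r 0 + c' 0 * (ln t * t powr r 0))) \<in> o[at_right 0](\<lambda>t. t powr r 0)"
    using assms unfolding sublevel_expansion_def by (auto dest: spec[of _ 0])
  from smalloD_tendsto[OF this]
  show ?thesis
  proof (rule Lim_transform_eventually)
    show "\<forall>\<^sub>F t in at_right 0. (I t - (c 0 * t powr r 0 + c' 0 * (ln t * t powr r 0))) / t powr r 0
        = I t / t powr r 0 - (c 0 + c' 0 * ln t)"
      using eventually_at_right_less[of "0::real"] by eventually_elim (simp add: field_simps)
  qed
qed

lemma leading_osc:
  assumes "osc_expansion J s d d'"
  shows "((\<lambda>l. J l / of_real (l powr (- s 0)) - (d 0 + d' 0 * of_real (ln l))) \<longlongrightarrow> 0) at_top"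
proof -
  have "(\<lambda>l. J l - (d 0 * of_real (l powr (- s 0)) + d' 0 * of_real (ln l * l powr (- s 0))))
      \<in> o[at_top](\<lambda>l. complex_of_real (l powr (- s 0)))"
    using assms unfolding osc_expansion_def by (auto dest: spec[of _ 0])
  from smalloD_tendsto[OF this]
  show ?thesis
  proof (rule Lim_transform_eventually)
    show "\<forall>\<^sub>F l in at_top. (J l - (d 0 * of_real (l powr (- s 0)) + d' 0 * of_real (ln l * l powr (- s 0)))) / of_real (l powr (- s 0))
        = J l / of_real (l powr (- s 0)) - (d 0 + d' 0 * of_real (ln l))"
      using eventually_gt_at_top[of "0::real"] by eventually_elim (simp add: field_simps)
  qed
qed

text \<open>At an exponent below the true one both coefficients are zero. This allows expansions
  with different leading exponents to be compared at the smaller one; the zero coefficients are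
  displayed in the form expected by \<open>osc_sublevel_comparison\<close>.\<close>

lemma leading_sublevel_subcritical:
  assumes lim: "((\<lambda>t. I t / t powr q - (c + c' * ln t)) \<longlongrightarrow> 0) (at_right 0)" and "e < (q::real)"
  shows "((\<lambda>t. I t / t powr e - (0 + 0 * ln t)) \<longlongrightarrow> 0) (at_right 0)"
proof -
  define a where "a = q - e"
  have a: "a > 0" using assms(2) by (simp add: a_def)
  have p: "((\<lambda>t::real. t powr a) \<longlongrightarrow> 0) (at_right 0)" "((\<lambda>t::real. t powr a * ln t) \<longlongrightarrow> 0) (at_right 0)"
    using a by real_asymp+
  have "((\<lambda>t. (I t / t powr q - (c + c' * ln t)) * t powr a + (c * t powr a + c' * (t powr a * ln t)))
      \<longlongrightarrow> 0 * 0 + (c * 0 + c' * 0)) (at_right 0)"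
    by (intro tendsto_intros lim p)
  then have "((\<lambda>t. (I t / t powr q - (c + c' * ln t)) * t powr a + (c * t powr a + c' * (t powr a * ln t)))
      \<longlongrightarrow> 0) (at_right 0)" by simp
  then show ?thesis
  proof (rule Lim_transform_eventually)
    show "\<forall>\<^sub>F t in at_right 0. (I t / t powr q - (c + c' * ln t)) * t powr a + (c * t powr a + c' * (t powr a * ln t))
        = I t / t powr e - (0 + 0 * ln t)"
      using eventually_at_right_less[of "0::real"]
      by eventually_elim (simp add: a_def powr_diff field_simps)
  qed
qed

lemma leading_osc_subcritical:
  fixes J :: "real \<Rightarrow> complex"
  assumes lim: "((\<lambda>l. J l / of_real (l powr (- q)) - (c + c' * of_real (ln l))) \<longlongrightarrow> 0) at_top" and "e < (q::real)"
  shows "((\<lambda>l. J l / of_real (l powr (- e)) - (0 + 0 * of_real (ln l))) \<longlongrightarrow> 0) at_top"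
proof -
  define a where "a = q - e"
  have a: "a > 0" using assms(2) by (simp add: a_def)
  have p: "((\<lambda>t::real. t powr (- a)) \<longlongrightarrow> 0) at_top" "((\<lambda>t::real. t powr (- a) * ln t) \<longlongrightarrow> 0) at_top"
    using a by real_asymp+
  have "((\<lambda>l. (J l / of_real (l powr (- q)) - (c + c' * of_real (ln l))) * of_real (l powr (- a))
       + (c * of_real (l powr (- a)) + c' * of_real (l powr (- a) * ln l)))
      \<longlongrightarrow> 0 * of_real 0 + (c * of_real 0 + c' * of_real 0)) at_top"
    by (intro tendsto_intros lim p)
  then have "((\<lambda>l. (J l / of_real (l powr (- q)) - (c + c' * of_real (ln l))) * of_real (l powr (- a))
       + (c * of_real (l powr (- a)) + c' * of_real (l powr (- a) * ln l))) \<longlongrightarrow> 0) at_top" by simp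
  then show ?thesis
  proof (rule Lim_transform_eventually)
    show "\<forall>\<^sub>F l in at_top. (J l / of_real (l powr (- q)) - (c + c' * of_real (ln l))) * of_real (l powr (- a))
       + (c * of_real (l powr (- a)) + c' * of_real (l powr (- a) * ln l))
        = J l / of_real (l powr (- e)) - (0 + 0 * of_real (ln l))"
      using eventually_gt_at_top[of "0::real"]
    proof eventually_elim
      case (elim l)
      have "l powr (- a) = l powr (- q) * l powr e" using elim by (simp add: a_def powr_add[symmetric])
      moreover have "l powr (- e) = 1 / l powr e" by (rule powr_minus_divide)
      moreover have "(A / Q - (c + c' * L)) * (Q * E) + (c * (Q * E) + c' * (Q * E * L)) = A / (1 / E) - (0 + 0 * L)"
        if "Q \<noteq> 0" for A Q E L :: complex using that by (simp add: field_simps)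
      moreover have "complex_of_real (l powr (- q)) \<noteq> 0" using elim by simp
      ultimately show ?case by (simp only: of_real_mult of_real_divide of_real_1)
    qed
  qed
qed

section \<open>Vanishing coefficients and negligible sets\<close>

lemma log_bounded_imp_zero:
  fixes c c' B :: real
  assumes "\<forall>\<^sub>F t in at_right 0. \<bar>c + c' * ln t\<bar> \<le> B"
  shows "c' = 0"
proof (rule ccontr)
  assume "c' \<noteq> 0"
  have l: "((\<lambda>t::real. 1 / ln t) \<longlongrightarrow> 0) (at_right 0)" by real_asymp
  have "((\<lambda>t. (c + c' * ln t) * (1 / ln t)) \<longlongrightarrow> 0) (at_right 0)"
  proof (rule Lim_null_comparison)
    show "((\<lambda>t. B * \<bar>1 / ln t\<bar>) \<longlongrightarrow> 0) (at_right 0)"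
      using tendsto_mult[OF tendsto_const[of B] tendsto_rabs[OF l]] by simp
    show "\<forall>\<^sub>F t in at_right 0. norm ((c + c' * ln t) * (1 / ln t)) \<le> B * \<bar>1 / ln t\<bar>"
      using assms by eventually_elim (simp only: real_norm_def abs_mult, rule mult_right_mono, simp_all)
  qed
  moreover have "((\<lambda>t. (c + c' * ln t) * (1 / ln t)) \<longlongrightarrow> c * 0 + c') (at_right 0)"
  proof (rule Lim_transform_eventually)
    show "((\<lambda>t. c * (1 / ln t) + c') \<longlongrightarrow> c * 0 + c') (at_right 0)" by (intro tendsto_intros l)
    have "\<forall>\<^sub>F t in at_right (0::real). t < 1" by (rule eventually_at_right_real[THEN eventually_mono, of 0 1]) auto
    then show "\<forall>\<^sub>F t in at_right 0. c * (1 / ln t) + c' = (c + c' * ln t) * (1 / ln t)"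
      using eventually_at_right_less[of "0::real"] by eventually_elim (simp add: field_simps)
  qed
  ultimately have "c * 0 + c' = 0" using tendsto_unique[OF trivial_limit_at_right_real] by blast
  then show False using \<open>c' \<noteq> 0\<close> by simp
qed

lemma log_tendsto_zero_imp_zero:
  fixes c c' :: real
  assumes "((\<lambda>t. c + c' * ln t) \<longlongrightarrow> 0) (at_right 0)"
  shows "c = 0 \<and> c' = 0"
proof -
  have "\<forall>\<^sub>F t in at_right 0. \<bar>c + c' * ln t\<bar> < 1"
    using order_tendstoD(2)[OF tendsto_rabs_zero[OF assms], of 1] by simp
  then have "\<forall>\<^sub>F t in at_right 0. \<bar>c + c' * ln t\<bar> \<le> 1" by eventually_elim simp
  then have "c' = 0" by (rule log_bounded_imp_zero)
  then have "((\<lambda>t::real. c) \<longlongrightarrow> 0) (at_right 0)" using assms by simp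
  then show ?thesis using \<open>c' = 0\<close> by (simp add: tendsto_const_iff)
qed

text \<open>The two phases are linearly independent over the reals, as cos \<theta> and sin \<theta>
  are nonzero. So the contributions of S > 0 and S < 0, having real coefficients, cannot
  cancel.\<close>

lemma exp_combination_zero:
  assumes "0 < \<theta>" "\<theta> < pi / 2"
    and "exp (\<i> * complex_of_real \<theta>) * complex_of_real x + exp (- \<i> * complex_of_real \<theta>) * complex_of_real y = 0"
  shows "x = 0 \<and> y = 0"
proof -
  have pos: "cos \<theta> > 0" "sin \<theta> > 0" using assms(1,2) by (auto intro!: cos_gt_zero sin_gt_zero)
  have "Re (exp (\<i> * complex_of_real \<theta>) * complex_of_real x + exp (- \<i> * complex_of_real \<theta>) * complex_of_real y) = 0"
    "Im (exp (\<i> * complex_of_real \<theta>) * complex_of_real x + exp (- \<i> * complex_of_real \<theta>) * complex_of_real y) = 0"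
    unfolding assms(3) by simp_all
  then have "cos \<theta> * (x + y) = 0" "sin \<theta> * (x - y) = 0"
    by (simp_all add: Re_exp Im_exp algebra_simps)
  then show ?thesis using pos by auto
qed

text \<open>The zero set lies in the intersection of the covers for a sequence of levels tending to
  0. It supplies the null set hypothesis of \<open>laplace_identity\<close>.\<close>

lemma sublevel_bound_null:
  assumes "sublevel_bound F r bd" and bd: "((\<lambda>\<epsilon>. bd \<epsilon>) \<longlongrightarrow> 0) (at_right 0)"
  shows "AE p in lborel. \<not> (\<bar>fst p\<bar> < r \<and> \<bar>snd p\<bar> < r \<and> F (fst p) (snd p) = 0)"
proof -
  obtain C where C: "C \<ge> 0" "\<forall>\<epsilon>>0. \<exists>N\<in>sets lborel.
      {(x, y). \<bar>x\<bar> < r \<and> \<bar>y\<bar> < r \<and> \<bar>F x y\<bar> < \<epsilon>} \<subseteq> N \<and> emeasure lborel N \<le> ennreal (C * bd \<epsilon>)"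
    using assms(1) unfolding sublevel_bound_def by blast
  define e where "e n = 1 / real (Suc n)" for n
  have e: "e n > 0" for n by (simp add: e_def)
  have "\<forall>n. \<exists>N. N \<in> sets lborel \<and> {(x, y). \<bar>x\<bar> < r \<and> \<bar>y\<bar> < r \<and> \<bar>F x y\<bar> < e n} \<subseteq> N \<and> emeasure lborel N \<le> ennreal (C * bd (e n))"
    using C(2) e by blast
  from choice[OF this] obtain N where N': "\<forall>n. N n \<in> sets lborel \<and>
      {(x, y). \<bar>x\<bar> < r \<and> \<bar>y\<bar> < r \<and> \<bar>F x y\<bar> < e n} \<subseteq> N n \<and> emeasure lborel (N n) \<le> ennreal (C * bd (e n))"
    by blast
  then have N: "\<And>n. N n \<in> sets lborel" "\<And>n. {(x, y). \<bar>x\<bar> < r \<and> \<bar>y\<bar> < r \<and> \<bar>F x y\<bar> < e n} \<subseteq> N n"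
    "\<And>n. emeasure lborel (N n) \<le> ennreal (C * bd (e n))" by blast+
  define Z where "Z = (\<Inter>n. N n)"
  have Zs: "Z \<in> sets lborel" unfolding Z_def using N(1) by (intro sets.countable_INT) auto
  have "filterlim e (at_right 0) sequentially"
  proof -
    have "e \<longlonglongrightarrow> 0" unfolding e_def by real_asymp
    then show ?thesis unfolding filterlim_at using e by (auto simp: less_imp_neq[symmetric])
  qed
  from filterlim_compose[OF bd this] have "(\<lambda>n. ennreal (C * bd (e n))) \<longlonglongrightarrow> ennreal (C * 0)"
    by (intro tendsto_ennrealI tendsto_mult tendsto_const)
  moreover have "emeasure lborel Z \<le> ennreal (C * bd (e n))" for n
  proof -
    have "emeasure lborel Z \<le> emeasure lborel (N n)" by (rule emeasure_mono) (auto simp: Z_def N(1)[simplified])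
    then show ?thesis using N(3)[of n] by (rule order_trans)
  qed
  ultimately have "emeasure lborel Z \<le> ennreal (C * 0)" by (intro LIMSEQ_le_const) auto
  then have "emeasure lborel Z = 0" by simp
  then show ?thesis
  proof (intro AE_I[of _ _ Z])
    show "{p \<in> space lborel. \<not> \<not> (\<bar>fst p\<bar> < r \<and> \<bar>snd p\<bar> < r \<and> F (fst p) (snd p) = 0)} \<subseteq> Z"
    proof
      fix p assume "p \<in> {p \<in> space lborel. \<not> \<not> (\<bar>fst p\<bar> < r \<and> \<bar>snd p\<bar> < r \<and> F (fst p) (snd p) = 0)}"
      then have "p \<in> {(x, y). \<bar>x\<bar> < r \<and> \<bar>y\<bar> < r \<and> \<bar>F x y\<bar> < e n}" for n
        using e[of n] by (auto simp: case_prod_unfold)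
      then have "p \<in> N n" for n by (rule subsetD[OF N(2)])
      then show "p \<in> Z" by (simp add: Z_def)
    qed
  qed (use Zs in auto)
qed

text \<open>The predicate \<open>P\<close> selects the sign of S, so both sublevel integrals are
  covered. A nonintegrable integrand has integral 0 by convention and satisfies the bound
  trivially.\<close>

lemma sublevel_integral_bound:
  fixes S' :: "real \<times> real \<Rightarrow> real"
  assumes "sublevel_bound F r bd" "\<And>\<epsilon>. \<epsilon> > 0 \<Longrightarrow> bd \<epsilon> \<ge> 0"
    and S': "\<And>x y. \<bar>x\<bar> < r \<Longrightarrow> \<bar>y\<bar> < r \<Longrightarrow> S' (x, y) = F x y"
    and out: "\<And>x y. \<not> (\<bar>x\<bar> < r \<and> \<bar>y\<bar> < r) \<Longrightarrow> \<phi> (x, y) = 0"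
    and B: "B \<ge> 0" "\<And>p. \<bar>\<phi> p\<bar> \<le> B"
  shows "\<exists>C\<ge>0. \<forall>\<epsilon>>0. \<bar>\<integral>p. (if P p \<and> \<bar>S' p\<bar> < \<epsilon> then \<phi> p else 0) \<partial>lborel\<bar> \<le> C * bd \<epsilon>"
proof -
  obtain C where C: "C \<ge> 0" "\<forall>\<epsilon>>0. \<exists>N\<in>sets lborel.
      {(x, y). \<bar>x\<bar> < r \<and> \<bar>y\<bar> < r \<and> \<bar>F x y\<bar> < \<epsilon>} \<subseteq> N \<and> emeasure lborel N \<le> ennreal (C * bd \<epsilon>)"
    using assms(1) unfolding sublevel_bound_def by blast
  have "\<bar>\<integral>p. (if P p \<and> \<bar>S' p\<bar> < \<epsilon> then \<phi> p else 0) \<partial>lborel\<bar> \<le> (B * C) * bd \<epsilon>" if \<epsilon>: "\<epsilon> > 0" for \<epsilon>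
  proof (cases "integrable lborel (\<lambda>p. if P p \<and> \<bar>S' p\<bar> < \<epsilon> then \<phi> p else 0)")
    case True
    obtain N where N: "N \<in> sets lborel" "{(x, y). \<bar>x\<bar> < r \<and> \<bar>y\<bar> < r \<and> \<bar>F x y\<bar> < \<epsilon>} \<subseteq> N"
      "emeasure lborel N \<le> ennreal (C * bd \<epsilon>)" using C(2) \<epsilon> by blast
    have nn: "0 \<le> C * bd \<epsilon>" using C(1) assms(2)[OF \<epsilon>] by simp
    have fin: "emeasure lborel N < \<infinity>" using N(3) by (rule le_less_trans) simp
    have mN: "measure lborel N \<le> C * bd \<epsilon>"
      unfolding measure_def using N(3) nn by (rule enn2real_leI[rotated])
    have iN: "integrable lborel (\<lambda>p. B * indicator N p :: real)"
      using N(1) fin by (intro integrable_mult_right) (simp add: integrable_indicator_iff)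
    have "\<bar>\<integral>p. (if P p \<and> \<bar>S' p\<bar> < \<epsilon> then \<phi> p else 0) \<partial>lborel\<bar> \<le> (\<integral>p. \<bar>if P p \<and> \<bar>S' p\<bar> < \<epsilon> then \<phi> p else 0\<bar> \<partial>lborel)"
      by (rule integral_abs_bound)
    also have "\<dots> \<le> (\<integral>p. B * indicator N p \<partial>lborel)"
    proof (rule integral_mono)
      fix p :: "real \<times> real"
      show "\<bar>if P p \<and> \<bar>S' p\<bar> < \<epsilon> then \<phi> p else 0\<bar> \<le> B * indicator N p"
      proof (cases "\<phi> p \<noteq> 0 \<and> \<bar>S' p\<bar> < \<epsilon>")
        case True
        obtain x y where p: "p = (x, y)" by (cases p)
        have xy: "\<bar>x\<bar> < r" "\<bar>y\<bar> < r" using out[of x y] True by (auto simp: p)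
        then have "p \<in> N" using N(2) True S'[OF xy] by (auto simp: p)
        then show ?thesis using B by simp
      qed (use B(1) in auto)
    qed (use True iN in auto)
    also have "\<dots> = B * measure lborel N" using N(1) by simp
    also have "\<dots> \<le> B * (C * bd \<epsilon>)" using mN B(1) by (rule mult_left_mono)
    finally show ?thesis by (simp add: mult.assoc)
  next
    case False
    then show ?thesis using C(1) B(1) assms(2)[OF \<epsilon>] by (simp add: not_integrable_integral_eq)
  qed
  then show ?thesis using C(1) B(1) by (intro exI[of _ "B * C"]) auto
qed

section \<open>Identification of the leading exponents and coefficients\<close>

theorem theorem1p2:
  fixes S :: "real \<times> real \<Rightarrow> real" and U V :: "(real \<times> real) set" and d :: real
    and s r :: "nat \<Rightarrow> real"
    and \<delta> \<delta>' :: "nat \<Rightarrow> (real \<times> real \<Rightarrow> real) \<Rightarrow> complex"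
    and c c' C C' :: "nat \<Rightarrow> (real \<times> real \<Rightarrow> real) \<Rightarrow> real"
  assumes "open U" and "(0, 0) \<in> U" and "real_analytic_on S U"
    and "S (0, 0) = 0" and "(S has_derivative (\<lambda>_. 0)) (at (0, 0))"
    and "\<exists>a b. taylor_coeff S a b \<noteq> 0"
    and "superadapted S" and "d = newton_distance S" and "d > 1"
    and "open V" and "(0, 0) \<in> V"
    and "exponent_progression s" and "exponent_progression r"
    and "\<And>\<phi>. \<phi> \<in> test_functions V \<Longrightarrow>
           osc_expansion (osc_integral S \<phi>) s (\<lambda>j. \<delta> j \<phi>) (\<lambda>j. \<delta>' j \<phi>)"
    and "\<And>\<phi>. \<phi> \<in> test_functions V \<Longrightarrow>
           sublevel_expansion (sublevel_integral S \<phi>) r (\<lambda>j. c j \<phi>) (\<lambda>j. c' j \<phi>)"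
    and "\<And>\<phi>. \<phi> \<in> test_functions V \<Longrightarrow>
           sublevel_expansion (sublevel_integral (\<lambda>p. - S p) \<phi>) r (\<lambda>j. C j \<phi>) (\<lambda>j. C' j \<phi>)"
    and "\<And>W. open W \<Longrightarrow> (0, 0) \<in> W \<Longrightarrow> W \<subseteq> V \<Longrightarrow>
           \<exists>\<phi>\<in>test_functions W. \<delta> 0 \<phi> \<noteq> 0 \<or> \<delta>' 0 \<phi> \<noteq> 0"
    and "\<And>W. open W \<Longrightarrow> (0, 0) \<in> W \<Longrightarrow> W \<subseteq> V \<Longrightarrow>
           \<exists>\<phi>\<in>test_functions W. c 0 \<phi> \<noteq> 0 \<or> c' 0 \<phi> \<noteq> 0 \<or> C 0 \<phi> \<noteq> 0 \<or> C' 0 \<phi> \<noteq> 0"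
  shows "s 0 = 1 / d \<and>
    (\<exists>W. open W \<and> (0, 0) \<in> W \<and> W \<subseteq> V \<and> (\<forall>\<phi>\<in>test_functions W.
      (newton_case1 S \<or> newton_case3 S \<longrightarrow>
         \<delta>' 0 \<phi> = 0 \<and>
         \<delta> 0 \<phi> = complex_of_real (Gamma (1 / d) / d) *
           (exp (\<i> * complex_of_real (pi / (2 * d))) * complex_of_real (c 0 \<phi>) +
            exp (- \<i> * complex_of_real (pi / (2 * d))) * complex_of_real (C 0 \<phi>))) \<and>
      (newton_case2 S \<longrightarrow>
         \<delta>' 0 \<phi> = - complex_of_real (Gamma (1 / d) / d) *
           (exp (\<i> * complex_of_real (pi / (2 * d))) * complex_of_real (c' 0 \<phi>) +
            exp (- \<i> * complex_of_real (pi / (2 * d))) * complex_of_real (C' 0 \<phi>)))))"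
proof -
  have an: "real_analytic_on S U" "(0, 0) \<in> U" and ne: "\<exists>a b. taylor_coeff S a b \<noteq> 0" and sup: "superadapted S"
    and d: "d = newton_distance S" "d > 1" and V: "open V" "(0, 0) \<in> V"
    and prog: "exponent_progression s" "exponent_progression r" by fact+
  note osc = assms(14) and subp = assms(15) and subm = assms(16) and ex_osc = assms(17) and ex_sub = assms(18)
  let ?s = "taylor_coeff S"
  obtain s' \<rho> where \<rho>: "\<rho> > 0" and summ': "(\<lambda>(a, b). \<bar>s' a b\<bar> * \<rho> ^ a * \<rho> ^ b) summable_on UNIV"
    and S': "\<And>x y. \<bar>x\<bar> \<le> \<rho> \<Longrightarrow> \<bar>y\<bar> \<le> \<rho> \<Longrightarrow> S (x, y) = series2 s' x y" and s': "\<And>a b. ?s a b = s' a b"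
    by (rule real_analytic_series2[OF an]) blast
  have ss: "s' = ?s" using s' by (intro ext) simp
  note summ = summ'[unfolded ss] and Ss = S'[unfolded ss]
  obtain r0 where r0: "r0 > 0" "r0 \<le> \<rho>"
    and ub: "sublevel_bound (series2 ?s) r0 (\<lambda>\<epsilon>. \<epsilon> powr (1 / d) * (1 + \<bar>ln \<epsilon>\<bar>))"
    and ub': "newton_case1 S \<or> newton_case3 S \<Longrightarrow> sublevel_bound (series2 ?s) r0 (\<lambda>\<epsilon>. \<epsilon> powr (1 / d))"
    using sublevel_bound_superadapted[OF \<rho> summ ne sup d] by blast
  define W where "W = V \<inter> ({-r0<..<r0} \<times> {-r0<..<r0})"
  have W: "open W" "(0, 0) \<in> W" "W \<subseteq> V" using V r0(1) by (auto simp: W_def intro!: open_Int open_Times)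
  \<comment> \<open>S is analytic only on U and may be non-measurable elsewhere. \<open>R\<close> is
    Borel on the whole plane and agrees with S wherever a test function supported in
    \<open>W\<close> is nonzero.\<close>
  define R where "R = (\<lambda>(x, y). if \<bar>x\<bar> \<le> \<rho> \<and> \<bar>y\<bar> \<le> \<rho> then series2 ?s x y else 0)"
  have Rm: "R \<in> borel_measurable borel"
    using series2_measurable[OF summ] unfolding R_def borel_prod .
  have RS: "R (x, y) = S (x, y)" if "\<bar>x\<bar> < r0" "\<bar>y\<bar> < r0" for x y
    using that r0(2) Ss[of x y] by (simp add: R_def)
  have RF: "R (x, y) = series2 ?s x y" if "\<bar>x\<bar> < r0" "\<bar>y\<bar> < r0" for x y
    using that r0(2) by (simp add: R_def)
  have tV: "\<phi> \<in> test_functions V" if "\<phi> \<in> test_functions W" for \<phi>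
    using that test_functions_mono[OF W(3)] by blast
  have out: "\<phi> (x, y) = 0" if "\<phi> \<in> test_functions W" "\<not> (\<bar>x\<bar> < r0 \<and> \<bar>y\<bar> < r0)" for \<phi> x y
    by (rule test_function_outside[OF that(1)]) (use that(2) in \<open>auto simp: W_def abs_less_iff\<close>)
  have inbox: "\<bar>fst p\<bar> < r0 \<and> \<bar>snd p\<bar> < r0" if "\<phi> \<in> test_functions W" "\<phi> p \<noteq> 0" for \<phi> p
    by (rule ccontr) (use out[OF that(1), of "fst p" "snd p"] that(2) in simp)
  have \<phi>S: "S p = R p" if "\<phi> \<in> test_functions W" "\<phi> p \<noteq> 0" for \<phi> p
    using inbox[OF that] RS[of "fst p" "snd p"] by simp
  have null: "AE p in lborel. \<phi> p \<noteq> 0 \<longrightarrow> R p \<noteq> 0" if "\<phi> \<in> test_functions W" for \<phi>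
  proof -
    have "d > 0" using d(2) by simp
    then have "((\<lambda>\<epsilon>. \<epsilon> powr (1 / d) * (1 + \<bar>ln \<epsilon>\<bar>)) \<longlongrightarrow> 0) (at_right 0)" by real_asymp
    from sublevel_bound_null[OF ub this] show ?thesis
    proof eventually_elim
      case (elim p)
      show ?case
      proof
        assume "\<phi> p \<noteq> 0"
        then show "R p \<noteq> 0" using elim inbox[OF that, of p] RF[of "fst p" "snd p"] by simp
      qed
    qed
  qed
  have oscR: "osc_integral S \<phi> = (\<lambda>l. \<integral>p. exp (\<i> * of_real (l * R p)) * of_real (\<phi> p) \<partial>lborel)"
    if "\<phi> \<in> test_functions W" for \<phi>
    unfolding osc_integral_def
  proof (intro ext Bochner_Integration.integral_cong refl)
    fix l p
    show "exp (\<i> * complex_of_real (l * S p)) * complex_of_real (\<phi> p) = exp (\<i> * of_real (l * R p)) * of_real (\<phi> p)"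
      using \<phi>S[OF that, of p] by (cases "\<phi> p = 0") auto
  qed
  have subR: "sublevel_integral S \<phi> = (\<lambda>t. \<integral>p. (if 0 < R p \<and> R p < t then \<phi> p else 0) \<partial>lborel)"
    "sublevel_integral (\<lambda>p. - S p) \<phi> = (\<lambda>t. \<integral>p. (if 0 < - R p \<and> - R p < t then \<phi> p else 0) \<partial>lborel)"
    if "\<phi> \<in> test_functions W" for \<phi>
    unfolding sublevel_integral_def set_lebesgue_integral_def
  proof -
    show "(\<lambda>\<epsilon>. \<integral>p. indicator {p. 0 < S p \<and> S p < \<epsilon>} p *\<^sub>R \<phi> p \<partial>lborel) = (\<lambda>t. \<integral>p. (if 0 < R p \<and> R p < t then \<phi> p else 0) \<partial>lborel)"
    proof (intro ext Bochner_Integration.integral_cong refl)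
      fix t p
      show "indicator {p. 0 < S p \<and> S p < t} p *\<^sub>R \<phi> p = (if 0 < R p \<and> R p < t then \<phi> p else 0)"
        using \<phi>S[OF that, of p] by (cases "\<phi> p = 0") auto
    qed
    show "(\<lambda>\<epsilon>. \<integral>p. indicator {p. 0 < - S p \<and> - S p < \<epsilon>} p *\<^sub>R \<phi> p \<partial>lborel) = (\<lambda>t. \<integral>p. (if 0 < - R p \<and> - R p < t then \<phi> p else 0) \<partial>lborel)"
    proof (intro ext Bochner_Integration.integral_cong refl)
      fix t p
      show "indicator {p. 0 < - S p \<and> - S p < t} p *\<^sub>R \<phi> p = (if 0 < - R p \<and> - R p < t then \<phi> p else 0)"
        using \<phi>S[OF that, of p] by (cases "\<phi> p = 0") auto
    qed
  qed
  have bound: "\<exists>C\<ge>0. \<forall>\<epsilon>>0. \<bar>sublevel_integral S \<phi> \<epsilon>\<bar> \<le> C * bd \<epsilon> \<and> \<bar>sublevel_integral (\<lambda>p. - S p) \<phi> \<epsilon>\<bar> \<le> C * bd \<epsilon>"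
    if \<phi>: "\<phi> \<in> test_functions W" and b: "sublevel_bound (series2 ?s) r0 bd" "\<And>\<epsilon>. \<epsilon> > 0 \<Longrightarrow> bd \<epsilon> \<ge> 0" for \<phi> bd
  proof -
    obtain B where B: "B \<ge> 0" "\<And>p. \<bar>\<phi> p\<bar> \<le> B" using test_function_bounded[OF \<phi>] by blast
    obtain C1 where C1: "C1 \<ge> 0" "\<And>\<epsilon>. \<epsilon> > 0 \<Longrightarrow> \<bar>\<integral>p. (if 0 < R p \<and> \<bar>R p\<bar> < \<epsilon> then \<phi> p else 0) \<partial>lborel\<bar> \<le> C1 * bd \<epsilon>"
      using sublevel_integral_bound[where \<phi> = \<phi> and S' = R and P = "\<lambda>p. 0 < R p", OF b RF out[OF \<phi>] B] by blast
    obtain C2 where C2: "C2 \<ge> 0" "\<And>\<epsilon>. \<epsilon> > 0 \<Longrightarrow> \<bar>\<integral>p. (if 0 < - R p \<and> \<bar>R p\<bar> < \<epsilon> then \<phi> p else 0) \<partial>lborel\<bar> \<le> C2 * bd \<epsilon>"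
      using sublevel_integral_bound[where \<phi> = \<phi> and S' = R and P = "\<lambda>p. 0 < - R p", OF b RF out[OF \<phi>] B] by blast
    have e: "(0 < R p \<and> R p < \<epsilon>) = (0 < R p \<and> \<bar>R p\<bar> < \<epsilon>)" "(0 < - R p \<and> - R p < \<epsilon>) = (0 < - R p \<and> \<bar>R p\<bar> < \<epsilon>)" for p \<epsilon>
      by auto
    have le: "C1 * bd \<epsilon> \<le> (C1 + C2) * bd \<epsilon>" "C2 * bd \<epsilon> \<le> (C1 + C2) * bd \<epsilon>" if "\<epsilon> > 0" for \<epsilon>
      using C1(1) C2(1) b(2)[OF that] by (auto intro!: mult_right_mono)
    show ?thesis
      unfolding subR[OF \<phi>] e
    proof (intro exI[of _ "C1 + C2"] conjI allI impI)
      fix \<epsilon> :: real assume \<epsilon>: "\<epsilon> > 0"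
      show "\<bar>\<integral>p. (if 0 < R p \<and> \<bar>R p\<bar> < \<epsilon> then \<phi> p else 0) \<partial>lborel\<bar> \<le> (C1 + C2) * bd \<epsilon>"
        by (rule order_trans[OF C1(2)[OF \<epsilon>] le(1)[OF \<epsilon>]])
      show "\<bar>\<integral>p. (if 0 < - R p \<and> \<bar>R p\<bar> < \<epsilon> then \<phi> p else 0) \<partial>lborel\<bar> \<le> (C1 + C2) * bd \<epsilon>"
        by (rule order_trans[OF C2(2)[OF \<epsilon>] le(2)[OF \<epsilon>]])
    qed (use C1(1) C2(1) in simp)
  qed
  define e where "e = 1 / d"
  have e: "0 < e" "e < 1" using d(2) by (simp_all add: e_def)
  have limJ: "((\<lambda>l. osc_integral S \<phi> l / of_real (l powr (- s 0)) - (\<delta> 0 \<phi> + \<delta>' 0 \<phi> * of_real (ln l))) \<longlongrightarrow> 0) at_top"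
    if "\<phi> \<in> test_functions W" for \<phi> by (rule leading_osc[OF osc[OF tV[OF that]]])
  have limp: "((\<lambda>t. sublevel_integral S \<phi> t / t powr r 0 - (c 0 \<phi> + c' 0 \<phi> * ln t)) \<longlongrightarrow> 0) (at_right 0)"
    if "\<phi> \<in> test_functions W" for \<phi> by (rule leading_sublevel[OF subp[OF tV[OF that]]])
  have limm: "((\<lambda>t. sublevel_integral (\<lambda>p. - S p) \<phi> t / t powr r 0 - (C 0 \<phi> + C' 0 \<phi> * ln t)) \<longlongrightarrow> 0) (at_right 0)"
    if "\<phi> \<in> test_functions W" for \<phi> by (rule leading_sublevel[OF subm[OF tV[OF that]]])
  obtain \<phi>1 where \<phi>1: "\<phi>1 \<in> test_functions W" "c 0 \<phi>1 \<noteq> 0 \<or> c' 0 \<phi>1 \<noteq> 0 \<or> C 0 \<phi>1 \<noteq> 0 \<or> C' 0 \<phi>1 \<noteq> 0"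
    using ex_sub[OF W] by blast
  obtain \<phi>2 where \<phi>2: "\<phi>2 \<in> test_functions W" "\<delta> 0 \<phi>2 \<noteq> 0 \<or> \<delta>' 0 \<phi>2 \<noteq> 0"
    using ex_osc[OF W] by blast
  have zero: "k = 0 \<and> k' = 0"
    if I: "((\<lambda>t. I t / t powr q - (k + k' * ln t)) \<longlongrightarrow> 0) (at_right 0)" and I0: "((\<lambda>t. I t / t powr q) \<longlongrightarrow> 0) (at_right 0)"
    for I :: "real \<Rightarrow> real" and q k k' :: real
    by (rule log_tendsto_zero_imp_zero) (use tendsto_diff[OF I0 I] in simp)
  \<comment> \<open>Otherwise the upper area bound makes both sublevel integrals o(t to the power r
    0), and all four leading coefficients of \<phi>1 vanish.\<close>
  have "r 0 \<ge> e"
  proof (rule ccontr)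
    assume "\<not> r 0 \<ge> e"
    then have lt: "e - r 0 > 0" by simp
    obtain B where B: "B \<ge> 0" "\<And>\<epsilon>. \<epsilon> > 0 \<Longrightarrow> \<bar>sublevel_integral S \<phi>1 \<epsilon>\<bar> \<le> B * (\<epsilon> powr (1 / d) * (1 + \<bar>ln \<epsilon>\<bar>))"
      "\<And>\<epsilon>. \<epsilon> > 0 \<Longrightarrow> \<bar>sublevel_integral (\<lambda>p. - S p) \<phi>1 \<epsilon>\<bar> \<le> B * (\<epsilon> powr (1 / d) * (1 + \<bar>ln \<epsilon>\<bar>))"
      using bound[OF \<phi>1(1) ub] by auto
    have small: "((\<lambda>t. I t / t powr r 0) \<longlongrightarrow> 0) (at_right 0)"
      if "\<And>\<epsilon>. \<epsilon> > 0 \<Longrightarrow> \<bar>I \<epsilon>\<bar> \<le> B * (\<epsilon> powr (1 / d) * (1 + \<bar>ln \<epsilon>\<bar>))" for I :: "real \<Rightarrow> real"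
    proof (rule Lim_null_comparison)
      have "((\<lambda>t. t powr (e - r 0) * (1 + \<bar>ln t\<bar>)) \<longlongrightarrow> 0) (at_right 0)" using lt by real_asymp
      then show "((\<lambda>t. B * (t powr (e - r 0) * (1 + \<bar>ln t\<bar>))) \<longlongrightarrow> 0) (at_right 0)" by (rule tendsto_mult_right_zero)
      show "\<forall>\<^sub>F t in at_right 0. norm (I t / t powr r 0) \<le> B * (t powr (e - r 0) * (1 + \<bar>ln t\<bar>))"
        using eventually_at_right_less[of "0::real"]
      proof eventually_elim
        case (elim t)
        have "\<bar>I t\<bar> / t powr r 0 \<le> B * (t powr (1 / d) * (1 + \<bar>ln t\<bar>)) / t powr r 0"
          using that[OF elim] by (rule divide_right_mono) simp
        then show ?case by (simp add: e_def powr_diff)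
      qed
    qed
    show False using \<phi>1(2) zero[OF limp[OF \<phi>1(1)] small[OF B(2)]] zero[OF limm[OF \<phi>1(1)] small[OF B(3)]] by blast
  qed
  have "r 0 \<le> e"
  proof (rule ccontr)
    assume "\<not> r 0 \<le> e"
    then have lt: "e < r 0" by simp
    \<comment> \<open>\<phi>1 may change sign and is used here only as raw material for a
      nonnegative bump at the origin.\<close>
    have "\<exists>p0. \<phi>1 p0 \<noteq> 0"
    proof (rule ccontr)
      assume "\<not> (\<exists>p0. \<phi>1 p0 \<noteq> 0)"
      then have z: "\<phi>1 p = 0" for p by blast
      have "sublevel_integral S \<phi>1 t = 0" "sublevel_integral (\<lambda>p. - S p) \<phi>1 t = 0" for t
        by (simp_all add: sublevel_integral_def set_lebesgue_integral_def z)
      then show False using \<phi>1(2) zero[OF limp[OF \<phi>1(1)]] zero[OF limm[OF \<phi>1(1)]] by simp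
    qed
    then obtain p0 where "\<phi>1 p0 \<noteq> 0" by blast
    from ex_nonneg_test_function[OF \<phi>1(1) this W(1,2)]
    obtain \<psi> where \<psi>: "\<psi> \<in> test_functions W" "\<And>p. \<psi> p \<ge> 0" "\<psi> (0, 0) > 0" by blast
    define m where "m = \<psi> (0, 0) / 2"
    have m: "m > 0" using \<psi>(3) by (simp add: m_def)
    have "isCont \<psi> (0, 0)" using test_function_continuous[OF \<psi>(1)] by (simp add: continuous_on_eq_continuous_at)
    then obtain \<eta> where \<eta>: "\<eta> > 0" "\<And>p. dist p (0, 0) < \<eta> \<Longrightarrow> dist (\<psi> p) (\<psi> (0, 0)) < m"
      unfolding continuous_at_eps_delta using m by blast
    \<comment> \<open>Two coordinates of size \<eta> / 3 keep the distance to the origin below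
      \<eta>; the other entry keeps the box inside the domain of \<open>R\<close>.\<close>
    define r1 where "r1 = min (\<eta> / 3) (r0 / 2)"
    have r1: "r1 > 0" "r1 < r0" using \<eta>(1) r0(1) by (auto simp: r1_def)
    have \<psi>m: "\<psi> (u, v) \<ge> m" if "\<bar>u\<bar> \<le> r1" "\<bar>v\<bar> \<le> r1" for u v
    proof -
      have "dist (u, v) (0, 0) \<le> \<bar>u\<bar> + \<bar>v\<bar>" by (simp add: dist_Pair_Pair dist_real_def sqrt_sum_squares_le_sum_abs)
      also have "\<dots> < \<eta>" using that \<eta>(1) by (simp add: r1_def)
      finally have "\<bar>\<psi> (u, v) - \<psi> (0, 0)\<bar> < m" using \<eta>(2) by (simp add: dist_real_def)
      then show ?thesis unfolding m_def by linarith
    qed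
    obtain \<kappa>1 \<kappa>2 where \<kappa>: "\<kappa>1 \<ge> 0" "\<kappa>2 \<ge> 0" "\<kappa>1 + \<kappa>2 = 1 / d"
      "\<And>a b. (a, b) \<in> {(a, b). ?s a b \<noteq> 0} \<Longrightarrow> 1 \<le> \<kappa>1 * real a + \<kappa>2 * real b"
    proof (rule supporting_weight[of "{(a, b). ?s a b \<noteq> 0}" d])
      show "{(a, b). ?s a b \<noteq> 0} \<noteq> {}" using ne by auto
    qed (use d in \<open>auto simp: newton_distance_eq\<close>)
    obtain k where k: "k > 0" "\<And>\<epsilon>. 0 < \<epsilon> \<Longrightarrow> \<epsilon> < 1 \<Longrightarrow> \<exists>x y. 0 < x \<and> x \<le> r1 \<and> 0 < y \<and> y \<le> r1 \<and>
       x * y = k * \<epsilon> powr (\<kappa>1 + \<kappa>2) \<and> (\<forall>u v. \<bar>u\<bar> \<le> x \<and> \<bar>v\<bar> \<le> y \<longrightarrow> \<bar>series2 ?s u v\<bar> < \<epsilon>)"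
      using small_box[OF \<rho> summ \<kappa>(1,2) _ r1(1)] \<kappa>(4) by blast
    \<comment> \<open>The sign of S on the box is unknown, so the two sublevel integrals are added;
      almost everywhere on the box 0 < \<open>\<bar>S\<bar>\<close> < t and the bump is at least
      m.\<close>
    have lower: "4 * m * k * t powr e \<le> sublevel_integral S \<psi> t + sublevel_integral (\<lambda>p. - S p) \<psi> t"
      if t: "0 < t" "t < 1" for t
    proof -
      obtain x y where xy: "0 < x" "x \<le> r1" "0 < y" "y \<le> r1" "x * y = k * t powr e"
        "\<And>u v. \<bar>u\<bar> \<le> x \<Longrightarrow> \<bar>v\<bar> \<le> y \<Longrightarrow> \<bar>series2 ?s u v\<bar> < t"
        using k(2)[OF t] unfolding \<kappa>(3) e_def by blast
      let ?Q = "{-x..x} \<times> {-y..y}"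
      have Qm: "?Q \<in> sets borel" by (intro borel_closed closed_Times closed_atLeastAtMost)
      have "emeasure lborel ?Q = emeasure lborel {-x..x} * emeasure lborel {-y..y}"
        unfolding lborel_prod[symmetric] by (rule lborel.emeasure_pair_measure_Times) simp_all
      also have "\<dots> = ennreal (4 * (x * y))" using xy by (simp add: ennreal_mult'[symmetric])
      finally have Q: "emeasure lborel ?Q = ennreal (4 * (x * y))" .
      have mQ: "measure lborel ?Q = 4 * (x * y)"
        unfolding measure_def Q by (rule enn2real_ennreal) (use xy(1,3) in simp)
      have iQ: "integrable lborel (\<lambda>p. m * indicator ?Q p :: real)"
        using Q Qm by (intro integrable_mult_right) (simp add: integrable_indicator_iff)
      have \<psi>i: "integrable lborel \<psi>" by (rule test_function_integrable[OF \<psi>(1)])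
      have [measurable]: "\<psi> \<in> borel_measurable borel" "R \<in> borel_measurable borel"
        using borel_measurable_integrable[OF \<psi>i] Rm by simp_all
      have i1: "integrable lborel (\<lambda>p. if 0 < R p \<and> R p < t then \<psi> p else 0)"
        by (rule Bochner_Integration.integrable_bound[OF \<psi>i]) auto
      have i2: "integrable lborel (\<lambda>p. if 0 < - R p \<and> - R p < t then \<psi> p else 0)"
        by (rule Bochner_Integration.integrable_bound[OF \<psi>i]) auto
      have "4 * m * k * t powr e = m * measure lborel ?Q" unfolding mQ xy(5) by simp
      also have "\<dots> = (\<integral>p. m * indicator ?Q p \<partial>lborel)" using Qm by simp
      also have "\<dots> \<le> (\<integral>p. (if 0 < R p \<and> R p < t then \<psi> p else 0) + (if 0 < - R p \<and> - R p < t then \<psi> p else 0) \<partial>lborel)"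
      proof (rule integral_mono_AE)
        show "AE p in lborel. m * indicator ?Q p \<le> (if 0 < R p \<and> R p < t then \<psi> p else 0) + (if 0 < - R p \<and> - R p < t then \<psi> p else 0)"
          using null[OF \<psi>(1)]
        proof eventually_elim
          case (elim p)
          show ?case
          proof (cases "p \<in> ?Q")
            case True
            obtain u v where p: "p = (u, v)" by (cases p)
            have uv: "\<bar>u\<bar> \<le> x" "\<bar>v\<bar> \<le> y" using True by (auto simp: p)
            then have "\<psi> p \<ge> m" using \<psi>m[of u v] xy(2,4) by (simp add: p)
            moreover have "R p = series2 ?s u v" using RF[of u v] uv xy(2,4) r1(2) by (simp add: p)
            then have "\<bar>R p\<bar> < t" using xy(6)[OF uv] by simp
            moreover have "R p \<noteq> 0" using elim \<open>\<psi> p \<ge> m\<close> m by auto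
            ultimately show ?thesis using True by (auto simp: abs_less_iff)
          qed (simp add: \<psi>(2))
        qed
      qed (use iQ i1 i2 in auto)
      also have "\<dots> = sublevel_integral S \<psi> t + sublevel_integral (\<lambda>p. - S p) \<psi> t"
        unfolding subR[OF \<psi>(1)] by (rule Bochner_Integration.integral_add[OF i1 i2])
      finally show ?thesis .
    qed
    \<comment> \<open>With e < r 0 the sum of the two integrals would be o(t to the power e),
      contradicting \<open>lower\<close>.\<close>
    have "((\<lambda>t. (sublevel_integral S \<psi> t / t powr e - (0 + 0 * ln t)) + (sublevel_integral (\<lambda>p. - S p) \<psi> t / t powr e - (0 + 0 * ln t))) \<longlongrightarrow> 0 + 0) (at_right 0)"
      by (intro tendsto_add leading_sublevel_subcritical[OF limp[OF \<psi>(1)] lt] leading_sublevel_subcritical[OF limm[OF \<psi>(1)] lt])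
    then have "((\<lambda>t. (sublevel_integral S \<psi> t + sublevel_integral (\<lambda>p. - S p) \<psi> t) / t powr e) \<longlongrightarrow> 0) (at_right 0)"
      by (simp add: add_divide_distrib)
    moreover have "\<forall>\<^sub>F t in at_right 0. 4 * m * k \<le> (sublevel_integral S \<psi> t + sublevel_integral (\<lambda>p. - S p) \<psi> t) / t powr e"
    proof -
      have "\<forall>\<^sub>F t in at_right 0. t \<in> {0<..<1::real}" by (rule eventually_at_right_real) simp
      then show ?thesis
      proof eventually_elim
        case (elim t)
        then show ?case using lower[of t] by (simp add: le_divide_eq)
      qed
    qed
    ultimately have "4 * m * k \<le> 0" by (rule tendsto_lowerbound) simp
    then show False using m k(1) by (simp add: mult_le_0_iff)
  qed
  with \<open>r 0 \<ge> e\<close> have r0e: "r 0 = e" by simp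
  have s0: "s 0 > 0" using prog(1) by (simp add: exponent_progression_def)
  have compare: "dd' = - of_real (q * Gamma q) * (exp (\<i> * of_real (pi * q / 2)) * of_real k' + exp (- \<i> * of_real (pi * q / 2)) * of_real K') \<and>
      (k' = 0 \<longrightarrow> K' = 0 \<longrightarrow> dd = of_real (q * Gamma q) * (exp (\<i> * of_real (pi * q / 2)) * of_real k + exp (- \<i> * of_real (pi * q / 2)) * of_real K))"
    if "\<phi> \<in> test_functions W" "0 < q" "q < 1"
      "((\<lambda>l. osc_integral S \<phi> l / of_real (l powr (- q)) - (dd + dd' * of_real (ln l))) \<longlongrightarrow> 0) at_top"
      "((\<lambda>t. sublevel_integral S \<phi> t / t powr q - (k + k' * ln t)) \<longlongrightarrow> 0) (at_right 0)"
      "((\<lambda>t. sublevel_integral (\<lambda>p. - S p) \<phi> t / t powr q - (K + K' * ln t)) \<longlongrightarrow> 0) (at_right 0)"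
    for \<phi> dd dd' k k' K K' q
    using osc_sublevel_comparison[OF that(2,3) Rm test_function_integrable[OF that(1)] null[OF that(1)]
        that(4)[unfolded oscR[OF that(1)]] that(5,6)[unfolded subR[OF that(1)]]]
    by blast
  have th: "0 < pi * e / 2" "pi * e / 2 < pi / 2" using e by simp_all
  have "s 0 = e"
  proof (rule ccontr)
    assume "s 0 \<noteq> e"
    then consider "s 0 < e" | "e < s 0" by linarith
    then show False
    proof cases
      case 1
      \<comment> \<open>At the exponent s 0 the sublevel coefficients are zero, hence so are the
        oscillatory ones of \<phi>2.\<close>
      have "s 0 < r 0" using 1 r0e by simp
      from compare[OF \<phi>2(1) s0 _ limJ[OF \<phi>2(1)] leading_sublevel_subcritical[OF limp[OF \<phi>2(1)] this] leading_sublevel_subcritical[OF limm[OF \<phi>2(1)] this]]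
      show False using \<phi>2(2) 1 e by simp
    next
      case 2
      \<comment> \<open>At the exponent e the oscillatory coefficients are zero; independence of the
        phases kills first the logarithmic sublevel coefficients of \<phi>1 and then the remaining
        two.\<close>
      from compare[OF \<phi>1(1) e leading_osc_subcritical[OF limJ[OF \<phi>1(1)] 2] limp[OF \<phi>1(1), unfolded r0e] limm[OF \<phi>1(1), unfolded r0e]]
      have h: "(0::complex) = - of_real (e * Gamma e) * (exp (\<i> * of_real (pi * e / 2)) * of_real (c' 0 \<phi>1) + exp (- \<i> * of_real (pi * e / 2)) * of_real (C' 0 \<phi>1))"
        "c' 0 \<phi>1 = 0 \<Longrightarrow> C' 0 \<phi>1 = 0 \<Longrightarrow> (0::complex) = of_real (e * Gamma e) * (exp (\<i> * of_real (pi * e / 2)) * of_real (c 0 \<phi>1) + exp (- \<i> * of_real (pi * e / 2)) * of_real (C 0 \<phi>1))"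
        by blast+
      have g: "complex_of_real (e * Gamma e) \<noteq> 0" using e Gamma_real_pos[of e] by (simp del: Gamma_real_pos)
      have "exp (\<i> * of_real (pi * e / 2)) * of_real (c' 0 \<phi>1) + exp (- \<i> * of_real (pi * e / 2)) * of_real (C' 0 \<phi>1) = (0::complex)"
        using h(1) g by (metis mult_eq_0_iff neg_equal_0_iff_equal)
      then have z: "c' 0 \<phi>1 = 0" "C' 0 \<phi>1 = 0" using exp_combination_zero[OF th] by blast+
      have "exp (\<i> * of_real (pi * e / 2)) * of_real (c 0 \<phi>1) + exp (- \<i> * of_real (pi * e / 2)) * of_real (C 0 \<phi>1) = (0::complex)"
        using h(2)[OF z] g by (metis mult_eq_0_iff)
      then have "c 0 \<phi>1 = 0" "C 0 \<phi>1 = 0" using exp_combination_zero[OF th] by blast+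
      then show False using \<phi>1(2) z by simp
    qed
  qed
  have main: "(newton_case1 S \<or> newton_case3 S \<longrightarrow>
         \<delta>' 0 \<phi> = 0 \<and>
         \<delta> 0 \<phi> = complex_of_real (Gamma (1 / d) / d) *
           (exp (\<i> * complex_of_real (pi / (2 * d))) * complex_of_real (c 0 \<phi>) +
            exp (- \<i> * complex_of_real (pi / (2 * d))) * complex_of_real (C 0 \<phi>))) \<and>
      (newton_case2 S \<longrightarrow>
         \<delta>' 0 \<phi> = - complex_of_real (Gamma (1 / d) / d) *
           (exp (\<i> * complex_of_real (pi / (2 * d))) * complex_of_real (c' 0 \<phi>) +
            exp (- \<i> * complex_of_real (pi / (2 * d))) * complex_of_real (C' 0 \<phi>)))"
    if \<phi>: "\<phi> \<in> test_functions W" for \<phi>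
  proof -
    have eqs: "e * Gamma e = Gamma (1 / d) / d" "pi * e / 2 = pi / (2 * d)" by (simp_all add: e_def)
    have cmp: "\<delta>' 0 \<phi> = - of_real (Gamma (1 / d) / d) * (exp (\<i> * of_real (pi / (2 * d))) * of_real (c' 0 \<phi>) + exp (- \<i> * of_real (pi / (2 * d))) * of_real (C' 0 \<phi>)) \<and>
      (c' 0 \<phi> = 0 \<longrightarrow> C' 0 \<phi> = 0 \<longrightarrow> \<delta> 0 \<phi> = of_real (Gamma (1 / d) / d) * (exp (\<i> * of_real (pi / (2 * d))) * of_real (c 0 \<phi>) + exp (- \<i> * of_real (pi / (2 * d))) * of_real (C 0 \<phi>)))"
      using compare[OF \<phi> e limJ[OF \<phi>, unfolded \<open>s 0 = e\<close>] limp[OF \<phi>, unfolded r0e] limm[OF \<phi>, unfolded r0e]]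
      unfolding eqs .
    \<comment> \<open>In Cases 1 and 3 the area bound has no logarithm, so the sublevel integrals
      over t to the power e stay bounded and no ln t term can occur.\<close>
    have nolog: "c' 0 \<phi> = 0 \<and> C' 0 \<phi> = 0" if ncase: "newton_case1 S \<or> newton_case3 S"
    proof -
      obtain B where B: "B \<ge> 0" "\<And>\<epsilon>. \<epsilon> > 0 \<Longrightarrow> \<bar>sublevel_integral S \<phi> \<epsilon>\<bar> \<le> B * \<epsilon> powr (1 / d)"
        "\<And>\<epsilon>. \<epsilon> > 0 \<Longrightarrow> \<bar>sublevel_integral (\<lambda>p. - S p) \<phi> \<epsilon>\<bar> \<le> B * \<epsilon> powr (1 / d)"
        using bound[OF \<phi> ub'[OF ncase]] by auto
      have "k' = 0" if lim: "((\<lambda>t. I t / t powr e - (k + k' * ln t)) \<longlongrightarrow> 0) (at_right 0)"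
        and bI: "\<And>\<epsilon>. \<epsilon> > 0 \<Longrightarrow> \<bar>I \<epsilon>\<bar> \<le> B * \<epsilon> powr (1 / d)" for I :: "real \<Rightarrow> real" and k k'
      proof (rule log_bounded_imp_zero)
        have "\<forall>\<^sub>F t in at_right 0. \<bar>I t / t powr e - (k + k' * ln t)\<bar> < 1"
          using order_tendstoD(2)[OF tendsto_rabs_zero[OF lim], of 1] by simp
        then show "\<forall>\<^sub>F t in at_right 0. \<bar>k + k' * ln t\<bar> \<le> B + 1"
          using eventually_at_right_less[of "0::real"]
        proof eventually_elim
          case (elim t)
          have "\<bar>I t / t powr e\<bar> \<le> B"
            using bI[OF elim(2)] elim(2) by (simp add: e_def divide_le_eq)
          then show ?case using elim(1) by linarith
        qed
      qed
      then show ?thesis using limp[OF \<phi>, unfolded r0e] limm[OF \<phi>, unfolded r0e] B by blast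
    qed
    show ?thesis using cmp nolog by simp
  qed
  show ?thesis using \<open>s 0 = e\<close> W main unfolding e_def by blast
qed

end
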